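(* Let $1<p\neq q<\infty$. Then $X(p,q)$ is not UMD and $X^{\mathbb C}(p,q)$ is not AUMD. Moreover, there exists $0<\theta<1$ such that $X^{\mathbb C}(p,q)$ is $\theta$-Hilbertian. In particular, $X^{\mathbb C}(p,q)$, and a fortiori $X(p,q)$, is super-reflexive.
   Context: **The spaces.** Let $D=\{-1,1\}$ with $\mu=\frac12\delta_{-1}+\frac12\delta_1$. Set $X_0(p,q)=\mathbb R$ and $X_{n+1}(p,q)=L_p(D,\mu;L_q(D,\mu;X_n(p,q)))$. There is a canonical isometric inclusion $X_n(p,q)\subset X_{n+1}(p,q)$ (as constant functions). $X(p,q)$ is the completion of $\bigcup_nX_n(p,q)$, i.e. the Banach space inductive limit; it is a Banach lattice of functions on $(D^{\mathbb N},\mu^{\otimes\mathbb N})$. $X^{\mathbb C}(p,q)$ is defined in the same way starting from $X^{\mathbb C}_0=\mathbb C$. **UMD.** A Banach space $X$ is UMD if for all (equivalently, some) $1<s<\infty$ there is a constant $C$ with $\sup_{\varepsilon_k=\pm1}\|\sum_{k=0}^n\varepsilon_k\,df_k\|_{L_s(X)}\le C\|\sum_{k=0}^n df_k\|_{L_s(X)}$ for all $n\ge0$ and all $X$-valued martingale difference sequences. **AUMD.** A complex Banach space $X$ is AUMD (analytic UMD) if for all (equivalently, some) such $s$ the same inequality holds for all $X$-valued Hardy martingales. Here, on $\mathbb T^{\mathbb N}$ ($\mathbb T$ the unit circle) with the product of normalised Haar measures, coordinates $z=(z_n)_{n\ge0}$ with the convention $z_0\equiv1$, and $\mathcal G_n=\sigma(z_0,\dots,z_n)$,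 a Hardy martingale in $L_s$ is an $L_s$-bounded martingale $(f_n)$ with respect to $(\mathcal G_n)$ such that, for $n\ge1$, $df_n=f_n-f_{n-1}=\sum_{k\ge1}\phi_{n,k}(z_0,\dots,z_{n-1})z_n^k$ (and $df_0=f_0$). **$\theta$-Hilbertian.** A complex Banach space $X$ is $\theta$-Hilbertian ($0\le\theta\le1$) if there is an interpolation pair (compatible couple) $(X_0,X_1)$ of Banach spaces such that $X$ is isometric to the complex interpolation space $[X_0,X_1]_\theta$ and $X_1$ is a Hilbert space. *)

theory Defs
  imports "HOL-Probability.Probability"
begin

section \<open>Real and complex normed spaces\<close>

text \<open>
  The library has no class of complex normed spaces. A normed space over the scalars
  \<open>'k\<close> (the reals or the complex numbers) is a type of class \<open>real_normed_vector\<close> together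
  with a scalar multiplication that extends \<open>scaleR\<close> and for which the norm is
  \<open>'k\<close>-homogeneous. For \<open>'k = real\<close> the scalar multiplication is \<open>scaleR\<close>.
\<close>

definition normed_space_over ::
  "('k::real_normed_field \<Rightarrow> 'x::real_normed_vector \<Rightarrow> 'x) \<Rightarrow> bool" where
  "normed_space_over sc \<longleftrightarrow>
     vector_space sc \<and>
     (\<forall>r x. sc (of_real r) x = r *\<^sub>R x) \<and>
     (\<forall>c x. norm (sc c x) = norm c * norm x)"


section \<open>The spaces X(p,q)\<close>

text \<open>
  The two-point set \<open>D\<close> is represented by \<open>bool\<close>, with both points of mass 1/2. Elements of
  \<open>X\<^sub>n\<close> are functions on the Cantor group that depend on the first \<open>2n\<close> coordinates only, so the
  inclusions of \<open>X\<^sub>n\<close> in \<open>X\<^sub>n\<^sub>+\<^sub>1\<close> are set inclusions. In \<open>L\<^sub>p(D; L\<^sub>q(D; X\<^sub>n))\<close> the variable of \<open>L\<^sub>p\<close>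
  is the coordinate \<open>2n\<close> and the variable of \<open>L\<^sub>q\<close> is the coordinate \<open>2n+1\<close>. The norm
  \<open>X_norm p q n\<close> is meaningful on \<open>X\<^sub>n\<close>; elements of \<open>X\<^sub>0\<close> are constant functions, which may be
  evaluated anywhere.
\<close>

definition D_norm :: "real \<Rightarrow> (bool \<Rightarrow> real) \<Rightarrow> real" where
  "D_norm r g = (\<Sum>s\<in>UNIV. 1/2 * \<bar>g s\<bar> powr r) powr (1/r)"

definition X_level :: "nat \<Rightarrow> ((nat \<Rightarrow> bool) \<Rightarrow> 'k) set" where
  "X_level n = {f. \<forall>\<omega> \<omega>'. (\<forall>i<2*n. \<omega> i = \<omega>' i) \<longrightarrow> f \<omega> = f \<omega>'}"

primrec X_norm ::
  "real \<Rightarrow> real \<Rightarrow> nat \<Rightarrow> ((nat \<Rightarrow> bool) \<Rightarrow> 'k::real_normed_field) \<Rightarrow> real" where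
  "X_norm p q 0 f = norm (f (\<lambda>_. True))"
| "X_norm p q (Suc n) f =
     D_norm p (\<lambda>s. D_norm q (\<lambda>t. X_norm p q n (\<lambda>\<omega>. f (fun_upd (fun_upd \<omega> (2*n) s) (2*n+1) t))))"

definition X_union :: "((nat \<Rightarrow> bool) \<Rightarrow> 'k) set" where
  "X_union = (\<Union>n. X_level n)"

text \<open>
  The Banach space \<open>'x\<close> with scalar multiplication \<open>sc\<close> is a completion of the union of the \<open>X\<^sub>n\<close>,
  with \<open>J\<close> as the canonical isometric embedding of the union; completions are unique up to
  isometric isomorphism. This is \<open>X(p,q)\<close> for real and its complex counterpart for complex
  scalars.
\<close>

definition is_X ::
  "real \<Rightarrow> real \<Rightarrow> ('k::real_normed_field \<Rightarrow> 'x::banach \<Rightarrow> 'x) \<Rightarrow>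
   (((nat \<Rightarrow> bool) \<Rightarrow> 'k) \<Rightarrow> 'x) \<Rightarrow> bool" where
  "is_X p q sc J \<longleftrightarrow>
     normed_space_over sc \<and>
     (\<forall>f\<in>X_union. \<forall>g\<in>X_union. J (\<lambda>\<omega>. f \<omega> + g \<omega>) = J f + J g) \<and>
     (\<forall>c. \<forall>f\<in>X_union. J (\<lambda>\<omega>. c * f \<omega>) = sc c (J f)) \<and>
     (\<forall>n. \<forall>f\<in>X_level n. norm (J f) = X_norm p q n f) \<and>
     closure (J ` X_union) = UNIV"


section \<open>Martingales with values in a Banach space\<close>

text \<open>
  The class \<open>second_countable_topology\<close> (separability) is required by the Bochner integral of
  the library. The spaces \<open>X(p,q)\<close> are separable.
\<close>

definition banach_martingale ::
  "'a measure \<Rightarrow> (nat \<Rightarrow> 'a measure) \<Rightarrow>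
   (nat \<Rightarrow> 'a \<Rightarrow> 'x::{banach,second_countable_topology}) \<Rightarrow> bool" where
  "banach_martingale M F f \<longleftrightarrow>
     (\<forall>n. subalgebra M (F n)) \<and> filtration (space M) F \<and>
     (\<forall>n. f n \<in> borel_measurable (F n) \<and> integrable M (f n)) \<and>
     (\<forall>m n. m \<le> n \<longrightarrow> (\<forall>A\<in>sets (F m). (LINT x:A|M. f n x) = (LINT x:A|M. f m x)))"

definition mdiff :: "(nat \<Rightarrow> 'a \<Rightarrow> 'x::real_normed_vector) \<Rightarrow> nat \<Rightarrow> 'a \<Rightarrow> 'x" where
  "mdiff f n x = (if n = 0 then f 0 x else f n x - f (n - 1) x)"

definition in_L ::
  "'a measure \<Rightarrow> real \<Rightarrow> ('a \<Rightarrow> 'x::{banach,second_countable_topology}) \<Rightarrow> bool" where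
  "in_L M s g \<longleftrightarrow> g \<in> borel_measurable M \<and> integrable M (\<lambda>x. norm (g x) powr s)"

definition L_norm ::
  "'a measure \<Rightarrow> real \<Rightarrow> ('a \<Rightarrow> 'x::{banach,second_countable_topology}) \<Rightarrow> real" where
  "L_norm M s g = (LINT x|M. norm (g x) powr s) powr (1/s)"

text \<open>The inequality with the supremum over all choices of signs, for one sequence of differences.\<close>

definition unconditional_bound ::
  "'a measure \<Rightarrow> real \<Rightarrow> real \<Rightarrow>
   (nat \<Rightarrow> 'a \<Rightarrow> 'x::{banach,second_countable_topology}) \<Rightarrow> bool" where
  "unconditional_bound M s C d \<longleftrightarrow>
     (\<forall>n. \<forall>\<epsilon> :: nat \<Rightarrow> real. (\<forall>k. \<epsilon> k \<in> {-1, 1}) \<longrightarrow>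
        L_norm M s (\<lambda>x. \<Sum>k=0..n. \<epsilon> k *\<^sub>R d k x) \<le> C * L_norm M s (\<lambda>x. \<Sum>k=0..n. d k x))"

text \<open>
  HOL cannot quantify over sample spaces inside a definition. The sample space is \<open>real\<close>, with
  an arbitrary probability measure and filtration. Nothing is lost: the joint law of a martingale
  with values in a separable Banach space lives on a Polish space, which is Borel isomorphic to
  a Borel subset of the real line.
\<close>

definition UMD :: "'x::{banach,second_countable_topology} itself \<Rightarrow> bool" where
  "UMD _ \<longleftrightarrow>
     (\<forall>s>1. \<exists>C. \<forall>(M :: real measure) F (f :: nat \<Rightarrow> real \<Rightarrow> 'x).
        prob_space M \<and> banach_martingale M F f \<and> (\<forall>n. in_L M s (f n)) \<longrightarrow>
        unconditional_bound M s C (mdiff f))"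


section \<open>Hardy martingales\<close>

definition circle_haar :: "complex measure" where
  "circle_haar = distr (uniform_measure lborel {0..<1}) borel (\<lambda>t::real. cis (2 * pi * t))"

text \<open>The coordinate with index 0 is the constant 1, hence the Dirac factor.\<close>

definition torus :: "(nat \<Rightarrow> complex) measure" where
  "torus = PiM UNIV (\<lambda>n. if n = 0 then return borel 1 else circle_haar)"

definition torus_filtration :: "nat \<Rightarrow> (nat \<Rightarrow> complex) measure" where
  "torus_filtration n =
     sigma (space torus) {(\<lambda>z. z k) -` B \<inter> space torus | k B. k \<le> n \<and> B \<in> sets borel}"

text \<open>
  The expansion of \<open>df\<^sub>n\<close> as the sum of \<open>\<phi>\<^sub>n\<^sub>,\<^sub>k z\<^sub>n\<^sup>k\<close> over \<open>k \<ge> 1\<close>, with \<open>\<phi>\<^sub>n\<^sub>,\<^sub>k\<close> a function of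
  \<open>z\<^sub>0, \<dots>, z\<^sub>n\<^sub>-\<^sub>1\<close>, is the Fourier expansion in the variable \<open>z\<^sub>n\<close>: conditionally on the
  preceding coordinates, the \<open>k\<close>-th Fourier coefficient of \<open>df\<^sub>n\<close> is \<open>\<phi>\<^sub>n\<^sub>,\<^sub>k\<close> for \<open>k \<ge> 1\<close> and 0 for
  \<open>k \<le> 0\<close>.
\<close>

definition hardy_martingale ::
  "(complex \<Rightarrow> 'y::{banach,second_countable_topology} \<Rightarrow> 'y) \<Rightarrow>
   (nat \<Rightarrow> (nat \<Rightarrow> complex) \<Rightarrow> 'y) \<Rightarrow> bool" where
  "hardy_martingale sc f \<longleftrightarrow>
     banach_martingale torus torus_filtration f \<and>
     (\<exists>\<phi> :: nat \<Rightarrow> int \<Rightarrow> (nat \<Rightarrow> complex) \<Rightarrow> 'y. \<forall>n\<ge>1.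
        (\<forall>k\<ge>1. \<phi> n k \<in> borel_measurable (torus_filtration (n - 1)) \<and> integrable torus (\<phi> n k)) \<and>
        (\<forall>k. \<forall>A\<in>sets (torus_filtration (n - 1)).
           (LINT z:A|torus. sc (z n powi (- k)) (mdiff f n z)) =
           (if k \<ge> 1 then (LINT z:A|torus. \<phi> n k z) else 0)))"

definition AUMD :: "(complex \<Rightarrow> 'y::{banach,second_countable_topology} \<Rightarrow> 'y) \<Rightarrow> bool" where
  "AUMD sc \<longleftrightarrow>
     (\<forall>s>1. \<exists>C. \<forall>f :: nat \<Rightarrow> (nat \<Rightarrow> complex) \<Rightarrow> 'y.
        hardy_martingale sc f \<and> (\<forall>n. in_L torus s (f n)) \<and>
        bdd_above (range (\<lambda>n. L_norm torus s (f n))) \<longrightarrow>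
        unconditional_bound torus s C (mdiff f))"


section \<open>Complex interpolation\<close>

text \<open>
  A Banach space inside an ambient complex vector space is a subspace \<open>S\<close> with a norm \<open>N\<close> of
  its own; the values of \<open>N\<close> outside \<open>S\<close> are irrelevant.
\<close>

definition banach_on ::
  "(complex \<Rightarrow> 'v::ab_group_add \<Rightarrow> 'v) \<Rightarrow> 'v set \<Rightarrow> ('v \<Rightarrow> real) \<Rightarrow> bool" where
  "banach_on sc S N \<longleftrightarrow>
     module.subspace sc S \<and>
     (\<forall>x\<in>S. 0 \<le> N x \<and> (N x = 0 \<longleftrightarrow> x = 0)) \<and>
     (\<forall>x\<in>S. \<forall>y\<in>S. N (x + y) \<le> N x + N y) \<and>
     (\<forall>c. \<forall>x\<in>S. N (sc c x) = norm c * N x) \<and>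
     (\<forall>u :: nat \<Rightarrow> 'v. (\<forall>n. u n \<in> S) \<and> (\<forall>e>0. \<exists>k. \<forall>m\<ge>k. \<forall>n\<ge>k. N (u m - u n) < e) \<longrightarrow>
        (\<exists>l\<in>S. (\<lambda>n. N (u n - l)) \<longlonglongrightarrow> 0))"

definition hilbert_on ::
  "(complex \<Rightarrow> 'v::ab_group_add \<Rightarrow> 'v) \<Rightarrow> 'v set \<Rightarrow> ('v \<Rightarrow> real) \<Rightarrow> bool" where
  "hilbert_on sc S N \<longleftrightarrow>
     banach_on sc S N \<and>
     (\<exists>ip :: 'v \<Rightarrow> 'v \<Rightarrow> complex.
        (\<forall>x\<in>S. \<forall>y\<in>S. \<forall>z\<in>S. ip (x + y) z = ip x z + ip y z) \<and>
        (\<forall>c. \<forall>x\<in>S. \<forall>y\<in>S. ip (sc c x) y = c * ip x y) \<and>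
        (\<forall>x\<in>S. \<forall>y\<in>S. ip y x = cnj (ip x y)) \<and>
        (\<forall>x\<in>S. ip x x = of_real ((N x)\<^sup>2)))"

text \<open>
  The ambient space of a compatible couple is a normed space into which both members are
  continuously included. A normed space instead of a Hausdorff topological vector space is no
  restriction, as the sum of the couple can serve as the ambient space.
\<close>

definition compatible_couple ::
  "(complex \<Rightarrow> 'v::real_normed_vector \<Rightarrow> 'v) \<Rightarrow> 'v set \<Rightarrow> ('v \<Rightarrow> real) \<Rightarrow> 'v set \<Rightarrow> ('v \<Rightarrow> real) \<Rightarrow> bool" where
  "compatible_couple sc S0 N0 S1 N1 \<longleftrightarrow>
     normed_space_over sc \<and> banach_on sc S0 N0 \<and> banach_on sc S1 N1 \<and>
     (\<exists>C. \<forall>x\<in>S0. norm x \<le> C * N0 x) \<and> (\<exists>C. \<forall>x\<in>S1. norm x \<le> C * N1 x)"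

definition sum_space :: "'v::ab_group_add set \<Rightarrow> 'v set \<Rightarrow> 'v set" where
  "sum_space S0 S1 = {a + b | a b. a \<in> S0 \<and> b \<in> S1}"

definition sum_norm ::
  "'v::ab_group_add set \<Rightarrow> ('v \<Rightarrow> real) \<Rightarrow> 'v set \<Rightarrow> ('v \<Rightarrow> real) \<Rightarrow> 'v \<Rightarrow> real" where
  "sum_norm S0 N0 S1 N1 x = Inf {N0 a + N1 b | a b. a \<in> S0 \<and> b \<in> S1 \<and> x = a + b}"

text \<open>
  The admissible functions on the strip: bounded and continuous with values in the sum,
  analytic in the interior, with bounded continuous boundary values in the members of the couple.
  Calderon's additional requirement that the boundary values vanish at infinity gives the
  same interpolation space with the same norm, by multiplication with \<open>exp (\<delta> * (z\<^sup>2 - \<theta>\<^sup>2))\<close>.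
\<close>

definition strip_functions ::
  "(complex \<Rightarrow> 'v::ab_group_add \<Rightarrow> 'v) \<Rightarrow> 'v set \<Rightarrow> ('v \<Rightarrow> real) \<Rightarrow> 'v set \<Rightarrow> ('v \<Rightarrow> real) \<Rightarrow>
   (complex \<Rightarrow> 'v) set" where
  "strip_functions sc S0 N0 S1 N1 =
     (let V = sum_space S0 S1; K = sum_norm S0 N0 S1 N1; strip = {z. 0 \<le> Re z \<and> Re z \<le> 1}
      in {F.
        (\<forall>z\<in>strip. F z \<in> V) \<and>
        bdd_above ((\<lambda>z. K (F z)) ` strip) \<and>
        (\<forall>z\<in>strip. ((\<lambda>w. K (F w - F z)) \<longlongrightarrow> 0) (at z within strip)) \<and>
        (\<forall>z. 0 < Re z \<and> Re z < 1 \<longrightarrow>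
           (\<exists>l\<in>V. ((\<lambda>w. K (sc (1 / (w - z)) (F w - F z) - l)) \<longlongrightarrow> 0) (at z))) \<and>
        (\<forall>t::real. F (Complex 0 t) \<in> S0 \<and> F (Complex 1 t) \<in> S1) \<and>
        bdd_above (range (\<lambda>t. N0 (F (Complex 0 t)))) \<and>
        bdd_above (range (\<lambda>t. N1 (F (Complex 1 t)))) \<and>
        (\<forall>t. ((\<lambda>u. N0 (F (Complex 0 u) - F (Complex 0 t))) \<longlongrightarrow> 0) (at t)) \<and>
        (\<forall>t. ((\<lambda>u. N1 (F (Complex 1 u) - F (Complex 1 t))) \<longlongrightarrow> 0) (at t))})"

definition strip_norm :: "('v \<Rightarrow> real) \<Rightarrow> ('v \<Rightarrow> real) \<Rightarrow> (complex \<Rightarrow> 'v) \<Rightarrow> real" where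
  "strip_norm N0 N1 F = max (SUP t. N0 (F (Complex 0 t))) (SUP t. N1 (F (Complex 1 t)))"

definition interp_space ::
  "(complex \<Rightarrow> 'v::ab_group_add \<Rightarrow> 'v) \<Rightarrow> 'v set \<Rightarrow> ('v \<Rightarrow> real) \<Rightarrow> 'v set \<Rightarrow> ('v \<Rightarrow> real) \<Rightarrow>
   real \<Rightarrow> 'v set" where
  "interp_space sc S0 N0 S1 N1 \<theta> = (\<lambda>F. F (of_real \<theta>)) ` strip_functions sc S0 N0 S1 N1"

definition interp_norm ::
  "(complex \<Rightarrow> 'v::ab_group_add \<Rightarrow> 'v) \<Rightarrow> 'v set \<Rightarrow> ('v \<Rightarrow> real) \<Rightarrow> 'v set \<Rightarrow> ('v \<Rightarrow> real) \<Rightarrow>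
   real \<Rightarrow> 'v \<Rightarrow> real" where
  "interp_norm sc S0 N0 S1 N1 \<theta> x =
     Inf (strip_norm N0 N1 ` {F \<in> strip_functions sc S0 N0 S1 N1. F (of_real \<theta>) = x})"

text \<open>
  The first argument is the type of the ambient space of the couple, which HOL cannot
  quantify existentially. The bounded sequences \<open>nat \<Rightarrow>\<^sub>C complex\<close> contain every separable
  complex Banach space isometrically.
\<close>

definition theta_hilbertian ::
  "'v::real_normed_vector itself \<Rightarrow> real \<Rightarrow> (complex \<Rightarrow> 'y::banach \<Rightarrow> 'y) \<Rightarrow> bool" where
  "theta_hilbertian _ \<theta> scY \<longleftrightarrow>
     0 \<le> \<theta> \<and> \<theta> \<le> 1 \<and>
     (\<exists>(sc :: complex \<Rightarrow> 'v \<Rightarrow> 'v) S0 N0 S1 N1.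
        compatible_couple sc S0 N0 S1 N1 \<and> hilbert_on sc S1 N1 \<and>
        (\<exists>T :: 'y \<Rightarrow> 'v. Vector_Spaces.linear scY sc T \<and>
           range T = interp_space sc S0 N0 S1 N1 \<theta> \<and>
           (\<forall>y. interp_norm sc S0 N0 S1 N1 \<theta> (T y) = norm y)))"


section \<open>Super-reflexivity\<close>

definition dual :: "('k::real_normed_field \<Rightarrow> 'x::real_normed_vector \<Rightarrow> 'x) \<Rightarrow> ('x \<Rightarrow> 'k) set" where
  "dual sc = {f. bounded_linear f \<and> (\<forall>c x. f (sc c x) = c * f x)}"

definition bidual ::
  "('k::real_normed_field \<Rightarrow> 'x::real_normed_vector \<Rightarrow> 'x) \<Rightarrow> (('x \<Rightarrow> 'k) \<Rightarrow> 'k) set" where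
  "bidual sc = {\<Phi>.
     (\<forall>f\<in>dual sc. \<forall>g\<in>dual sc. \<Phi> (\<lambda>x. f x + g x) = \<Phi> f + \<Phi> g) \<and>
     (\<forall>c. \<forall>f\<in>dual sc. \<Phi> (\<lambda>x. c * f x) = c * \<Phi> f) \<and>
     (\<exists>B. \<forall>f\<in>dual sc. norm (\<Phi> f) \<le> B * onorm f)}"

definition reflexive :: "('k::real_normed_field \<Rightarrow> 'x::banach \<Rightarrow> 'x) \<Rightarrow> bool" where
  "reflexive sc \<longleftrightarrow> (\<forall>\<Phi>\<in>bidual sc. \<exists>x. \<forall>f\<in>dual sc. \<Phi> f = f x)"

text \<open>
  The finite-dimensional subspaces are the spans of finite sets; a linear map on such a
  subspace is the restriction of a linear map on the whole space.
\<close>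

definition finitely_representable ::
  "('k::real_normed_field \<Rightarrow> 'u::real_normed_vector \<Rightarrow> 'u) \<Rightarrow>
   ('k \<Rightarrow> 'x::real_normed_vector \<Rightarrow> 'x) \<Rightarrow> bool" where
  "finitely_representable scU scX \<longleftrightarrow>
     (\<forall>B. finite B \<longrightarrow> (\<forall>\<epsilon>>0. \<exists>T. Vector_Spaces.linear scU scX T \<and>
        (\<forall>u\<in>module.span scU B. norm u \<le> norm (T u) \<and> norm (T u) \<le> (1 + \<epsilon>) * norm u)))"

text \<open>
  Every Banach space finitely representable in the given one is reflexive. The type \<open>'u\<close> of
  the finitely representable spaces is a parameter; super-reflexivity is the statement for
  all types \<open>'u\<close>, that is, with \<open>'u\<close> a type variable of the theorem.
\<close>

definition super_reflexive ::
  "'u::banach itself \<Rightarrow> ('k::real_normed_field \<Rightarrow> 'x::banach \<Rightarrow> 'x) \<Rightarrow> bool" where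
  "super_reflexive _ scX \<longleftrightarrow>
     (\<forall>scU :: 'k \<Rightarrow> 'u \<Rightarrow> 'u.
        normed_space_over scU \<and> finitely_representable scU scX \<longrightarrow> reflexive scU)"

end

theory Submission
  imports Defs "HOL-Complex_Analysis.Complex_Analysis"
begin

text \<open>
  The norm of \<open>X\<^sub>n\<close> is an iterated norm over bits, with exponents \<open>p\<close> and \<open>q\<close> in turn.

  Let \<open>r1 < r2\<close> be the two exponents. A path of bits, read from the outermost norm inwards, may
  stop in each period at a bit of exponent \<open>r1\<close>, and otherwise it has to make two prescribed moves
  at bits of exponent \<open>r2\<close>, or it fails. With the critical weight \<open>g\<^sup>k\<close> for the \<open>k\<close>-th period, the
  function living on the stopped paths has a norm of order \<open>N\<close> to the power \<open>1/r1\<close> after \<open>N\<close>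
  periods, while the function living on the failed paths has a norm of order \<open>N\<close> to the power \<open>1/r2\<close>.
  A martingale with two differences per period, both almost equal to \<open>g\<^sup>k\<close> on the surviving paths, is
  comparable with the former if all signs are +1, but up to a small multiple only with the latter
  if the signs alternate, and this holds at every point of the sample space. So no constant works
  in the inequality of UMD. The prescribed moves are chosen by independent variables; in the
  complex case the factor that is almost 1 can be chosen to be an analytic polynomial on the circle.

  For small \<open>a > 1\<close> and large \<open>b\<close>, a two-point inequality
  \<open>|u|\<^sup>b + c |v|\<^sup>b \<le> M\<^sup>b\<close>, where \<open>M\<close> is the mean of order \<open>a\<close> of \<open>|u + v|\<close> and \<open>|u - v|\<close>, passes from
  the scalars to the iterated norms by two applications of Minkowski's inequality, hence to X(p,q)
  and to all spaces finitely representable in it. It makes them uniformly convex: if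
  functionals \<open>f\<^sub>n\<close> almost attain the norm of an element of the bidual, then points at which they are
  almost attained converge, and the limit represents that element.

  By uniform convexity, the complex X(p,q) is the space of martingales on the dyadic tree with
  bounded mixed norms. For \<open>1/p = (1 - \<theta>)/p0 + \<theta>/2\<close> and likewise for \<open>q\<close>, it is the interpolation space of
  the martingale spaces for \<open>(p0, q0)\<close> and \<open>(2, 2)\<close>: one inequality follows from duality and the maximum
  principle on the strip, the other one from Calderon's factorization on finite levels, summed over
  a series of martingale differences.
\<close>

section \<open>Two-point norms\<close>

text \<open>The weight \<open>g = 2 powr (1/r1) * 16 powr (1/r2)\<close> is the one for which a
  period is neutral: not stopping has mass 1/2 in the norm with exponent \<open>r1\<close>, hitting
  both moves has mass 1/16 in the four norms with exponent \<open>r2\<close>, and \<open>g\<close>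
  undoes both. Each period then adds a constant to the \<open>r1\<close>-th power of the stopped
  norm and at most a constant to the \<open>r2\<close>-th power of the failed norm;
  \<open>r1 < r2\<close> separates the two rates. A move consists of two bits because of the
  analytic case. The factor \<open>1 - (1 + z \<zeta>)^d\<close> is near 1 for large
  \<open>d\<close> only where \<open>z \<zeta>\<close> lies within 60 degrees of -1. Half circles
  are too wide for this, quarter circles, with half-width 45 degrees, are not. Off its arc the
  factor is merely bounded by \<open>1 + 2 ^ d\<close>. This is harmless, since that bound
  multiplies the failed function only, while the closeness to 1 has to beat the given constant. As
  the bounds hold at every sample point, they pass to every exponent of integration, and 2 is
  taken.\<close>

lemma powr_le_powr_iff:
  fixes x y r :: real
  assumes "0 \<le> x" "0 \<le> y" "0 < r"
  shows "x powr r \<le> y powr r \<longleftrightarrow> x \<le> y"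
  using assms by (metis linorder_not_le powr_less_mono2 powr_mono2 less_eq_real_def)

text \<open>Convexity of the power function is used on the open half line; at 0 the inequality
  reduces to \<open>w powr r \<le> w\<close> for weights in [0,1].\<close>

lemma powr_convex_pair:
  fixes x y u v r :: real
  assumes "1 \<le> r" "0 \<le> x" "0 \<le> y" "0 \<le> u" "0 \<le> v" "u + v = 1"
  shows "(u * x + v * y) powr r \<le> u * x powr r + v * y powr r"
proof -
  have small: "w powr r \<le> w" if "0 \<le> w" "w \<le> 1" for w :: real
  proof (cases "w = 0")
    case False
    then have "w powr r \<le> w powr 1"
      using that assms(1) by (intro powr_mono') auto
    then show ?thesis using that False by simp
  qed auto
  have le1: "u \<le> 1" "v \<le> 1" using assms by auto
  consider "x = 0" | "y = 0" | "x > 0" "y > 0" using assms by linarith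
  then show ?thesis
  proof cases
    case 1
    then have "(u * x + v * y) powr r = v powr r * y powr r"
      using assms by (simp add: powr_mult)
    also have "\<dots> \<le> v * y powr r" using small[of v] assms le1 by (intro mult_right_mono) auto
    finally show ?thesis using 1 assms by simp
  next
    case 2
    then have "(u * x + v * y) powr r = u powr r * x powr r"
      using assms by (simp add: powr_mult)
    also have "\<dots> \<le> u * x powr r" using small[of u] assms le1 by (intro mult_right_mono) auto
    finally show ?thesis using 2 assms by simp
  next
    case 3
    have u: "u = 1 - v" using assms by simp
    show ?thesis
      using convex_onD[OF powr_convex[OF assms(1)], of v x y] 3 assms(5) le1(2) unfolding u by simp
  qed
qed

lemma D_norm_alt: "D_norm r g = ((\<bar>g True\<bar> powr r + \<bar>g False\<bar> powr r) / 2) powr (1/r)"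
  by (simp add: D_norm_def UNIV_bool add.commute add_divide_distrib)

lemma D_norm_nonneg [simp]: "0 \<le> D_norm r g"
  by (simp add: D_norm_def)

lemma D_norm_powr: "r > 0 \<Longrightarrow> D_norm r g powr r = (\<bar>g True\<bar> powr r + \<bar>g False\<bar> powr r) / 2"
  by (simp add: D_norm_alt powr_powr)

lemma D_norm_const [simp]: "r > 0 \<Longrightarrow> D_norm r (\<lambda>_. c) = \<bar>c\<bar>"
  by (simp add: D_norm_alt powr_powr)

lemma D_norm_mono:
  assumes "r > 0" "\<And>s. \<bar>g s\<bar> \<le> \<bar>h s\<bar>"
  shows "D_norm r g \<le> D_norm r h"
  unfolding D_norm_alt using assms by (intro powr_mono2 divide_right_mono add_mono) auto

lemma D_norm_cmult:
  assumes "r > 0" shows "D_norm r (\<lambda>s. c * g s) = \<bar>c\<bar> * D_norm r g"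
proof -
  have "(\<bar>c * g True\<bar> powr r + \<bar>c * g False\<bar> powr r) / 2
      = \<bar>c\<bar> powr r * ((\<bar>g True\<bar> powr r + \<bar>g False\<bar> powr r) / 2)"
    by (simp add: abs_mult powr_mult algebra_simps add_divide_distrib)
  then show ?thesis
    unfolding D_norm_alt by (simp only:) (subst powr_mult, use assms in \<open>simp_all add: powr_powr\<close>)
qed

lemma D_norm_divide: "r > 0 \<Longrightarrow> D_norm r (\<lambda>s. g s / c) = D_norm r g / \<bar>c\<bar>"
  using D_norm_cmult[of r "1/c" g] by simp

text \<open>An atom of D has mass 1/2, so the exact factor is \<open>2 powr (1/r)\<close>;
  \<open>r \<ge> 1\<close> allows 2 for all exponents at once.\<close>

lemma D_norm_point:
  assumes "r \<ge> 1" shows "\<bar>g s\<bar> \<le> 2 * D_norm r g"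
proof -
  have r: "r > 0" using assms by simp
  have "\<bar>g s\<bar> powr r \<le> 2 * (D_norm r g powr r)"
    using D_norm_powr[OF r, of g] powr_ge_zero[of "\<bar>g True\<bar>" r] powr_ge_zero[of "\<bar>g False\<bar>" r]
    by (cases s) (simp_all del: powr_ge_zero)
  also have "\<dots> \<le> 2 powr r * D_norm r g powr r"
    using powr_mono[of 1 r 2] assms by (intro mult_right_mono) auto
  also have "\<dots> = (2 * D_norm r g) powr r" by (simp add: powr_mult)
  finally show ?thesis using r by (subst (asm) powr_le_powr_iff) auto
qed

lemma D_norm_eq_0_iff: "r \<ge> 1 \<Longrightarrow> D_norm r g = 0 \<longleftrightarrow> (\<forall>s. g s = 0)"
  using D_norm_point[of r g] by (auto simp: D_norm_alt)

lemma D_norm_normalized: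
  assumes "r > 0" "D_norm r g = A" "A \<noteq> 0"
  shows "(\<bar>g True\<bar> / A) powr r + (\<bar>g False\<bar> / A) powr r = 2"
proof -
  have "A > 0" using assms D_norm_nonneg[of r g] by linarith
  moreover have "\<bar>g True\<bar> powr r + \<bar>g False\<bar> powr r = 2 * A powr r"
    using D_norm_powr[OF assms(1), of g] assms by simp
  ultimately show ?thesis
    by (simp add: powr_divide add_divide_distrib[symmetric])
qed

text \<open>Minkowski by normalization: with A and B the two norms, convexity is applied to the
  moduli of g/A and h/B with weights A/(A+B) and B/(A+B), and both normalized powers have mean
  1.\<close>

lemma D_norm_triangle:
  assumes "r \<ge> 1"
  shows "D_norm r (\<lambda>s. g s + h s) \<le> D_norm r g + D_norm r h"
proof -
  have r: "r > 0" using assms by simp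
  define A B where "A = D_norm r g" and "B = D_norm r h"
  show ?thesis
  proof (cases "A = 0 \<or> B = 0")
    case True
    then show ?thesis using D_norm_eq_0_iff[OF assms] by (auto simp: A_def B_def)
  next
    case False
    then have pos: "A > 0" "B > 0" using D_norm_nonneg[of r] by (auto simp: A_def B_def less_le)
    define u v where "u = A / (A + B)" and "v = B / (A + B)"
    have uv: "u \<ge> 0" "v \<ge> 0" "u + v = 1" using pos by (auto simp: u_def v_def add_divide_distrib[symmetric])
    have pt: "(\<bar>g s + h s\<bar> / (A + B)) powr r
        \<le> u * (\<bar>g s\<bar> / A) powr r + v * (\<bar>h s\<bar> / B) powr r" for s
    proof -
      have "\<bar>g s + h s\<bar> / (A + B) \<le> (\<bar>g s\<bar> + \<bar>h s\<bar>) / (A + B)"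
        using pos by (intro divide_right_mono) auto
      also have "\<dots> = u * (\<bar>g s\<bar> / A) + v * (\<bar>h s\<bar> / B)"
        using pos by (simp add: u_def v_def add_divide_distrib)
      finally have "(\<bar>g s + h s\<bar> / (A + B)) powr r \<le> (u * (\<bar>g s\<bar> / A) + v * (\<bar>h s\<bar> / B)) powr r"
        using pos r by (intro powr_mono2) auto
      also have "\<dots> \<le> u * (\<bar>g s\<bar> / A) powr r + v * (\<bar>h s\<bar> / B) powr r"
        using assms uv pos by (intro powr_convex_pair) auto
      finally show ?thesis .
    qed
    have "(\<bar>g True + h True\<bar> / (A + B)) powr r + (\<bar>g False + h False\<bar> / (A + B)) powr r
        \<le> u * ((\<bar>g True\<bar> / A) powr r + (\<bar>g False\<bar> / A) powr r)
          + v * ((\<bar>h True\<bar> / B) powr r + (\<bar>h False\<bar> / B) powr r)"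
      using pt[of True] pt[of False] by (simp add: algebra_simps)
    also have "\<dots> = 2"
      using D_norm_normalized[OF r A_def[symmetric]] D_norm_normalized[OF r B_def[symmetric]] pos uv
      by (simp add: distrib_right[symmetric])
    finally have "D_norm r (\<lambda>s. (g s + h s) / (A + B)) \<le> 1"
      using pos r by (auto simp: D_norm_alt intro!: powr_le1)
    then show ?thesis
      using pos r by (simp add: D_norm_divide A_def B_def field_simps)
  qed
qed

text \<open>Twice the mean is the constant function g + (g reflected), and reflection preserves the
  norm.\<close>

lemma D_norm_mean: "r \<ge> 1 \<Longrightarrow> \<bar>(g True + g False) / 2\<bar> \<le> D_norm r g"
proof -
  assume r: "r \<ge> 1"
  have eq: "D_norm r (\<lambda>s. g (\<not> s)) = D_norm r g" by (simp add: D_norm_alt add.commute)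
  have "\<bar>g True + g False\<bar> = D_norm r (\<lambda>s. g s + g (\<not> s))"
    using r by (simp add: D_norm_alt add.commute powr_powr)
  also have "\<dots> \<le> D_norm r g + D_norm r g"
    using D_norm_triangle[OF r, of g "\<lambda>s. g (\<not> s)"] eq by simp
  finally show ?thesis by simp
qed

lemma D_norm_powr_powr:
  assumes "r > 0" "b > 0"
  shows "D_norm b g powr r = D_norm (b / r) (\<lambda>s. \<bar>g s\<bar> powr r)"
  using assms by (simp add: D_norm_alt powr_powr)

text \<open>Minkowski's integral inequality: after taking \<open>r\<close>-th powers it is the
  triangle inequality in the norm with exponent \<open>b / r\<close>.\<close>

lemma D_norm_swap:
  assumes "0 < r" "r \<le> b"
  shows "D_norm b (\<lambda>s. D_norm r (h s)) \<le> D_norm r (\<lambda>t. D_norm b (\<lambda>s. h s t))"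
proof -
  have b: "b > 0" and k: "b / r \<ge> 1" using assms by auto
  have "D_norm b (\<lambda>s. D_norm r (h s)) powr r
      = D_norm (b/r) (\<lambda>s. \<bar>h s True\<bar> powr r / 2 + \<bar>h s False\<bar> powr r / 2)"
    using assms b by (simp add: D_norm_powr_powr D_norm_powr[OF assms(1), simplified] add_divide_distrib
        D_norm_powr_powr[of r r])
       (simp add: D_norm_alt add_divide_distrib)
  also have "\<dots> \<le> D_norm (b/r) (\<lambda>s. \<bar>h s True\<bar> powr r / 2) + D_norm (b/r) (\<lambda>s. \<bar>h s False\<bar> powr r / 2)"
    by (rule D_norm_triangle[OF k])
  also have "\<dots> = (D_norm b (\<lambda>s. h s True) powr r + D_norm b (\<lambda>s. h s False) powr r) / 2"
    using assms b by (simp add: D_norm_divide D_norm_powr_powr add_divide_distrib)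
  also have "\<dots> = D_norm r (\<lambda>t. D_norm b (\<lambda>s. h s t)) powr r"
    using assms by (simp add: D_norm_powr)
  finally show ?thesis using assms by (simp add: powr_le_powr_iff)
qed

lemma D_norm_holder:
  assumes "r > 1" "r' > 1" "1/r + 1/r' = 1"
  shows "(\<bar>g True * h True\<bar> + \<bar>g False * h False\<bar>) / 2 \<le> D_norm r g * D_norm r' h"
proof -
  define A B where "A = D_norm r g" and "B = D_norm r' h"
  show ?thesis
  proof (cases "A = 0 \<or> B = 0")
    case True
    then show ?thesis using D_norm_eq_0_iff[of r g] D_norm_eq_0_iff[of r' h] assms
      by (auto simp: A_def B_def)
  next
    case False
    then have pos: "A > 0" "B > 0" using D_norm_nonneg[of r g] D_norm_nonneg[of r' h] by (auto simp: A_def B_def less_le)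
    have "\<bar>g s\<bar> / A * (\<bar>h s\<bar> / B) \<le> (\<bar>g s\<bar> / A) powr r / r + (\<bar>h s\<bar> / B) powr r' / r'" for s
      using assms pos by (intro Youngs_inequality) auto
    from this[of True] this[of False]
    have "(\<bar>g True * h True\<bar> + \<bar>g False * h False\<bar>) / (A * B)
       \<le> ((\<bar>g True\<bar> / A) powr r + (\<bar>g False\<bar> / A) powr r) / r
        + ((\<bar>h True\<bar> / B) powr r' + (\<bar>h False\<bar> / B) powr r') / r'"
      by (simp add: add_divide_distrib abs_mult)
    also have "\<dots> = 2 / r + 2 / r'"
      using D_norm_normalized[OF _ A_def[symmetric]] D_norm_normalized[OF _ B_def[symmetric]] pos assms
      by simp
    also have "\<dots> = 2 * (1 / r + 1 / r')" by simp
    also have "\<dots> = 2" using assms(3) by (simp del: add_divide_distrib)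
    finally show ?thesis using pos by (simp add: A_def B_def field_simps)
  qed
qed

lemma D_norm_dual_attained:
  assumes "r > 1" "r' > 1" "1/r + 1/r' = 1" "\<And>s. 0 \<le> g s"
  obtains h where "\<And>s. 0 \<le> h s" "D_norm r' h \<le> 1" "(g True * h True + g False * h False) / 2 = D_norm r g"
proof (cases "D_norm r g = 0")
  case True
  then have "\<And>s. g s = 0" using D_norm_eq_0_iff[of r g] assms by auto
  with True show ?thesis using assms by (intro that[of "\<lambda>_. 0"]) auto
next
  case False
  define A where "A = D_norm r g"
  have A: "A > 0" using False D_norm_nonneg[of r g] by (auto simp: A_def less_le)
  \<comment> \<open>The case of equality in Hoelder's inequality.\<close>
  define h where "h s = (g s / A) powr (r - 1)" for s
  have norm: "(g True / A) powr r + (g False / A) powr r = 2"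
    using D_norm_normalized[OF _ A_def[symmetric]] assms A by simp
  have "(r - 1) * r' = r" using assms by (simp add: field_simps)
  then have "D_norm r' h = 1"
    using norm assms by (simp add: D_norm_alt h_def powr_powr)
  moreover have "g s * h s = A * (g s / A) powr r" for s
  proof (cases "g s = 0")
    case False
    have "0 < g s / A" using A assms(4)[of s] False by simp
    from powr_mult_base[of "g s / A" "r - 1"] this show ?thesis using A by (simp add: h_def field_simps)
  qed auto
  then have "g True * h True + g False * h False = A * ((g True / A) powr r + (g False / A) powr r)"
    by (simp add: distrib_left)
  ultimately show ?thesis using norm A by (intro that[of h]) (auto simp: h_def A_def)
qed

lemma tendsto_D_norm:
  assumes "r > 0" "\<And>s. ((\<lambda>n. g n s) \<longlongrightarrow> h s) F"
  shows "((\<lambda>n. D_norm r (g n)) \<longlongrightarrow> D_norm r h) F"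
  unfolding D_norm_alt
  by (rule tendsto_powr' tendsto_intros assms disjI2 conjI | use assms in \<open>force intro!: always_eventually\<close>)+


section \<open>Mixed norms on functions of finitely many bits\<close>

text \<open>The first exponent belongs to the outermost norm and to the head of the list of bits.\<close>

primrec mixed_norm :: "real list \<Rightarrow> (bool list \<Rightarrow> 'k::real_normed_field) \<Rightarrow> real" where
  "mixed_norm [] f = norm (f [])"
| "mixed_norm (r # rs) f = D_norm r (\<lambda>s. mixed_norm rs (\<lambda>l. f (s # l)))"

lemma mixed_norm_nonneg [simp]: "0 \<le> mixed_norm rs f"
  by (cases rs) auto

lemma mixed_norm_cong:
  "(\<And>l. length l = length rs \<Longrightarrow> f l = g l) \<Longrightarrow> mixed_norm rs f = mixed_norm rs g"
proof (induction rs arbitrary: f g)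
  case (Cons r rs)
  have "mixed_norm rs (\<lambda>l. f (s # l)) = mixed_norm rs (\<lambda>l. g (s # l))" for s
    by (rule Cons.IH) (simp add: Cons.prems)
  then show ?case by simp
qed auto

lemma mixed_norm_mono:
  assumes "\<forall>r\<in>set rs. 0 < r" "\<And>l. length l = length rs \<Longrightarrow> norm (f l) \<le> norm (g l)"
  shows "mixed_norm rs f \<le> mixed_norm rs g"
  using assms
proof (induction rs arbitrary: f g)
  case (Cons r rs)
  have "mixed_norm rs (\<lambda>l. f (s # l)) \<le> mixed_norm rs (\<lambda>l. g (s # l))" for s
    by (rule Cons.IH) (use Cons.prems in auto)
  then show ?case using Cons.prems by (auto intro!: D_norm_mono)
qed auto

lemma mixed_norm_cmult:
  "\<forall>r\<in>set rs. 0 < r \<Longrightarrow> mixed_norm rs (\<lambda>l. c * f l) = norm c * mixed_norm rs f"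
  by (induction rs arbitrary: f) (auto simp: norm_mult D_norm_cmult)

lemma mixed_norm_const [simp]: "\<forall>r\<in>set rs. 0 < r \<Longrightarrow> mixed_norm rs (\<lambda>_. c) = norm c"
  by (induction rs) auto

lemma mixed_norm_norm [simp]: "mixed_norm rs (\<lambda>l. norm (f l)) = mixed_norm rs f"
  by (induction rs arbitrary: f) auto

lemma mixed_norm_triangle:
  "\<forall>r\<in>set rs. 1 \<le> r \<Longrightarrow> mixed_norm rs (\<lambda>l. f l + g l) \<le> mixed_norm rs f + mixed_norm rs g"
proof (induction rs arbitrary: f g)
  case (Cons r rs)
  have "mixed_norm (r # rs) (\<lambda>l. f l + g l)
     \<le> D_norm r (\<lambda>s. mixed_norm rs (\<lambda>l. f (s # l)) + mixed_norm rs (\<lambda>l. g (s # l)))"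
    using Cons by (auto intro!: D_norm_mono)
  also have "\<dots> \<le> mixed_norm (r # rs) f + mixed_norm (r # rs) g"
    using Cons.prems by (auto intro!: D_norm_triangle)
  finally show ?case .
qed (auto intro: norm_triangle_ineq)

lemma mixed_norm_point:
  "\<forall>r\<in>set rs. 1 \<le> r \<Longrightarrow> length l = length rs \<Longrightarrow> norm (f l) \<le> 2 ^ length l * mixed_norm rs f"
proof (induction rs arbitrary: f l)
  case (Cons r rs)
  obtain s l' where l: "l = s # l'" using Cons.prems by (cases l) auto
  have "norm (f l) \<le> 2 ^ length l' * mixed_norm rs (\<lambda>l. f (s # l))"
    using Cons.IH[of l' "\<lambda>l. f (s # l)"] Cons.prems l by auto
  also have "\<dots> \<le> 2 ^ length l' * (2 * mixed_norm (r # rs) f)"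
    using D_norm_point[of r "\<lambda>s. mixed_norm rs (\<lambda>l. f (s # l))" s] Cons.prems
    by (intro mult_left_mono) auto
  finally show ?case by (simp add: l)
qed auto

lemma mixed_norm_eq_0D:
  "\<forall>r\<in>set rs. 1 \<le> r \<Longrightarrow> mixed_norm rs f = 0 \<Longrightarrow> length l = length rs \<Longrightarrow> f l = 0"
  using mixed_norm_point[of rs l f] by auto

lemma tendsto_mixed_norm:
  assumes "\<forall>r\<in>set rs. 0 < r" "\<And>l. length l = length rs \<Longrightarrow> ((\<lambda>n. f n l) \<longlongrightarrow> g l) F"
  shows "((\<lambda>n. mixed_norm rs (f n)) \<longlongrightarrow> mixed_norm rs g) F"
  using assms
proof (induction rs arbitrary: f g)
  case (Cons r rs)
  have "((\<lambda>n. mixed_norm rs (\<lambda>l. f n (s # l))) \<longlongrightarrow> mixed_norm rs (\<lambda>l. g (s # l))) F" for s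
    by (rule Cons.IH) (use Cons.prems in auto)
  then show ?case using Cons.prems by (auto intro!: tendsto_D_norm)
qed (auto intro: tendsto_norm)

text \<open>Averaging over the head bit is a conditional expectation, hence a contraction; iterated,
  this makes the level norms of a martingale increase.\<close>

lemma mixed_norm_mean_le:
  assumes "\<forall>s\<in>set (r # rs). 1 \<le> s"
  shows "mixed_norm rs (\<lambda>l. (f (True # l) + f (False # l)) / 2) \<le> mixed_norm (r # rs) f"
proof -
  have r: "\<forall>r\<in>set rs. 1 \<le> r" "\<forall>r\<in>set rs. 0 < r" "1 \<le> r" using assms by auto
  have "mixed_norm rs (\<lambda>l. (1/2) * (f (True # l) + f (False # l)))
      = (1/2) * mixed_norm rs (\<lambda>l. f (True # l) + f (False # l))"
    by (subst mixed_norm_cmult[OF r(2)]) (simp add: norm_divide)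
  also have "\<dots> \<le> (mixed_norm rs (\<lambda>l. f (True # l)) + mixed_norm rs (\<lambda>l. f (False # l))) / 2"
    using mixed_norm_triangle[OF r(1), of "\<lambda>l. f (True # l)" "\<lambda>l. f (False # l)"] by simp
  also have "\<dots> \<le> mixed_norm (r # rs) f"
    using D_norm_mean[OF r(3), of "\<lambda>s. mixed_norm rs (\<lambda>l. f (s # l))"] by simp
  finally show ?thesis by simp
qed


section \<open>Duality and factorization for mixed norms\<close>

text \<open>The expectation over n fair bits, by recursion on the head so that inductions run in
  step with \<open>mixed_norm\<close>.\<close>

primrec lmean :: "nat \<Rightarrow> (bool list \<Rightarrow> 'k::real_normed_field) \<Rightarrow> 'k" where
  "lmean 0 f = f []"
| "lmean (Suc n) f = (lmean n (\<lambda>l. f (True # l)) + lmean n (\<lambda>l. f (False # l))) / 2"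

lemma lmean_cmult: "lmean n (\<lambda>l. c * f l) = c * lmean n f"
  by (induction n arbitrary: f) (auto simp: algebra_simps)

lemma lmean_cong: "(\<And>l. length l = n \<Longrightarrow> f l = g l) \<Longrightarrow> lmean n f = lmean n g"
proof (induction n arbitrary: f g)
  case (Suc n)
  have "lmean n (\<lambda>l. f (s # l)) = lmean n (\<lambda>l. g (s # l))" for s
    by (rule Suc.IH) (simp add: Suc.prems)
  then show ?case by simp
qed auto

text \<open>The exponents are functions of the entries of an index list, so that several exponent
  lists of the same shape can be treated in a single induction; likewise in the next two
  lemmas.\<close>

lemma mixed_norm_holder:
  assumes "\<forall>e\<in>set es. 1 < \<phi> e \<and> 1 < \<psi> e \<and> 1 / \<phi> e + 1 / \<psi> e = 1"
  shows "norm (lmean (length es) (\<lambda>l. f l * g l)) \<le> mixed_norm (map \<phi> es) f * mixed_norm (map \<psi> es) g"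
  using assms
proof (induction es arbitrary: f g)
  case (Cons e es)
  define A where "A s = mixed_norm (map \<phi> es) (\<lambda>l. f (s # l))" for s
  define B where "B s = mixed_norm (map \<psi> es) (\<lambda>l. g (s # l))" for s
  define m where "m s = lmean (length es) (\<lambda>l. f (s # l) * g (s # l))" for s
  have IH: "norm (m s) \<le> A s * B s" for s
    unfolding m_def A_def B_def by (rule Cons.IH) (use Cons.prems in auto)
  have "norm (lmean (length (e # es)) (\<lambda>l. f l * g l)) = norm (m True + m False) / 2"
    by (simp add: m_def norm_divide)
  also have "\<dots> \<le> (\<bar>A True * B True\<bar> + \<bar>A False * B False\<bar>) / 2"
    using norm_triangle_ineq[of "m True" "m False"] IH[of True] IH[of False]
      abs_ge_self[of "A True * B True"] abs_ge_self[of "A False * B False"]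
    by (intro divide_right_mono) linarith+
  also have "\<dots> \<le> D_norm (\<phi> e) A * D_norm (\<psi> e) B"
    using Cons.prems by (intro D_norm_holder) auto
  finally show ?case by (simp add: A_def[abs_def] B_def[abs_def])
qed (simp add: norm_mult)

lemma mixed_norm_dual_attained:
  assumes "\<forall>e\<in>set es. 1 < \<phi> e \<and> 1 < \<psi> e \<and> 1 / \<phi> e + 1 / \<psi> e = 1"
  shows "\<exists>g :: bool list \<Rightarrow> real. (\<forall>l. 0 \<le> g l) \<and> mixed_norm (map \<psi> es) g \<le> 1 \<and>
           lmean (length es) (\<lambda>l. norm (f l) * g l) = mixed_norm (map \<phi> es) f"
  using assms
proof (induction es arbitrary: f)
  case Nil
  show ?case by (intro exI[of _ "\<lambda>_. 1"]) auto
next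
  case (Cons e es)
  have "\<exists>g :: bool list \<Rightarrow> real. (\<forall>l. 0 \<le> g l) \<and> mixed_norm (map \<psi> es) g \<le> 1 \<and>
      lmean (length es) (\<lambda>l. norm (f (s # l)) * g l) = mixed_norm (map \<phi> es) (\<lambda>l. f (s # l))" for s
    by (rule Cons.IH) (use Cons.prems in auto)
  then obtain g :: "bool \<Rightarrow> bool list \<Rightarrow> real" where g: "\<And>s l. 0 \<le> g s l"
    "\<And>s. mixed_norm (map \<psi> es) (g s) \<le> 1"
    "\<And>s. lmean (length es) (\<lambda>l. norm (f (s # l)) * g s l) = mixed_norm (map \<phi> es) (\<lambda>l. f (s # l))"
    by metis
  define A where "A s = mixed_norm (map \<phi> es) (\<lambda>l. f (s # l))" for s
  obtain h where h: "\<And>s. 0 \<le> h s" "D_norm (\<psi> e) h \<le> 1"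
      "(A True * h True + A False * h False) / 2 = D_norm (\<phi> e) A"
    using D_norm_dual_attained[of "\<phi> e" "\<psi> e" A] Cons.prems by (auto simp: A_def)
  \<comment> \<open>Norming functions of the sections, weighted by a norming function of the section
    norms.\<close>
  define G where "G l = h (hd l) * g (hd l) (tl l)" for l
  have "mixed_norm (map \<psi> es) (\<lambda>l. G (s # l)) \<le> h s" for s
  proof -
    have "mixed_norm (map \<psi> es) (\<lambda>l. G (s # l)) = h s * mixed_norm (map \<psi> es) (g s)"
    proof -
      have "\<forall>r\<in>set (map \<psi> es). 0 < r" using Cons.prems by fastforce
      from mixed_norm_cmult[OF this, of "h s" "g s"] show ?thesis using h(1)[of s] by (simp add: G_def)
    qed
    then show ?thesis using mult_left_le[OF g(2)[of s] h(1)[of s]] by simp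
  qed
  then have "mixed_norm (map \<psi> (e # es)) G \<le> D_norm (\<psi> e) h"
    using Cons.prems by (auto intro!: D_norm_mono order_trans[OF _ abs_ge_self])
  moreover have "lmean (length es) (\<lambda>l. norm (f (s # l)) * G (s # l)) = h s * A s" for s
  proof -
    have "lmean (length es) (\<lambda>l. norm (f (s # l)) * G (s # l))
        = lmean (length es) (\<lambda>l. h s * (norm (f (s # l)) * g s l))"
      by (rule lmean_cong) (simp add: G_def)
    then show ?thesis by (simp add: lmean_cmult g A_def)
  qed
  ultimately show ?case using h g(1)
    by (intro exI[of _ G]) (auto simp: G_def A_def[abs_def] mult.commute intro: order_trans)
qed

lemma calderon_factorization:
  assumes th: "0 < \<theta>" "\<theta> < 1"
    and "\<forall>e\<in>set es. 1 \<le> \<phi> e \<and> 1 \<le> \<phi>0 e \<and> 1 \<le> \<phi>1 e \<and> 1 / \<phi> e = (1 - \<theta>) / \<phi>0 e + \<theta> / \<phi>1 e"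
  shows "\<exists>f0 f1 :: bool list \<Rightarrow> real. (\<forall>l. 0 \<le> f0 l \<and> 0 \<le> f1 l) \<and>
      (\<forall>l. length l = length es \<longrightarrow> norm (f l) = f0 l powr (1 - \<theta>) * f1 l powr \<theta>) \<and>
      mixed_norm (map \<phi>0 es) f0 \<le> mixed_norm (map \<phi> es) f \<and>
      mixed_norm (map \<phi>1 es) f1 \<le> mixed_norm (map \<phi> es) f"
  using assms(3)
proof (induction es arbitrary: f)
  case Nil
  show ?case
    by (intro exI[of _ "\<lambda>l. norm (f l)"] exI[of _ "\<lambda>l. norm (f l)"]) (auto simp flip: powr_add)
next
  case (Cons e es)
  define a where "a s = mixed_norm (map \<phi> es) (\<lambda>l. f (s # l))" for s
  have "\<exists>f0 f1 :: bool list \<Rightarrow> real. (\<forall>l. 0 \<le> f0 l \<and> 0 \<le> f1 l) \<and>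
      (\<forall>l. length l = length es \<longrightarrow> norm (f (s # l)) = f0 l powr (1 - \<theta>) * f1 l powr \<theta>) \<and>
      mixed_norm (map \<phi>0 es) f0 \<le> a s \<and> mixed_norm (map \<phi>1 es) f1 \<le> a s" for s
    unfolding a_def by (rule Cons.IH) (use Cons.prems in auto)
  then obtain g0 g1 :: "bool \<Rightarrow> bool list \<Rightarrow> real" where g: "\<And>s l. 0 \<le> g0 s l" "\<And>s l. 0 \<le> g1 s l"
    "\<And>s l. length l = length es \<Longrightarrow> norm (f (s # l)) = g0 s l powr (1 - \<theta>) * g1 s l powr \<theta>"
    "\<And>s. mixed_norm (map \<phi>0 es) (g0 s) \<le> a s" "\<And>s. mixed_norm (map \<phi>1 es) (g1 s) \<le> a s"
    by metis
  have pos: "0 < \<phi> e" "0 < \<phi>0 e" "0 < \<phi>1 e" "1 / \<phi> e = (1 - \<theta>) / \<phi>0 e + \<theta> / \<phi>1 e" "1 \<le> \<phi> e"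
    using Cons.prems by auto
  define A where "A = D_norm (\<phi> e) a"
  have A0: "A \<ge> 0" by (simp add: A_def)
  have a0: "a s \<ge> 0" for s by (simp add: a_def)
  \<comment> \<open>The factors of a section have norm at most \<open>a s\<close>. This weight turns
    \<open>a s\<close> into \<open>A * (a s / A) powr (\<phi> e / r)\<close>, whose norm with
    exponent \<open>r\<close> is at most A. By the relation between the exponents, the weights for
    \<open>\<phi>0 e\<close> and \<open>\<phi>1 e\<close> cancel in the product. Where
    \<open>a s = 0\<close> the weight is 0, and \<open>f\<close> vanishes there.\<close>
  define c where "c r s = (a s / A) powr (\<phi> e / r - 1)" for r s
  have f0: "f (s # l) = 0" if "a s = 0" "length l = length es" for s l
    using mixed_norm_eq_0D[of "map \<phi> es" "\<lambda>l. f (s # l)" l] that Cons.prems by (auto simp: a_def)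
  have aA: "a s = 0" if "A = 0" for s
    using that D_norm_eq_0_iff[of "\<phi> e" a] pos by (simp add: A_def)
  have bound: "D_norm r (\<lambda>s. mixed_norm (map \<phi>' es) (\<lambda>l. c r s * g s l)) \<le> A"
    if r: "0 < r" and g': "\<And>s. mixed_norm (map \<phi>' es) (g s) \<le> a s" and "\<forall>e\<in>set es. 1 \<le> \<phi>' e"
    for r \<phi>' and g :: "bool \<Rightarrow> bool list \<Rightarrow> real"
  proof -
    have "mixed_norm (map \<phi>' es) (\<lambda>l. c r s * g s l) \<le> c r s * a s" for s
    proof -
      have "mixed_norm (map \<phi>' es) (\<lambda>l. c r s * g s l) = c r s * mixed_norm (map \<phi>' es) (g s)"
        using that(3) by (subst mixed_norm_cmult) (auto simp: c_def)
      also have "\<dots> \<le> c r s * a s" using g' by (intro mult_left_mono) (auto simp: c_def)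
      finally show ?thesis .
    qed
    moreover have "c r s * a s = A * (a s / A) powr (\<phi> e / r)" for s
    proof (cases "a s = 0")
      case False
      then have "A > 0" using aA[of s] A0 by fastforce
      then have "0 < a s / A" using False a0[of s] by auto
      from powr_mult_base[OF less_imp_le[OF this], of "\<phi> e / r - 1"] show ?thesis
        using \<open>A > 0\<close> by (simp add: c_def field_simps)
    qed auto
    ultimately have "D_norm r (\<lambda>s. mixed_norm (map \<phi>' es) (\<lambda>l. c r s * g s l))
        \<le> D_norm r (\<lambda>s. A * (a s / A) powr (\<phi> e / r))"
      using r A0 by (intro D_norm_mono) (auto simp: abs_mult)
    also have "\<dots> = A * D_norm r (\<lambda>s. (a s / A) powr (\<phi> e / r))"
      using r A0 by (simp add: D_norm_cmult)
    also have "\<dots> \<le> A"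
    proof (cases "A = 0")
      case False
      have "(a True / A) powr \<phi> e + (a False / A) powr \<phi> e = 2"
        using D_norm_normalized[OF pos(1) A_def[symmetric] False] a0 by simp
      then show ?thesis using r by (simp add: D_norm_alt powr_powr)
    qed simp
    finally show ?thesis .
  qed
  define F0 where "F0 l = c (\<phi>0 e) (hd l) * g0 (hd l) (tl l)" for l
  define F1 where "F1 l = c (\<phi>1 e) (hd l) * g1 (hd l) (tl l)" for l
  have "norm (f l) = F0 l powr (1 - \<theta>) * F1 l powr \<theta>" if l: "length l = length (e # es)" for l
  proof -
    obtain s l' where l': "l = s # l'" "length l' = length es" using l by (cases l) auto
    show ?thesis
    proof (cases "a s = 0")
      case True
      then show ?thesis using f0[OF True l'(2)] l' by (simp add: F0_def c_def)
    next
      case False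
      then have "A > 0" using aA[of s] A0 by fastforce
      then have x: "0 < a s / A" using False a0[of s] by auto
      have "(\<phi> e / \<phi>0 e - 1) * (1 - \<theta>) + (\<phi> e / \<phi>1 e - 1) * \<theta>
          = \<phi> e * ((1 - \<theta>) / \<phi>0 e + \<theta> / \<phi>1 e) - 1"
        by (simp add: algebra_simps)
      also have "\<dots> = 0" using pos by (simp flip: pos(4))
      finally have "c (\<phi>0 e) s powr (1 - \<theta>) * c (\<phi>1 e) s powr \<theta> = 1"
        using x by (simp add: c_def powr_powr powr_add[symmetric]) auto
      then show ?thesis
        using g(1,2)[of s l'] g(3)[OF l'(2), of s] l' by (simp add: F0_def F1_def powr_mult c_def)
    qed
  qed
  moreover have "mixed_norm (map \<phi>0 (e # es)) F0 \<le> mixed_norm (map \<phi> (e # es)) f"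
    using bound[of "\<phi>0 e" \<phi>0 g0] g(4) pos Cons.prems by (simp add: F0_def A_def a_def[abs_def])
  moreover have "mixed_norm (map \<phi>1 (e # es)) F1 \<le> mixed_norm (map \<phi> (e # es)) f"
    using bound[of "\<phi>1 e" \<phi>1 g1] g(5) pos Cons.prems by (simp add: F1_def A_def a_def[abs_def])
  ultimately show ?case using g(1,2)
    by (intro exI[of _ F0] exI[of _ F1]) (auto simp: F0_def F1_def c_def)
qed


section \<open>A uniform convexity inequality\<close>

lemma powr_concave_pair:
  fixes x y u v \<alpha> :: real
  assumes "0 < \<alpha>" "\<alpha> \<le> 1" "0 \<le> x" "0 \<le> y" "0 \<le> u" "0 \<le> v" "u + v = 1"
  shows "u * x powr \<alpha> + v * y powr \<alpha> \<le> (u * x + v * y) powr \<alpha>"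
proof -
  have "(u * x powr \<alpha> + v * y powr \<alpha>) powr (1/\<alpha>) \<le> u * (x powr \<alpha>) powr (1/\<alpha>) + v * (y powr \<alpha>) powr (1/\<alpha>)"
    using assms by (intro powr_convex_pair) auto
  also have "\<dots> = u * x + v * y" using assms by (simp add: powr_powr)
  finally have "((u * x powr \<alpha> + v * y powr \<alpha>) powr (1/\<alpha>)) powr \<alpha> \<le> (u * x + v * y) powr \<alpha>"
    using assms by (intro powr_mono2) auto
  then show ?thesis using assms by (simp add: powr_powr)
qed

text \<open>\<open>a * (a - 1) / 2\<close> is the second Taylor coefficient of the right-hand side
  at 0, and the second derivative is at least its value there: \<open>(1 + t) powr (a - 2)\<close>
  and \<open>(1 - t) powr (a - 2)\<close> add up to at least 2, by the geometric mean and
  \<open>a \<le> 2\<close>.\<close>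

lemma two_point_quadratic:
  fixes a r :: real
  assumes a: "1 < a" "a \<le> 2" and r: "0 \<le> r" "r \<le> 1"
  shows "1 + a * (a - 1) / 2 * r\<^sup>2 \<le> ((1 + r) powr a + (1 - r) powr a) / 2"
proof -
  have D1: "2 * (a - 1) * x \<le> (1 + x) powr (a - 1) - (1 - x) powr (a - 1)" if x: "0 \<le> x" "x < 1" for x
  proof -
    have "(1 + 0) powr (a - 1) - (1 - 0) powr (a - 1) - 2 * (a - 1) * 0
        \<le> (1 + x) powr (a - 1) - (1 - x) powr (a - 1) - 2 * (a - 1) * x"
    proof (rule DERIV_nonneg_imp_nondecreasing[OF x(1)])
      fix t assume t: "0 \<le> t" "t \<le> x"
      have amgm: "2 \<le> (1 + t) powr (a - 2) + (1 - t) powr (a - 2)"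
      proof -
        define X where "X = (1 + t) powr ((a - 2)/2)"
        define Y where "Y = (1 - t) powr ((a - 2)/2)"
        have "X * Y = (1 - t\<^sup>2) powr ((a - 2)/2)"
        proof -
          have "X * Y = ((1 + t) * (1 - t)) powr ((a - 2)/2)"
            using t x by (simp only: X_def Y_def powr_mult)
          then show ?thesis by (simp add: power2_eq_square algebra_simps)
        qed
        moreover have "(1 - t\<^sup>2) powr ((a - 2)/2) \<ge> 1"
        proof -
          have "t\<^sup>2 < 1" using t x by (simp add: abs_square_less_1)
          then have "(1 - t\<^sup>2) powr 0 \<le> (1 - t\<^sup>2) powr ((a - 2)/2)"
            using a by (intro powr_mono') auto
          then show ?thesis using \<open>t\<^sup>2 < 1\<close> by simp
        qed
        moreover have "X\<^sup>2 = (1 + t) powr (a - 2)" "Y\<^sup>2 = (1 - t) powr (a - 2)"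
          using t x by (simp_all only: X_def Y_def power2_eq_square powr_add[symmetric] field_sum_of_halves)
        moreover have "X\<^sup>2 + Y\<^sup>2 - 2 * (X * Y) = (X - Y)\<^sup>2" by (simp add: power2_eq_square algebra_simps)
        moreover have "(X - Y)\<^sup>2 \<ge> 0" by simp
        ultimately show ?thesis by linarith
      qed
      have "((\<lambda>x. (1 + x) powr (a - 1) - (1 - x) powr (a - 1) - 2 * (a - 1) * x) has_real_derivative
          (a - 1) * ((1 + t) powr (a - 2) + (1 - t) powr (a - 2) - 2)) (at t)"
        using t x by (auto intro!: derivative_eq_intros simp: algebra_simps)
      moreover have "(a - 1) * ((1 + t) powr (a - 2) + (1 - t) powr (a - 2) - 2) \<ge> 0"
        using a amgm by auto
      ultimately show "\<exists>y. ((\<lambda>x. (1 + x) powr (a - 1) - (1 - x) powr (a - 1) - 2 * (a - 1) * x)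
          has_real_derivative y) (at t) \<and> y \<ge> 0" by blast
    qed
    then show ?thesis by simp
  qed
  define h where "h x = ((1 + x) powr a + (1 - x) powr a) / 2 - 1 - a * (a - 1) / 2 * x\<^sup>2" for x
  have "h 0 \<le> h r"
  \<comment> \<open>At r = 1 the base \<open>1 - x\<close> reaches 0; so the derivative is taken in
    the open interval, and continuity covers the endpoint.\<close>
  proof (rule DERIV_nonneg_imp_increasing_open[OF r(1)])
    fix t assume t: "0 < t" "t < r"
    have "(h has_real_derivative a / 2 * ((1 + t) powr (a - 1) - (1 - t) powr (a - 1) - 2 * (a - 1) * t)) (at t)"
      unfolding h_def using t r by (auto intro!: derivative_eq_intros simp: field_simps)
    moreover have "a / 2 * ((1 + t) powr (a - 1) - (1 - t) powr (a - 1) - 2 * (a - 1) * t) \<ge> 0"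
      using D1[of t] t r a by (intro mult_nonneg_nonneg) auto
    ultimately show "\<exists>y. (h has_real_derivative y) (at t) \<and> 0 \<le> y" by blast
  next
    show "continuous_on {0..r} h"
      unfolding h_def using r a by (intro continuous_intros continuous_on_powr') auto
  qed
  then have "0 \<le> ((1 + r) powr a + (1 - r) powr a) / 2 - 1 - a * (a - 1) / 2 * r\<^sup>2"
    by (simp add: h_def)
  then show ?thesis by linarith
qed

lemma power2_powr_half: "0 \<le> x \<Longrightarrow> (x\<^sup>2) powr (a/2) = x powr (a::real)"
  by (cases "x = 0") (simp_all add: powr_def ln_realpow)

text \<open>For fixed norms of u and v the worst case is that they are parallel: the squared norms
  of u + v and u - v are s + t and s - t with |t| at most T, and t = T is the worst case by
  concavity of the power a/2. This leaves the scalar inequality for the ratio of the norms. If v is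
  the longer vector, exchanging the two only increases the left-hand side, since the constant is at
  most 1.\<close>

lemma two_point_inner:
  fixes u v :: "'h::real_inner"
  assumes a: "1 < a" "a \<le> 2" and b: "2 \<le> b"
  shows "norm u powr b + a * (a - 1) / 2 * norm v powr b
     \<le> D_norm a (\<lambda>s. norm (if s then u + v else u - v)) powr b"
proof -
  define \<kappa> where "\<kappa> = a * (a - 1) / 2"
  have k: "0 < \<kappa>" "\<kappa> \<le> 1"
  proof -
    have "a * (a - 1) \<le> 2 * 1" using a by (intro mult_mono) auto
    then show "0 < \<kappa>" "\<kappa> \<le> 1" using a by (auto simp: \<kappa>_def)
  qed
  have main: "norm u powr b + \<kappa> * norm v powr b
     \<le> D_norm a (\<lambda>s. norm (if s then u + v else u - v)) powr b" if le: "norm v \<le> norm u" for u v :: 'h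
  proof (cases "u = 0")
    case True
    then show ?thesis using le by simp
  next
    case False
    define x y t where "x = norm u" "y = norm v" "t = 2 * inner u v"
    have xy: "x > 0" "0 \<le> y" "y \<le> x" using False le by (auto simp: x_y_t_def)
    define s T where "s = x\<^sup>2 + y\<^sup>2" "T = 2 * x * y"
    have tT: "\<bar>t\<bar> \<le> T" using Cauchy_Schwarz_ineq2[of u v] by (simp add: x_y_t_def s_T_def)
    have sT: "s + T = (x + y)\<^sup>2" "s - T = (x - y)\<^sup>2" by (auto simp: s_T_def power2_eq_square algebra_simps)
    have pow: "norm w powr a = ((norm w)\<^sup>2) powr (a/2)" for w :: 'h
      by (simp add: power2_powr_half)
    have uv: "(norm (u + v))\<^sup>2 = s + t" "(norm (u - v))\<^sup>2 = s - t"
      by (auto simp: s_T_def x_y_t_def power2_norm_eq_inner inner_add inner_diff inner_commute)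
    have conc: "(s + T) powr (a/2) + (s - T) powr (a/2) \<le> (s + t) powr (a/2) + (s - t) powr (a/2)"
    proof (cases "T = 0")
      case True then show ?thesis using tT by simp
    next
      case F: False
      then have T: "T > 0" using tT by auto
      define l m where "l = (T + t) / (2 * T)" "m = (T - t) / (2 * T)"
      have lm: "0 \<le> l" "0 \<le> m" "l + m = 1" using T tT by (auto simp: l_m_def add_divide_distrib[symmetric])
      have st: "s + t = l * (s + T) + m * (s - T)" "s - t = m * (s + T) + l * (s - T)"
        using T by (auto simp: l_m_def field_simps)
      have nn: "s + T \<ge> 0" "s - T \<ge> 0" by (auto simp: sT)
      have "l * (s + T) powr (a/2) + m * (s - T) powr (a/2) \<le> (s + t) powr (a/2)"
        unfolding st(1) using a lm nn by (intro powr_concave_pair) auto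
      moreover have "m * (s + T) powr (a/2) + l * (s - T) powr (a/2) \<le> (s - t) powr (a/2)"
        unfolding st(2) using a lm nn by (intro powr_concave_pair) auto
      moreover have "m = 1 - l" using lm by simp
      ultimately show ?thesis by (simp add: algebra_simps)
    qed
    define r where "r = y / x"
    have r: "0 \<le> r" "r \<le> 1" using xy by (auto simp: r_def)
    have yx: "y = r * x" using xy by (simp add: r_def)
    define D where "D = D_norm a (\<lambda>s. norm (if s then u + v else u - v))"
    have "x powr a * (1 + \<kappa> * r\<^sup>2) \<le> x powr a * (((1 + r) powr a + (1 - r) powr a) / 2)"
      using two_point_quadratic[OF a r] by (intro mult_left_mono) (auto simp: \<kappa>_def)
    also have "\<dots> = ((x + y) powr a + (x - y) powr a) / 2"
    proof -
      have "x + y = x * (1 + r)" "x - y = x * (1 - r)" by (auto simp: yx algebra_simps)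
      then have "(x + y) powr a = x powr a * (1 + r) powr a" "(x - y) powr a = x powr a * (1 - r) powr a"
        using r xy by (simp_all only: powr_mult)
      then show ?thesis by (simp add: algebra_simps)
    qed
    also have "\<dots> = ((s + T) powr (a/2) + (s - T) powr (a/2)) / 2"
      using xy unfolding sT by (simp add: power2_powr_half)
    also have "\<dots> \<le> D powr a"
      using conc a unfolding D_def by (subst D_norm_powr) (auto simp: pow uv)
    finally have "(x powr a * (1 + \<kappa> * r\<^sup>2)) powr (b/a) \<le> (D powr a) powr (b/a)"
      using k b a by (intro powr_mono2) auto
    then have 1: "x powr b * (1 + \<kappa> * r\<^sup>2) powr (b/a) \<le> D powr b"
      using a k by (simp add: powr_mult powr_powr)
    \<comment> \<open>\<open>b \<ge> 2\<close> enters twice: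
      \<open>r powr b \<le> r\<^sup>2\<close>, and the outer power \<open>b / a\<close> is at least
      1.\<close>
    have "1 + \<kappa> * r powr b \<le> 1 + \<kappa> * r\<^sup>2"
    proof (cases "r = 0")
      case False
      then have "r powr b \<le> r powr 2" using r b by (intro powr_mono') auto
      then show ?thesis using k r False by (simp add: powr_numeral)
    qed auto
    also have "\<dots> = (1 + \<kappa> * r\<^sup>2) powr 1" using k by (simp add: add_nonneg_nonneg)
    also have "\<dots> \<le> (1 + \<kappa> * r\<^sup>2) powr (b/a)" using k a b by (intro powr_mono) auto
    finally have "x powr b * (1 + \<kappa> * r powr b) \<le> D powr b"
      using 1 by (meson mult_left_mono powr_ge_zero order_trans)
    moreover have "x powr b * (1 + \<kappa> * r powr b) = x powr b + \<kappa> * y powr b"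
      using xy r by (simp add: yx powr_mult algebra_simps)
    ultimately show ?thesis by (simp add: x_y_t_def D_def)
  qed
  show ?thesis
  proof (cases "norm v \<le> norm u")
    case True then show ?thesis using main by (simp add: \<kappa>_def)
  next
    case False
    then have "norm u powr b \<le> norm v powr b" using b by (intro powr_mono2) auto
    then have "norm u powr b + \<kappa> * norm v powr b \<le> norm v powr b + \<kappa> * norm u powr b"
      using k mult_left_mono[of "norm u powr b" "norm v powr b" "1 - \<kappa>"] by (simp add: algebra_simps)
    also have "\<dots> \<le> D_norm a (\<lambda>s. norm (if s then v + u else v - u)) powr b"
      using False by (intro main) auto
    also have "D_norm a (\<lambda>s. norm (if s then v + u else v - u)) = D_norm a (\<lambda>s. norm (if s then u + v else u - v))"
      by (simp add: D_norm_alt add.commute norm_minus_commute)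
    finally show ?thesis by (simp add: \<kappa>_def)
  qed
qed

text \<open>Written as a comparison of two norms over the sign \<open>\<sigma>\<close>, with
  exponent b on the left and a on the right, the inequality passes through a norm with exponent r by
  two swaps: the b-norm moves inside as r \<le> b, the a-norm moves outside as a \<le> r. The
  factors \<open>2 powr (1/b)\<close> and \<open>\<kappa>\<close> make the left side the b-th root
  of the expression in \<open>two_point_inner\<close>.\<close>

lemma mixed_norm_convexity_aux:
  fixes u v :: "bool list \<Rightarrow> 'k::{real_normed_field,real_inner}"
  assumes a: "1 < a" "a \<le> 2" and b: "2 \<le> b" and rs: "\<forall>r\<in>set rs. a \<le> r \<and> r \<le> b"
  defines "\<kappa> \<equiv> (a * (a - 1) / 2) powr (1/b)"
  shows "2 powr (1/b) * D_norm b (\<lambda>\<sigma>. if \<sigma> then mixed_norm rs u else \<kappa> * mixed_norm rs v)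
     \<le> D_norm a (\<lambda>\<sigma>. mixed_norm rs (\<lambda>l. if \<sigma> then u l + v l else u l - v l))"
  using rs
proof (induction rs arbitrary: u v)
  case Nil
  let ?D = "D_norm b (\<lambda>\<sigma>. if \<sigma> then norm (u []) else \<kappa> * norm (v []))"
  have "(2 powr (1/b) * ?D) powr b = norm (u []) powr b + a * (a - 1) / 2 * norm (v []) powr b"
    using a b by (simp add: powr_mult D_norm_powr powr_powr abs_mult \<kappa>_def)
  also have "\<dots> \<le> D_norm a (\<lambda>s. norm (if s then u [] + v [] else u [] - v [])) powr b"
    by (rule two_point_inner[OF a b])
  finally show ?case unfolding mixed_norm.simps using b by (subst (asm) powr_le_powr_iff) auto
next
  case (Cons r rs)
  have r: "a \<le> r" "r \<le> b" "0 < r" using Cons.prems a by auto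
  define U where "U s = mixed_norm rs (\<lambda>l. u (s # l))" for s
  define V where "V s = mixed_norm rs (\<lambda>l. v (s # l))" for s
  define W where "W \<sigma> s = mixed_norm rs (\<lambda>l. if \<sigma> then u (s # l) + v (s # l) else u (s # l) - v (s # l))" for \<sigma> s
  have "2 powr (1/b) * D_norm b (\<lambda>\<sigma>. if \<sigma> then D_norm r U else \<kappa> * D_norm r V)
      = 2 powr (1/b) * D_norm b (\<lambda>\<sigma>. D_norm r (\<lambda>s. if \<sigma> then U s else \<kappa> * V s))"
    using r by (simp add: if_distrib D_norm_cmult \<kappa>_def cong: if_cong)
       (simp add: D_norm_alt[of b] D_norm_cmult)
  also have "\<dots> \<le> 2 powr (1/b) * D_norm r (\<lambda>s. D_norm b (\<lambda>\<sigma>. if \<sigma> then U s else \<kappa> * V s))"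
    using r by (intro mult_left_mono D_norm_swap) auto
  also have "\<dots> = D_norm r (\<lambda>s. 2 powr (1/b) * D_norm b (\<lambda>\<sigma>. if \<sigma> then U s else \<kappa> * V s))"
    using r by (simp add: D_norm_cmult)
  also have "\<dots> \<le> D_norm r (\<lambda>s. D_norm a (\<lambda>\<sigma>. W \<sigma> s))"
  proof (rule D_norm_mono[OF r(3)])
    fix s
    have "2 powr (1/b) * D_norm b (\<lambda>\<sigma>. if \<sigma> then U s else \<kappa> * V s) \<le> D_norm a (\<lambda>\<sigma>. W \<sigma> s)"
      unfolding U_def V_def W_def by (rule Cons.IH) (use Cons.prems in auto)
    then show "\<bar>2 powr (1/b) * D_norm b (\<lambda>\<sigma>. if \<sigma> then U s else \<kappa> * V s)\<bar> \<le> \<bar>D_norm a (\<lambda>\<sigma>. W \<sigma> s)\<bar>"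
      by simp
  qed
  also have "\<dots> \<le> D_norm a (\<lambda>\<sigma>. D_norm r (\<lambda>s. W \<sigma> s))"
    using a r by (intro D_norm_swap) auto
  finally show ?case unfolding mixed_norm.simps U_def[abs_def] V_def[abs_def] W_def .
qed

lemma mixed_norm_convexity:
  fixes u v :: "bool list \<Rightarrow> 'k::{real_normed_field,real_inner}"
  assumes a: "1 < a" "a \<le> 2" and b: "2 \<le> b" and rs: "\<forall>r\<in>set rs. a \<le> r \<and> r \<le> b"
  shows "mixed_norm rs u powr b + a * (a - 1) / 2 * mixed_norm rs v powr b
     \<le> D_norm a (\<lambda>\<sigma>. mixed_norm rs (\<lambda>l. if \<sigma> then u l + v l else u l - v l)) powr b"
proof -
  define D where "D = D_norm b (\<lambda>\<sigma>. if \<sigma> then mixed_norm rs u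
      else (a * (a - 1) / 2) powr (1/b) * mixed_norm rs v)"
  have "mixed_norm rs u powr b + a * (a - 1) / 2 * mixed_norm rs v powr b = (2 powr (1/b) * D) powr b"
    using a b by (simp add: D_def powr_mult D_norm_powr powr_powr abs_mult)
  also have "\<dots> \<le> D_norm a (\<lambda>\<sigma>. mixed_norm rs (\<lambda>l. if \<sigma> then u l + v l else u l - v l)) powr b"
    unfolding D_def using b by (intro powr_mono2 mixed_norm_convexity_aux assms) (auto simp: rs)
  finally show ?thesis .
qed


section \<open>The maximum principle on the strip\<close>

text \<open>The three lines theorem with equal bounds. The factor
  \<open>exp (\<epsilon> * (z\<^sup>2 - 1))\<close> has norm at most 1 on the strip and decays
  vertically, so that the maximum principle on a large rectangle applies; then
  \<open>\<epsilon>\<close> tends to 0.\<close>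

lemma strip_maximum:
  assumes cont: "continuous_on {z. 0 \<le> Re z \<and> Re z \<le> 1} G"
    and hol: "G holomorphic_on {z. 0 < Re z \<and> Re z < 1}"
    and B: "\<And>z. 0 \<le> Re z \<Longrightarrow> Re z \<le> 1 \<Longrightarrow> norm (G z) \<le> B"
    and M0: "\<And>t. norm (G (Complex 0 t)) \<le> M" and M1: "\<And>t. norm (G (Complex 1 t)) \<le> M"
    and \<xi>: "0 \<le> Re \<xi>" "Re \<xi> \<le> 1"
  shows "norm (G \<xi>) \<le> M"
proof -
  \<comment> \<open>The height of the rectangle can be chosen for a strictly positive bound; M = 0
    is reached by a limit at the end.\<close>
  have pos: "norm (G \<xi>) \<le> M" if M: "M > 0" and M0: "\<And>t. norm (G (Complex 0 t)) \<le> M"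
    and M1: "\<And>t. norm (G (Complex 1 t)) \<le> M" for M
  proof -
    have est: "norm (G \<xi>) \<le> M * exp (\<epsilon> * (1 - Re (\<xi>\<^sup>2)))" if \<epsilon>: "\<epsilon> > 0" for \<epsilon> :: real
    proof -
      define E where "E z = exp (of_real \<epsilon> * (z\<^sup>2 - 1))" for z :: complex
      have nE: "norm (E z) = exp (\<epsilon> * ((Re z)\<^sup>2 - (Im z)\<^sup>2 - 1))" for z
        by (simp add: E_def norm_exp_eq_Re power2_eq_square)
      have E1: "norm (E z) \<le> exp (- \<epsilon> * (Im z)\<^sup>2)" if "0 \<le> Re z" "Re z \<le> 1" for z
      proof -
        have "(Re z)\<^sup>2 \<le> 1" using that by (simp add: power_le_one)
        then have "\<epsilon> * ((Re z)\<^sup>2 - (Im z)\<^sup>2 - 1) \<le> \<epsilon> * (- (Im z)\<^sup>2)" using \<epsilon> by (intro mult_left_mono) auto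
        then show ?thesis by (simp add: nE)
      qed
      have "((\<lambda>R. B * exp (- \<epsilon> * R\<^sup>2)) \<longlongrightarrow> 0) at_top"
        using \<epsilon> by real_asymp
      then have "eventually (\<lambda>R. B * exp (- \<epsilon> * R\<^sup>2) < M) at_top"
        using M by (simp add: order_tendstoD)
      then have "eventually (\<lambda>R. B * exp (- \<epsilon> * R\<^sup>2) < M \<and> R \<ge> \<bar>Im \<xi>\<bar> + 1) at_top"
        by (intro eventually_conj eventually_ge_at_top)
      then obtain R where R: "B * exp (- \<epsilon> * R\<^sup>2) < M" "R \<ge> \<bar>Im \<xi>\<bar> + 1"
        by (auto simp: eventually_at_top_linorder)
      define S where "S = cbox (Complex 0 (-R)) (Complex 1 R)"
      have S: "z \<in> S \<longleftrightarrow> 0 \<le> Re z \<and> Re z \<le> 1 \<and> -R \<le> Im z \<and> Im z \<le> R" for z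
        by (auto simp: S_def in_cbox_complex_iff)
      have "norm (G \<xi> * E \<xi>) \<le> M"
      proof (rule maximum_modulus_frontier[of "\<lambda>z. G z * E z" S])
        show "(\<lambda>z. G z * E z) holomorphic_on interior S"
          unfolding S_def interior_cbox E_def
          by (intro holomorphic_intros holomorphic_on_subset[OF hol]) (auto simp: in_box_complex_iff)
        show "continuous_on (closure S) (\<lambda>z. G z * E z)"
        proof -
          have "closure S = S" by (simp add: S_def)
          then show ?thesis unfolding E_def
            by (intro continuous_intros continuous_on_subset[OF cont]) (auto simp: S)
        qed
        show "bounded S" by (simp add: S_def)
        show "\<xi> \<in> S" using \<xi> R by (auto simp: S)
      next
        fix z assume "z \<in> frontier S"
        then have z: "z \<in> S" "z \<notin> box (Complex 0 (-R)) (Complex 1 R)" by (auto simp: S_def frontier_cbox)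
        then have z1: "0 \<le> Re z" "Re z \<le> 1" by (auto simp: S)
        from z have "Re z = 0 \<or> Re z = 1 \<or> \<bar>Im z\<bar> = R" by (auto simp: S in_box_complex_iff)
        then show "norm (G z * E z) \<le> M"
        proof (elim disjE)
          assume "Re z = 0"
          then have "z = Complex 0 (Im z)" by (simp add: complex_eq_iff)
          then have "norm (G z) \<le> M" using M0 by metis
          moreover have "norm (E z) \<le> 1" using E1[OF z1] \<epsilon> by (auto intro: order_trans)
          ultimately show ?thesis using mult_mono[of "norm (G z)" M "norm (E z)" 1] M by (simp add: norm_mult)
        next
          assume "Re z = 1"
          then have "z = Complex 1 (Im z)" by (simp add: complex_eq_iff)
          then have "norm (G z) \<le> M" using M1 by metis
          moreover have "norm (E z) \<le> 1" using E1[OF z1] \<epsilon> by (auto intro: order_trans)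
          ultimately show ?thesis using mult_mono[of "norm (G z)" M "norm (E z)" 1] M by (simp add: norm_mult)
        next
          assume "\<bar>Im z\<bar> = R"
          then have "(Im z)\<^sup>2 = R\<^sup>2" by (metis power2_abs)
          then have "norm (G z) * norm (E z) \<le> B * exp (- \<epsilon> * R\<^sup>2)"
            using B[OF z1] E1[OF z1] by (intro mult_mono) (auto intro: order_trans[OF norm_ge_zero])
          then show ?thesis using R by (simp add: norm_mult)
        qed
      qed
      then have "norm (G \<xi>) * exp (\<epsilon> * (Re (\<xi>\<^sup>2) - 1)) \<le> M"
        by (simp add: norm_mult E_def norm_exp_eq_Re)
      then have "norm (G \<xi>) * exp (\<epsilon> * (Re (\<xi>\<^sup>2) - 1)) * exp (\<epsilon> * (1 - Re (\<xi>\<^sup>2))) \<le> M * exp (\<epsilon> * (1 - Re (\<xi>\<^sup>2)))"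
        by (intro mult_right_mono) auto
      moreover have "exp (\<epsilon> * (Re (\<xi>\<^sup>2) - 1)) * exp (\<epsilon> * (1 - Re (\<xi>\<^sup>2))) = 1"
        by (simp add: algebra_simps flip: exp_add)
      ultimately show ?thesis by (simp only: mult.assoc mult_1_right)
    qed
    have "((\<lambda>\<epsilon>. M * exp (\<epsilon> * (1 - Re (\<xi>\<^sup>2)))) \<longlongrightarrow> M * exp (0 * (1 - Re (\<xi>\<^sup>2)))) (at_right 0)"
      by (intro tendsto_intros)
    moreover have "eventually (\<lambda>\<epsilon>. norm (G \<xi>) \<le> M * exp (\<epsilon> * (1 - Re (\<xi>\<^sup>2)))) (at_right 0)"
      using eventually_at_right_less[of 0] by eventually_elim (rule est)
    ultimately show ?thesis by (intro tendsto_lowerbound[of _ M "at_right 0"]) auto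
  qed
  show ?thesis
  proof (rule field_le_epsilon)
    fix e :: real assume "e > 0"
    moreover have "M \<ge> 0" using M0[of 0] norm_ge_zero order_trans by blast
    ultimately show "norm (G \<xi>) \<le> M + e"
      using M0 M1 by (intro pos) (auto intro: add_increasing2)
  qed
qed


section \<open>The norms of the spaces X(p,q) as mixed norms\<close>

text \<open>The type of the entries is left open: besides lists of exponents,
  \<open>exps True False n\<close> serves as an index list that tells the places of p from those of
  q.\<close>

primrec exps :: "'a \<Rightarrow> 'a \<Rightarrow> nat \<Rightarrow> 'a list" where
  "exps p q 0 = []"
| "exps p q (Suc n) = p # q # exps p q n"

lemma length_exps [simp]: "length (exps p q n) = 2 * n"
  by (induction n) auto

lemma set_exps_subset: "set (exps p q n) \<subseteq> {p, q}"
  by (induction n) auto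

lemma ball_exps: "P p \<Longrightarrow> P q \<Longrightarrow> \<forall>r\<in>set (exps p q n). P r"
  using set_exps_subset[of p q n] by auto

lemma map_exps: "map \<phi> (exps p q n) = exps (\<phi> p) (\<phi> q) n"
  by (induction n) auto

text \<open>The latest coordinates come first, since their norms are outermost.\<close>

primrec bits :: "nat \<Rightarrow> (nat \<Rightarrow> bool) \<Rightarrow> bool list" where
  "bits 0 \<omega> = []"
| "bits (Suc n) \<omega> = \<omega> (2 * n) # \<omega> (2 * n + 1) # bits n \<omega>"

lemma length_bits [simp]: "length (bits n \<omega>) = 2 * n"
  by (induction n) auto

lemma all_less_2_Suc: "(\<forall>i<2 * Suc n. P i) \<longleftrightarrow> (\<forall>i<2 * n. P i) \<and> P (2 * n) \<and> P (2 * n + 1)"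
  by (auto simp: less_Suc_eq)

lemma bits_eq_iff: "bits n \<omega> = bits n \<omega>' \<longleftrightarrow> (\<forall>i<2 * n. \<omega> i = \<omega>' i)"
  by (induction n) (auto simp: all_less_2_Suc simp del: mult_Suc_right)

lemma drop_bits: "n \<le> m \<Longrightarrow> drop (2 * m - 2 * n) (bits m \<omega>) = bits n \<omega>"
proof (induction m)
  case (Suc m)
  show ?case
  proof (cases "n = Suc m")
    case False
    then have "n \<le> m" using Suc.prems by simp
    then have "2 * Suc m - 2 * n = Suc (Suc (2 * m - 2 * n))" by simp
    then show ?thesis using Suc.IH \<open>n \<le> m\<close> by simp
  qed simp
qed simp

lemma X_norm_bits: "X_norm p q n (\<lambda>\<omega>. h (bits n \<omega>)) = mixed_norm (exps p q n) h"
proof (induction n arbitrary: h)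
  case (Suc n)
  have "bits n (fun_upd (fun_upd \<omega> (2 * n) s) (Suc (2 * n)) t) = bits n \<omega>" for \<omega> s t
    by (simp add: bits_eq_iff)
  then show ?case using Suc.IH[of "\<lambda>l. h (s # t # l)" for s t] by simp
qed simp

lemma bits_in_X_level: "n \<le> m \<Longrightarrow> (\<lambda>\<omega>. h (bits n \<omega>)) \<in> X_level m"
proof -
  assume "n \<le> m"
  then have "bits n \<omega> = bits n \<omega>'" if "\<forall>i<2 * m. \<omega> i = \<omega>' i" for \<omega> \<omega>'
    using that by (simp add: bits_eq_iff)
  then show ?thesis by (auto simp: X_level_def intro!: arg_cong[of _ _ h])
qed

lemma X_levelE:
  assumes "f \<in> X_level n"
  obtains h where "f = (\<lambda>\<omega>. h (bits n \<omega>))"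
proof -
  define h where "h l = f (SOME \<omega>. bits n \<omega> = l)" for l
  have "f \<omega> = h (bits n \<omega>)" for \<omega>
  proof -
    have "bits n (SOME \<omega>'. bits n \<omega>' = bits n \<omega>) = bits n \<omega>"
      by (rule someI[of "\<lambda>\<omega>'. bits n \<omega>' = bits n \<omega>"]) simp
    then show ?thesis using assms unfolding h_def X_level_def bits_eq_iff by auto
  qed
  then show ?thesis using that by blast
qed

lemma X_level_mono: "n \<le> m \<Longrightarrow> X_level n \<subseteq> X_level m"
  by (auto simp: X_level_def)

lemma X_union_two:
  assumes "f \<in> X_union" "g \<in> X_union"
  obtains n where "f \<in> X_level n" "g \<in> X_level n"
proof -
  obtain n m where "f \<in> X_level n" "g \<in> X_level m" using assms by (auto simp: X_union_def)
  then show ?thesis using that[of "max n m"] X_level_mono[of n "max n m"] X_level_mono[of m "max n m"] by auto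
qed

lemma X_level_union: "f \<in> X_level n \<Longrightarrow> f \<in> X_union"
  by (auto simp: X_union_def)

lemma bits_in_X_union [simp]: "(\<lambda>\<omega>. h (bits n \<omega>)) \<in> X_union"
  using bits_in_X_level[of n n h] X_level_union by blast

lemma
  assumes "is_X p q sc J"
  shows is_X_add: "f \<in> X_union \<Longrightarrow> g \<in> X_union \<Longrightarrow> J (\<lambda>\<omega>. f \<omega> + g \<omega>) = J f + J g"
    and is_X_cmult: "f \<in> X_union \<Longrightarrow> J (\<lambda>\<omega>. c * f \<omega>) = sc c (J f)"
    and is_X_norm_bits: "norm (J (\<lambda>\<omega>. h (bits n \<omega>))) = mixed_norm (exps p q n) h"
    and is_X_closure: "closure (J ` X_union) = UNIV"
    and is_X_normed_space: "normed_space_over sc"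
  using assms bits_in_X_level[of n n h] by (auto simp: is_X_def X_norm_bits)

lemma normed_space_over_scale_minus:
  assumes "normed_space_over sc" shows "sc (- 1) x = - x"
proof -
  have "sc (of_real (- 1)) x = (- 1) *\<^sub>R x" using assms unfolding normed_space_over_def by blast
  then show ?thesis by simp
qed

lemma is_X_diff:
  assumes "is_X p q sc J" "f \<in> X_union" "g \<in> X_union"
  shows "J (\<lambda>\<omega>. f \<omega> - g \<omega>) = J f - J g"
proof -
  obtain n where "g \<in> X_level n" using assms(3) by (auto simp: X_union_def)
  then have "(\<lambda>\<omega>. - 1 * g \<omega>) \<in> X_level n" by (auto simp: X_level_def)
  then have "J (\<lambda>\<omega>. f \<omega> + (- 1 * g \<omega>)) = J f + J (\<lambda>\<omega>. - 1 * g \<omega>)"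
    by (intro is_X_add[OF assms(1)] assms X_level_union)
  also have "J (\<lambda>\<omega>. - 1 * g \<omega>) = - J g"
    using is_X_cmult[OF assms(1,3), of "- 1"] normed_space_over_scale_minus[OF is_X_normed_space[OF assms(1)]]
    by simp
  finally show ?thesis by simp
qed

text \<open>A form of uniform convexity that involves only two vectors at a time; hence it passes to
  closures and along finite representability.\<close>

definition two_point_convex :: "real \<Rightarrow> real \<Rightarrow> real \<Rightarrow> 'x::real_normed_vector itself \<Rightarrow> bool" where
  "two_point_convex a b c _ \<longleftrightarrow> (\<forall>u v :: 'x. norm u powr b + c * norm v powr b
     \<le> D_norm a (\<lambda>\<sigma>. norm (if \<sigma> then u + v else u - v)) powr b)"

text \<open>\<open>a\<close> and \<open>b\<close> enclose p, q and 2, as the inequality for mixed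
  norms requires; continuity extends it from the dense subspace.\<close>

lemma two_point_convex_X:
  fixes sc :: "'k::{real_normed_field,real_inner} \<Rightarrow> 'x::banach \<Rightarrow> 'x"
  assumes X: "is_X p q sc J" and pq: "1 < p" "1 < q"
  defines "a \<equiv> min 2 (min p q)" and "b \<equiv> max 2 (max p q)"
  shows "two_point_convex a b (a * (a - 1) / 2) TYPE('x)"
  unfolding two_point_convex_def
proof (intro allI)
  fix u v :: 'x
  have ab: "1 < a" "a \<le> 2" "2 \<le> b" "a \<le> p" "a \<le> q" "p \<le> b" "q \<le> b"
    using pq by (auto simp: a_def b_def)
  let ?P = "\<lambda>u v. norm u powr b + a * (a - 1) / 2 * norm v powr b
     \<le> D_norm a (\<lambda>\<sigma>. norm (if \<sigma> then u + v else u - v)) powr b"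
  have dense: "?P (J f) (J g)" if fg: "f \<in> X_union" "g \<in> X_union" for f g
  proof -
    obtain n where "f \<in> X_level n" "g \<in> X_level n" using fg X_union_two by blast
    then obtain h k where hk: "f = (\<lambda>\<omega>. h (bits n \<omega>))" "g = (\<lambda>\<omega>. k (bits n \<omega>))"
      by (meson X_levelE)
    have "norm (if \<sigma> then J f + J g else J f - J g)
        = mixed_norm (exps p q n) (\<lambda>l. if \<sigma> then h l + k l else h l - k l)" for \<sigma>
      using is_X_add[OF X fg] is_X_diff[OF X fg] is_X_norm_bits[OF X, of "\<lambda>l. h l + k l" n]
        is_X_norm_bits[OF X, of "\<lambda>l. h l - k l" n] by (simp add: hk)
    moreover have "norm (J f) = mixed_norm (exps p q n) h" "norm (J g) = mixed_norm (exps p q n) k"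
      using is_X_norm_bits[OF X] by (auto simp: hk)
    ultimately show ?thesis
      using mixed_norm_convexity[OF ab(1-3), of "exps p q n" h k] ab ball_exps[of "\<lambda>r. a \<le> r \<and> r \<le> b" p q n]
      by simp
  qed
  obtain F G where FG: "\<And>n. F n \<in> J ` X_union" "F \<longlonglongrightarrow> u" "\<And>n. G n \<in> J ` X_union" "G \<longlonglongrightarrow> v"
    using is_X_closure[OF X] closure_sequential by (metis UNIV_I)
  have "(\<lambda>n. norm (F n) powr b + a * (a - 1) / 2 * norm (G n) powr b)
      \<longlonglongrightarrow> norm u powr b + a * (a - 1) / 2 * norm v powr b"
    using ab FG by (intro tendsto_intros tendsto_powr') auto
  moreover have "(\<lambda>n. D_norm a (\<lambda>\<sigma>. norm (if \<sigma> then F n + G n else F n - G n)) powr b)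
      \<longlonglongrightarrow> D_norm a (\<lambda>\<sigma>. norm (if \<sigma> then u + v else u - v)) powr b"
  proof (intro tendsto_powr' tendsto_D_norm tendsto_const)
    show "(\<lambda>n. norm (if \<sigma> then F n + G n else F n - G n)) \<longlonglongrightarrow> norm (if \<sigma> then u + v else u - v)" for \<sigma>
      using FG by (cases \<sigma>) (auto intro!: tendsto_intros)
  qed (use ab in auto)
  moreover have "?P (F n) (G n)" for n
  proof -
    obtain f g where "f \<in> X_union" "g \<in> X_union" "F n = J f" "G n = J g" using FG(1,3) by blast
    then show ?thesis using dense[of f g] by (simp only:)
  qed
  ultimately show "?P u v" by (intro LIMSEQ_le) auto
qed

text \<open>Only the span of u and v has to be embedded, with distortion
  \<open>1 + \<epsilon>\<close>, and \<open>\<epsilon>\<close> tends to 0.\<close>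

lemma two_point_convex_finitely_representable:
  fixes scU :: "'k::real_normed_field \<Rightarrow> 'u::real_normed_vector \<Rightarrow> 'u"
    and scX :: "'k \<Rightarrow> 'x::real_normed_vector \<Rightarrow> 'x"
  assumes conv: "two_point_convex a b c TYPE('x)" and fr: "finitely_representable scU scX"
    and U: "normed_space_over scU" and abc: "0 < a" "0 < b" "0 \<le> c"
  shows "two_point_convex a b c TYPE('u)"
  unfolding two_point_convex_def
proof (intro allI)
  fix u v :: 'u
  interpret U: vector_space scU using U by (simp add: normed_space_over_def)
  let ?D = "D_norm a (\<lambda>\<sigma>. norm (if \<sigma> then u + v else u - v))"
  have est: "norm u powr b + c * norm v powr b \<le> ((1 + \<epsilon>) * ?D) powr b" if \<epsilon>: "\<epsilon> > 0" for \<epsilon>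
  proof -
    obtain T where T: "Vector_Spaces.linear scU scX T"
      "\<And>w. w \<in> U.span {u, v} \<Longrightarrow> norm w \<le> norm (T w) \<and> norm (T w) \<le> (1 + \<epsilon>) * norm w"
      using fr \<epsilon> unfolding finitely_representable_def by (metis finite.emptyI finite.insertI)
    interpret T: Vector_Spaces.linear scU scX T by fact
    have span: "u \<in> U.span {u, v}" "v \<in> U.span {u, v}" "u + v \<in> U.span {u, v}" "u - v \<in> U.span {u, v}"
      by (auto intro: U.span_add U.span_diff U.span_base)
    have "norm u powr b + c * norm v powr b \<le> norm (T u) powr b + c * norm (T v) powr b"
      using T(2) span abc by (intro add_mono mult_left_mono powr_mono2) auto
    also have "\<dots> \<le> D_norm a (\<lambda>\<sigma>. norm (if \<sigma> then T u + T v else T u - T v)) powr b"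
      using conv unfolding two_point_convex_def by blast
    also have "\<dots> \<le> D_norm a (\<lambda>\<sigma>. (1 + \<epsilon>) * norm (if \<sigma> then u + v else u - v)) powr b"
    proof (intro powr_mono2 D_norm_mono)
      show "\<bar>norm (if \<sigma> then T u + T v else T u - T v)\<bar> \<le> \<bar>(1 + \<epsilon>) * norm (if \<sigma> then u + v else u - v)\<bar>" for \<sigma>
        using T(2)[OF span(3)] T(2)[OF span(4)] \<epsilon> by (simp add: T.add T.diff abs_mult)
    qed (use abc in auto)
    also have "\<dots> = ((1 + \<epsilon>) * ?D) powr b" using abc \<epsilon> by (simp add: D_norm_cmult)
    finally show ?thesis .
  qed
  have "((\<lambda>\<epsilon>. ((1 + \<epsilon>) * ?D) powr b) \<longlongrightarrow> ((1 + 0) * ?D) powr b) (at_right 0)"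
    using abc by (intro tendsto_powr' tendsto_intros disjI2 conjI)
      (auto intro!: eventually_mono[OF eventually_at_right_less[of 0]])
  moreover have "eventually (\<lambda>\<epsilon>. norm u powr b + c * norm v powr b \<le> ((1 + \<epsilon>) * ?D) powr b) (at_right 0)"
    using eventually_at_right_less[of 0] by eventually_elim (rule est)
  ultimately show "norm u powr b + c * norm v powr b \<le> ?D powr b"
    by (intro tendsto_lowerbound[of _ _ "at_right 0"]) auto
qed


section \<open>Reflexivity\<close>

context
  fixes sc :: "'k::{real_normed_field,real_inner} \<Rightarrow> 'u::banach \<Rightarrow> 'u"
  assumes nso: "normed_space_over sc"
begin

text \<open>\<open>inner z 1\<close> serves as the real part, for real and complex scalars
  alike.\<close>

lemma abs_inner_one_le: "\<bar>inner (z::'k) 1\<bar> \<le> norm z"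
  using Cauchy_Schwarz_ineq2[of z 1] by simp

lemma inner_of_real_one: "inner (of_real r :: 'k) 1 = r"
  by (simp add: of_real_def flip: power2_norm_eq_inner)

lemma norm_sc: "norm (sc z x) = norm z * norm x"
  using nso by (simp add: normed_space_over_def)

lemma dual_cmult:
  assumes "f \<in> dual sc" shows "(\<lambda>x. z * f x) \<in> dual sc" "onorm (\<lambda>x. z * f x) = norm z * onorm f"
proof -
  have f: "bounded_linear f" "\<And>c x. f (sc c x) = c * f x" using assms by (auto simp: dual_def)
  show "(\<lambda>x. z * f x) \<in> dual sc"
    using f by (auto simp: dual_def intro!: bounded_linear_const_mult)
  have le: "onorm (\<lambda>x. z * g x) \<le> norm z * onorm g" if "bounded_linear g" for z :: 'k and g :: "'u \<Rightarrow> 'k"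
    using onorm[OF that] that
    by (intro onorm_bound) (auto simp: norm_mult mult.assoc mult_left_mono onorm_pos_le)
  show "onorm (\<lambda>x. z * f x) = norm z * onorm f"
  proof (cases "z = 0")
    case False
    have "onorm (\<lambda>x. inverse z * (z * f x)) \<le> norm (inverse z) * onorm (\<lambda>x. z * f x)"
      using f by (intro le bounded_linear_const_mult)
    then have "norm z * onorm f \<le> onorm (\<lambda>x. z * f x)"
      using False by (simp add: norm_inverse norm_divide field_simps flip: mult.assoc)
    then show ?thesis using le[OF f(1), of z] by simp
  qed (simp add: onorm_zero)
qed

lemma dual_add: "f \<in> dual sc \<Longrightarrow> g \<in> dual sc \<Longrightarrow> (\<lambda>x. f x + g x) \<in> dual sc"
  by (auto simp: dual_def distrib_left intro: bounded_linear_add)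

lemma onorm_almost_attained:
  assumes h: "h \<in> dual sc" and \<delta>: "\<delta> > 0"
  obtains y where "norm y \<le> 1" "inner (h y) 1 \<ge> onorm h - \<delta>"
proof (cases "onorm h \<le> \<delta>")
  case True
  have "h 0 = 0" using h by (auto simp: dual_def linear_0 bounded_linear.linear)
  then show ?thesis using that[of 0] True by simp
next
  case False
  have bl: "bounded_linear h" "\<And>c x. h (sc c x) = c * h x" using h by (auto simp: dual_def)
  obtain x where x: "norm (h x) / norm x > onorm h - \<delta>"
  proof (rule ccontr)
    assume none: "\<not> thesis"
    have "norm (h x) \<le> (onorm h - \<delta>) * norm x" for x
    proof (cases "x = 0")
      case True
      then show ?thesis using bl(1) by (simp add: linear_simps)
    next
      case False
      have "norm (h x) / norm x \<le> onorm h - \<delta>"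
        using none that[of x] by linarith
      then show ?thesis using False by (simp add: divide_le_eq)
    qed
    then have "onorm h \<le> onorm h - \<delta>" using False by (intro onorm_bound) auto
    then show False using \<delta> by simp
  qed
  then have x0: "x \<noteq> 0" "h x \<noteq> 0" using False by auto
  \<comment> \<open>Rescales x to the unit sphere and rotates \<open>h x\<close> to the positive
    axis.\<close>
  define z :: 'k where "z = of_real (norm (h x)) / h x / of_real (norm x)"
  have "norm (sc z x) \<le> 1" using x0 by (simp add: norm_sc z_def norm_divide norm_mult)
  moreover have "h (sc z x) = of_real (norm (h x) / norm x)" using x0 by (simp add: bl z_def field_simps)
  then have "inner (h (sc z x)) 1 = norm (h x) / norm x" by (simp only: inner_of_real_one)
  ultimately show ?thesis using that x by simp
qed

text \<open>The midpoint of two points of the slice has norm at least \<open>1 - \<delta>\<close>,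
  so uniform convexity leaves little room for half their difference. The maximum with 0 covers
  \<open>\<delta> > 1\<close>.\<close>

lemma slice_diameter:
  fixes x y :: 'u
  assumes conv: "two_point_convex a b c TYPE('u)" and abc: "0 < a" "0 < b" "0 < c"
    and f: "f \<in> dual sc" "onorm f \<le> 1" and xy: "norm x \<le> 1" "norm y \<le> 1"
    and d: "inner (f x) 1 \<ge> 1 - \<delta>" "inner (f y) 1 \<ge> 1 - \<delta>"
  shows "norm (x - y) \<le> 2 * ((1 - max 0 (1 - \<delta>) powr b) / c) powr (1/b)"
proof -
  have bl: "bounded_linear f" using f by (auto simp: dual_def)
  define u v where "u = (1/2) *\<^sub>R (x + y)" "v = (1/2) *\<^sub>R (x - y)"
  have uv: "u + v = x" "u - v = y" by (auto simp: u_v_def simp flip: scaleR_add_right scaleR_diff_right)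
  have "inner (f u) 1 = (inner (f x) 1 + inner (f y) 1) / 2"
    using bl by (simp add: u_v_def linear_simps inner_add_left)
  then have "1 - \<delta> \<le> inner (f u) 1" using d by simp
  also have "\<dots> \<le> norm (f u)" using abs_inner_one_le[of "f u"] by simp
  also have "\<dots> \<le> norm u" using onorm[OF bl, of u] f(2) mult_right_mono[of "onorm f" 1 "norm u"] by simp
  finally have "max 0 (1 - \<delta>) powr b \<le> norm u powr b" using abc by (intro powr_mono2) auto
  moreover have "norm u powr b + c * norm v powr b \<le> D_norm a (\<lambda>\<sigma>. norm (if \<sigma> then u + v else u - v)) powr b"
    using conv unfolding two_point_convex_def by blast
  moreover have "D_norm a (\<lambda>\<sigma>. norm (if \<sigma> then u + v else u - v)) \<le> D_norm a (\<lambda>_. 1)"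
    using abc xy by (intro D_norm_mono) (auto simp: uv)
  then have "D_norm a (\<lambda>\<sigma>. norm (if \<sigma> then u + v else u - v)) powr b \<le> 1"
    using abc by (intro powr_le1) auto
  ultimately have "norm v powr b \<le> (1 - max 0 (1 - \<delta>) powr b) / c"
    using abc by (simp add: field_simps)
  then have "(norm v powr b) powr (1/b) \<le> ((1 - max 0 (1 - \<delta>) powr b) / c) powr (1/b)"
    using abc by (intro powr_mono2) auto
  then show ?thesis using abc by (simp add: powr_powr u_v_def)
qed

text \<open>The Milman-Pettis theorem without weak topologies: the slices of the unit ball cut out
  by nearly optimal functionals \<open>f n\<close> shrink to a point, and that point times the norm
  M of \<open>\<Phi>\<close> represents \<open>\<Phi>\<close>.\<close>

lemma reflexive_of_two_point_convex:
  assumes conv: "two_point_convex a b c TYPE('u)" and abc: "0 < a" "0 < b" "0 < c"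
  shows "reflexive sc"
  unfolding reflexive_def
proof
  fix \<Phi> assume "\<Phi> \<in> bidual sc"
  then have add: "\<And>f g. f \<in> dual sc \<Longrightarrow> g \<in> dual sc \<Longrightarrow> \<Phi> (\<lambda>x. f x + g x) = \<Phi> f + \<Phi> g"
    and cmult: "\<And>z f. f \<in> dual sc \<Longrightarrow> \<Phi> (\<lambda>x. z * f x) = z * \<Phi> f"
    and "\<exists>B. \<forall>f\<in>dual sc. norm (\<Phi> f) \<le> B * onorm f"
    by (auto simp: bidual_def)
  then obtain B where B: "\<And>f. f \<in> dual sc \<Longrightarrow> norm (\<Phi> f) \<le> B * onorm f" by blast
  have onn: "onorm f \<ge> 0" if "f \<in> dual sc" for f using that by (auto simp: dual_def onorm_pos_le)
  define W where "W = (\<lambda>f. norm (\<Phi> f)) ` {f \<in> dual sc. onorm f \<le> 1}"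
  define M where "M = Sup W"
  have bdd: "bdd_above W"
  proof -
    have "norm (\<Phi> f) \<le> \<bar>B\<bar>" if "f \<in> dual sc" "onorm f \<le> 1" for f
    proof -
      have "norm (\<Phi> f) \<le> \<bar>B\<bar> * onorm f" using B[OF that(1)] onn[OF that(1)]
        by (meson abs_ge_self mult_right_mono order_trans)
      also have "\<dots> \<le> \<bar>B\<bar>" using that onn[OF that(1)] by (simp add: mult_left_le)
      finally show ?thesis .
    qed
    then show ?thesis unfolding W_def by (intro bdd_aboveI2) auto
  qed
  have M: "norm (\<Phi> f) \<le> M * onorm f" if f: "f \<in> dual sc" for f
  proof (cases "onorm f = 0")
    case True
    then show ?thesis using B[OF f] by simp
  next
    case False
    then have pos: "onorm f > 0" using onn[OF f] by simp
    define g where "g = (\<lambda>x. of_real (1 / onorm f) * f x)"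
    have "g \<in> dual sc" "onorm g = norm (of_real (1 / onorm f) :: 'k) * onorm f"
      using dual_cmult[OF f] by (auto simp only: g_def)
    then have g: "g \<in> dual sc" "onorm g \<le> 1" using pos by (auto simp: norm_divide)
    then have "norm (\<Phi> g) \<le> M" unfolding M_def using bdd by (intro cSup_upper) (auto simp: W_def)
    moreover have "norm (\<Phi> g) = norm (\<Phi> f) / onorm f"
      unfolding g_def cmult[OF f] using pos by (simp add: norm_mult norm_divide)
    ultimately show ?thesis using pos by (simp add: field_simps)
  qed
  have zero: "(\<lambda>x. 0) \<in> dual sc" by (auto simp: dual_def)
  have W0: "0 \<in> W"
  proof -
    have "\<Phi> (\<lambda>x. 0) = 0" using cmult[OF zero, of 0] by simp
    then show ?thesis unfolding W_def using zero by (intro image_eqI[of _ _ "\<lambda>x. 0"]) (auto simp: onorm_zero)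
  qed
  then have M0: "M \<ge> 0" unfolding M_def using bdd by (intro cSup_upper)
  show "\<exists>x. \<forall>f\<in>dual sc. \<Phi> f = f x"
  proof (cases "M = 0")
    case True
    then have "\<Phi> f = f 0" if "f \<in> dual sc" for f
      using M[OF that] that by (auto simp: dual_def linear_0 bounded_linear.linear)
    then show ?thesis by blast
  next
    case False
    then have Mp: "M > 0" using M0 by simp
    have almost: "\<exists>f. f \<in> dual sc \<and> onorm f \<le> 1 \<and> inner (\<Phi> f) 1 \<ge> M * (1 - \<epsilon>)" if \<epsilon>: "\<epsilon> > 0" for \<epsilon>
    proof -
      have "M * (1 - \<epsilon>) < M" using Mp \<epsilon> by simp
      then obtain f where f: "f \<in> dual sc" "onorm f \<le> 1" "M * (1 - \<epsilon>) < norm (\<Phi> f)"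
        using less_cSupE[of "M * (1 - \<epsilon>)" W] W0 unfolding M_def[symmetric] by (auto simp: W_def)
      show ?thesis
      proof (cases "\<Phi> f = 0")
        case True
        then show ?thesis using f by (intro exI[of _ f]) auto
      next
        case False
        define z where "z = of_real (norm (\<Phi> f)) / \<Phi> f"
        have "norm z = 1" "z * \<Phi> f = of_real (norm (\<Phi> f))" using False by (auto simp: z_def norm_divide)
        then show ?thesis using f dual_cmult[OF f(1), of z] cmult[OF f(1), of z]
          by (intro exI[of _ "\<lambda>x. z * f x"]) (auto simp: inner_of_real_one)
      qed
    qed
    define \<epsilon> where "\<epsilon> n = inverse (real (Suc n))" for n
    have \<epsilon>: "\<epsilon> n > 0" for n by (simp add: \<epsilon>_def)
    have \<epsilon>0: "\<epsilon> \<longlonglongrightarrow> 0" unfolding \<epsilon>_def by (rule LIMSEQ_inverse_real_of_nat)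
    obtain f where f: "\<And>n. f n \<in> dual sc" "\<And>n. onorm (f n) \<le> 1" "\<And>n. inner (\<Phi> (f n)) 1 \<ge> M * (1 - \<epsilon> n)"
      using almost[OF \<epsilon>] by metis
    have low: "onorm g \<ge> inner (\<Phi> g) 1 / M" if "g \<in> dual sc" for g
      using M[OF that] abs_inner_one_le[of "\<Phi> g"] Mp by (simp add: field_simps)
    have one: "inner (f n y) 1 \<le> 1" if "norm y \<le> 1" for n y
    proof -
      have "norm (f n y) \<le> onorm (f n) * norm y" using f(1)[of n] by (intro onorm) (auto simp: dual_def)
      also have "\<dots> \<le> 1" using that f(2)[of n] onn[OF f(1)[of n]] by (intro mult_le_one) auto
      finally show ?thesis using abs_inner_one_le[of "f n y"] by simp
    qed
    have "\<exists>y. norm y \<le> 1 \<and> inner (f n y) 1 \<ge> 1 - 2 * \<epsilon> n" for n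
    proof -
      have "M * (1 - \<epsilon> n) / M \<le> inner (\<Phi> (f n)) 1 / M" using f(3)[of n] Mp by (intro divide_right_mono) auto
      then have "onorm (f n) \<ge> 1 - \<epsilon> n" using low[OF f(1), of n] Mp by simp
      moreover obtain y where "norm y \<le> 1" "inner (f n y) 1 \<ge> onorm (f n) - \<epsilon> n"
        using onorm_almost_attained[OF f(1) \<epsilon>, of n n] by blast
      ultimately show ?thesis by (intro exI[of _ y]) auto
    qed
    then obtain x where x: "\<And>n. norm (x n) \<le> 1" "\<And>n. inner (f n (x n)) 1 \<ge> 1 - 2 * \<epsilon> n" by metis
    \<comment> \<open>The bound for the diameter of a slice of depth
      \<open>\<delta>\<close>.\<close>
    define \<eta> where "\<eta> \<delta> = 2 * ((1 - max 0 (1 - \<delta>) powr b) / c) powr (1/b)" for \<delta>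
    have \<eta>0: "(\<lambda>n. \<eta> (\<delta> n)) \<longlonglongrightarrow> 0" if "\<delta> \<longlonglongrightarrow> 0" "\<And>n. \<delta> n \<ge> 0" for \<delta>
    proof -
      have le: "0 \<le> (1 - max 0 (1 - d) powr b) / c" if "d \<ge> 0" for d
        using that abc by (auto intro!: divide_nonneg_nonneg powr_le1)
      have "(\<lambda>n. 1 - \<delta> n) \<longlonglongrightarrow> 1 - 0" by (intro tendsto_intros that)
      then have "(\<lambda>n. max 0 (1 - \<delta> n)) \<longlonglongrightarrow> max 0 (1 - 0)" by (intro tendsto_max tendsto_const)
      then have "(\<lambda>n. max 0 (1 - \<delta> n) powr b) \<longlonglongrightarrow> max 0 (1 - 0) powr b" by (intro tendsto_powr) auto
      then have "(\<lambda>n. (1 - max 0 (1 - \<delta> n) powr b) / c) \<longlonglongrightarrow> (1 - max 0 (1 - 0) powr b) / c"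
        using abc by (intro tendsto_divide tendsto_diff tendsto_const) auto
      then have "(\<lambda>n. ((1 - max 0 (1 - \<delta> n) powr b) / c) powr (1/b)) \<longlonglongrightarrow> ((1 - max 0 (1 - 0) powr b) / c) powr (1/b)"
        using abc le that by (intro tendsto_powr' tendsto_const) auto
      from tendsto_mult_left[OF this, of 2] show ?thesis by (simp add: \<eta>_def)
    qed
    have slice: "norm (x n - y) \<le> \<eta> \<delta>"
      if "norm y \<le> 1" "inner (f n y) 1 \<ge> 1 - \<delta>" "2 * \<epsilon> n \<le> \<delta>" for n y \<delta>
      unfolding \<eta>_def using that x[of n] by (intro slice_diameter[OF conv abc f(1,2)]) auto
    \<comment> \<open>Slices of different functionals are compared through a point y at which
      \<open>f n + f m\<close> is almost maximal: since neither summand exceeds 1 there, y lies in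
      both slices.\<close>
    have close: "norm (x n - x m) \<le> 2 * \<eta> (4 * \<epsilon> N)" if "N \<le> n" "N \<le> m" for N n m
    proof -
      have eN: "\<epsilon> n \<le> \<epsilon> N" "\<epsilon> m \<le> \<epsilon> N" using that by (auto simp: \<epsilon>_def)
      define h where "h = (\<lambda>z. f n z + f m z)"
      have h: "h \<in> dual sc" unfolding h_def by (intro dual_add f)
      have "inner (\<Phi> h) 1 / M \<ge> (M * (1 - \<epsilon> n) + M * (1 - \<epsilon> m)) / M"
        using f(3)[of n] f(3)[of m] Mp unfolding h_def add[OF f(1) f(1)] inner_add_left
        by (intro divide_right_mono add_mono) auto
      then have "onorm h \<ge> 2 - \<epsilon> n - \<epsilon> m" using low[OF h] Mp by (simp add: add_divide_distrib)
      moreover obtain y where y: "norm y \<le> 1" "inner (h y) 1 \<ge> onorm h - \<epsilon> N"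
        using onorm_almost_attained[OF h \<epsilon>] by blast
      ultimately have "inner (f n y) 1 + inner (f m y) 1 \<ge> 2 - 3 * \<epsilon> N"
        using eN by (simp add: h_def inner_add_left)
      then have "norm (x n - y) \<le> \<eta> (4 * \<epsilon> N)" "norm (x m - y) \<le> \<eta> (4 * \<epsilon> N)"
        using one[OF y(1), of n] one[OF y(1), of m] eN \<epsilon>[of N] by (auto intro!: slice[OF y(1)])
      then show ?thesis using norm_triangle_ineq4[of "x n - y" "x m - y"] by simp
    qed
    have "Cauchy x"
    proof (rule CauchyI)
      fix e :: real assume "e > 0"
      have "(\<lambda>N. \<eta> (4 * \<epsilon> N)) \<longlonglongrightarrow> 0"
        using \<epsilon> by (intro \<eta>0) (auto intro!: tendsto_eq_intros \<epsilon>0 simp: less_imp_le)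
      then have "eventually (\<lambda>N. \<eta> (4 * \<epsilon> N) < e / 2) sequentially"
        using \<open>e > 0\<close> by (intro order_tendstoD) auto
      then obtain N where "\<eta> (4 * \<epsilon> N) < e / 2" by (auto simp: eventually_sequentially)
      then have "2 * \<eta> (4 * \<epsilon> N) < e" by simp
      then show "\<exists>N. \<forall>m\<ge>N. \<forall>n\<ge>N. norm (x m - x n) < e"
        using close by (meson order.strict_trans1)
    qed
    then obtain X where X: "x \<longlonglongrightarrow> X" using Cauchy_convergent convergent_def by blast
    have ge: "inner (g X) 1 \<ge> inner (\<Phi> g) 1 / M" if g: "g \<in> dual sc" for g
    proof -
      have bl: "bounded_linear g" using g by (simp add: dual_def)
      define L where "L = onorm g"
      have L: "L \<ge> 0" "inner (\<Phi> g) 1 / M \<le> L" "- L \<le> inner (\<Phi> g) 1 / M" "\<And>z. \<bar>inner (g z) 1\<bar> \<le> L * norm z"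
      proof -
        show "L \<ge> 0" "inner (\<Phi> g) 1 / M \<le> L" using onn[OF g] low[OF g] by (auto simp: L_def)
        show "- L \<le> inner (\<Phi> g) 1 / M"
          using M[OF g] abs_inner_one_le[of "\<Phi> g"] Mp by (simp add: field_simps L_def)
        show "\<bar>inner (g z) 1\<bar> \<le> L * norm z" for z
          using abs_inner_one_le[of "g z"] onorm[OF bl, of z] by (simp add: L_def)
      qed
      \<comment> \<open>\<open>f n\<close> is perturbed to \<open>f n + t n * g\<close>; the norm of
        the sum forces \<open>g\<close>, near the n-th slice, to be almost as large as
        \<open>\<Phi> g / M\<close>. With the square root, both \<open>t n\<close> and the error
        \<open>\<epsilon> n / t n\<close> tend to 0.\<close>
      define t where "t n = sqrt (\<epsilon> n)" for n
      have t: "t n > 0" "t n * t n = \<epsilon> n" for n using \<epsilon>[of n] by (auto simp: t_def)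
      have t0: "t \<longlonglongrightarrow> 0" unfolding t_def using tendsto_real_sqrt[OF \<epsilon>0] by simp
      have est: "inner (g (x n)) 1 \<ge> inner (\<Phi> g) 1 / M - 2 * t n - L * \<eta> (2 * \<epsilon> n + 2 * t n * L)" for n
      proof -
        define tg where "tg = (\<lambda>z. of_real (t n) * g z)"
        define h where "h = (\<lambda>z. f n z + tg z)"
        have tg: "tg \<in> dual sc" unfolding tg_def using g by (rule dual_cmult)
        have h: "h \<in> dual sc" unfolding h_def using f tg by (intro dual_add) auto
        have itg: "inner (tg z) 1 = t n * inner (g z) 1" for z
          by (simp add: tg_def flip: scaleR_conv_of_real)
        have "\<Phi> h = \<Phi> (f n) + of_real (t n) * \<Phi> g"
          unfolding h_def add[OF f(1) tg] unfolding tg_def cmult[OF g] ..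
        then have "inner (\<Phi> h) 1 = inner (\<Phi> (f n)) 1 + t n * inner (\<Phi> g) 1"
          by (simp add: inner_add_left flip: scaleR_conv_of_real)
        then have "inner (\<Phi> h) 1 / M \<ge> (M * (1 - \<epsilon> n) + t n * inner (\<Phi> g) 1) / M"
          using f(3)[of n] Mp by (intro divide_right_mono) auto
        then have "onorm h \<ge> 1 - \<epsilon> n + t n * (inner (\<Phi> g) 1 / M)"
          using low[OF h] Mp by (simp add: add_divide_distrib)
        moreover obtain y where y: "norm y \<le> 1" "inner (h y) 1 \<ge> onorm h - \<epsilon> n"
          using onorm_almost_attained[OF h \<epsilon>] by blast
        ultimately have hy: "inner (f n y) 1 + t n * inner (g y) 1 \<ge> 1 - 2 * \<epsilon> n + t n * (inner (\<Phi> g) 1 / M)"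
          by (simp add: h_def inner_add_left itg)
        then have "t n * inner (g y) 1 \<ge> t n * (inner (\<Phi> g) 1 / M) - 2 * (t n * t n)"
          using one[OF y(1), of n] t(2)[of n] by linarith
        then have "t n * inner (g y) 1 \<ge> t n * (inner (\<Phi> g) 1 / M - 2 * t n)"
          by (simp only: right_diff_distrib mult.left_commute)
        then have gy: "inner (g y) 1 \<ge> inner (\<Phi> g) 1 / M - 2 * t n"
          using t(1)[of n] by (simp only: mult_le_cancel_left_pos)
        have "inner (g y) 1 \<le> L" using L(4)[of y] mult_left_le[OF y(1) L(1)] by linarith
        then have "t n * inner (g y) 1 \<le> t n * L" "t n * (- L) \<le> t n * (inner (\<Phi> g) 1 / M)"
          using t(1)[of n] L(3) by (intro mult_left_mono; simp)+
        then have "inner (f n y) 1 \<ge> 1 - (2 * \<epsilon> n + 2 * t n * L)" using hy by simp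
        then have "norm (x n - y) \<le> \<eta> (2 * \<epsilon> n + 2 * t n * L)"
          using L(1) t(1)[of n] by (intro slice[OF y(1)]) auto
        then have "L * norm (y - x n) \<le> L * \<eta> (2 * \<epsilon> n + 2 * t n * L)"
          using L(1) by (intro mult_left_mono) (auto simp: norm_minus_commute)
        moreover have "inner (g y) 1 - inner (g (x n)) 1 \<le> L * norm (y - x n)"
          using L(4)[of "y - x n"] bl by (simp add: linear_simps inner_diff_left)
        ultimately show ?thesis using gy by linarith
      qed
      have "(\<lambda>n. \<eta> (2 * \<epsilon> n + 2 * t n * L)) \<longlonglongrightarrow> 0"
        using L(1) t(1) \<epsilon> by (intro \<eta>0) (auto intro!: tendsto_eq_intros \<epsilon>0 t0 add_nonneg_nonneg simp: less_imp_le)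
      then have "(\<lambda>n. inner (\<Phi> g) 1 / M - 2 * t n - L * \<eta> (2 * \<epsilon> n + 2 * t n * L)) \<longlonglongrightarrow> inner (\<Phi> g) 1 / M - 2 * 0 - L * 0"
        by (intro tendsto_intros t0)
      moreover have "(\<lambda>n. inner (g (x n)) 1) \<longlonglongrightarrow> inner (g X) 1"
        by (intro tendsto_intros bounded_linear.tendsto[OF bl] X)
      ultimately show ?thesis using est by (intro LIMSEQ_le) auto
    qed
    \<comment> \<open>The inequality for -g is the reverse one.\<close>
    have eq: "inner (g X) 1 = inner (\<Phi> g) 1 / M" if g: "g \<in> dual sc" for g
    proof -
      have "(\<lambda>x. - 1 * g x) \<in> dual sc" using dual_cmult(1)[OF g] .
      from ge[OF this] ge[OF g] cmult[OF g, of "- 1"] show ?thesis by simp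
    qed
    have "\<Phi> g = g (M *\<^sub>R X)" if g: "g \<in> dual sc" for g
    proof -
      define d where "d = of_real M * g X - \<Phi> g"
      \<comment> \<open>Equality of real parts, applied to the multiple
        \<open>inverse d * g\<close>, forces \<open>d = 0\<close> and so yields equality of the
        scalars.\<close>
      have "inner (inverse d * g X) 1 = inner (inverse d * \<Phi> g) 1 / M"
        using eq[OF dual_cmult(1)[OF g]] cmult[OF g] by simp
      then have "inner (inverse d * d) 1 = 0"
        using Mp by (simp add: d_def right_diff_distrib inner_diff_left mult.left_commute flip: scaleR_conv_of_real)
      then have "d = 0" using inner_of_real_one[of 1] by (cases "d = 0") auto
      then show ?thesis using g by (simp add: d_def dual_def linear_simps scaleR_conv_of_real)
    qed
    then show ?thesis by blast
  qed
qed

end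

lemma super_reflexive_X:
  fixes sc :: "'k::{real_normed_field,real_inner} \<Rightarrow> 'x::banach \<Rightarrow> 'x"
  assumes "is_X p q sc J" "1 < p" "1 < q"
  shows "super_reflexive TYPE('u::banach) sc"
  unfolding super_reflexive_def
proof (intro allI impI, elim conjE)
  fix scU :: "'k \<Rightarrow> 'u \<Rightarrow> 'u"
  assume U: "normed_space_over scU" "finitely_representable scU sc"
  define a where "a = min 2 (min p q)"
  have a: "a > 1" using assms by (simp add: a_def)
  have "two_point_convex a (max 2 (max p q)) (a * (a - 1) / 2) TYPE('x)"
    unfolding a_def using assms by (rule two_point_convex_X)
  then have "two_point_convex a (max 2 (max p q)) (a * (a - 1) / 2) TYPE('u)"
    using a U by (intro two_point_convex_finitely_representable[of a _ _ scU sc]) auto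
  then show "reflexive scU" using a U(1) by (intro reflexive_of_two_point_convex) auto
qed


section \<open>Stopped branching functions\<close>

definition sel :: "bool list \<Rightarrow> 'a list \<Rightarrow> 'a list" where
  "sel ms l = map snd (filter fst (zip ms l))"

lemma sel_simps [simp]:
  "sel [] l = []"
  "sel (True # ms) (x # l) = x # sel ms l"
  "sel (False # ms) (x # l) = sel ms l"
  by (auto simp: sel_def)

lemma mixed_norm_sel:
  assumes "length ms = length rs" "\<forall>r\<in>set rs. 0 < r"
  shows "mixed_norm rs (\<lambda>l. h (sel ms l)) = mixed_norm (sel ms rs) h"
  using assms
proof (induction ms rs arbitrary: h rule: list_induct2)
  case (Cons b ms r rs)
  show ?case
  proof (cases b)
    case True
    have "mixed_norm rs (\<lambda>l. h (s # sel ms l)) = mixed_norm (sel ms rs) (\<lambda>l. h (s # l))" for s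
      using Cons.IH[of "\<lambda>l. h (s # l)"] Cons.prems by simp
    then show ?thesis using True by simp
  next
    case False
    then show ?thesis using Cons.IH[of h] Cons.prems by simp
  qed
qed simp

text \<open>
  A period consists of five bits: one decides whether to stop, in the norm with exponent \<open>r1\<close>,
  and two pairs of bits are moves, in the norm with exponent \<open>r2\<close>. Out of the ten bits of five
  levels of X(p,q), five are left unused.
\<close>

primrec pexps :: "real \<Rightarrow> real \<Rightarrow> nat \<Rightarrow> real list" where
  "pexps r1 r2 0 = []"
| "pexps r1 r2 (Suc n) = r1 # r2 # r2 # r2 # r2 # pexps r1 r2 n"

text \<open>For \<open>b\<close> the role of \<open>r1\<close> is played by p, and places 0, 3, 5,
  7, 9 of each block are kept; otherwise it is played by q, and places 1, 2, 4, 6, 8 are kept.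
  Either way the stopping bit comes first.\<close>

primrec pmask :: "bool \<Rightarrow> nat \<Rightarrow> bool list" where
  "pmask b 0 = []"
| "pmask b (Suc n) = [b, \<not> b, \<not> b, b, \<not> b, b, \<not> b, b, \<not> b, b] @ pmask b n"

lemma length_pexps [simp]: "length (pexps r1 r2 n) = 5 * n"
  by (induction n) auto

lemma length_pmask [simp]: "length (pmask b n) = 2 * (5 * n)"
  by (induction n) auto

lemma exps_5_Suc: "exps p q (5 * Suc n) = p # q # p # q # p # q # p # q # p # q # exps p q (5 * n)"
  by (simp add: numeral_eq_Suc)

lemma sel_pmask_exps:
  "sel (pmask b n) (exps p q (5 * n)) = pexps (if b then p else q) (if b then q else p) n"
proof (induction n)
  case (Suc n)
  then show ?case by (cases b) (simp_all only: pmask.simps exps_5_Suc append_Cons append_Nil, simp_all)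
qed simp

lemma mixed_norm_exps_sel:
  assumes "0 < p" "0 < q"
  shows "mixed_norm (exps p q (5 * n)) (\<lambda>l. h (sel (pmask b n) l))
       = mixed_norm (pexps (if b then p else q) (if b then q else p) n) h"
  using mixed_norm_sel[of "pmask b n" "exps p q (5 * n)" h] ball_exps[of "\<lambda>r. 0 < r" p q "5 * n"] assms
  by (simp add: sel_pmask_exps)

text \<open>Period k occupies the bits 5k to 5k+4: first the stopping bit, then the pairs for the
  moves of index 2k and 2k+1.\<close>

definition move :: "nat \<Rightarrow> bool list \<Rightarrow> bool \<times> bool" where
  "move i l = (l ! (5 * (i div 2) + (1 + 2 * (i mod 2))), l ! (5 * (i div 2) + (2 + 2 * (i mod 2))))"

definition alive :: "(nat \<Rightarrow> bool \<times> bool) \<Rightarrow> nat \<Rightarrow> bool list \<Rightarrow> bool" where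
  "alive \<alpha> i l \<longleftrightarrow> (\<forall>j<i. move j l = \<alpha> j)"

text \<open>The stopping bit of the current period counts as well, hence the successor.\<close>

definition running :: "nat \<Rightarrow> bool list \<Rightarrow> bool" where
  "running i l \<longleftrightarrow> (\<forall>k<Suc (i div 2). \<not> l ! (5 * k))"

definition dterm :: "real \<Rightarrow> (nat \<Rightarrow> bool \<times> bool) \<Rightarrow> (nat \<Rightarrow> bool \<times> bool \<Rightarrow> 'k::real_normed_field)
    \<Rightarrow> nat \<Rightarrow> bool list \<Rightarrow> 'k" where
  "dterm g \<alpha> Q i l = (if running i l \<and> alive \<alpha> i l then of_real (g ^ (i div 2)) * Q i (move i l) else 0)"

definition dsum :: "real \<Rightarrow> (nat \<Rightarrow> bool \<times> bool) \<Rightarrow> (nat \<Rightarrow> bool \<times> bool \<Rightarrow> 'k::real_normed_field)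
    \<Rightarrow> (nat \<Rightarrow> real) \<Rightarrow> nat \<Rightarrow> bool list \<Rightarrow> 'k" where
  "dsum g \<alpha> Q \<sigma> n l = (\<Sum>i<2 * n. of_real (\<sigma> i) * dterm g \<alpha> Q i l)"

text \<open>A path that stops after k successful periods has the value \<open>g ^ k\<close>, and
  surviving all n periods counts as stopping. For g > 0 exactly one of \<open>stopped\<close> and
  \<open>failed\<close> is nonzero on a path, and its value is g to the number of successful
  periods.\<close>

primrec stopped :: "real \<Rightarrow> nat \<Rightarrow> (nat \<Rightarrow> bool \<times> bool) \<Rightarrow> bool list \<Rightarrow> real" where
  "stopped g 0 \<alpha> l = 1"
| "stopped g (Suc n) \<alpha> l = (if l ! 0 then 1 else if move 0 l = \<alpha> 0 \<and> move 1 l = \<alpha> 1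
     then g * stopped g n (\<lambda>i. \<alpha> (Suc (Suc i))) (drop 5 l) else 0)"

primrec failed :: "real \<Rightarrow> nat \<Rightarrow> (nat \<Rightarrow> bool \<times> bool) \<Rightarrow> bool list \<Rightarrow> real" where
  "failed g 0 \<alpha> l = 0"
| "failed g (Suc n) \<alpha> l = (if l ! 0 then 0 else if move 0 l = \<alpha> 0 \<and> move 1 l = \<alpha> 1
     then g * failed g n (\<lambda>i. \<alpha> (Suc (Suc i))) (drop 5 l) else 1)"

lemma stopped_nonneg: "0 \<le> g \<Longrightarrow> 0 \<le> stopped g n \<alpha> l"
  by (induction n arbitrary: \<alpha> l) auto

lemma failed_nonneg: "0 \<le> g \<Longrightarrow> 0 \<le> failed g n \<alpha> l"
  by (induction n arbitrary: \<alpha> l) auto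

lemma nth_5_Suc: "5 \<le> length l \<Longrightarrow> l ! (5 * Suc k + m) = drop 5 l ! (5 * k + m)"
  by (simp add: add.assoc)

lemma move_Suc_Suc: "5 \<le> length l \<Longrightarrow> move (Suc (Suc i)) l = move i (drop 5 l)"
  unfolding move_def by (simp only: div2_Suc_Suc mod2_Suc_Suc nth_5_Suc)

lemma running_Suc_Suc: "5 \<le> length l \<Longrightarrow> running (Suc (Suc i)) l \<longleftrightarrow> \<not> l ! 0 \<and> running i (drop 5 l)"
  using nth_5_Suc[of l _ 0] unfolding running_def by (simp only: div2_Suc_Suc All_less_Suc2) simp

lemma alive_Suc_Suc: "5 \<le> length l \<Longrightarrow> alive \<alpha> (Suc (Suc i)) l \<longleftrightarrow>
    move 0 l = \<alpha> 0 \<and> move 1 l = \<alpha> 1 \<and> alive (\<lambda>i. \<alpha> (Suc (Suc i))) i (drop 5 l)"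
  unfolding alive_def by (simp only: All_less_Suc2 move_Suc_Suc One_nat_def)

lemma dterm_Suc_Suc: "5 \<le> length l \<Longrightarrow> dterm g \<alpha> Q (Suc (Suc i)) l =
    (if \<not> l ! 0 \<and> move 0 l = \<alpha> 0 \<and> move 1 l = \<alpha> 1
     then of_real g * dterm g (\<lambda>i. \<alpha> (Suc (Suc i))) (\<lambda>i. Q (Suc (Suc i))) i (drop 5 l) else 0)"
  by (simp add: dterm_def running_Suc_Suc alive_Suc_Suc move_Suc_Suc)

lemma dterm_0: "dterm g \<alpha> Q 0 l = (if l ! 0 then 0 else Q 0 (move 0 l))"
  by (simp add: dterm_def running_def alive_def)

lemma dterm_1: "dterm g \<alpha> Q (Suc 0) l = (if \<not> l ! 0 \<and> move 0 l = \<alpha> 0 then Q 1 (move 1 l) else 0)"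
  by (simp add: dterm_def running_def alive_def)

lemma dsum_Suc:
  assumes "5 \<le> length l"
  shows "dsum g \<alpha> Q \<sigma> (Suc n) l = (if l ! 0 then 0 else of_real (\<sigma> 0) * Q 0 (move 0 l) +
    (if move 0 l = \<alpha> 0 then of_real (\<sigma> 1) * Q 1 (move 1 l) +
      (if move 1 l = \<alpha> 1 then of_real g * dsum g (\<lambda>i. \<alpha> (Suc (Suc i))) (\<lambda>i. Q (Suc (Suc i)))
          (\<lambda>i. \<sigma> (Suc (Suc i))) n (drop 5 l) else 0) else 0))"
proof -
  have "2 * Suc n = Suc (Suc (2 * n))" by simp
  then have "dsum g \<alpha> Q \<sigma> (Suc n) l = of_real (\<sigma> 0) * dterm g \<alpha> Q 0 l + (of_real (\<sigma> 1) * dterm g \<alpha> Q (Suc 0) l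
     + (\<Sum>i<2 * n. of_real (\<sigma> (Suc (Suc i))) * dterm g \<alpha> Q (Suc (Suc i)) l))"
    unfolding dsum_def by (simp only: sum.lessThan_Suc_shift One_nat_def)
  then show ?thesis
    by (simp add: dterm_0 dterm_1 dterm_Suc_Suc[OF assms] dsum_def sum_distrib_left mult.left_commute)
qed

text \<open>
  On paths that stop after \<open>k\<close> successful periods, the sum of the terms of the \<open>i\<close>-th period is
  about \<open>(s0 + s1) g\<^sup>i\<close>, and the geometric sum over \<open>i < k\<close> is the multiple of \<open>g\<^sup>k - 1\<close> below.
\<close>

lemma dsum_estimate:
  fixes Q :: "nat \<Rightarrow> bool \<times> bool \<Rightarrow> 'k::real_normed_field"
  assumes g: "1 < g" and s: "\<bar>s0\<bar> = 1" "\<bar>s1\<bar> = 1"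
    and Q: "\<And>i. norm (Q i (\<alpha> i) - 1) \<le> err" "\<And>i j. norm (Q i j) \<le> K"
    and l: "length l = 5 * n"
  shows "norm (dsum g \<alpha> Q (\<lambda>i. if even i then s0 else s1) n l
           - of_real ((s0 + s1) / (g - 1) * (stopped g n \<alpha> l - 1)))
     \<le> 2 * err / (g - 1) * (stopped g n \<alpha> l + failed g n \<alpha> l - 1) + (2 * K + 2 / (g - 1)) * failed g n \<alpha> l"
  using Q l
proof (induction n arbitrary: \<alpha> Q l)
  case 0
  then show ?case by (simp add: dsum_def)
next
  case (Suc n)
  define \<alpha>' where "\<alpha>' = (\<lambda>i. \<alpha> (Suc (Suc i)))"
  define Q' where "Q' = (\<lambda>i. Q (Suc (Suc i)))"
  define c where "c = (s0 + s1) / (g - 1)"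
  define e' where "e' = 2 * err / (g - 1)"
  define K' where "K' = 2 * K + 2 / (g - 1)"
  define S where "S = dsum g \<alpha>' Q' (\<lambda>i. if even i then s0 else s1) n (drop 5 l)"
  define P where "P = stopped g n \<alpha>' (drop 5 l)"
  define F where "F = failed g n \<alpha>' (drop 5 l)"
  have len: "5 \<le> length l" "length (drop 5 l) = 5 * n" using Suc.prems by auto
  have IH: "norm (S - of_real (c * (P - 1))) \<le> e' * (P + F - 1) + K' * F"
    unfolding S_def P_def F_def c_def e'_def K'_def
    by (rule Suc.IH) (use Suc.prems len in \<open>auto simp: \<alpha>'_def Q'_def\<close>)
  have K0: "K \<ge> 0" using Suc.prems(2)[of 0 "\<alpha> 0"] norm_ge_zero order_trans by blast
  have "\<bar>c\<bar> \<le> 2 / (g - 1)" using g s by (auto simp: c_def abs_divide intro!: divide_right_mono)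
  then have cK: "\<bar>c\<bar> + 2 * K \<le> K'" by (simp add: K'_def)
  have Qb: "norm (of_real s0 * Q 0 j) \<le> K" "norm (of_real s1 * Q 1 j) \<le> K" for j
    using Suc.prems(2) s by (auto simp: norm_mult)
  have D: "dsum g \<alpha> Q (\<lambda>i. if even i then s0 else s1) (Suc n) l =
    (if l ! 0 then 0 else of_real s0 * Q 0 (move 0 l) + (if move 0 l = \<alpha> 0 then of_real s1 * Q 1 (move 1 l) +
      (if move 1 l = \<alpha> 1 then of_real g * S else 0) else 0))"
    unfolding dsum_Suc[OF len(1)] by (simp add: S_def \<alpha>'_def Q'_def)
  have PF: "stopped g (Suc n) \<alpha> l = (if l ! 0 then 1 else if move 0 l = \<alpha> 0 \<and> move 1 l = \<alpha> 1 then g * P else 0)"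
    "failed g (Suc n) \<alpha> l = (if l ! 0 then 0 else if move 0 l = \<alpha> 0 \<and> move 1 l = \<alpha> 1 then g * F else 1)"
    by (simp_all add: P_def F_def \<alpha>'_def)
  have goal: "norm (dsum g \<alpha> Q (\<lambda>i. if even i then s0 else s1) (Suc n) l - of_real (c * (stopped g (Suc n) \<alpha> l - 1)))
     \<le> e' * (stopped g (Suc n) \<alpha> l + failed g (Suc n) \<alpha> l - 1) + K' * failed g (Suc n) \<alpha> l"
  proof (cases "l ! 0")
    case True
    then show ?thesis by (simp add: D PF del: stopped.simps failed.simps)
  next
    case run: False
    show ?thesis
    proof (cases "move 0 l = \<alpha> 0 \<and> move 1 l = \<alpha> 1")
      case True
      \<comment> \<open>\<open>c\<close> and \<open>e'\<close> are fixed-point constants: the terms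
        of one period plus g times \<open>c * (P - 1)\<close> for the rest is again of this form,
        and likewise for the errors with \<open>e' * (P + F - 1)\<close>.\<close>
      have "c * (g - 1) = s0 + s1" "2 * err = e' * (g - 1)" using g by (auto simp: c_def e'_def)
      then have "s0 + s1 + g * (c * (P - 1)) = c * (g * P - 1)" by (simp add: algebra_simps)
      then have "of_real (c * (g * P - 1)) = (of_real s0 + of_real s1 + of_real g * of_real (c * (P - 1)) :: 'k)"
        by (metis of_real_add of_real_mult)
      then have "of_real s0 * Q 0 (\<alpha> 0) + (of_real s1 * Q 1 (\<alpha> 1) + of_real g * S) - of_real (c * (g * P - 1))
        = of_real s0 * (Q 0 (\<alpha> 0) - 1) + of_real s1 * (Q 1 (\<alpha> 1) - 1) + of_real g * (S - of_real (c * (P - 1)))"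
        by (simp add: algebra_simps)
      also have "norm \<dots> \<le> norm (of_real s0 * (Q 0 (\<alpha> 0) - 1)) + norm (of_real s1 * (Q 1 (\<alpha> 1) - 1))
          + norm (of_real g * (S - of_real (c * (P - 1))))"
        by (intro norm_triangle_le add_mono order_refl norm_triangle_ineq)
      also have "\<dots> \<le> err + err + g * (e' * (P + F - 1) + K' * F)"
        using Suc.prems(1)[of 0] Suc.prems(1)[of 1] s g IH
        by (intro add_mono) (simp_all add: norm_mult del: of_real_mult of_real_diff)
      also have "\<dots> = e' * (g * P + g * F - 1) + K' * (g * F)"
        using \<open>2 * err = e' * (g - 1)\<close> by (simp add: algebra_simps)
      finally show ?thesis using True run by (simp add: D PF del: stopped.simps failed.simps)
    next
      case False
      \<comment> \<open>The failing period contributes at most two terms of norm at most K, and the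
        value to compare with is -c since \<open>stopped\<close> is 0; \<open>K'\<close> covers
        both.\<close>
      have n1: "norm (x + of_real c :: 'k) \<le> K'" if "norm x \<le> 2 * K" for x
        using norm_triangle_ineq[of x "of_real c"] that cK by simp
      have "norm (of_real s0 * Q 0 (move 0 l)) \<le> 2 * K" using Qb(1)[of "move 0 l"] K0 by linarith
      moreover have "norm (of_real s0 * Q 0 (move 0 l) + of_real s1 * Q 1 (move 1 l)) \<le> 2 * K"
        using norm_triangle_ineq[of "of_real s0 * Q 0 (move 0 l)" "of_real s1 * Q 1 (move 1 l)"]
          Qb(1)[of "move 0 l"] Qb(2)[of "move 1 l"] by linarith
      ultimately show ?thesis using False run n1 by (auto simp: D PF simp del: stopped.simps failed.simps)
    qed
  qed
  show ?case using goal unfolding c_def e'_def K'_def .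
qed

text \<open>The sixteen values of four bits are equally likely, and one of them is the prescribed
  pair of moves.\<close>

lemma D_norm_two_moves:
  assumes "r > 0"
  shows "D_norm r (\<lambda>a. D_norm r (\<lambda>b. D_norm r (\<lambda>c. D_norm r (\<lambda>d.
     if (a, b) = m \<and> (c, d) = m' then X else Y)))) powr r = (\<bar>X\<bar> powr r + 15 * \<bar>Y\<bar> powr r) / 16"
proof -
  obtain m1 m2 m3 m4 where m: "m = (m1, m2)" "m' = (m3, m4)" by (cases m, cases m') auto
  show ?thesis
    unfolding m by (cases m1; cases m2; cases m3; cases m4) (simp_all add: D_norm_powr[OF assms] assms)
qed

lemma move_Cons [simp]: "move 0 (s # a # b # l) = (a, b)" "move (Suc 0) (s # a # b # c # d # l) = (c, d)"
  by (simp_all add: move_def numeral_eq_Suc)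

text \<open>Hitting both moves costs the factor \<open>16 powr (- 1/r2)\<close>, so a successful
  period turns the norm W of the rest into \<open>2 powr (1/r1) * W\<close>. Taking the mean with
  the stopped value 1 gives \<open>1/2 + W powr r1\<close>.\<close>

lemma stopped_norm:
  assumes r: "1 < r1" "1 < r2" and g: "g = 2 powr (1/r1) * 16 powr (1/r2)"
  shows "mixed_norm (pexps r1 r2 n) (stopped g n \<alpha>) powr r1 = real n / 2 + 1"
proof (induction n arbitrary: \<alpha>)
  case 0
  then show ?case by simp
next
  case (Suc n)
  define W where "W = mixed_norm (pexps r1 r2 n) (stopped g n (\<lambda>i. \<alpha> (Suc (Suc i))))"
  have pos: "\<forall>r\<in>set (pexps r1 r2 n). 0 < r" using r by (induction n) auto
  have g0: "g > 0" using g by simp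
  have W0: "W \<ge> 0" by (simp add: W_def)
  have inner: "mixed_norm (pexps r1 r2 n) (\<lambda>l. stopped g (Suc n) \<alpha> (False # a # b # c # d # l))
     = (if (a, b) = \<alpha> 0 \<and> (c, d) = \<alpha> 1 then g * W else 0)" for a b c d
  proof (cases "(a, b) = \<alpha> 0 \<and> (c, d) = \<alpha> 1")
    case True
    then show ?thesis
      using mixed_norm_cmult[OF pos, of g "stopped g n (\<lambda>i. \<alpha> (Suc (Suc i)))"] g0 by (simp add: W_def)
  next
    case False
    then have "mixed_norm (pexps r1 r2 n) (\<lambda>l. stopped g (Suc n) \<alpha> (False # a # b # c # d # l))
        = mixed_norm (pexps r1 r2 n) (\<lambda>_. 0 :: real)"
      by (intro mixed_norm_cong) auto
    then show ?thesis using False pos by (simp only: if_False) auto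
  qed
  define N where "N = D_norm r2 (\<lambda>a. D_norm r2 (\<lambda>b. D_norm r2 (\<lambda>c. D_norm r2 (\<lambda>d.
     if (a, b) = \<alpha> 0 \<and> (c, d) = \<alpha> 1 then g * W else 0))))"
  have "N powr r2 = (g * W) powr r2 / 16"
    unfolding N_def using r g0 W0 by (subst D_norm_two_moves) auto
  also have "\<dots> = (2 powr (1/r1) * W) powr r2"
    using r W0 by (simp add: g powr_mult powr_powr)
  finally have N: "N = 2 powr (1/r1) * W"
    using r W0 powr_inj[of N "2 powr (1/r1) * W" r2] powr_le_powr_iff[of N "2 powr (1/r1) * W" r2]
      powr_le_powr_iff[of "2 powr (1/r1) * W" N r2] by (auto simp: N_def)
  have "mixed_norm (pexps r1 r2 (Suc n)) (stopped g (Suc n) \<alpha>) = D_norm r1 (\<lambda>s. if s then 1 else N)"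
  proof -
    have "D_norm r2 (\<lambda>a. D_norm r2 (\<lambda>b. D_norm r2 (\<lambda>c. D_norm r2 (\<lambda>d.
        mixed_norm (pexps r1 r2 n) (\<lambda>l. stopped g (Suc n) \<alpha> (s # a # b # c # d # l))))))
      = (if s then 1 else N)" for s
    proof (cases s)
      case True
      then show ?thesis using pos r by simp
    next
      case False
      then show ?thesis unfolding N_def by (simp only: inner if_False)
    qed
    then show ?thesis by (simp only: pexps.simps mixed_norm.simps)
  qed
  then have "mixed_norm (pexps r1 r2 (Suc n)) (stopped g (Suc n) \<alpha>) powr r1 = (1 + N powr r1) / 2"
    using r by (simp only:) (simp add: D_norm_powr N_def)
  also have "\<dots> = 1/2 + W powr r1" using r W0 by (simp add: N powr_mult powr_powr add_divide_distrib)
  also have "\<dots> = real (Suc n) / 2 + 1" using Suc.IH by (simp add: W_def add_divide_distrib)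
  finally show ?case .
qed

text \<open>In the r2-th power, g balances the masses again, so W is carried over unchanged; the
  fifteen failing values add \<open>15/16 * (1/2) powr (r2/r1)\<close>, which is below 1.\<close>

lemma failed_norm:
  assumes r: "1 < r1" "1 < r2" and g: "g = 2 powr (1/r1) * 16 powr (1/r2)"
  shows "mixed_norm (pexps r1 r2 n) (failed g n \<alpha>) powr r2 \<le> real n"
proof (induction n arbitrary: \<alpha>)
  case 0
  then show ?case by simp
next
  case (Suc n)
  define W where "W = mixed_norm (pexps r1 r2 n) (failed g n (\<lambda>i. \<alpha> (Suc (Suc i))))"
  have pos: "\<forall>r\<in>set (pexps r1 r2 n). 0 < r" using r by (induction n) auto
  have g0: "g > 0" using g by simp
  have W0: "W \<ge> 0" by (simp add: W_def)
  have inner: "mixed_norm (pexps r1 r2 n) (\<lambda>l. failed g (Suc n) \<alpha> (False # a # b # c # d # l))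
     = (if (a, b) = \<alpha> 0 \<and> (c, d) = \<alpha> 1 then g * W else 1)" for a b c d
  proof (cases "(a, b) = \<alpha> 0 \<and> (c, d) = \<alpha> 1")
    case True
    then show ?thesis
      using mixed_norm_cmult[OF pos, of g "failed g n (\<lambda>i. \<alpha> (Suc (Suc i)))"] g0 by (simp add: W_def)
  next
    case False
    then have "mixed_norm (pexps r1 r2 n) (\<lambda>l. failed g (Suc n) \<alpha> (False # a # b # c # d # l))
        = mixed_norm (pexps r1 r2 n) (\<lambda>_. 1 :: real)"
      by (intro mixed_norm_cong) auto
    then show ?thesis using False pos by (simp only: if_False) auto
  qed
  define N where "N = D_norm r2 (\<lambda>a. D_norm r2 (\<lambda>b. D_norm r2 (\<lambda>c. D_norm r2 (\<lambda>d.
     if (a, b) = \<alpha> 0 \<and> (c, d) = \<alpha> 1 then g * W else 1))))"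
  have N: "N powr r2 = ((g * W) powr r2 + 15) / 16"
    unfolding N_def using r g0 W0 by (subst D_norm_two_moves) auto
  have "mixed_norm (pexps r1 r2 (Suc n)) (failed g (Suc n) \<alpha>) = D_norm r1 (\<lambda>s. if s then 0 else N)"
  proof -
    have "D_norm r2 (\<lambda>a. D_norm r2 (\<lambda>b. D_norm r2 (\<lambda>c. D_norm r2 (\<lambda>d.
        mixed_norm (pexps r1 r2 n) (\<lambda>l. failed g (Suc n) \<alpha> (s # a # b # c # d # l))))))
      = (if s then 0 else N)" for s
    proof (cases s)
      case True
      then show ?thesis using pos r by simp
    next
      case False
      then show ?thesis unfolding N_def by (simp only: inner if_False)
    qed
    then show ?thesis by (simp only: pexps.simps mixed_norm.simps)
  qed
  also have "D_norm r1 (\<lambda>s. if s then 0 else N) = N * (1/2) powr (1/r1)"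
  proof -
    have "D_norm r1 (\<lambda>s. if s then 0 else N) = (N powr r1 * (1/2)) powr (1/r1)"
      using r by (simp add: D_norm_alt N_def)
    also have "\<dots> = (N powr r1) powr (1/r1) * (1/2) powr (1/r1)" by (rule powr_mult)
    finally show ?thesis using r by (simp add: powr_powr N_def)
  qed
  finally have "mixed_norm (pexps r1 r2 (Suc n)) (failed g (Suc n) \<alpha>) powr r2
      = ((g * W) powr r2 + 15) / 16 * (1/2) powr (r2/r1)"
    by (simp only: powr_mult[of N] N[symmetric]) (simp add: powr_powr N_def)
  also have "\<dots> = W powr r2 + 15/16 * (1/2) powr (r2/r1)"
  proof -
    have "2 powr (r2/r1) * (1/2) powr (r2/r1) = (2 * (1/2)) powr (r2/r1)"
      by (rule powr_mult[symmetric])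
    then have h: "2 powr (r2/r1) * (1/2) powr (r2/r1) = 1" by simp
    have "(g * W) powr r2 = 16 * (2 powr (r2/r1) * W powr r2)"
      using r W0 by (simp add: g powr_mult powr_powr)
    then have "((g * W) powr r2 + 15) / 16 * (1/2) powr (r2/r1)
        = W powr r2 * (2 powr (r2/r1) * (1/2) powr (r2/r1)) + 15/16 * (1/2) powr (r2/r1)"
      by (simp only:) (simp add: add_divide_distrib distrib_right)
    then show ?thesis unfolding h by simp
  qed
  also have "\<dots> \<le> W powr r2 + 1"
    using powr_le1[of "r2/r1" "1/2"] r by (simp del: powr_le1)
  also have "\<dots> \<le> real (Suc n)" using Suc.IH[of "\<lambda>i. \<alpha> (Suc (Suc i))"] by (simp add: W_def)
  finally show ?case .
qed

text \<open>\<open>g\<close>, \<open>A0\<close> and \<open>n\<close> precede the quantifiers over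
  \<open>\<alpha>\<close> and \<open>Q\<close>: these will vary with the sample point, and the gap
  has to be uniform. The condition on \<open>err\<close> keeps \<open>1 + C\<close> times the
  stopped part of the error below half of the main term. The rest is constant or grows at most like
  \<open>n powr (1/r2)\<close>, and it loses for large n, however large K is.\<close>

lemma transform_gap:
  assumes r: "1 < r1" "r1 < r2" and C: "C \<ge> 0" and err: "2 * err * (1 + C) \<le> 1" "err \<ge> 0" and K: "K \<ge> 0"
  shows "\<exists>g A0 :: real. \<exists>n :: nat. 1 < g \<and> (\<forall>\<alpha> (Q :: nat \<Rightarrow> bool \<times> bool \<Rightarrow> 'k::real_normed_field).
       (\<forall>i. norm (Q i (\<alpha> i) - 1) \<le> err) \<and> (\<forall>i j. norm (Q i j) \<le> K) \<longrightarrow>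
       mixed_norm (pexps r1 r2 n) (dsum g \<alpha> Q (\<lambda>i. if even i then 1 else - 1) n) \<le> A0 \<and>
       C * A0 + 1 \<le> mixed_norm (pexps r1 r2 n) (dsum g \<alpha> Q (\<lambda>i. 1) n))"
proof -
  define g where "g = 2 powr (1/r1) * 16 powr (1/r2)"
  have g: "1 < g"
  proof -
    have "1 * 1 < 2 powr (1/r1) * 16 powr (1/r2)"
      using r by (intro mult_strict_mono) (auto simp: gr_one_powr less_imp_le)
    then show ?thesis by (simp add: g_def)
  qed
  define c where "c = 2 / (g - 1)"
  define e' where "e' = 2 * err / (g - 1)"
  define K' where "K' = 2 * K + 2 / (g - 1)"
  define A where "A = (1 + C) * (e' + K')"
  have c: "c > 0" and e': "0 \<le> e'" "(1 + C) * e' \<le> c / 2" and K': "K' \<ge> 0"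
  proof -
    show "c > 0" "0 \<le> e'" "K' \<ge> 0" using g err K by (auto simp: c_def e'_def K'_def)
    have "(1 + C) * e' = (2 * err * (1 + C)) / (g - 1)" by (simp add: e'_def)
    also have "\<dots> \<le> 1 / (g - 1)" using err g by (intro divide_right_mono) auto
    also have "\<dots> = c / 2" using g by (simp add: c_def field_simps)
    finally show "(1 + C) * e' \<le> c / 2" .
  qed
  have lim: "filterlim (\<lambda>n. c / 2 * (real n / 2) powr (1/r1) - c - A * real n powr (1/r2)) at_top sequentially"
  proof -
    define x y where "x = 1/r1" "y = 1/r2"
    have xy: "0 < y" "y < x" using r by (auto simp: x_y_def field_simps)
    show ?thesis unfolding x_y_def[symmetric] using xy c by real_asymp
  qed
  obtain n where n: "1 \<le> c / 2 * (real n / 2) powr (1/r1) - c - A * real n powr (1/r2)"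
    using filterlim_at_top[THEN iffD1, OF lim, rule_format, of 1] by (auto simp: eventually_sequentially)
  have pos: "\<forall>r\<in>set (pexps r1 r2 n). 0 < r" "\<forall>r\<in>set (pexps r1 r2 n). 1 \<le> r" using r by (induction n) auto
  define A0 where "A0 = e' * (real n / 2 + 1) powr (1/r1) + (e' + K') * real n powr (1/r2)"
  have gap: "mixed_norm (pexps r1 r2 n) (dsum g \<alpha> Q (\<lambda>i. if even i then 1 else - 1) n) \<le> A0 \<and>
      C * A0 + 1 \<le> mixed_norm (pexps r1 r2 n) (dsum g \<alpha> Q (\<lambda>i. 1) n)"
    if Q: "\<And>i. norm (Q i (\<alpha> i) - 1) \<le> err" "\<And>i j. norm (Q i j) \<le> K"
    for \<alpha> and Q :: "nat \<Rightarrow> bool \<times> bool \<Rightarrow> 'k"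
  proof -
    let ?N = "\<lambda>f. mixed_norm (pexps r1 r2 n) f"
    define P where "P = stopped g n \<alpha>"
    define F where "F = failed g n \<alpha>"
    define E where "E l = e' * P l + (e' + K') * F l" for l
    have PF: "P l \<ge> 0" "F l \<ge> 0" for l using g by (auto simp: P_def F_def stopped_nonneg failed_nonneg)
    have E0: "E l \<ge> 0" for l using PF[of l] e' K' by (auto simp: E_def)
    have "norm (dsum g \<alpha> Q (\<lambda>i. if even i then 1 else - 1) n l) \<le> E l" if "length l = 5 * n" for l
      using dsum_estimate[where ?s0.0 = 1 and ?s1.0 = "- 1" and \<alpha> = \<alpha> and Q = Q and err = err and K = K, OF g _ _ Q that] e' unfolding E_def P_def F_def e'_def K'_def
      by (simp add: algebra_simps)
    then have minus: "?N (dsum g \<alpha> Q (\<lambda>i. if even i then 1 else - 1) n) \<le> ?N E"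
      using pos E0 by (intro mixed_norm_mono) auto
    have "c * P l \<le> norm (dsum g \<alpha> Q (\<lambda>i. 1) n l) + (c + E l)" if "length l = 5 * n" for l
    proof -
      have "norm (dsum g \<alpha> Q (\<lambda>i. 1) n l - of_real (c * (P l - 1))) \<le> E l"
        using dsum_estimate[where ?s0.0 = 1 and ?s1.0 = 1 and \<alpha> = \<alpha> and Q = Q and err = err and K = K, OF g _ _ Q that] e' unfolding E_def P_def F_def e'_def K'_def c_def
        by (simp add: algebra_simps)
      then have "norm (of_real (c * (P l - 1)) :: 'k) \<le> norm (dsum g \<alpha> Q (\<lambda>i. 1) n l) + E l"
        using norm_triangle_sub[of "of_real (c * (P l - 1))" "dsum g \<alpha> Q (\<lambda>i. 1) n l"]
        by (simp only: norm_minus_commute)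
      then have "c * (P l - 1) \<le> norm (dsum g \<alpha> Q (\<lambda>i. 1) n l) + E l" by (simp only: norm_of_real)
      then show ?thesis by (simp add: algebra_simps)
    qed
    then have "?N (\<lambda>l. c * P l) \<le> ?N (\<lambda>l. norm (dsum g \<alpha> Q (\<lambda>i. 1) n l) + (c + E l))"
      using pos PF E0 c by (intro mixed_norm_mono) auto
    also have "\<dots> \<le> ?N (\<lambda>l. norm (dsum g \<alpha> Q (\<lambda>i. 1) n l)) + ?N (\<lambda>l. c + E l)"
      by (intro mixed_norm_triangle pos)
    also have "?N (\<lambda>l. c + E l) \<le> ?N (\<lambda>_. c) + ?N E" by (intro mixed_norm_triangle pos)
    finally have plus: "c * ?N P \<le> ?N (dsum g \<alpha> Q (\<lambda>i. 1) n) + c + ?N E"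
      using c pos by (simp add: mixed_norm_cmult)
    have "?N E \<le> ?N (\<lambda>l. e' * P l) + ?N (\<lambda>l. (e' + K') * F l)"
      unfolding E_def by (intro mixed_norm_triangle pos)
    then have NE: "?N E \<le> e' * ?N P + (e' + K') * ?N F"
      using e' K' pos by (simp add: mixed_norm_cmult)
    have NP: "?N P = (real n / 2 + 1) powr (1/r1)"
    proof -
      have "?N P = (?N P powr r1) powr (1/r1)" using r by (simp add: powr_powr)
      then show ?thesis unfolding P_def using stopped_norm[of r1 r2 g n \<alpha>] r by (simp add: g_def)
    qed
    have NF: "?N F \<le> real n powr (1/r2)"
    proof -
      have "?N F = (?N F powr r2) powr (1/r2)" using r by (simp add: powr_powr)
      also have "\<dots> \<le> real n powr (1/r2)" unfolding F_def using failed_norm[of r1 r2 g n \<alpha>] r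
        by (intro powr_mono2) (auto simp: g_def)
      finally show ?thesis .
    qed
    have "(e' + K') * ?N F \<le> (e' + K') * real n powr (1/r2)"
      using NF e' K' by (intro mult_left_mono) auto
    then have NA: "?N E \<le> A0" using NE unfolding NP A0_def by simp
    have "(1 + C) * A0 \<le> c / 2 * ?N P + A * real n powr (1/r2)"
    proof -
      have "(1 + C) * A0 = (1 + C) * e' * ?N P + A * real n powr (1/r2)"
        by (simp add: A_def A0_def NP algebra_simps)
      also have "\<dots> \<le> c / 2 * ?N P + A * real n powr (1/r2)" using e' by (intro add_mono mult_right_mono) auto
      finally show ?thesis .
    qed
    moreover have "c / 2 * (real n / 2) powr (1/r1) \<le> c / 2 * ?N P"
      unfolding NP using c r by (intro mult_left_mono powr_mono2) auto
    ultimately show ?thesis using n plus minus NA by (simp add: algebra_simps)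
  qed
  show ?thesis
    by (rule exI[of _ g], rule exI[of _ A0], rule exI[of _ n]) (use g gap in blast)
qed


section \<open>Martingales in X(p,q)\<close>

lemma bounded_linear_scale:
  fixes sc :: "'k::real_normed_field \<Rightarrow> 'x::real_normed_vector \<Rightarrow> 'x"
  assumes "normed_space_over sc" shows "bounded_linear (\<lambda>c. sc c v)"
proof (rule bounded_linear_intro[where K = "norm v"])
  interpret vector_space sc using assms by (simp add: normed_space_over_def)
  show "sc (x + y) v = sc x v + sc y v" for x y by (rule scale_left_distrib)
  show "sc (r *\<^sub>R x) v = r *\<^sub>R sc x v" for r x
    using assms by (simp add: normed_space_over_def scaleR_conv_of_real flip: scale_scale)
  show "norm (sc x v) \<le> norm x * norm v" for x
    using assms by (simp add: normed_space_over_def)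
qed

lemma is_X_zero:
  assumes "is_X p q sc J" shows "J (\<lambda>_. 0) = 0"
  using is_X_norm_bits[OF assms, of "\<lambda>_. 0" 0] by simp

lemma is_X_sum:
  assumes "is_X p q sc J" "finite S"
  shows "J (\<lambda>\<omega>. \<Sum>i\<in>S. g i (bits n \<omega>)) = (\<Sum>i\<in>S. J (\<lambda>\<omega>. g i (bits n \<omega>)))"
  using assms(2)
proof (induction S rule: finite_induct)
  case empty
  then show ?case using is_X_zero[OF assms(1)] by simp
next
  case (insert i S)
  have "(\<lambda>\<omega>. \<Sum>i\<in>S. g i (bits n \<omega>)) \<in> X_union" using bits_in_X_union[of "\<lambda>l. \<Sum>i\<in>S. g i l" n] .
  then show ?case using insert by (simp add: is_X_add[OF assms(1)])
qed

lemma finite_bool_lists: "finite {l :: bool list. length l = n}"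
  using finite_lists_length_eq[of "UNIV :: bool set" n] by simp

text \<open>Expansion in the finitely many indicator vectors of a level: measurability and integrals
  of vector-valued functions reduce to those of scalar coefficients.\<close>

lemma is_X_expand:
  assumes X: "is_X p q sc J"
  shows "J (\<lambda>\<omega>. h (bits n \<omega>))
    = (\<Sum>l | length l = 2 * n. sc (h l) (J (\<lambda>\<omega>. of_bool (bits n \<omega> = l))))"
proof -
  have "h (bits n \<omega>) = (\<Sum>l | length l = 2 * n. h l * of_bool (bits n \<omega> = l))" for \<omega>
    by (subst sum.remove[of _ "bits n \<omega>"]) (auto simp: finite_bool_lists intro!: sum.neutral)
  then have "J (\<lambda>\<omega>. h (bits n \<omega>)) = J (\<lambda>\<omega>. \<Sum>l | length l = 2 * n. h l * of_bool (bits n \<omega> = l))"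
    by presburger
  also have "\<dots> = (\<Sum>l | length l = 2 * n. J (\<lambda>\<omega>. h l * of_bool (bits n \<omega> = l)))"
    by (rule is_X_sum[OF X finite_bool_lists, of "\<lambda>l l'. h l * of_bool (l' = l)"])
  also have "\<dots> = (\<Sum>l | length l = 2 * n. sc (h l) (J (\<lambda>\<omega>. of_bool (bits n \<omega> = l))))"
    by (intro sum.cong refl is_X_cmult[OF X] bits_in_X_union[of "\<lambda>l'. of_bool (l' = _)" n])
  finally show ?thesis .
qed

text \<open>
  The differences of the martingale: the moves in the \<open>i\<close>-th period that keep a path alive are
  prescribed by \<open>a\<close>, and \<open>R i\<close> is the random factor that is close to 1 on that move.
\<close>

definition move_diff :: "(((nat \<Rightarrow> bool) \<Rightarrow> 'k::real_normed_field) \<Rightarrow> 'x) \<Rightarrow> real \<Rightarrow> bool \<Rightarrow> nat \<Rightarrow>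
    (nat \<Rightarrow> 'a \<Rightarrow> bool \<times> bool) \<Rightarrow> (nat \<Rightarrow> 'a \<Rightarrow> bool \<times> bool \<Rightarrow> 'k) \<Rightarrow> nat \<Rightarrow> 'a \<Rightarrow> 'x" where
  "move_diff J g b N a R i x = J (\<lambda>\<omega>. if i < 2 * N then of_real ((- 1) ^ i) *
     dterm g (\<lambda>j. a j x) (\<lambda>j. R j x) i (sel (pmask b N) (bits (5 * N) \<omega>)) else 0)"

text \<open>Time is shifted by one, the martingale starting at 0. The alternating sign belongs to
  the differences: the martingale itself is the small sum, and the signs applied to it later remove
  the alternation.\<close>

definition move_martingale :: "(((nat \<Rightarrow> bool) \<Rightarrow> 'k::real_normed_field) \<Rightarrow> 'x::real_normed_vector) \<Rightarrow> real \<Rightarrow> bool \<Rightarrow> nat \<Rightarrow>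
    (nat \<Rightarrow> 'a \<Rightarrow> bool \<times> bool) \<Rightarrow> (nat \<Rightarrow> 'a \<Rightarrow> bool \<times> bool \<Rightarrow> 'k) \<Rightarrow> nat \<Rightarrow> 'a \<Rightarrow> 'x" where
  "move_martingale J g b N a R n x = (\<Sum>i<n. move_diff J g b N a R i x)"

lemma mdiff_move_martingale:
  "mdiff (move_martingale J g b N a R) n x = (case n of 0 \<Rightarrow> 0 | Suc i \<Rightarrow> move_diff J g b N a R i x)"
  by (cases n) (auto simp: mdiff_def move_martingale_def)

lemma move_diff_eq_0:
  assumes "is_X p q sc J" "2 * N \<le> i" shows "move_diff J g b N a R i x = 0"
  using assms is_X_zero[OF assms(1)] by (simp add: move_diff_def)

lemma sum_move_diff:
  assumes X: "is_X p q sc J"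
  shows "(\<Sum>i<2 * N. \<epsilon> i *\<^sub>R move_diff J g b N a R i x)
    = J (\<lambda>\<omega>. dsum g (\<lambda>j. a j x) (\<lambda>j. R j x) (\<lambda>i. \<epsilon> i * (- 1) ^ i) N (sel (pmask b N) (bits (5 * N) \<omega>)))"
proof -
  let ?d = "\<lambda>i l. dterm g (\<lambda>j. a j x) (\<lambda>j. R j x) i (sel (pmask b N) l)"
  have "\<epsilon> i *\<^sub>R move_diff J g b N a R i x
      = J (\<lambda>\<omega>. of_real (\<epsilon> i * (- 1) ^ i) * ?d i (bits (5 * N) \<omega>))" if "i < 2 * N" for i
  proof -
    have "\<epsilon> i *\<^sub>R move_diff J g b N a R i x = sc (of_real (\<epsilon> i)) (move_diff J g b N a R i x)"
      using is_X_normed_space[OF X] by (simp add: normed_space_over_def)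
    also have "\<dots> = J (\<lambda>\<omega>. of_real (\<epsilon> i) * (of_real ((- 1) ^ i) * ?d i (bits (5 * N) \<omega>)))"
      unfolding move_diff_def using that
        is_X_cmult[OF X bits_in_X_union[of "\<lambda>l. of_real ((- 1) ^ i) * ?d i l" "5 * N"], of "of_real (\<epsilon> i)"]
      by simp
    finally show ?thesis by (simp add: mult.assoc)
  qed
  then have "(\<Sum>i<2 * N. \<epsilon> i *\<^sub>R move_diff J g b N a R i x)
      = (\<Sum>i<2 * N. J (\<lambda>\<omega>. of_real (\<epsilon> i * (- 1) ^ i) * ?d i (bits (5 * N) \<omega>)))"
    by (intro sum.cong refl) simp
  also have "\<dots> = J (\<lambda>\<omega>. \<Sum>i<2 * N. of_real (\<epsilon> i * (- 1) ^ i) * ?d i (bits (5 * N) \<omega>))"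
    by (rule is_X_sum[OF X finite_lessThan, symmetric])
  finally show ?thesis unfolding dsum_def .
qed

text \<open>At each sample point the norm is that of a deterministic sum, to which
  \<open>transform_gap\<close> applies.\<close>

lemma norm_sum_move_diff:
  assumes X: "is_X p q sc J" and pq: "0 < p" "0 < q"
  shows "norm (\<Sum>i<2 * N. \<epsilon> i *\<^sub>R move_diff J g b N a R i x)
    = mixed_norm (pexps (if b then p else q) (if b then q else p) N)
        (dsum g (\<lambda>j. a j x) (\<lambda>j. R j x) (\<lambda>i. \<epsilon> i * (- 1) ^ i) N)"
  unfolding sum_move_diff[OF X] is_X_norm_bits[OF X, of "\<lambda>l. dsum g (\<lambda>j. a j x) (\<lambda>j. R j x) _ N (sel (pmask b N) l)"]
  by (rule mixed_norm_exps_sel[OF pq])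

section \<open>Integrals and \<open>L_norm\<close> bounds over a probability space\<close>

context prob_space
begin

lemma integrable_scale:
  fixes sc :: "'k::{real_normed_field,banach,second_countable_topology} \<Rightarrow> 'x::{banach,second_countable_topology} \<Rightarrow> 'x"
  assumes "normed_space_over sc" "integrable M c"
  shows "integrable M (\<lambda>x. sc (c x) v)" "(LINT x|M. sc (c x) v) = sc (LINT x|M. c x) v"
  using integrable_bounded_linear[OF bounded_linear_scale[OF assms(1)] assms(2)]
    integral_bounded_linear[OF bounded_linear_scale[OF assms(1)] assms(2)] by auto

lemma integrable_bdd:
  fixes f :: "'a \<Rightarrow> 'b::{banach,second_countable_topology}"
  assumes "f \<in> borel_measurable M" "\<And>x. norm (f x) \<le> B"
  shows "integrable M f"
  using assms by (intro integrable_const_bound[of _ B]) auto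

lemma L_norm_bounds:
  fixes f :: "'a \<Rightarrow> 'b::{banach,second_countable_topology}"
  assumes "f \<in> borel_measurable M" "\<And>x. norm (f x) \<le> B" "s > 0"
  shows "in_L M s f" "L_norm M s f \<le> B" "(\<And>x. norm (f x) \<ge> A) \<Longrightarrow> A \<ge> 0 \<Longrightarrow> A \<le> L_norm M s f"
proof -
  obtain x where "x \<in> space M" using not_empty by blast
  have B: "B \<ge> 0" using assms(2)[of x] norm_ge_zero order_trans by blast
  have int: "integrable M (\<lambda>x. norm (f x) powr s)"
    using assms B by (intro integrable_bdd[of _ "B powr s"]) (auto intro: powr_mono2)
  then show "in_L M s f" using assms by (auto simp: in_L_def)
  have "(LINT x|M. norm (f x) powr s) \<le> B powr s"
    using assms int B by (intro integral_le_const AE_I2 powr_mono2) auto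
  then have "(LINT x|M. norm (f x) powr s) powr (1/s) \<le> (B powr s) powr (1/s)"
    using assms by (intro powr_mono2) auto
  then show "L_norm M s f \<le> B" using assms B by (simp add: L_norm_def powr_powr)
  assume A: "\<And>x. norm (f x) \<ge> A" "A \<ge> 0"
  have "A powr s \<le> (LINT x|M. norm (f x) powr s)"
    using assms int A by (intro integral_ge_const AE_I2 powr_mono2) auto
  then have "(A powr s) powr (1/s) \<le> (LINT x|M. norm (f x) powr s) powr (1/s)"
    using assms by (intro powr_mono2) auto
  then show "A \<le> L_norm M s f" using assms A by (simp add: L_norm_def powr_powr)
qed

end

text \<open>The common frame of the real and the complex example: at time j + 1 the sample reveals
  the move \<open>a j\<close> that keeps a path alive and the factor \<open>R j\<close>.\<close>

locale branching = prob_space M for M :: "'a measure" +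
  fixes p q :: real
    and sc :: "'k::{real_normed_field,real_inner,banach,second_countable_topology} \<Rightarrow> 'x \<Rightarrow> 'x::{banach,second_countable_topology}"
    and J :: "((nat \<Rightarrow> bool) \<Rightarrow> 'k) \<Rightarrow> 'x"
    and F :: "nat \<Rightarrow> 'a measure"
    and g K :: real and b :: bool and N :: nat
    and a :: "nat \<Rightarrow> 'a \<Rightarrow> bool \<times> bool"
    and R :: "nat \<Rightarrow> 'a \<Rightarrow> bool \<times> bool \<Rightarrow> 'k"
  assumes X: "is_X p q sc J" and pq: "1 < p" "1 < q"
    and sub: "\<And>n. subalgebra M (F n)" and filt: "filtration (space M) F"
    and a_meas: "\<And>j. a j \<in> measurable (F (Suc j)) (count_space UNIV)"
    and R_meas: "\<And>j m. (\<lambda>x. R j x m) \<in> borel_measurable (F (Suc j))"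
    and R_bdd: "\<And>j x m. norm (R j x m) \<le> K"
begin

lemma F_mono: "i \<le> j \<Longrightarrow> subalgebra (F j) (F i)"
  using filtration.sets_F_mono[OF filt, of i j] filtration.space_F[OF filt] by (simp add: subalgebra_def)

lemma sets_F: "A \<in> sets (F n) \<Longrightarrow> A \<in> sets M"
  using sub[of n] by (auto simp: subalgebra_def)

lemma space_F: "space (F n) = space M"
  using filtration.space_F[OF filt] by simp

lemma R_meas_less: "i < n \<Longrightarrow> (\<lambda>x. R i x m) \<in> borel_measurable (F n)"
  by (rule measurable_from_subalg[OF F_mono R_meas]) simp

text \<open>Being alive before move i depends only on what is revealed up to time i. Hence a term of
  index i is a factor known at time i times a value of \<open>R i\<close>, and its conditional
  expectation reduces to that of \<open>R i\<close>.\<close>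

lemma alive_set: "{x \<in> space M. alive (\<lambda>j. a j x) i l} \<in> sets (F i)"
proof -
  have "{x \<in> space (F i). a j x = m} \<in> sets (F i)" if "j < i" for j m
  proof -
    have "a j \<in> measurable (F i) (count_space UNIV)"
      using that by (intro measurable_from_subalg[OF F_mono a_meas]) simp
    from measurable_sets[OF this, of "{m}"] show ?thesis by (simp add: vimage_def Int_def conj_commute)
  qed
  then have "{x \<in> space (F i). \<forall>j\<in>{..<i}. a j x = move j l} \<in> sets (F i)"
    by (intro sets.sets_Collect_finite_All finite_lessThan) (simp only: lessThan_iff)
  moreover have "{x \<in> space M. alive (\<lambda>j. a j x) i l} = {x \<in> space (F i). \<forall>j\<in>{..<i}. a j x = move j l}"
    unfolding alive_def space_F by (rule Collect_cong) (metis lessThan_iff)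
  ultimately show ?thesis by simp
qed

lemma dterm_as_indicator:
  fixes R' :: "nat \<Rightarrow> 'a \<Rightarrow> bool \<times> bool \<Rightarrow> 'k"
  assumes "x \<in> space M"
  shows "dterm g (\<lambda>j. a j x) (\<lambda>j. R' j x) i l
    = indicator {x \<in> space M. alive (\<lambda>j. a j x) i l} x *\<^sub>R
        ((if running i l then of_real (g ^ (i div 2)) else 0) * R' i x (move i l))"
  using assms by (auto simp: dterm_def indicator_def)

lemma dterm_meas:
  fixes R' :: "nat \<Rightarrow> 'a \<Rightarrow> bool \<times> bool \<Rightarrow> 'k"
  assumes "i \<le> n" "(\<lambda>x. R' i x (move i l)) \<in> borel_measurable (F n)"
  shows "(\<lambda>x. dterm g (\<lambda>j. a j x) (\<lambda>j. R' j x) i l) \<in> borel_measurable (F n)"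
proof -
  have "{x \<in> space M. alive (\<lambda>j. a j x) i l} \<in> sets (F n)"
    using alive_set[of i l] F_mono[of i n] assms(1) by (auto simp: subalgebra_def)
  then have "(\<lambda>x. indicator {x \<in> space M. alive (\<lambda>j. a j x) i l} x *\<^sub>R
        ((if running i l then of_real (g ^ (i div 2)) else 0) * R' i x (move i l))) \<in> borel_measurable (F n)"
    using assms(2)
    by (intro borel_measurable_scaleR borel_measurable_indicator borel_measurable_times borel_measurable_const) auto
  then show ?thesis
    by (subst measurable_cong[OF dterm_as_indicator]) (auto simp: space_F)
qed

lemma dterm_bdd:
  fixes R' :: "nat \<Rightarrow> 'a \<Rightarrow> bool \<times> bool \<Rightarrow> 'k"
  assumes "\<And>m. norm (R' i x m) \<le> K'"
  shows "norm (dterm g (\<lambda>j. a j x) (\<lambda>j. R' j x) i l) \<le> \<bar>g\<bar> ^ (i div 2) * K'"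
proof -
  have "K' \<ge> 0" using assms norm_ge_zero order_trans by blast
  then show ?thesis
    by (cases "running i l \<and> alive (\<lambda>j. a j x) i l")
      (simp_all add: dterm_def norm_mult norm_power mult_left_mono assms)
qed

lemma set_integral_dterm:
  fixes R' :: "nat \<Rightarrow> 'a \<Rightarrow> bool \<times> bool \<Rightarrow> 'k"
  assumes A: "A \<in> sets (F i)" and R': "(\<lambda>x. R' i x (move i l)) \<in> borel_measurable (F (Suc i))"
    and eq: "\<And>A. A \<in> sets (F i) \<Longrightarrow> (LINT x|M. indicator A x *\<^sub>R (w x * R' i x (move i l))) = (LINT x|M. indicator A x *\<^sub>R c)"
  shows "(LINT x|M. indicator A x *\<^sub>R (w x * dterm g (\<lambda>j. a j x) (\<lambda>j. R' j x) i l))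
    = (LINT x|M. indicator A x *\<^sub>R dterm g (\<lambda>j. a j x) (\<lambda>j m. c) i l)"
proof -
  define B where "B = {x \<in> space M. alive (\<lambda>j. a j x) i l}"
  define \<rho> :: 'k where "\<rho> = (if running i l then of_real (g ^ (i div 2)) else 0)"
  have AB: "A \<inter> B \<in> sets (F i)" unfolding B_def using A alive_set by auto
  have "(LINT x|M. indicator A x *\<^sub>R (w x * dterm g (\<lambda>j. a j x) (\<lambda>j. R' j x) i l))
      = (LINT x|M. \<rho> * (indicator (A \<inter> B) x *\<^sub>R (w x * R' i x (move i l))))"
    by (intro Bochner_Integration.integral_cong refl)
      (simp add: dterm_as_indicator B_def[symmetric] \<rho>_def[symmetric] indicator_inter_arith mult_ac)
  also have "\<dots> = (LINT x|M. \<rho> * (indicator (A \<inter> B) x *\<^sub>R c))"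
    by (simp only: integral_mult_right_zero eq[OF AB])
  also have "\<dots> = (LINT x|M. indicator A x *\<^sub>R dterm g (\<lambda>j. a j x) (\<lambda>j m. c) i l)"
    by (intro Bochner_Integration.integral_cong refl)
      (simp add: dterm_as_indicator[of _ "\<lambda>_ _ _. c"] B_def[symmetric] \<rho>_def[symmetric] indicator_inter_arith mult_ac)
  finally show ?thesis .
qed

abbreviation coef :: "(nat \<Rightarrow> 'a \<Rightarrow> bool \<times> bool \<Rightarrow> 'k) \<Rightarrow> nat \<Rightarrow> 'a \<Rightarrow> bool list \<Rightarrow> 'k" where
  "coef R' i x l \<equiv> (if i < 2 * N then of_real ((- 1) ^ i) *
     dterm g (\<lambda>j. a j x) (\<lambda>j. R' j x) i (sel (pmask b N) l) else 0)"

lemma move_diff_expand: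
  "move_diff J g b N a R' i x = (\<Sum>l | length l = 2 * (5 * N). sc (coef R' i x l) (J (\<lambda>\<omega>. of_bool (bits (5 * N) \<omega> = l))))"
  unfolding move_diff_def by (rule is_X_expand[OF X, of "coef R' i x"])

lemma move_diff_meas:
  assumes "i \<le> n" "\<And>m. (\<lambda>x. R' i x m) \<in> borel_measurable (F n)"
  shows "move_diff J g b N a R' i \<in> borel_measurable (F n)"
proof -
  have "(\<lambda>x. sc (coef R' i x l) v) \<in> borel_measurable (F n)" for l v
    using dterm_meas[OF assms(1), of R'] assms(2)
    by (intro borel_measurable_continuous_on[OF linear_continuous_on[OF bounded_linear_scale[OF is_X_normed_space[OF X]]]])
      (auto intro!: borel_measurable_times)
  then show ?thesis unfolding move_diff_expand[abs_def] by (intro borel_measurable_sum)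
qed

lemma move_diff_bdd:
  assumes "\<And>x m. norm (R' i x m :: 'k) \<le> K'"
  shows "\<exists>B. \<forall>x. norm (move_diff J g b N a R' i x) \<le> B"
proof -
  define v where "v l = J (\<lambda>\<omega>. of_bool (bits (5 * N) \<omega> = l))" for l
  have "K' \<ge> 0" using assms norm_ge_zero order_trans by blast
  have "norm (move_diff J g b N a R' i x) \<le> (\<Sum>l | length l = 2 * (5 * N). \<bar>g\<bar> ^ (i div 2) * K' * norm (v l))" for x
    unfolding move_diff_expand v_def[symmetric]
  proof (rule sum_norm_le)
    fix l
    have "norm (coef R' i x l) \<le> \<bar>g\<bar> ^ (i div 2) * K'"
      using dterm_bdd[of R' i x K'] assms \<open>K' \<ge> 0\<close> by (auto simp: norm_mult norm_power)
    then show "norm (sc (coef R' i x l) (v l)) \<le> \<bar>g\<bar> ^ (i div 2) * K' * norm (v l)"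
      using is_X_normed_space[OF X] unfolding normed_space_over_def by (simp only: mult_right_mono norm_ge_zero)
  qed
  then show ?thesis by blast
qed

text \<open>If the conditional expectations of \<open>w x * R i x m\<close> are constants
  \<open>c m\<close>, that of the weighted difference arises by replacing \<open>R i\<close> by c.
  The weight 1 with c = 0 gives the martingale property, powers of the new coordinate as weights
  give the Fourier coefficients.\<close>

lemma set_integral_move_diff:
  assumes A: "A \<in> sets (F i)" and R': "\<And>m. (\<lambda>x. R i x m) \<in> borel_measurable (F (Suc i))"
    and w: "w \<in> borel_measurable M" "integrable M w"
    and eq: "\<And>A m. i < 2 * N \<Longrightarrow> A \<in> sets (F i) \<Longrightarrow>
      (LINT x|M. indicator A x *\<^sub>R (w x * R i x m)) = (LINT x|M. indicator A x *\<^sub>R c m)"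
  shows "(LINT x:A|M. sc (w x) (move_diff J g b N a R i x)) = (LINT x:A|M. move_diff J g b N a (\<lambda>_ _. c) i x)"
proof -
  interpret sc: vector_space sc using is_X_normed_space[OF X] by (simp add: normed_space_over_def)
  have nso: "normed_space_over sc" by (rule is_X_normed_space[OF X])
  have sR: "r *\<^sub>R v = sc (of_real r) v" for r v using nso by (simp add: normed_space_over_def)
  define v where "v l = J (\<lambda>\<omega>. of_bool (bits (5 * N) \<omega> = l))" for l
  define u where "u l x = indicator A x *\<^sub>R (w x * coef R i x l)" for l x
  define u' where "u' l x = indicator A x *\<^sub>R coef (\<lambda>_ _. c) i x l" for l x
  have AM: "A \<in> sets M" using sets_F[OF A] .
  have Fm: "h \<in> borel_measurable M" if "h \<in> borel_measurable (F n)" for h :: "'a \<Rightarrow> 'k" and n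
    using measurable_from_subalg[OF sub that] .
  have m1: "(\<lambda>x. coef R i x l) \<in> borel_measurable M" for l
    using Fm[OF dterm_meas[of i "Suc i" R, OF _ R_meas]] by (auto intro!: borel_measurable_times)
  have m2: "(\<lambda>x. coef (\<lambda>_ _. c) i x l) \<in> borel_measurable M" for l
    using Fm[OF dterm_meas[of i "Suc i" "\<lambda>_ _. c"]] by (auto intro!: borel_measurable_times)
  have iu: "integrable M (u l)" for l
  proof -
    have bnd: "norm (u l x) \<le> norm (\<bar>g\<bar> ^ (i div 2) * K * norm (w x))" for x
    proof -
      have "K \<ge> 0" using R_bdd norm_ge_zero order_trans by blast
      moreover have "norm (coef R i x l) \<le> \<bar>g\<bar> ^ (i div 2) * K"
        using dterm_bdd[of R i x K] R_bdd calculation by (auto simp: norm_mult norm_power)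
      then have "norm (w x) * norm (coef R i x l) \<le> norm (w x) * (\<bar>g\<bar> ^ (i div 2) * K)"
        by (intro mult_left_mono) auto
      ultimately show ?thesis
        unfolding u_def by (auto simp: indicator_def norm_mult mult_ac simp del: mult_eq_0_iff split del: if_split split: if_splits)
    qed
    have mu: "u l \<in> borel_measurable M"
      unfolding u_def using w(1) m1[of l] AM
      by (intro borel_measurable_scaleR borel_measurable_indicator borel_measurable_times)
    have iw: "integrable M (\<lambda>x. \<bar>g\<bar> ^ (i div 2) * K * norm (w x))"
      using w(2) by (intro integrable_mult_right integrable_norm)
    show ?thesis
      by (rule Bochner_Integration.integrable_bound[OF iw mu]) (rule AE_I2, rule bnd)
  qed
  have iu': "integrable M (u' l)" for l
  proof -
    define C where "C = (\<Sum>m\<in>UNIV. norm (c m))"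
    have "norm (c m) \<le> C" for m unfolding C_def by (rule member_le_sum) auto
    moreover from this have "C \<ge> 0" using norm_ge_zero order_trans by blast
    ultimately have "norm (coef (\<lambda>_ _. c) i x l) \<le> \<bar>g\<bar> ^ (i div 2) * C" for x
      using dterm_bdd[of "\<lambda>_ _. c" i x C] by (auto simp: norm_mult norm_power)
    moreover have "0 \<le> \<bar>g\<bar> ^ (i div 2) * C" using \<open>C \<ge> 0\<close> by simp
    ultimately have "norm (u' l x) \<le> \<bar>g\<bar> ^ (i div 2) * C" for x
      unfolding u'_def by (auto simp: indicator_def simp del: mult_eq_0_iff split del: if_split split: if_splits)
    moreover have "u' l \<in> borel_measurable M"
      unfolding u'_def using m2[of l] AM by (intro borel_measurable_scaleR borel_measurable_indicator)
    ultimately show ?thesis using integrable_bdd by blast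
  qed
  have "(LINT x|M. u l x) = (LINT x|M. u' l x)" for l
  proof (cases "i < 2 * N")
    case True
    have "(LINT x|M. indicator A x *\<^sub>R (w x * dterm g (\<lambda>j. a j x) (\<lambda>j. R j x) i l'))
      = (LINT x|M. indicator A x *\<^sub>R dterm g (\<lambda>j. a j x) (\<lambda>j. c) i l')" for l'
    proof -
      have "(LINT x|M. indicator A x *\<^sub>R (w x * dterm g (\<lambda>j. a j x) (\<lambda>j. R j x) i l'))
        = (LINT x|M. indicator A x *\<^sub>R dterm g (\<lambda>j. a j x) (\<lambda>j m. c (move i l')) i l')"
        by (rule set_integral_dterm[where R' = R and w = w, OF A R_meas]) (rule eq[OF True])
      moreover have "dterm g (\<lambda>j. a j x) (\<lambda>j m. c (move i l')) i l' = dterm g (\<lambda>j. a j x) (\<lambda>j. c) i l'" for x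
        by (simp add: dterm_def)
      ultimately show ?thesis by simp
    qed
    from arg_cong[OF this[of "sel (pmask b N) l"], of "\<lambda>z. of_real ((- 1) ^ i) * z"]
    have "of_real ((- 1) ^ i) * (LINT x|M. indicator A x *\<^sub>R (w x * dterm g (\<lambda>j. a j x) (\<lambda>j. R j x) i (sel (pmask b N) l)))
        = of_real ((- 1) ^ i) * (LINT x|M. indicator A x *\<^sub>R dterm g (\<lambda>j. a j x) (\<lambda>j. c) i (sel (pmask b N) l))" .
    then show ?thesis unfolding u_def u'_def integral_mult_right_zero[symmetric] using True
      by (simp only: if_True mult_scaleR_right mult.left_commute)
  next
    case False
    then show ?thesis by (simp add: u_def u'_def)
  qed
  then have "(\<Sum>l | length l = 2 * (5 * N). sc (LINT x|M. u l x) (v l))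
      = (\<Sum>l | length l = 2 * (5 * N). sc (LINT x|M. u' l x) (v l))" by simp
  moreover have "(LINT x:A|M. sc (w x) (move_diff J g b N a R i x))
      = (\<Sum>l | length l = 2 * (5 * N). sc (LINT x|M. u l x) (v l))"
  proof -
    have "(LINT x:A|M. sc (w x) (move_diff J g b N a R i x))
       = (LINT x|M. (\<Sum>l | length l = 2 * (5 * N). sc (u l x) (v l)))"
      unfolding set_lebesgue_integral_def move_diff_expand v_def[symmetric] u_def
      by (intro Bochner_Integration.integral_cong refl)
        (simp add: sR sc.scale_sum_right scaleR_conv_of_real del: of_real_mult)
    also have "\<dots> = (\<Sum>l | length l = 2 * (5 * N). sc (LINT x|M. u l x) (v l))"
      using integrable_scale[OF nso iu] by (subst Bochner_Integration.integral_sum) auto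
    finally show ?thesis .
  qed
  moreover have "(LINT x:A|M. move_diff J g b N a (\<lambda>_ _. c) i x)
      = (\<Sum>l | length l = 2 * (5 * N). sc (LINT x|M. u' l x) (v l))"
  proof -
    have "(LINT x:A|M. move_diff J g b N a (\<lambda>_ _. c) i x)
       = (LINT x|M. (\<Sum>l | length l = 2 * (5 * N). sc (u' l x) (v l)))"
      unfolding set_lebesgue_integral_def move_diff_expand v_def[symmetric] u'_def
      by (intro Bochner_Integration.integral_cong refl)
        (simp add: sR sc.scale_sum_right scaleR_conv_of_real del: of_real_mult)
    also have "\<dots> = (\<Sum>l | length l = 2 * (5 * N). sc (LINT x|M. u' l x) (v l))"
      using integrable_scale[OF nso iu'] by (subst Bochner_Integration.integral_sum) auto
    finally show ?thesis .
  qed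
  ultimately show ?thesis by simp
qed

lemma move_martingale_meas: "move_martingale J g b N a R n \<in> borel_measurable (F n)"
  unfolding move_martingale_def[abs_def]
  by (intro borel_measurable_sum move_diff_meas R_meas_less) auto

lemma move_martingale_bdd:
  obtains B where "\<And>n x. norm (move_martingale J g b N a R n x) \<le> B"
proof -
  obtain B where B: "\<And>i x. norm (move_diff J g b N a R i x) \<le> B i"
    using move_diff_bdd[of R _ K] R_bdd by metis
  have B0: "B i \<ge> 0" for i using B[of i] norm_ge_zero order_trans by blast
  have "norm (move_martingale J g b N a R n x) \<le> (\<Sum>i<2 * N. B i)" for n x
  proof -
    have "move_martingale J g b N a R n x = (\<Sum>i\<in>{..<n} \<inter> {..<2 * N}. move_diff J g b N a R i x)"
      unfolding move_martingale_def 
      by (intro sum.mono_neutral_right) (auto, meson move_diff_eq_0[OF X] not_less)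
    also have "norm \<dots> \<le> (\<Sum>i\<in>{..<n} \<inter> {..<2 * N}. B i)" by (intro sum_norm_le B)
    also have "\<dots> \<le> (\<Sum>i<2 * N. B i)" by (intro sum_mono2) (auto simp: B0)
    finally show ?thesis .
  qed
  then show ?thesis using that by blast
qed

lemma move_martingale_in_L: "s > 0 \<Longrightarrow> in_L M s (move_martingale J g b N a R n)"
proof -
  assume s: "s > 0"
  obtain B where "\<And>n x. norm (move_martingale J g b N a R n x) \<le> B" using move_martingale_bdd by blast
  then show ?thesis using L_norm_bounds(1)[OF measurable_from_subalg[OF sub move_martingale_meas] _ s] by blast
qed

lemma move_martingale_L_norm_bdd:
  "s > 0 \<Longrightarrow> bdd_above (range (\<lambda>n. L_norm M s (move_martingale J g b N a R n)))"
proof -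
  assume s: "s > 0"
  obtain B where "\<And>n x. norm (move_martingale J g b N a R n x) \<le> B" using move_martingale_bdd by blast
  then show ?thesis
    using L_norm_bounds(2)[OF measurable_from_subalg[OF sub move_martingale_meas] _ s] by (intro bdd_aboveI2) blast
qed

lemma banach_martingale_move:
  assumes zero: "\<And>i A m. i < 2 * N \<Longrightarrow> A \<in> sets (F i) \<Longrightarrow> (LINT x|M. indicator A x *\<^sub>R R i x m) = 0"
  shows "banach_martingale M F (move_martingale J g b N a R)"
proof -
  let ?f = "move_martingale J g b N a R"
  obtain B where B: "\<And>n x. norm (?f n x) \<le> B" using move_martingale_bdd by blast
  have meas: "?f n \<in> borel_measurable M" for n
    using measurable_from_subalg[OF sub move_martingale_meas] .
  have int: "integrable M (?f n)" for n using integrable_bdd[OF meas B] .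
  have dmeas: "move_diff J g b N a R i \<in> borel_measurable M" for i
    using measurable_from_subalg[OF sub move_diff_meas[of i "Suc i" R, OF _ R_meas]] by simp
  have zero': "(LINT x:A|M. move_diff J g b N a R i x) = 0" if A: "A \<in> sets (F i)" for A i
  proof -
    interpret sc: vector_space sc using is_X_normed_space[OF X] by (simp add: normed_space_over_def)
    have "(LINT x:A|M. sc 1 (move_diff J g b N a R i x)) = (LINT x:A|M. move_diff J g b N a (\<lambda>_ _ _. 0) i x)"
      using zero by (intro set_integral_move_diff[OF A R_meas]) auto
    moreover have "move_diff J g b N a (\<lambda>_ _ _. 0) i x = 0" for x
      using is_X_zero[OF X] by (simp add: move_diff_def dterm_def cong: if_cong)
    ultimately show ?thesis by simp
  qed
  have "(LINT x:A|M. ?f (m + k) x) = (LINT x:A|M. ?f m x)" if A: "A \<in> sets (F m)" for A m k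
  proof (induction k)
    case (Suc k)
    have A': "A \<in> sets (F (m + k))" using A F_mono[of m "m + k"] by (auto simp: subalgebra_def)
    obtain B' where "\<And>x. norm (move_diff J g b N a R (m + k) x) \<le> B'"
      using move_diff_bdd[of R "m + k" K] R_bdd by metis
    then have intd: "integrable M (move_diff J g b N a R (m + k))" using integrable_bdd[OF dmeas] by blast
    have "(LINT x:A|M. ?f (m + Suc k) x) = (LINT x:A|M. ?f (m + k) x + move_diff J g b N a R (m + k) x)"
      by (simp add: move_martingale_def)
    also have "\<dots> = (LINT x:A|M. ?f (m + k) x) + (LINT x:A|M. move_diff J g b N a R (m + k) x)"
      using int intd sets_F[OF A] by (intro set_integral_add) (auto simp: set_integrable_def intro!: integrable_mult_indicator)
    finally show ?case using Suc zero'[OF A'] by simp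
  qed simp
  then have "\<forall>m n. m \<le> n \<longrightarrow> (\<forall>A\<in>sets (F m). (LINT x:A|M. ?f n x) = (LINT x:A|M. ?f m x))"
    by (metis le_add_diff_inverse)
  then show ?thesis
    unfolding banach_martingale_def using sub filt move_martingale_meas int by blast
qed

text \<open>The gap holds at every sample point, so it survives integration with any exponent s, and
  the added 1 makes it strict.\<close>

lemma not_unconditional_bound:
  assumes gap: "\<And>x. mixed_norm (pexps (if b then p else q) (if b then q else p) N)
         (dsum g (\<lambda>j. a j x) (\<lambda>j. R j x) (\<lambda>i. if even i then 1 else - 1) N) \<le> A0"
      "\<And>x. C * A0 + 1 \<le> mixed_norm (pexps (if b then p else q) (if b then q else p) N)
         (dsum g (\<lambda>j. a j x) (\<lambda>j. R j x) (\<lambda>i. 1) N)"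
    and C: "C \<ge> 0" and s: "s > 0"
  shows "\<not> unconditional_bound M s C (mdiff (move_martingale J g b N a R))"
proof
  let ?f = "move_martingale J g b N a R"
  assume ub: "unconditional_bound M s C (mdiff ?f)"
  have pq0: "0 < p" "0 < q" using pq by auto
  \<comment> \<open>Difference k is \<open>move_diff\<close> of index k - 1, and this is its sign;
    at k = 0, where the difference vanishes, truncated subtraction gives the sign 1.\<close>
  define \<epsilon> :: "nat \<Rightarrow> real" where "\<epsilon> k = (- 1) ^ (k - 1)" for k
  have sum: "(\<Sum>k=0..2 * N. e k *\<^sub>R mdiff ?f k x) = (\<Sum>i<2 * N. e (Suc i) *\<^sub>R move_diff J g b N a R i x)" for e x
  proof -
    have "(\<Sum>k=0..2 * N. e k *\<^sub>R mdiff ?f k x) = (\<Sum>k<Suc (2 * N). e k *\<^sub>R mdiff ?f k x)"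
      by (simp add: atLeast0AtMost lessThan_Suc_atMost)
    then show ?thesis unfolding sum.lessThan_Suc_shift by (simp add: mdiff_move_martingale)
  qed
  have "\<forall>k. \<epsilon> k \<in> {-1, 1}"
  proof
    show "\<epsilon> k \<in> {-1, 1}" for k by (cases "even (k - 1)") (auto simp: \<epsilon>_def)
  qed
  then have le: "L_norm M s (\<lambda>x. \<Sum>k=0..2 * N. \<epsilon> k *\<^sub>R mdiff ?f k x) \<le> C * L_norm M s (\<lambda>x. \<Sum>k=0..2 * N. mdiff ?f k x)"
    using ub unfolding unconditional_bound_def by blast
  have n1: "norm (\<Sum>k=0..2 * N. mdiff ?f k x) \<le> A0" for x
  proof -
    have "(\<Sum>k=0..2 * N. mdiff ?f k x) = (\<Sum>i<2 * N. 1 *\<^sub>R move_diff J g b N a R i x)"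
      using sum[of "\<lambda>_. 1" x] by simp
    also have "norm \<dots> = mixed_norm (pexps (if b then p else q) (if b then q else p) N)
         (dsum g (\<lambda>j. a j x) (\<lambda>j. R j x) (\<lambda>i. 1 * (- 1) ^ i) N)"
      by (rule norm_sum_move_diff[OF X pq0])
    also have "(\<lambda>i. 1 * (- 1) ^ i) = (\<lambda>i::nat. if even i then 1 else - 1 :: real)" by auto
    finally show ?thesis using gap(1)[of x] by simp
  qed
  have n2: "C * A0 + 1 \<le> norm (\<Sum>k=0..2 * N. \<epsilon> k *\<^sub>R mdiff ?f k x)" for x
  proof -
    have "norm (\<Sum>k=0..2 * N. \<epsilon> k *\<^sub>R mdiff ?f k x) = mixed_norm (pexps (if b then p else q) (if b then q else p) N)
         (dsum g (\<lambda>j. a j x) (\<lambda>j. R j x) (\<lambda>i. \<epsilon> (Suc i) * (- 1) ^ i) N)"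
      unfolding sum by (rule norm_sum_move_diff[OF X pq0])
    also have "(\<lambda>i. \<epsilon> (Suc i) * (- 1) ^ i) = (\<lambda>i. 1)" by (auto simp: \<epsilon>_def simp flip: power_mult_distrib)
    finally show ?thesis using gap(2)[of x] by simp
  qed
  have dmeas: "move_diff J g b N a R i \<in> borel_measurable M" for i
    using measurable_from_subalg[OF sub move_diff_meas[of i "Suc i" R, OF _ R_meas]] by simp
  have meas: "(\<lambda>x. \<Sum>k=0..2 * N. e k *\<^sub>R mdiff ?f k x) \<in> borel_measurable M" for e :: "nat \<Rightarrow> real"
    unfolding sum using dmeas by (intro borel_measurable_sum borel_measurable_scaleR) auto
  obtain B where B: "\<And>i x. norm (move_diff J g b N a R i x) \<le> B i"
    using move_diff_bdd[of R _ K] R_bdd by metis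
  have bd: "norm (\<Sum>k=0..2 * N. \<epsilon> k *\<^sub>R mdiff ?f k x) \<le> (\<Sum>i<2 * N. B i)" for x
    unfolding sum using B by (intro sum_norm_le) (simp add: \<epsilon>_def)
  have A0: "A0 \<ge> 0" using n1[of undefined] norm_ge_zero order_trans by blast
  then have "C * A0 + 1 \<le> L_norm M s (\<lambda>x. \<Sum>k=0..2 * N. \<epsilon> k *\<^sub>R mdiff ?f k x)"
    using C by (intro L_norm_bounds(3)[OF meas[of \<epsilon>] bd s n2]) simp
  also note le
  also have "C * L_norm M s (\<lambda>x. \<Sum>k=0..2 * N. mdiff ?f k x) \<le> C * A0"
    using L_norm_bounds(2)[OF _ n1 s] meas[of "\<lambda>_. 1"] C by (intro mult_left_mono) auto
  finally show False by simp
qed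

end


section \<open>X(p,q) is not UMD\<close>

text \<open>Overwriting letter i is a bijection that keeps the prefix, so the four letters are
  equally frequent; three values -1/3 balance one value 1.\<close>

lemma sum_words_zero:
  fixes m :: "bool \<times> bool"
  assumes "i < n"
  shows "(\<Sum>w | length w = n. of_bool (take i w \<in> B) * (if w ! i = m then 1 else - 1/3)) = (0::real)"
proof -
  define T where "T m = card {w :: (bool \<times> bool) list. length w = n \<and> take i w \<in> B \<and> w ! i = m}" for m
  have fin: "finite {w :: (bool \<times> bool) list. length w = n}"
    using finite_lists_length_eq[of "UNIV :: (bool \<times> bool) set" n] by simp
  have T: "T m' = T m" for m'
    unfolding T_def
  proof (rule bij_betw_same_card)
    show "bij_betw (\<lambda>w. w[i := m]) {w. length w = n \<and> take i w \<in> B \<and> w ! i = m'}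
        {w. length w = n \<and> take i w \<in> B \<and> w ! i = m}"
      by (rule bij_betw_byWitness[where f' = "\<lambda>w. w[i := m']"]) (use assms in auto)
  qed
  have s: "(\<Sum>w | length w = n. of_bool (take i w \<in> B) * of_bool (w ! i = m')) = real (T m)" for m'
  proof -
    have "(\<Sum>w | length w = n. of_bool (take i w \<in> B) * of_bool (w ! i = m'))
        = (\<Sum>w | length w = n. of_bool (take i w \<in> B \<and> w ! i = m') :: real)"
      by (intro sum.cong) auto
    also have "\<dots> = real (T m')" unfolding T_def
      by (subst sum_of_bool_eq) (use fin in \<open>auto intro!: arg_cong[of _ _ card]\<close>)
    finally show ?thesis using T by simp
  qed
  have "of_bool (take i w \<in> B) * (if w ! i = m then 1 else - 1/3)
      = of_bool (take i w \<in> B) * of_bool (w ! i = m) - (1/3 :: real) *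
        (\<Sum>m'\<in>UNIV - {m}. of_bool (take i w \<in> B) * of_bool (w ! i = m'))" for w
  proof -
    have "(\<Sum>m'\<in>UNIV - {m}. of_bool (w ! i = m')) = (of_bool (w ! i \<noteq> m) :: real)"
      by (auto simp: of_bool_def)
    then show ?thesis by (auto simp flip: sum_distrib_left)
  qed
  then have "(\<Sum>w | length w = n. of_bool (take i w \<in> B) * (if w ! i = m then 1 else - 1/3))
      = (\<Sum>w | length w = n. of_bool (take i w \<in> B) * of_bool (w ! i = m) - (1/3 :: real) *
          (\<Sum>m'\<in>UNIV - {m}. of_bool (take i w \<in> B) * of_bool (w ! i = m')))"
    by presburger
  also have "\<dots> = (\<Sum>w | length w = n. of_bool (take i w \<in> B) * of_bool (w ! i = m)) - 1/3 *
      (\<Sum>w | length w = n. \<Sum>m'\<in>UNIV - {m}. of_bool (take i w \<in> B) * of_bool (w ! i = m'))"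
    by (simp only: sum_subtractf sum_distrib_left)
  also have "(\<Sum>w | length w = n. \<Sum>m'\<in>UNIV - {m}. of_bool (take i w \<in> B) * of_bool (w ! i = m'))
      = (\<Sum>m'\<in>UNIV - {m}. \<Sum>w | length w = n. (of_bool (take i w \<in> B) * of_bool (w ! i = m') :: real))"
    by (rule sum.swap)
  also have "\<dots> = real (card (UNIV - {m})) * real (T m)" by (simp only: s) simp
  also have "card (UNIV - {m}) = 3" 
  proof -
    have "card (UNIV :: (bool \<times> bool) set) = card (UNIV :: bool set) * card (UNIV :: bool set)"
      using card_cartesian_product[of "UNIV :: bool set" "UNIV :: bool set"] by simp
    then show ?thesis by (simp add: card_Diff_singleton)
  qed
  finally show ?thesis by (simp add: s)
qed

text \<open>The sample is a uniformly distributed word of moves, read letter by letter; refuting the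
  exponent 2 suffices.\<close>

lemma not_UMD_X:
  fixes J :: "((nat \<Rightarrow> bool) \<Rightarrow> real) \<Rightarrow> 'x::{banach,second_countable_topology}"
  assumes X: "is_X p q scaleR J" and pq: "1 < p" "1 < q" "p \<noteq> q"
  shows "\<not> UMD TYPE('x)"
proof
  assume "UMD TYPE('x)"
  then obtain C where C: "\<And>(M :: real measure) F (f :: nat \<Rightarrow> real \<Rightarrow> 'x).
        prob_space M \<Longrightarrow> banach_martingale M F f \<Longrightarrow> (\<And>n. in_L M 2 (f n)) \<Longrightarrow>
        unconditional_bound M 2 C (mdiff f)"
    unfolding UMD_def by (metis one_less_numeral_iff semiring_norm(76))
  define b where "b = (p < q)"
  define r1 r2 where "r1 = (if b then p else q)" "r2 = (if b then q else p)"
  have r: "1 < r1" "r1 < r2" using pq by (auto simp: r1_r2_def b_def)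
  \<comment> \<open>The real factor is exactly 1 on the prescribed move and -1/3 elsewhere, so the
    error is 0 and the bound is 1. C itself may be negative, hence the maximum.\<close>
  have "0 \<le> max C 0" "2 * 0 * (1 + max C 0) \<le> (1::real)" "0 \<le> (0::real)" "0 \<le> (1::real)" by auto
  from transform_gap[OF r this, where 'k = real] obtain g A0 N where g: "1 < g" and
    gap: "\<forall>\<alpha> (Q :: nat \<Rightarrow> bool \<times> bool \<Rightarrow> real).
       (\<forall>i. norm (Q i (\<alpha> i) - 1) \<le> 0) \<and> (\<forall>i j. norm (Q i j) \<le> 1) \<longrightarrow>
       mixed_norm (pexps r1 r2 N) (dsum g \<alpha> Q (\<lambda>i. if even i then 1 else - 1) N) \<le> A0 \<and>
       max C 0 * A0 + 1 \<le> mixed_norm (pexps r1 r2 N) (dsum g \<alpha> Q (\<lambda>i. 1) N)"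
    by (elim exE conjE)
  define n where "n = 2 * N"
  define S where "S = {w :: (bool \<times> bool) list. length w = n}"
  have S: "finite S" "S \<noteq> {}"
    using finite_lists_length_eq[of "UNIV :: (bool \<times> bool) set" n] Ex_list_of_length[of n] by (auto simp: S_def)
  \<comment> \<open>Words are placed in the real line as natural numbers, since UMD is stated for
    measures on the reals.\<close>
  define enc where "enc w = real (to_nat (w :: (bool \<times> bool) list))" for w
  define dec where "dec x = (from_nat (nat \<lfloor>x\<rfloor>) :: (bool \<times> bool) list)" for x :: real
  have dec: "dec (enc w) = w" for w by (simp add: dec_def enc_def)
  define M where "M = measure_pmf (map_pmf enc (pmf_of_set S))"
  define F where "F k = vimage_algebra UNIV (\<lambda>x. take k (dec x)) (count_space UNIV)" for k
  have F_sets: "sets (F k) = {(\<lambda>x. take k (dec x)) -` B | B. True}" for k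
    unfolding F_def by (subst sets_vimage_algebra2) auto
  have space_F: "space (F k) = UNIV" for k by (simp add: F_def)
  have measF: "(\<lambda>x. h (take k (dec x))) \<in> measurable (F k) N'"
    if "\<And>z. h z \<in> space N'" for h k and N' :: "'z measure"
    unfolding F_def
    by (rule measurable_compose[OF measurable_vimage_algebra1[of _ _ "count_space UNIV"]]) (auto simp: that)
  define a where "a j x = dec x ! j" for j x
  define R where "R j x m = (if a j x = m then 1 else - 1/3 :: real)" for j x m
  have nth: "a j x = take (Suc j) (dec x) ! j" for j x by (simp add: a_def)
  interpret prob_space M unfolding M_def by (rule prob_space_measure_pmf)
  interpret branching M p q scaleR J F g 1 b N a R
  proof (intro branching.intro branching_axioms.intro prob_space_axioms)
    show "subalgebra M (F k)" for k by (simp add: subalgebra_def M_def space_F)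
    show "filtration (space M) F"
    proof
      show "sets (F i) \<le> sets (F j)" if "i \<le> j" for i j
      proof
        fix A assume "A \<in> sets (F i)"
        then obtain B where "A = (\<lambda>x. take i (dec x)) -` B" by (auto simp: F_sets)
        then have "A = (\<lambda>x. take j (dec x)) -` (take i -` B)" using that by (auto simp: min_def)
        then show "A \<in> sets (F j)" unfolding F_sets by blast
      qed
    qed (simp add: space_F M_def)
    show "a j \<in> F (Suc j) \<rightarrow>\<^sub>M count_space UNIV" for j
      using measF[of "\<lambda>w. w ! j" "count_space UNIV" "Suc j"] by (simp add: nth[abs_def])
    show "(\<lambda>x. R j x m) \<in> borel_measurable (F (Suc j))" for j m
      using measF[of "\<lambda>w. if w ! j = m then 1 else - 1/3" borel "Suc j"] unfolding R_def nth[abs_def] by simp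
  qed (use X pq in \<open>auto simp: R_def\<close>)
  have zero: "(LINT x|M. indicator A x *\<^sub>R R i x m) = 0" if iA: "i < 2 * N" "A \<in> sets (F i)" for i A m
  proof -
    obtain B where B: "A = (\<lambda>x. take i (dec x)) -` B" using iA(2) unfolding F_sets by blast
    have "(LINT x|M. indicator A x *\<^sub>R R i x m)
        = (\<Sum>w\<in>S. indicator A (enc w) *\<^sub>R R i (enc w) m) / card S"
      unfolding M_def using S by (simp add: integral_pmf_of_set)
    also have "(\<Sum>w\<in>S. indicator A (enc w) *\<^sub>R R i (enc w) m)
        = (\<Sum>w | length w = n. of_bool (take i w \<in> B) * (if w ! i = m then 1 else - 1/3))"
      unfolding S_def by (intro sum.cong refl) (simp add: B R_def a_def dec indicator_def)
    also have "\<dots> = 0" using iA by (intro sum_words_zero) (simp add: n_def)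
    finally show ?thesis by simp
  qed
  have "\<not> unconditional_bound M 2 (max C 0) (mdiff (move_martingale J g b N a R))"
  proof (rule not_unconditional_bound[where ?A0.0 = A0])
    have "norm (R j x (a j x) - 1) \<le> 0" "norm (R j x m) \<le> 1" for j x m by (auto simp: R_def)
    then have "mixed_norm (pexps r1 r2 N) (dsum g (\<lambda>j. a j x) (\<lambda>j. R j x) (\<lambda>i. if even i then 1 else - 1) N) \<le> A0 \<and>
       max C 0 * A0 + 1 \<le> mixed_norm (pexps r1 r2 N) (dsum g (\<lambda>j. a j x) (\<lambda>j. R j x) (\<lambda>i. 1) N)" for x
      using gap[rule_format, of "\<lambda>j. R j x" "\<lambda>j. a j x"] by blast
    then show "mixed_norm (pexps (if b then p else q) (if b then q else p) N) (dsum g (\<lambda>j. a j x) (\<lambda>j. R j x) (\<lambda>i. if even i then 1 else - 1) N) \<le> A0"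
       "max C 0 * A0 + 1 \<le> mixed_norm (pexps (if b then p else q) (if b then q else p) N) (dsum g (\<lambda>j. a j x) (\<lambda>j. R j x) (\<lambda>i. 1) N)" for x
      unfolding r1_r2_def by blast+
  qed auto
  moreover have "unconditional_bound M 2 C (mdiff (move_martingale J g b N a R))"
    by (rule C[OF _ banach_martingale_move[OF zero] move_martingale_in_L]) (auto intro: prob_space_axioms)
  then have "unconditional_bound M 2 (max C 0) (mdiff (move_martingale J g b N a R))"
    unfolding unconditional_bound_def L_norm_def
    by (meson max.cobounded1 mult_right_mono order_trans powr_ge_zero)
  ultimately show False by simp
qed


section \<open>The complex space X(p,q) is not AUMD\<close>

lemma circle_integral:
  fixes f :: "complex \<Rightarrow> complex"
  assumes [measurable]: "f \<in> borel_measurable borel"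
  shows "(LINT z|circle_haar. f z) = (LINT t|lborel. indicator {0..<1} t *\<^sub>R f (cis (2 * pi * t)))"
proof -
  have u: "uniform_measure lborel {0..<1::real} = density lborel (\<lambda>t. ennreal (indicator {0..<1} t))"
    by (simp add: uniform_measure_def ennreal_indicator divide_ennreal_def)
  have [measurable]: "(\<lambda>t. cis (2 * pi * t)) \<in> borel_measurable borel"
    by (intro borel_measurable_continuous_onI continuous_intros)
  show ?thesis
    unfolding circle_haar_def u by (subst integral_distr) (auto simp: integral_density)
qed

lemma prob_space_circle: "prob_space circle_haar"
proof -
  interpret U: prob_space "uniform_measure lborel {0..<1::real}"
    by (rule prob_space_uniform_measure) auto
  have "(\<lambda>t. cis (2 * pi * t)) \<in> borel_measurable borel"
    by (intro borel_measurable_continuous_onI continuous_intros)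
  then show ?thesis unfolding circle_haar_def by (intro U.prob_space_distr) simp
qed

lemma sets_circle [simp, measurable_cong]: "sets circle_haar = sets borel"
  by (simp add: circle_haar_def)

lemma borel_measurable_power_int_complex [measurable]: "(\<lambda>z::complex. z powi k) \<in> borel_measurable borel"
  unfolding power_int_def by measurable

lemma circle_integral_powi: "(LINT z|circle_haar. z powi k) = of_bool (k = 0)"
proof -
  have "(LINT z|circle_haar. z powi k) = (LINT t|lborel. indicator {0..<1} t *\<^sub>R (cis (2 * pi * t) powi k))"
    by (rule circle_integral) measurable
  also have "\<dots> = (LINT t|lborel. indicator {0..1} t *\<^sub>R (exp (of_real t * (2 * of_real pi * \<i> * of_int k)) :: complex))"
  proof (rule integral_cong_AE)
    \<comment> \<open>The half-open interval is closed at the cost of a null set, to apply the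
      fundamental theorem of calculus.\<close>
    have "AE t in lborel. t \<noteq> (1::real)" by (rule AE_lborel_singleton)
    then show "AE t in lborel. indicator {0..<1} t *\<^sub>R (cis (2 * pi * t) powi k)
       = indicator {0..1} t *\<^sub>R (exp (of_real t * (2 * of_real pi * \<i> * of_int k)) :: complex)"
      unfolding cis_power_int by eventually_elim (auto simp: indicator_def cis_conv_exp mult_ac)
    show "(\<lambda>t. indicator {0..<1} t *\<^sub>R (cis (2 * pi * t) powi k)) \<in> borel_measurable lborel"
      unfolding cis_power_int
      by (intro borel_measurable_scaleR borel_measurable_indicator)
        (auto intro!: borel_measurable_continuous_onI continuous_intros)
    show "(\<lambda>t. indicator {0..1} t *\<^sub>R (exp (of_real t * (2 * of_real pi * \<i> * of_int k)) :: complex)) \<in> borel_measurable lborel"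
      by (intro borel_measurable_scaleR borel_measurable_indicator)
        (auto intro!: borel_measurable_continuous_onI continuous_intros)
  qed
  also have "\<dots> = of_bool (k = 0)"
  proof (cases "k = 0")
    case True
    then show ?thesis by simp
  next
    case False
    define c :: complex where "c = 2 * of_real pi * \<i> * of_int k"
    have c: "c \<noteq> 0" using False by (simp add: c_def)
    have "(LINT t|lborel. indicator {0..1} t *\<^sub>R exp (of_real t * c)) = exp (of_real 1 * c) / c - exp (of_real 0 * c) / c"
    proof (rule integral_FTC_atLeastAtMost)
      fix t :: real
      have "((\<lambda>z. exp (z * c) / c) has_field_derivative exp (of_real t * c)) (at (of_real t))"
        using c by (auto intro!: derivative_eq_intros)
      then show "((\<lambda>t. exp (of_real t * c) / c) has_vector_derivative exp (of_real t * c)) (at t within {0..1})"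
        by (rule has_vector_derivative_real_field)
    qed (auto intro!: continuous_intros)
    moreover have "exp (of_real 1 * c) = 1"
      using exp_integer_2pi[of "of_int k"] by (simp add: c_def mult_ac)
    ultimately show ?thesis using False by (simp add: c_def)
  qed
  finally show ?thesis .
qed

section \<open>The infinite torus, its filtration and independence\<close>

lemma torus_prob: "prob_space (if n = (0::nat) then return borel (1::complex) else circle_haar)"
  by (auto intro: prob_space_return prob_space_circle)

lemma product_prob_space_torus: "product_prob_space (\<lambda>n. if n = (0::nat) then return borel (1::complex) else circle_haar)"
  by (intro product_prob_spaceI torus_prob)

lemma prob_space_torus: "prob_space torus"
proof -
  interpret product_prob_space "\<lambda>n. if n = (0::nat) then return borel (1::complex) else circle_haar" UNIV
    by (rule product_prob_space_torus)
  show ?thesis unfolding torus_def by (rule P.prob_space_axioms)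
qed

lemma space_torus [simp]: "space torus = UNIV"
  by (auto simp: torus_def space_PiM circle_haar_def)

lemma coord_measurable [measurable]: "(\<lambda>z. z n) \<in> borel_measurable torus"
proof -
  have "(\<lambda>z. z n) \<in> measurable torus (if n = 0 then return borel (1::complex) else circle_haar)"
    unfolding torus_def by (rule measurable_component_singleton) simp
  then show ?thesis by (cases "n = 0") (simp_all cong: measurable_cong_sets)
qed

lemma torus_filtration_sigma_sets:
  "sets (torus_filtration n) = sigma_sets UNIV (\<Union>i\<le>n. {(\<lambda>z. z i) -` B | B. B \<in> sets borel})"
  unfolding torus_filtration_def by (subst sets_measure_of) (auto intro!: arg_cong[of _ _ "sigma_sets UNIV"])

lemma torus_filtration_coord:
  "k \<le> n \<Longrightarrow> (\<lambda>z. z k) \<in> borel_measurable (torus_filtration n)"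
proof (rule measurableI)
  fix B :: "complex set" assume "k \<le> n" "B \<in> sets borel"
  then show "(\<lambda>z. z k) -` B \<inter> space (torus_filtration n) \<in> sets (torus_filtration n)"
    unfolding torus_filtration_sigma_sets
    by (auto simp: torus_filtration_def space_measure_of_conv intro!: sigma_sets.Basic)
qed simp

lemma subalgebra_torus: "subalgebra torus (torus_filtration n)"
proof -
  have "sets (torus_filtration n) \<subseteq> sets torus"
    unfolding torus_filtration_sigma_sets
  proof (rule sets.sigma_sets_subset[of _ torus, unfolded space_torus], safe)
    fix i and B :: "complex set" assume "B \<in> sets borel"
    from measurable_sets[OF coord_measurable this] show "(\<lambda>z. z i) -` B \<in> sets torus" by simp
  qed
  then show ?thesis by (simp add: subalgebra_def torus_filtration_def space_measure_of_conv)
qed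

lemma filtration_torus: "filtration (space torus) torus_filtration"
proof
  show "sets (torus_filtration i) \<le> sets (torus_filtration j)" if "i \<le> j" for i j
    unfolding torus_filtration_sigma_sets using that by (intro sigma_sets_mono' UN_mono) auto
qed (simp add: torus_filtration_def space_measure_of_conv)

text \<open>The coordinate \<open>z (Suc n)\<close> is independent of those up to n: under the
  product measure the coordinates are independent, and independence passes to the sigma-algebras
  generated by the blocks {..n} and {Suc n}.\<close>

lemma torus_independence:
  fixes \<psi> :: "complex \<Rightarrow> complex"
  assumes A: "A \<in> sets (torus_filtration n)" and \<psi> [measurable]: "\<psi> \<in> borel_measurable borel"
    and int: "integrable circle_haar \<psi>"
  shows "(LINT z|torus. indicator A z *\<^sub>R \<psi> (z (Suc n))) = of_real (measure torus A) * (LINT c|circle_haar. \<psi> c)"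
    "integrable torus (\<lambda>z. \<psi> (z (Suc n)))"
proof -
  interpret prob_space torus by (rule prob_space_torus)
  have dist: "distr torus borel (\<lambda>z. z (Suc n)) = circle_haar"
  proof -
    have "distr torus (if Suc n = 0 then return borel (1::complex) else circle_haar) (\<lambda>z. z (Suc n))
        = (if Suc n = 0 then return borel (1::complex) else circle_haar)"
      unfolding torus_def by (rule distr_PiM_component) (rule torus_prob, simp)
    then show ?thesis by (simp cong: distr_cong)
  qed
  have "integrable (distr torus borel (\<lambda>z. z (Suc n))) \<psi>" using int by (simp add: dist)
  then show i\<psi>: "integrable torus (\<lambda>z. \<psi> (z (Suc n)))" by (subst (asm) integrable_distr_eq) auto
  have E\<psi>: "(LINT z|torus. \<psi> (z (Suc n))) = (LINT c|circle_haar. \<psi> c)"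
    unfolding dist[symmetric] by (subst integral_distr) auto
  have "indep_vars (\<lambda>_. borel) (\<lambda>i z. z i) (UNIV :: nat set)"
  proof (subst indep_vars_iff_distr_eq_PiM')
    have "distr torus (PiM UNIV (\<lambda>_. borel)) (\<lambda>z. \<lambda>i\<in>UNIV. z i) = distr torus torus (\<lambda>z. z)"
    proof -
      have "sets torus = sets (PiM UNIV (\<lambda>_. borel))"
        unfolding torus_def by (rule sets_PiM_cong[OF refl]) simp
      then show ?thesis by (intro distr_cong) auto
    qed
    also have "\<dots> = torus" by simp
    also have "\<dots> = PiM UNIV (\<lambda>i. distr torus borel (\<lambda>z. z i))"
      unfolding torus_def
    proof (rule PiM_cong[OF refl])
      fix i :: nat
      have "distr torus (if i = 0 then return borel (1::complex) else circle_haar) (\<lambda>z. z i)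
          = (if i = 0 then return borel (1::complex) else circle_haar)"
        unfolding torus_def by (rule distr_PiM_component) (rule torus_prob, simp)
      then show "(if i = 0 then return borel (1::complex) else circle_haar)
          = distr (PiM UNIV (\<lambda>n. if n = 0 then return borel 1 else circle_haar)) borel (\<lambda>z. z i)"
        unfolding torus_def[symmetric] by (cases "i = 0") (simp_all cong: distr_cong)
    qed
    finally show "distr torus (PiM UNIV (\<lambda>_. borel)) (\<lambda>z. \<lambda>i\<in>UNIV. z i) = PiM UNIV (\<lambda>i. distr torus borel (\<lambda>z. z i))" .
  qed auto
  then have ind: "indep_sets (\<lambda>i. {(\<lambda>z. z i) -` B \<inter> space torus | B. B \<in> sets borel}) (UNIV :: nat set)"
    unfolding indep_vars_def2 by simp
  define I where "I = case_bool {..n} {Suc n}"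
  have "indep_sets (\<lambda>j. sigma_sets (space torus) (\<Union>i\<in>I j. {(\<lambda>z. z i) -` B \<inter> space torus | B. B \<in> sets borel})) UNIV"
  proof (rule indep_sets_collect_sigma)
    show "indep_sets (\<lambda>i. {(\<lambda>z. z i) -` B \<inter> space torus | B. B \<in> sets borel}) (\<Union>j\<in>UNIV. I j)"
      by (rule indep_sets_mono_index[OF _ ind]) auto
    show "Int_stable {(\<lambda>z. z i) -` B \<inter> space torus | B. B \<in> sets borel}" for i :: nat
    proof (rule Int_stableI, safe)
      fix B B' :: "complex set" assume "B \<in> sets borel" "B' \<in> sets borel"
      then show "\<exists>B''. ((\<lambda>z. z i) -` B \<inter> space torus) \<inter> ((\<lambda>z. z i) -` B' \<inter> space torus)
          = (\<lambda>z. z i) -` B'' \<inter> space torus \<and> B'' \<in> sets borel"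
        by (intro exI[of _ "B \<inter> B'"]) auto
    qed
    show "disjoint_family_on I UNIV" by (auto simp: disjoint_family_on_def I_def split: bool.splits)
  qed
  then have ind2: "indep_sets (case_bool (sets (torus_filtration n)) (sigma_sets UNIV {(\<lambda>z. z (Suc n)) -` B | B. B \<in> sets borel})) UNIV"
    by (rule indep_sets_mono_sets) (auto simp: I_def torus_filtration_sigma_sets split: bool.splits)
  have AM: "A \<in> sets torus" using A subalgebra_torus[of n] by (auto simp: subalgebra_def)
  have "indep_var borel (indicator A :: _ \<Rightarrow> complex) borel (\<lambda>z. \<psi> (z (Suc n)))"
    unfolding indep_var_eq
  proof (intro conjI)
    show "indep_set (sigma_sets (space torus) {(indicator A :: _ \<Rightarrow> complex) -` B \<inter> space torus | B. B \<in> sets borel})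
       (sigma_sets (space torus) {(\<lambda>z. \<psi> (z (Suc n))) -` B \<inter> space torus | B. B \<in> sets borel})"
      unfolding indep_set_def
    proof (rule indep_sets_mono_sets[OF ind2])
      fix c :: bool
      have "sigma_sets UNIV {(indicator A :: _ \<Rightarrow> complex) -` B \<inter> space torus | B. B \<in> sets borel} \<subseteq> sets (torus_filtration n)"
      proof -
        have sp: "space (torus_filtration n) = UNIV" by (simp add: torus_filtration_def space_measure_of_conv)
        have m: "(indicator A :: _ \<Rightarrow> complex) \<in> borel_measurable (torus_filtration n)" using A by simp
        show ?thesis
        proof (rule sets.sigma_sets_subset[of _ "torus_filtration n", unfolded sp], safe)
          fix B :: "complex set" assume "B \<in> sets borel"
          from measurable_sets[OF m this]
          show "(indicator A :: _ \<Rightarrow> complex) -` B \<inter> space torus \<in> sets (torus_filtration n)" by (simp add: sp)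
        qed
      qed
      moreover have "sigma_sets UNIV {(\<lambda>z. \<psi> (z (Suc n))) -` B \<inter> space torus | B. B \<in> sets borel}
          \<subseteq> sigma_sets UNIV {(\<lambda>z. z (Suc n)) -` B | B. B \<in> sets borel}"
      proof (rule sigma_sets_mono', safe)
        fix B :: "complex set" assume "B \<in> sets borel"
        then have "\<psi> -` B \<in> sets borel" using measurable_sets[OF \<psi>, of B] by simp
        then show "\<exists>B'. (\<lambda>z. \<psi> (z (Suc n))) -` B \<inter> space torus = (\<lambda>z. z (Suc n)) -` B' \<and> B' \<in> sets borel"
          by (intro exI[of _ "\<psi> -` B"]) auto
      qed
      ultimately show "case_bool (sigma_sets (space torus) {(indicator A :: _ \<Rightarrow> complex) -` B \<inter> space torus | B. B \<in> sets borel})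
         (sigma_sets (space torus) {(\<lambda>z. \<psi> (z (Suc n))) -` B \<inter> space torus | B. B \<in> sets borel}) c
        \<subseteq> case_bool (sets (torus_filtration n)) (sigma_sets UNIV {(\<lambda>z. z (Suc n)) -` B | B. B \<in> sets borel}) c"
        by (cases c) auto
    qed
  qed (use AM in auto)
  moreover have "integrable torus (indicator A :: _ \<Rightarrow> complex)"
    by (rule integrable_const_bound[of _ 1]) (use AM in \<open>auto simp: indicator_def\<close>)
  ultimately have "(LINT z|torus. indicator A z * \<psi> (z (Suc n))) = (LINT z|torus. indicator A z) * (LINT z|torus. \<psi> (z (Suc n)))"
    by (rule indep_var_lebesgue_integral[OF _ _ i\<psi>])
  moreover have "(LINT z|torus. (indicator A z :: complex)) = of_real (measure torus A)"
  proof -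
    have "(LINT z|torus. (indicator A z :: complex)) = (LINT z|torus. indicator A z *\<^sub>R 1)"
      by (intro Bochner_Integration.integral_cong) (auto simp: indicator_def)
    then show ?thesis using AM by (simp add: scaleR_conv_of_real)
  qed
  moreover have "(LINT z|torus. indicator A z *\<^sub>R \<psi> (z (Suc n))) = (LINT z|torus. indicator A z * \<psi> (z (Suc n)))"
    by (intro Bochner_Integration.integral_cong) (auto simp: indicator_def)
  ultimately show "(LINT z|torus. indicator A z *\<^sub>R \<psi> (z (Suc n))) = of_real (measure torus A) * (LINT c|circle_haar. \<psi> c)"
    by (simp add: E\<psi>)
qed

text \<open>
  \<open>unimod\<close> only changes the coordinates on a null set and makes them unimodular everywhere. The
  quadrant of \<open>z\<close> is the move that is kept alive, and \<open>- cnj\<close> of the centre of its arc turns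
  \<open>z\<close> into a number close to -1, so that \<open>1 - (1 + z \<zeta>)\<^sup>d\<close> is close to 1. This is a
  polynomial in \<open>z\<close> without constant term, as needed for a Hardy martingale.
\<close>

definition unimod :: "complex \<Rightarrow> complex" where
  "unimod z = (if norm z = 1 then z else 1)"

definition quadrant :: "complex \<Rightarrow> bool \<times> bool" where
  "quadrant z = (0 \<le> Re z, 0 \<le> Im z)"

definition rotor :: "bool \<times> bool \<Rightarrow> complex" where
  "rotor m = - cnj (Complex (if fst m then 1 / sqrt 2 else - 1 / sqrt 2) (if snd m then 1 / sqrt 2 else - 1 / sqrt 2))"

definition analytic_factor :: "nat \<Rightarrow> complex \<Rightarrow> bool \<times> bool \<Rightarrow> complex" where
  "analytic_factor d z m = 1 - (1 + unimod z * rotor m) ^ d"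

text \<open>The Fourier coefficients of \<open>analytic_factor\<close> by the binomial theorem: the
  constant term 1 cancels, and for k > d the binomial coefficient is 0.\<close>

definition analytic_coeff :: "nat \<Rightarrow> int \<Rightarrow> bool \<times> bool \<Rightarrow> complex" where
  "analytic_coeff d k m = (if k \<ge> 1 then - (of_nat (d choose nat k) * rotor m ^ nat k) else 0)"

section \<open>Size and Fourier coefficients of the analytic factor\<close>

lemma norm_unimod [simp]: "norm (unimod z) = 1"
  by (simp add: unimod_def)

lemma norm_rotor [simp]: "norm (rotor m) = 1"
  by (cases m) (simp add: rotor_def cmod_def power_divide)

lemma unimod_measurable [measurable]: "unimod \<in> borel_measurable borel"
  unfolding unimod_def[abs_def] by measurable

lemma analytic_factor_measurable [measurable]: "(\<lambda>z. analytic_factor d z m) \<in> borel_measurable borel"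
  unfolding analytic_factor_def by measurable

lemma norm_analytic_factor: "norm (analytic_factor d z m) \<le> 1 + 2 ^ d"
proof -
  have "norm (1 + unimod z * rotor m) \<le> 2"
    using norm_triangle_ineq[of 1 "unimod z * rotor m"] by (simp add: norm_mult)
  then have "norm ((1 + unimod z * rotor m) ^ d) \<le> 2 ^ d"
    by (simp add: norm_power power_mono)
  then show ?thesis unfolding analytic_factor_def
    using norm_triangle_ineq4[of 1 "(1 + unimod z * rotor m) ^ d"] by simp
qed

text \<open>A unimodular number x + iy is at most 45 degrees from the centre of its quadrant: the
  squared norm of 1 plus the rotated number is 2 - 2 (|x| + |y|) / sqrt 2 with |x| + |y| at least 1,
  hence at most 2 - sqrt 2, which is below 1.\<close>

lemma analytic_factor_close:
  "norm (analytic_factor d z (quadrant (unimod z)) - 1) \<le> sqrt (2 - sqrt 2) ^ d"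
proof -
  define u where "u = unimod z"
  define x y where "x = Re u" "y = Im u"
  have xy: "x\<^sup>2 + y\<^sup>2 = 1"
    using norm_unimod[of z] by (simp add: cmod_def u_def[symmetric] x_y_def real_sqrt_eq_1_iff)
  have "(\<bar>x\<bar> + \<bar>y\<bar>)\<^sup>2 = x\<^sup>2 + y\<^sup>2 + 2 * (\<bar>x\<bar> * \<bar>y\<bar>)" by (simp add: power2_sum)
  then have "1\<^sup>2 \<le> (\<bar>x\<bar> + \<bar>y\<bar>)\<^sup>2" using xy by simp
  then have ge: "1 \<le> \<bar>x\<bar> + \<bar>y\<bar>" by (rule power2_le_imp_le) simp
  have Re: "Re (u * rotor (quadrant u)) = - ((\<bar>x\<bar> + \<bar>y\<bar>) / sqrt 2)"
    by (auto simp: rotor_def quadrant_def x_y_def field_simps)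
  have n1: "norm (u * rotor (quadrant u)) = 1" by (simp add: norm_mult u_def)
  have "(norm (1 + u * rotor (quadrant u)))\<^sup>2 = 2 + 2 * Re (u * rotor (quadrant u))"
  proof -
    have "(norm (1 + w))\<^sup>2 = 2 + 2 * Re w" if "norm w = 1" for w
    proof -
      have "(Re w)\<^sup>2 + (Im w)\<^sup>2 = 1" using that by (simp add: cmod_def real_sqrt_eq_1_iff)
      then show ?thesis by (simp add: cmod_power2 power2_sum)
    qed
    then show ?thesis using n1 by blast
  qed
  also have "\<dots> \<le> 2 - sqrt 2"
  proof -
    have "sqrt 2 * 1 \<le> sqrt 2 * (\<bar>x\<bar> + \<bar>y\<bar>)" using ge by (intro mult_left_mono) auto
    then have "sqrt 2 \<le> 2 * ((\<bar>x\<bar> + \<bar>y\<bar>) / sqrt 2)"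
      using real_div_sqrt[of 2] by (metis mult.commute mult_1 times_divide_eq_left times_divide_eq_right zero_le_numeral)
    then show ?thesis unfolding Re by linarith
  qed
  finally have "norm (1 + u * rotor (quadrant u)) \<le> sqrt (2 - sqrt 2)"
    by (rule real_le_rsqrt)
  then have "norm ((1 + u * rotor (quadrant u)) ^ d) \<le> sqrt (2 - sqrt 2) ^ d"
    unfolding norm_power by (intro power_mono) auto
  then show ?thesis by (simp add: analytic_factor_def u_def)
qed

lemma integrable_circle_powi: "integrable circle_haar (\<lambda>z. z powi k)"
proof -
  interpret prob_space circle_haar by (rule prob_space_circle)
  interpret U: prob_space "uniform_measure lborel {0..<1::real}"
    by (rule prob_space_uniform_measure) auto
  have "(\<lambda>t. cis (2 * pi * t)) \<in> borel_measurable borel"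
    by (intro borel_measurable_continuous_onI continuous_intros)
  then have m: "(\<lambda>t. cis (2 * pi * t)) \<in> measurable (uniform_measure lborel {0..<1}) borel" by simp
  have "integrable (uniform_measure lborel {0..<1}) (\<lambda>t. cis (2 * pi * t) powi k)"
    by (rule U.integrable_const_bound[of _ 1]) (use m in \<open>auto simp: norm_power_int\<close>)
  then show ?thesis unfolding circle_haar_def by (subst integrable_distr_eq[OF m]) auto
qed

lemma circle_integral_analytic_factor:
  "integrable circle_haar (\<lambda>z. z powi (- k) * analytic_factor d z m)"
  "(LINT z|circle_haar. z powi (- k) * analytic_factor d z m) = analytic_coeff d k m"
proof -
  \<comment> \<open>The Laurent polynomial obtained where \<open>unimod\<close> is the identity,
    that is, almost everywhere.\<close>
  define P where "P z = - (\<Sum>j=1..d. of_nat (d choose j) * rotor m ^ j * z powi (int j - k))" for z :: complex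
  have eq: "z powi (- k) * analytic_factor d z m = P z" if "norm z = 1" for z
  proof -
    have z0: "z \<noteq> 0" using that by auto
    have "(1 + z * rotor m) ^ d = (\<Sum>j\<le>d. of_nat (d choose j) * (z * rotor m) ^ j)"
      using binomial_ring[of "z * rotor m" 1 d] by (simp add: add.commute)
    also have "\<dots> = 1 + (\<Sum>j=1..d. of_nat (d choose j) * (z * rotor m) ^ j)"
      by (subst sum.atMost_shift) (simp add: sum.shift_bounds_Suc_ivl atLeast0LessThan[symmetric]
          atLeastLessThanSuc_atLeastAtMost[symmetric] del: sum.op_ivl_Suc)
    finally have "analytic_factor d z m = - (\<Sum>j=1..d. of_nat (d choose j) * (z * rotor m) ^ j)"
      using that by (simp add: analytic_factor_def unimod_def)
    then have "z powi (- k) * analytic_factor d z m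
        = - (\<Sum>j=1..d. z powi (- k) * (of_nat (d choose j) * (z * rotor m) ^ j))"
      by (simp add: sum_distrib_left)
    also have "\<dots> = P z" unfolding P_def
    proof (intro arg_cong[of _ _ uminus] sum.cong refl)
      fix j
      have "z powi (int j - k) = z ^ j * z powi (- k)" using z0 power_int_add[of z "int j" "- k"] by simp
      then show "z powi (- k) * (of_nat (d choose j) * (z * rotor m) ^ j)
          = of_nat (d choose j) * rotor m ^ j * z powi (int j - k)"
        by (simp add: power_mult_distrib mult_ac)
    qed
    finally show ?thesis .
  qed
  have Pm [measurable]: "P \<in> borel_measurable borel" unfolding P_def[abs_def] by measurable
  have Pm': "P \<in> borel_measurable circle_haar"
    unfolding measurable_cong_sets[OF sets_circle refl] by (rule Pm)
  have "(\<lambda>t. cis (2 * pi * t)) \<in> borel_measurable borel"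
    by (intro borel_measurable_continuous_onI continuous_intros)
  then have m: "(\<lambda>t. cis (2 * pi * t)) \<in> measurable (uniform_measure lborel {0..<1}) borel" by simp
  have Pint: "integrable circle_haar P" unfolding P_def[abs_def]
    by (intro Bochner_Integration.integrable_minus Bochner_Integration.integrable_sum integrable_mult_right integrable_circle_powi)
  have "AE z in circle_haar. norm z = 1"
    unfolding circle_haar_def by (subst AE_distr_iff[OF m]) auto
  then have ae: "AE z in circle_haar. z powi (- k) * analytic_factor d z m = P z"
    by eventually_elim (rule eq)
  have meas: "(\<lambda>z. z powi (- k) * analytic_factor d z m) \<in> borel_measurable circle_haar"
    unfolding measurable_cong_sets[OF sets_circle refl] by measurable
  show "integrable circle_haar (\<lambda>z. z powi (- k) * analytic_factor d z m)"
    using Pint ae meas Pm' by (subst integrable_cong_AE[of _ _ P]) auto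
  have "(LINT z|circle_haar. z powi (- k) * analytic_factor d z m) = (LINT z|circle_haar. P z)"
    using ae meas Pm' by (intro integral_cong_AE) auto
  also have "\<dots> = - (\<Sum>j=1..d. of_nat (d choose j) * rotor m ^ j * of_bool (int j - k = 0))"
    unfolding P_def[abs_def]
    by (subst integral_minus, subst Bochner_Integration.integral_sum)
      (auto intro!: integrable_mult_right integrable_circle_powi simp: circle_integral_powi)
  also have "(\<Sum>j=1..d. of_nat (d choose j) * rotor m ^ j * of_bool (int j - k = 0))
      = (if k \<ge> 1 then of_nat (d choose nat k) * rotor m ^ nat k else 0)"
  proof (cases "k \<ge> 1")
    case True
    then have b: "of_bool (int j - k = 0) = (of_bool (j = nat k) :: complex)" for j by auto
    show ?thesis
    proof (cases "nat k \<le> d")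
      case kd: True
      have "(\<Sum>j=1..d. of_nat (d choose j) * rotor m ^ j * of_bool (int j - k = 0))
          = (\<Sum>j=1..d. if j = nat k then of_nat (d choose j) * rotor m ^ j else 0)"
        unfolding b by (intro sum.cong) auto
      also have "\<dots> = of_nat (d choose nat k) * rotor m ^ nat k" using True kd by (subst sum.delta) auto
      finally show ?thesis using True by simp
    next
      case False
      then have "(\<Sum>j=1..d. of_nat (d choose j) * rotor m ^ j * of_bool (int j - k = 0)) = 0"
        unfolding b by (intro sum.neutral) auto
      then show ?thesis using False True by (simp add: binomial_eq_0)
    qed
  next
    case False
    then show ?thesis by (auto intro!: sum.neutral)
  qed
  finally show "(LINT z|circle_haar. z powi (- k) * analytic_factor d z m) = analytic_coeff d k m"
    by (simp add: analytic_coeff_def)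
qed

lemma not_AUMD_X:
  fixes sc :: "complex \<Rightarrow> 'y \<Rightarrow> 'y::{banach,second_countable_topology}"
  assumes X: "is_X p q sc J" and pq: "1 < p" "1 < q" "p \<noteq> q"
  shows "\<not> AUMD sc"
proof
  assume "AUMD sc"
  then obtain C where C: "\<And>f :: nat \<Rightarrow> (nat \<Rightarrow> complex) \<Rightarrow> 'y. hardy_martingale sc f \<Longrightarrow>
      (\<And>n. in_L torus 2 (f n)) \<Longrightarrow> bdd_above (range (\<lambda>n. L_norm torus 2 (f n))) \<Longrightarrow>
      unconditional_bound torus 2 C (mdiff f)"
    unfolding AUMD_def by (metis one_less_numeral_iff semiring_norm(76))
  define b where "b = (p < q)"
  define r1 r2 where "r1 = (if b then p else q)" "r2 = (if b then q else p)"
  have r: "1 < r1" "r1 < r2" using pq by (auto simp: r1_r2_def b_def)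
  define C' where "C' = max C 0"
  have C': "0 \<le> C'" "C \<le> C'" by (auto simp: C'_def)
  have "1 < sqrt 2" by simp
  then have "sqrt (2 - sqrt 2) < 1" by simp
  moreover have "0 \<le> sqrt (2 - sqrt 2)" using real_sqrt_le_iff[of 2 4] by simp
  \<comment> \<open>The degree d is chosen for the closeness to 1 that \<open>transform_gap\<close>
    demands for C'. The bound \<open>1 + 2 ^ d\<close> off the arc may then be large, at the expense
    of N.\<close>
  ultimately obtain d where d: "sqrt (2 - sqrt 2) ^ d < 1 / (2 * (1 + C'))"
    using real_arch_pow_inv[of "1 / (2 * (1 + C'))" "sqrt (2 - sqrt 2)"] C' by auto
  define err where "err = 1 / (2 * (1 + C'))"
  have err: "2 * err * (1 + C') \<le> 1" "0 \<le> err" using C' by (auto simp: err_def)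
  have K: "0 \<le> 1 + (2::real) ^ d" by simp
  from transform_gap[OF r C'(1) err K, where 'k = complex] obtain g A0 N where g: "1 < g" and
    gap: "\<forall>\<alpha> (Q :: nat \<Rightarrow> bool \<times> bool \<Rightarrow> complex).
       (\<forall>i. norm (Q i (\<alpha> i) - 1) \<le> err) \<and> (\<forall>i j. norm (Q i j) \<le> 1 + 2 ^ d) \<longrightarrow>
       mixed_norm (pexps r1 r2 N) (dsum g \<alpha> Q (\<lambda>i. if even i then 1 else - 1) N) \<le> A0 \<and>
       C' * A0 + 1 \<le> mixed_norm (pexps r1 r2 N) (dsum g \<alpha> Q (\<lambda>i. 1) N)"
    by (elim exE conjE)
  define a where "a j z = quadrant (unimod (z (Suc j)))" for j and z :: "nat \<Rightarrow> complex"
  define R where "R j z m = analytic_factor d (z (Suc j)) m" for j and z :: "nat \<Rightarrow> complex" and m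
  interpret prob_space torus by (rule prob_space_torus)
  interpret branching torus p q sc J torus_filtration g "1 + 2 ^ d" b N a R
  proof (intro branching.intro branching_axioms.intro prob_space_axioms)
    show "subalgebra torus (torus_filtration n)" for n by (rule subalgebra_torus)
    show "filtration (space torus) torus_filtration" by (rule filtration_torus)
    have q: "quadrant \<in> borel \<rightarrow>\<^sub>M count_space UNIV"
    proof (rule measurableI)
      fix A :: "(bool \<times> bool) set"
      have "quadrant -` {m} \<in> sets borel" for m
      proof -
        have "quadrant -` {m} = {z. (0 \<le> Re z) = fst m} \<inter> {z. (0 \<le> Im z) = snd m}"
          by (cases m) (auto simp: quadrant_def)
        also have "\<dots> \<in> sets borel" by measurable
        finally show ?thesis .
      qed
      then have "(\<Union>m\<in>A. quadrant -` {m}) \<in> sets borel" by (intro sets.finite_UN) auto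
      moreover have "(\<Union>m\<in>A. quadrant -` {m}) = quadrant -` A" by auto
      ultimately show "quadrant -` A \<inter> space borel \<in> sets borel" by simp
    qed simp
    show "a j \<in> torus_filtration (Suc j) \<rightarrow>\<^sub>M count_space UNIV" for j
      unfolding a_def[abs_def]
      by (intro measurable_compose[OF _ q] measurable_compose[OF torus_filtration_coord unimod_measurable]) simp
    show "(\<lambda>x. R j x m) \<in> borel_measurable (torus_filtration (Suc j))" for j m
      unfolding R_def by (intro measurable_compose[OF torus_filtration_coord analytic_factor_measurable]) simp
  qed (use X pq in \<open>auto simp: R_def norm_analytic_factor\<close>)
  let ?f = "move_martingale J g b N a R"
  \<comment> \<open>By independence, the conditional Fourier coefficients of the factor are
    constants.\<close>
  have star: "(LINT z|torus. indicator A z *\<^sub>R (z (Suc i) powi (- k) * R i z m))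
      = (LINT z|torus. indicator A z *\<^sub>R analytic_coeff d k m)" if A: "A \<in> sets (torus_filtration i)" for A i k m
  proof -
    have "(LINT z|torus. indicator A z *\<^sub>R (z (Suc i) powi (- k) * R i z m))
        = of_real (measure torus A) * analytic_coeff d k m"
      unfolding R_def
      using torus_independence(1)[OF A _ circle_integral_analytic_factor(1), of k d m] circle_integral_analytic_factor(2)[of k d m]
      by simp
    then show ?thesis using sets_F[OF A] by (simp add: scaleR_conv_of_real)
  qed
  have zero: "(LINT z|torus. indicator A z *\<^sub>R R i z m) = 0" if "A \<in> sets (torus_filtration i)" for A i m
    using star[OF that, of 0 m] by (simp add: analytic_coeff_def)
  have mart: "banach_martingale torus torus_filtration ?f" by (rule banach_martingale_move) (rule zero)
  have hardy: "hardy_martingale sc ?f"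
    unfolding hardy_martingale_def
  proof (intro conjI mart exI allI impI ballI)
    \<comment> \<open>The Fourier coefficient of a difference is the same expression with the random
      factor replaced by its constant coefficient, so it is known at time n - 1.\<close>
    define \<phi> where "\<phi> n k = move_diff J g b N a (\<lambda>_ _. analytic_coeff d k) (n - 1)" for n :: nat and k :: int
    fix n :: nat and k :: int assume n: "1 \<le> n"
    then obtain i where i: "n = Suc i" by (cases n) auto
    show meas: "\<phi> n k \<in> borel_measurable (torus_filtration (n - 1))"
      unfolding \<phi>_def by (rule move_diff_meas) auto
    have "\<exists>B. \<forall>x. norm (\<phi> n k x) \<le> B"
      unfolding \<phi>_def by (rule move_diff_bdd[of _ _ "\<Sum>m\<in>UNIV. norm (analytic_coeff d k m)"]) (auto intro!: member_le_sum)
    then show "integrable torus (\<phi> n k)"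
      using integrable_bdd[OF measurable_from_subalg[OF subalgebra_torus meas]] by blast
    fix A assume A: "A \<in> sets (torus_filtration (n - 1))"
    have "(LINT z:A|torus. sc (z n powi (- k)) (mdiff ?f n z)) = (LINT z:A|torus. \<phi> n k z)"
      unfolding i mdiff_move_martingale \<phi>_def nat.case diff_Suc_1
    proof (rule set_integral_move_diff)
      show "A \<in> sets (torus_filtration i)" using A i by simp
      show "(\<lambda>z. z (Suc i) powi (- k)) \<in> borel_measurable torus"
        by (rule measurable_compose[OF coord_measurable borel_measurable_power_int_complex])
      show "integrable torus (\<lambda>z. z (Suc i) powi (- k))"
        by (rule torus_independence(2)[OF sets.empty_sets borel_measurable_power_int_complex integrable_circle_powi])
    qed (auto intro: R_meas star)
    moreover have "\<phi> n k z = 0" if "\<not> 1 \<le> k" for z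
      using that is_X_zero[OF X] by (simp add: \<phi>_def move_diff_def dterm_def analytic_coeff_def cong: if_cong)
    ultimately show "(LINT z:A|torus. sc (z n powi (- k)) (mdiff ?f n z)) =
        (if k \<ge> 1 then (LINT z:A|torus. \<phi> n k z) else 0)"
      by (auto simp: set_lebesgue_integral_def)
  qed
  have "\<not> unconditional_bound torus 2 C' (mdiff ?f)"
  proof (rule not_unconditional_bound[where ?A0.0 = A0])
    have "norm (R j z (a j z) - 1) \<le> err" for j z
      unfolding R_def a_def err_def using analytic_factor_close[of d "z (Suc j)"] d by linarith
    moreover have "norm (R j z m) \<le> 1 + 2 ^ d" for j z m by (rule R_bdd)
    ultimately have "mixed_norm (pexps r1 r2 N) (dsum g (\<lambda>j. a j z) (\<lambda>j. R j z) (\<lambda>i. if even i then 1 else - 1) N) \<le> A0 \<and>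
       C' * A0 + 1 \<le> mixed_norm (pexps r1 r2 N) (dsum g (\<lambda>j. a j z) (\<lambda>j. R j z) (\<lambda>i. 1) N)" for z
      using gap[rule_format, of "\<lambda>j. R j z" "\<lambda>j. a j z"] by blast
    then show "mixed_norm (pexps (if b then p else q) (if b then q else p) N) (dsum g (\<lambda>j. a j z) (\<lambda>j. R j z) (\<lambda>i. if even i then 1 else - 1) N) \<le> A0"
       "C' * A0 + 1 \<le> mixed_norm (pexps (if b then p else q) (if b then q else p) N) (dsum g (\<lambda>j. a j z) (\<lambda>j. R j z) (\<lambda>i. 1) N)" for z
      unfolding r1_r2_def by blast+
  qed (use C' in auto)
  moreover have "unconditional_bound torus 2 C (mdiff ?f)"
    by (rule C[OF hardy move_martingale_in_L move_martingale_L_norm_bdd]) auto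
  then have "unconditional_bound torus 2 C' (mdiff ?f)"
    unfolding unconditional_bound_def L_norm_def using C'(2)
    by (meson mult_right_mono order_trans powr_ge_zero)
  ultimately show False by simp
qed


section \<open>Bounded martingales on the dyadic tree\<close>

text \<open>
  A function on bit lists encodes a martingale: its restriction to the lists of length \<open>2 n\<close> is
  the conditional expectation on the \<open>n\<close>-th level. By uniform convexity, X(p,q) is isometric to the
  space of bounded martingales, which makes sense for all exponents inside one ambient space.
\<close>

definition mart :: "(bool list \<Rightarrow> complex) \<Rightarrow> bool" where
  "mart f \<longleftrightarrow> (\<forall>l. f l = (f (True # l) + f (False # l)) / 2)"

definition bmart :: "real \<Rightarrow> real \<Rightarrow> (bool list \<Rightarrow> complex) set" where
  "bmart p q = {f. mart f \<and> bdd_above (range (\<lambda>n. mixed_norm (exps p q n) f))}"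

definition bnorm :: "real \<Rightarrow> real \<Rightarrow> (bool list \<Rightarrow> complex) \<Rightarrow> real" where
  "bnorm p q f = (SUP n. mixed_norm (exps p q n) f)"

section \<open>Norms and limits of bounded martingales\<close>

lemma martD: "mart f \<Longrightarrow> f l = (f (True # l) + f (False # l)) / 2"
  unfolding mart_def by blast

lemma mart_add: "mart f \<Longrightarrow> mart g \<Longrightarrow> mart (\<lambda>l. f l + g l)"
  unfolding mart_def by (simp add: field_simps)

lemma mart_cmult: "mart f \<Longrightarrow> mart (\<lambda>l. c * f l)"
  unfolding mart_def by (metis distrib_left times_divide_eq_right)

lemma mart_zero: "mart (\<lambda>_. 0)"
  by (simp add: mart_def)

lemma mart_limit:
  assumes "\<And>n. mart (f n)" "\<And>l. (\<lambda>n. f n l) \<longlonglongrightarrow> g l"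
  shows "mart g"
  unfolding mart_def
proof
  fix l
  have "(\<lambda>n. (f n (True # l) + f n (False # l)) / 2) \<longlonglongrightarrow> (g (True # l) + g (False # l)) / 2"
    by (intro tendsto_intros assms) auto
  then have "(\<lambda>n. f n l) \<longlonglongrightarrow> (g (True # l) + g (False # l)) / 2"
    by (simp only: martD[OF assms(1), symmetric])
  then show "g l = (g (True # l) + g (False # l)) / 2" using assms(2) LIMSEQ_unique by blast
qed

context
  fixes p q :: real
  assumes pq: "1 \<le> p" "1 \<le> q"
begin

lemma exps_ge_1: "\<forall>r\<in>set (exps p q n). 1 \<le> r" "\<forall>r\<in>set (exps p q n). 0 < r"
  using pq ball_exps[of "\<lambda>r. 1 \<le> r" p q n] ball_exps[of "\<lambda>r. 0 < r" p q n] by auto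

text \<open>A level consists of two bits, so one step down the levels consists of two conditional
  expectations.\<close>

lemma level_mono:
  assumes "mart f" "n \<le> m"
  shows "mixed_norm (exps p q n) f \<le> mixed_norm (exps p q m) f"
  using assms(2)
proof (induction m rule: dec_induct)
  case (step m)
  have f: "(\<lambda>l. (f (True # l) + f (False # l)) / 2) = f" using assms(1) by (auto simp: mart_def)
  have "mixed_norm (exps p q m) f \<le> mixed_norm (q # exps p q m) f"
    using mixed_norm_mean_le[of q "exps p q m" f] exps_ge_1[of m] pq unfolding f by simp
  also have "\<dots> \<le> mixed_norm (exps p q (Suc m)) f"
    using mixed_norm_mean_le[of p "q # exps p q m" f] exps_ge_1[of m] pq unfolding f by simp
  finally show ?case using step by linarith
qed simp

lemma level_le_bnorm: "f \<in> bmart p q \<Longrightarrow> mixed_norm (exps p q n) f \<le> bnorm p q f"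
  unfolding bnorm_def bmart_def by (auto intro: cSUP_upper)

lemma bnorm_le: "(\<And>n. mixed_norm (exps p q n) f \<le> B) \<Longrightarrow> bnorm p q f \<le> B"
  unfolding bnorm_def by (rule cSUP_least) auto

lemma bmartI: "mart f \<Longrightarrow> (\<And>n. mixed_norm (exps p q n) f \<le> B) \<Longrightarrow> f \<in> bmart p q"
  unfolding bmart_def using bdd_aboveI2[of UNIV "\<lambda>n. mixed_norm (exps p q n) f" B] by auto

lemma bnorm_nonneg: "f \<in> bmart p q \<Longrightarrow> 0 \<le> bnorm p q f"
  using level_le_bnorm[of f 0] mixed_norm_nonneg order_trans by blast

lemma bmart_mart: "f \<in> bmart p q \<Longrightarrow> mart f"
  by (simp add: bmart_def)

lemma level_tendsto_bnorm: "f \<in> bmart p q \<Longrightarrow> (\<lambda>n. mixed_norm (exps p q n) f) \<longlonglongrightarrow> bnorm p q f"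
  unfolding bnorm_def
  by (rule LIMSEQ_incseq_SUP) (auto simp: bmart_def incseq_def intro: level_mono)

text \<open>Words of odd length lie between levels; there f is the mean of two values on the next
  level, which costs one more factor 2. These bounds supply the weights of the ambient
  space.\<close>

lemma bmart_point:
  assumes "f \<in> bmart p q" shows "norm (f l) \<le> 2 ^ Suc (length l) * bnorm p q f"
proof -
  have even_case: "norm (f l) \<le> 2 ^ length l * bnorm p q f" if "length l = 2 * n" for l n
  proof -
    have "norm (f l) \<le> 2 ^ length l * mixed_norm (exps p q n) f"
      using exps_ge_1[of n] that by (intro mixed_norm_point) auto
    also have "\<dots> \<le> 2 ^ length l * bnorm p q f"
      using level_le_bnorm[OF assms] by (intro mult_left_mono) auto
    finally show ?thesis .
  qed
  show ?thesis
  proof (cases "even (length l)")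
    case True
    then obtain n where "length l = 2 * n" by blast
    then have "norm (f l) \<le> 2 ^ length l * bnorm p q f" by (rule even_case)
    also have "\<dots> \<le> 2 ^ Suc (length l) * bnorm p q f"
      using bnorm_nonneg[OF assms] by (intro mult_right_mono) auto
    finally show ?thesis .
  next
    case False
    then have "even (length (s # l))" for s by simp
    then obtain n where "length (s # l) = 2 * n" for s by (metis evenE length_Cons)
    then have "norm (f (s # l)) \<le> 2 ^ Suc (length l) * bnorm p q f" for s
      using even_case[of "s # l" n] by simp
    then have "norm (f (True # l) + f (False # l)) \<le> 2 * (2 ^ Suc (length l) * bnorm p q f)"
      by (intro order_trans[OF norm_triangle_ineq]) (smt (verit))
    moreover have "norm (f l) = norm ((f (True # l) + f (False # l)) / 2)"
      using martD[OF bmart_mart[OF assms], of l] by (rule arg_cong)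
    ultimately show ?thesis by (simp add: norm_divide)
  qed
qed

lemma bmart_zero: "(\<lambda>_. 0) \<in> bmart p q"
  using exps_ge_1(2) by (intro bmartI[where B = 0] mart_zero) simp

lemma bnorm_zero: "bnorm p q (\<lambda>_. 0) = 0"
  using exps_ge_1(2) by (simp add: bnorm_def)

lemma bmart_add:
  assumes "f \<in> bmart p q" "g \<in> bmart p q"
  shows "(\<lambda>l. f l + g l) \<in> bmart p q" "bnorm p q (\<lambda>l. f l + g l) \<le> bnorm p q f + bnorm p q g"
proof -
  have le: "mixed_norm (exps p q n) (\<lambda>l. f l + g l) \<le> bnorm p q f + bnorm p q g" for n
    using mixed_norm_triangle[OF exps_ge_1(1), of n f g] level_le_bnorm[OF assms(1), of n] level_le_bnorm[OF assms(2), of n]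
    by linarith
  show "(\<lambda>l. f l + g l) \<in> bmart p q" using assms bmart_mart by (intro bmartI[OF _ le] mart_add) auto
  show "bnorm p q (\<lambda>l. f l + g l) \<le> bnorm p q f + bnorm p q g" by (rule bnorm_le[OF le])
qed

lemma bmart_cmult:
  assumes "f \<in> bmart p q"
  shows "(\<lambda>l. c * f l) \<in> bmart p q" "bnorm p q (\<lambda>l. c * f l) = norm c * bnorm p q f"
proof -
  have eq: "mixed_norm (exps p q n) (\<lambda>l. c * f l) = norm c * mixed_norm (exps p q n) f" for n
    by (rule mixed_norm_cmult[OF exps_ge_1(2)])
  show c: "(\<lambda>l. c * f l) \<in> bmart p q"
    using level_le_bnorm[OF assms] by (intro bmartI[where B = "norm c * bnorm p q f"])
      (auto simp: eq intro!: mart_cmult bmart_mart[OF assms] mult_left_mono)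
  have "(\<lambda>n. norm c * mixed_norm (exps p q n) f) \<longlonglongrightarrow> norm c * bnorm p q f"
    by (intro tendsto_intros level_tendsto_bnorm assms)
  then show "bnorm p q (\<lambda>l. c * f l) = norm c * bnorm p q f"
    using level_tendsto_bnorm[OF c] unfolding eq by (rule LIMSEQ_unique[symmetric])
qed

lemma bmart_diff:
  assumes "f \<in> bmart p q" "g \<in> bmart p q"
  shows "(\<lambda>l. f l - g l) \<in> bmart p q"
  using bmart_add(1)[OF assms(1) bmart_cmult(1)[OF assms(2), of "- 1"]] by simp

lemma bmart_sum: "(\<And>k. k \<in> A \<Longrightarrow> g k \<in> bmart p q) \<Longrightarrow>
    (\<lambda>l. \<Sum>k\<in>A. g k l) \<in> bmart p q \<and> bnorm p q (\<lambda>l. \<Sum>k\<in>A. g k l) \<le> (\<Sum>k\<in>A. bnorm p q (g k))"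
proof (induction A rule: infinite_finite_induct)
  case (insert k A)
  then have IH: "(\<lambda>l. \<Sum>k\<in>A. g k l) \<in> bmart p q" "bnorm p q (\<lambda>l. \<Sum>k\<in>A. g k l) \<le> (\<Sum>k\<in>A. bnorm p q (g k))"
    and gk: "g k \<in> bmart p q" by auto
  show ?case using bmart_add[OF gk IH(1)] IH(2) insert.hyps by simp
qed (auto simp: bmart_zero bnorm_zero)

text \<open>The Fatou property: every level norm involves finitely many values and is continuous
  under pointwise convergence.\<close>

lemma bmart_limit:
  assumes "\<And>n. f n \<in> bmart p q" "\<And>n. bnorm p q (f n) \<le> B" "\<And>l. (\<lambda>n. f n l) \<longlonglongrightarrow> g l"
  shows "g \<in> bmart p q" "bnorm p q g \<le> B"
proof -
  have le: "mixed_norm (exps p q n) g \<le> B" for n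
  proof (rule LIMSEQ_le_const2)
    show "(\<lambda>k. mixed_norm (exps p q n) (f k)) \<longlonglongrightarrow> mixed_norm (exps p q n) g"
      by (intro tendsto_mixed_norm exps_ge_1 assms)
    show "\<exists>N. \<forall>k\<ge>N. mixed_norm (exps p q n) (f k) \<le> B"
      using level_le_bnorm[OF assms(1)] assms(2) order_trans by blast
  qed
  show "g \<in> bmart p q" using mart_limit[OF bmart_mart[OF assms(1)] assms(3)] by (intro bmartI[OF _ le]) auto
  show "bnorm p q g \<le> B" by (rule bnorm_le[OF le])
qed

lemma bmart_suminf:
  assumes g: "\<And>k. g k \<in> bmart p q" and sum: "summable (\<lambda>k. bnorm p q (g k))"
  shows "summable (\<lambda>k. g k l)" "(\<lambda>l. \<Sum>k. g k l) \<in> bmart p q"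
    "bnorm p q (\<lambda>l. \<Sum>k. g k l) \<le> (\<Sum>k. bnorm p q (g k))"
proof -
  show s: "summable (\<lambda>k. g k l)" for l
    by (rule summable_comparison_test'[OF summable_mult[OF sum]]) (rule bmart_point[OF g])
  have lim: "(\<lambda>m. \<Sum>k<m. g k l) \<longlonglongrightarrow> (\<Sum>k. g k l)" for l
    by (rule summable_LIMSEQ[OF s])
  have b: "(\<lambda>l. \<Sum>k<m. g k l) \<in> bmart p q" "bnorm p q (\<lambda>l. \<Sum>k<m. g k l) \<le> (\<Sum>k. bnorm p q (g k))" for m
  proof -
    have bs: "(\<lambda>l. \<Sum>k<m. g k l) \<in> bmart p q \<and> bnorm p q (\<lambda>l. \<Sum>k<m. g k l) \<le> (\<Sum>k<m. bnorm p q (g k))"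
      by (rule bmart_sum) (rule g)
    then show "(\<lambda>l. \<Sum>k<m. g k l) \<in> bmart p q" ..
    from bs have "bnorm p q (\<lambda>l. \<Sum>k<m. g k l) \<le> (\<Sum>k<m. bnorm p q (g k))" ..
    also have "\<dots> \<le> (\<Sum>k. bnorm p q (g k))" using bnorm_nonneg[OF g] by (intro sum_le_suminf sum) auto
    finally show "bnorm p q (\<lambda>l. \<Sum>k<m. g k l) \<le> (\<Sum>k. bnorm p q (g k))" .
  qed
  show "(\<lambda>l. \<Sum>k. g k l) \<in> bmart p q" "bnorm p q (\<lambda>l. \<Sum>k. g k l) \<le> (\<Sum>k. bnorm p q (g k))"
    by (rule bmart_limit[OF b lim])+
qed

end

section \<open>The inner product for the exponents 2, 2\<close>

lemma lmean_add: "lmean n (\<lambda>l. f l + g l) = lmean n f + lmean n g"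
  by (induction n arbitrary: f g) (auto simp: add_divide_distrib)

lemma lmean_cnj: "lmean n (\<lambda>l. cnj (f l)) = cnj (lmean n f)"
  by (induction n arbitrary: f) auto

lemma lmean_of_real: "lmean n (\<lambda>l. of_real (f l)) = of_real (lmean n f)"
  by (induction n arbitrary: f) auto

lemma mixed_norm_2: "(mixed_norm (exps 2 2 n) f)\<^sup>2 = lmean (2 * n) (\<lambda>l. (norm (f l))\<^sup>2)"
proof -
  have D: "(D_norm 2 g)\<^sup>2 = ((g True)\<^sup>2 + (g False)\<^sup>2) / 2" for g
    using D_norm_powr[of 2 g] by (simp add: powr_numeral)
  show ?thesis by (induction n arbitrary: f) (simp_all add: D)
qed

text \<open>The inner product is a limit over the levels. Monotonicity yields convergence for norms
  only; the general case follows by polarization.\<close>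

lemma bmart_2_inner_product:
  "\<exists>ip :: (bool list \<Rightarrow> complex) \<Rightarrow> (bool list \<Rightarrow> complex) \<Rightarrow> complex.
    (\<forall>f\<in>bmart 2 2. \<forall>g\<in>bmart 2 2. \<forall>h\<in>bmart 2 2. ip (\<lambda>l. f l + g l) h = ip f h + ip g h) \<and>
    (\<forall>c. \<forall>f\<in>bmart 2 2. \<forall>g\<in>bmart 2 2. ip (\<lambda>l. c * f l) g = c * ip f g) \<and>
    (\<forall>f\<in>bmart 2 2. \<forall>g\<in>bmart 2 2. ip g f = cnj (ip f g)) \<and>
    (\<forall>f\<in>bmart 2 2. ip f f = of_real ((bnorm 2 2 f)\<^sup>2))"
proof -
  define s where "s n f g = lmean (2 * n) (\<lambda>l. f l * cnj (g l))" for n and f g :: "bool list \<Rightarrow> complex"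
  define ip where "ip f g = lim (\<lambda>n. s n f g)" for f g
  have two: "1 \<le> (2::real)" by simp
  have diag: "s n f f = of_real ((mixed_norm (exps 2 2 n) f)\<^sup>2)" for n f
    unfolding s_def mixed_norm_2 lmean_of_real[symmetric] complex_norm_square ..
  have sadd: "s n (\<lambda>l. f l + g l) h = s n f h + s n g h" for n f g h
    by (simp add: s_def distrib_right lmean_add)
  have scm: "s n (\<lambda>l. c * f l) h = c * s n f h" for n c f h
    by (simp add: s_def mult.assoc lmean_cmult)
  have scnj: "s n g f = cnj (s n f g)" for n f g
    by (simp add: s_def mult.commute flip: lmean_cnj)
  have sqlim: "(\<lambda>n. s n f f) \<longlonglongrightarrow> of_real ((bnorm 2 2 f)\<^sup>2)" if "f \<in> bmart 2 2" for f
    unfolding diag by (intro tendsto_intros level_tendsto_bnorm[OF two two] that)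
  have lim: "(\<lambda>n. s n f g) \<longlonglongrightarrow> ip f g" if fg: "f \<in> bmart 2 2" "g \<in> bmart 2 2" for f g
  proof -
    have sadd': "s n h (\<lambda>l. f l + g l) = s n h f + s n h g" for n f g h
      using scnj[of n h "\<lambda>l. f l + g l"] scnj[of n h f] scnj[of n h g] by (simp add: sadd)
    have scm': "s n h (\<lambda>l. c * f l) = cnj c * s n h f" for n c f h
      using scnj[of n h "\<lambda>l. c * f l"] scnj[of n h f] by (simp add: scm)
    have pol: "s n f g = (s n (\<lambda>l. f l + 1 * g l) (\<lambda>l. f l + 1 * g l) - s n (\<lambda>l. f l + (- 1) * g l) (\<lambda>l. f l + (- 1) * g l)
       + \<i> * s n (\<lambda>l. f l + \<i> * g l) (\<lambda>l. f l + \<i> * g l) - \<i> * s n (\<lambda>l. f l + (- \<i>) * g l) (\<lambda>l. f l + (- \<i>) * g l)) / 4" for n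
      unfolding sadd sadd' scm scm' by (simp add: algebra_simps)
    define L where "L c = (of_real ((bnorm 2 2 (\<lambda>l. f l + c * g l))\<^sup>2) :: complex)" for c
    have L: "(\<lambda>n. s n (\<lambda>l. f l + c * g l) (\<lambda>l. f l + c * g l)) \<longlonglongrightarrow> L c" for c
      unfolding L_def by (rule sqlim[OF bmart_add(1)[OF two two fg(1) bmart_cmult(1)[OF two two fg(2)]]])
    have "(\<lambda>n. s n f g) \<longlonglongrightarrow> (L 1 - L (- 1) + \<i> * L \<i> - \<i> * L (- \<i>)) / 4"
      unfolding pol by (intro tendsto_divide tendsto_diff tendsto_add tendsto_mult tendsto_const L) auto
    then have "convergent (\<lambda>n. s n f g)" unfolding convergent_def by blast
    then show ?thesis unfolding ip_def by (simp add: convergent_LIMSEQ_iff)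
  qed
  show ?thesis
  proof (rule exI[of _ ip], intro conjI ballI allI)
    fix f g h c assume f: "f \<in> bmart 2 2" and g: "g \<in> bmart 2 2"
    have e: "s n g f = cnj (s n f g)" for n by (rule scnj)
    show "ip g f = cnj (ip f g)"
      using tendsto_cnj[OF lim[OF f g]] lim[OF g f] unfolding e by (rule LIMSEQ_unique[symmetric])
    show "ip (\<lambda>l. c * f l) g = c * ip f g"
      using tendsto_mult_left[OF lim[OF f g], of c] lim[OF bmart_cmult(1)[OF two two f, of c] g] unfolding scm
      by (rule LIMSEQ_unique[symmetric])
    show "ip f f = of_real ((bnorm 2 2 f)\<^sup>2)"
      using lim[OF f f] sqlim[OF f] by (rule LIMSEQ_unique)
    assume h: "h \<in> bmart 2 2"
    show "ip (\<lambda>l. f l + g l) h = ip f h + ip g h"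
      using tendsto_add[OF lim[OF f h] lim[OF g h]] lim[OF bmart_add(1)[OF two two f g] h] unfolding sadd
      by (rule LIMSEQ_unique[symmetric])
  qed
qed


section \<open>The ambient space of the couple\<close>

definition scl :: "complex \<Rightarrow> (nat \<Rightarrow>\<^sub>C complex) \<Rightarrow> nat \<Rightarrow>\<^sub>C complex" where
  "scl c v = Bcontfun (\<lambda>i. c * apply_bcontfun v i)"

text \<open>The weights turn the pointwise bound for bounded martingales into boundedness,
  \<open>from_nat\<close> enumerates the bit lists, and \<open>coord\<close> undoes the
  embedding.\<close>

definition amb :: "(bool list \<Rightarrow> complex) \<Rightarrow> nat \<Rightarrow>\<^sub>C complex" where
  "amb f = Bcontfun (\<lambda>i. f (from_nat i) / 2 ^ Suc (length (from_nat i :: bool list)))"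

definition coord :: "(nat \<Rightarrow>\<^sub>C complex) \<Rightarrow> bool list \<Rightarrow> complex" where
  "coord v l = 2 ^ Suc (length l) * apply_bcontfun v (to_nat l)"

definition grow :: "(bool list \<Rightarrow> complex) \<Rightarrow> bool" where
  "grow f \<longleftrightarrow> (\<exists>B. \<forall>l. norm (f l) \<le> 2 ^ Suc (length l) * B)"

lemma apply_scl [simp]: "apply_bcontfun (scl c v) i = c * apply_bcontfun v i"
proof -
  have "(\<lambda>i. c * apply_bcontfun v i) \<in> bcontfun"
    by (rule bcontfun_normI[where b = "norm c * norm v"]) (auto simp: norm_mult intro!: mult_left_mono norm_bounded)
  then show ?thesis by (simp add: scl_def Bcontfun_inverse)
qed

lemma vector_space_scl: "vector_space scl"
  by unfold_locales (auto intro!: bcontfun_eqI simp: algebra_simps)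

lemma normed_space_over_scl: "normed_space_over scl"
  unfolding normed_space_over_def
proof (intro conjI allI vector_space_scl)
  show "scl (of_real r) x = r *\<^sub>R x" for r x
    by (intro bcontfun_eqI) (simp add: scaleR_conv_of_real)
  have le: "norm (scl c x) \<le> norm c * norm x" for c x
    by (intro norm_bound) (auto simp: norm_mult intro!: mult_left_mono norm_bounded)
  show "norm (scl c x) = norm c * norm x" for c x
  proof (cases "c = 0")
    case True
    then show ?thesis using le[of 0 x] by simp
  next
    case False
    have "scl (inverse c) (scl c x) = x"
      using False by (intro bcontfun_eqI) simp
    then have "norm x \<le> norm (inverse c) * norm (scl c x)" using le[of "inverse c" "scl c x"] by simp
    then have "norm c * norm x \<le> norm (scl c x)" using False by (simp add: norm_inverse norm_divide field_simps)
    then show ?thesis using le[of c x] by simp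
  qed
qed

lemma coord_add: "coord (v + w) l = coord v l + coord w l"
  by (simp add: coord_def algebra_simps)

lemma coord_diff: "coord (v - w) l = coord v l - coord w l"
  by (simp add: coord_def algebra_simps)

lemma coord_scl: "coord (scl c v) l = c * coord v l"
  by (simp add: coord_def)

lemma coord_zero: "coord 0 l = 0"
  by (simp add: coord_def)

lemma apply_amb:
  assumes "grow f"
  shows "apply_bcontfun (amb f) i = f (from_nat i) / 2 ^ Suc (length (from_nat i :: bool list))"
proof -
  obtain B where B: "\<And>l. norm (f l) \<le> 2 ^ Suc (length l) * B" using assms by (auto simp: grow_def)
  have "norm (f l / 2 ^ Suc (length l)) \<le> B" for l
    using B[of l] by (simp add: norm_divide norm_mult norm_power divide_le_eq mult.commute)
  then have "(\<lambda>i. f (from_nat i) / 2 ^ Suc (length (from_nat i :: bool list))) \<in> bcontfun"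
    by (intro bcontfun_normI) auto
  then show ?thesis by (simp add: amb_def Bcontfun_inverse)
qed

lemma coord_amb: "grow f \<Longrightarrow> coord (amb f) = f"
  by (rule ext) (simp add: coord_def apply_amb)

lemma amb_add: "grow f \<Longrightarrow> grow g \<Longrightarrow> amb (\<lambda>l. f l + g l) = amb f + amb g \<and> grow (\<lambda>l. f l + g l)"
proof -
  assume fg: "grow f" "grow g"
  then obtain A B where AB: "\<And>l. norm (f l) \<le> 2 ^ Suc (length l) * A" "\<And>l. norm (g l) \<le> 2 ^ Suc (length l) * B"
    by (auto simp: grow_def)
  have "norm (f l + g l) \<le> 2 ^ Suc (length l) * (A + B)" for l
    using norm_triangle_ineq[of "f l" "g l"] AB(1)[of l] AB(2)[of l] by (simp only: distrib_left)
  then have "grow (\<lambda>l. f l + g l)" unfolding grow_def by blast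
  then show ?thesis using fg by (auto intro!: bcontfun_eqI simp: apply_amb add_divide_distrib)
qed

lemma amb_cmult: "grow f \<Longrightarrow> amb (\<lambda>l. c * f l) = scl c (amb f) \<and> grow (\<lambda>l. c * f l)"
proof -
  assume f: "grow f"
  then obtain A where A: "\<And>l. norm (f l) \<le> 2 ^ Suc (length l) * A" by (auto simp: grow_def)
  have "norm (c * f l) \<le> 2 ^ Suc (length l) * (norm c * A)" for l
    using mult_left_mono[OF A[of l], of "norm c"] by (simp add: norm_mult mult_ac)
  then have "grow (\<lambda>l. c * f l)" unfolding grow_def by blast
  then show ?thesis using f by (auto intro!: bcontfun_eqI simp: apply_amb)
qed

lemma amb_diff: "grow f \<Longrightarrow> grow g \<Longrightarrow> amb (\<lambda>l. f l - g l) = amb f - amb g \<and> grow (\<lambda>l. f l - g l)"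
proof -
  assume fg: "grow f" "grow g"
  have "amb (\<lambda>l. f l + - 1 * g l) = amb f + scl (- 1) (amb g) \<and> grow (\<lambda>l. f l + - 1 * g l)"
    using amb_add[of f "\<lambda>l. - 1 * g l"] amb_cmult[of g "- 1"] fg by simp
  then show ?thesis using normed_space_over_scale_minus[OF normed_space_over_scl] by simp
qed

definition mart_space :: "real \<Rightarrow> real \<Rightarrow> (nat \<Rightarrow>\<^sub>C complex) set" where
  "mart_space p q = amb ` bmart p q"

definition mart_norm :: "real \<Rightarrow> real \<Rightarrow> (nat \<Rightarrow>\<^sub>C complex) \<Rightarrow> real" where
  "mart_norm p q v = bnorm p q (coord v)"

section \<open>The martingale spaces as Banach spaces inside the ambient space\<close>

context
  fixes p q :: real
  assumes pq: "1 \<le> p" "1 \<le> q"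
begin

lemma bmart_grow: "f \<in> bmart p q \<Longrightarrow> grow f"
  using bmart_point[OF pq] unfolding grow_def by blast

lemma mart_spaceI: "f \<in> bmart p q \<Longrightarrow> amb f \<in> mart_space p q"
  by (simp add: mart_space_def)

lemma mart_spaceD:
  assumes "v \<in> mart_space p q"
  shows "coord v \<in> bmart p q" "amb (coord v) = v"
  using assms by (auto simp: mart_space_def coord_amb bmart_grow)

lemma mart_norm_amb: "f \<in> bmart p q \<Longrightarrow> mart_norm p q (amb f) = bnorm p q f"
  by (simp add: mart_norm_def coord_amb bmart_grow)

lemma mart_space_add:
  assumes "v \<in> mart_space p q" "w \<in> mart_space p q"
  shows "v + w \<in> mart_space p q" "mart_norm p q (v + w) \<le> mart_norm p q v + mart_norm p q w"
proof -
  have c: "coord (v + w) = (\<lambda>l. coord v l + coord w l)" by (simp add: fun_eq_iff coord_add)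
  have "v + w = amb (\<lambda>l. coord v l + coord w l)"
    using amb_add[OF bmart_grow bmart_grow, OF mart_spaceD(1)[OF assms(1)] mart_spaceD(1)[OF assms(2)]] mart_spaceD(2)[OF assms(1)] mart_spaceD(2)[OF assms(2)]
    by simp
  then show "v + w \<in> mart_space p q"
    using mart_spaceI[OF bmart_add(1)[OF pq mart_spaceD(1)[OF assms(1)] mart_spaceD(1)[OF assms(2)]]] by simp
  show "mart_norm p q (v + w) \<le> mart_norm p q v + mart_norm p q w"
    unfolding mart_norm_def c using assms by (intro bmart_add(2)[OF pq] mart_spaceD)
qed

lemma mart_space_scl:
  assumes "v \<in> mart_space p q"
  shows "scl c v \<in> mart_space p q" "mart_norm p q (scl c v) = norm c * mart_norm p q v"
proof -
  have c: "coord (scl c v) = (\<lambda>l. c * coord v l)" by (simp add: fun_eq_iff coord_scl)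
  have "scl c v = amb (\<lambda>l. c * coord v l)"
    using amb_cmult[OF bmart_grow[OF mart_spaceD(1)[OF assms]], of c] mart_spaceD(2)[OF assms] by simp
  then show "scl c v \<in> mart_space p q"
    using mart_spaceI[OF bmart_cmult(1)[OF pq mart_spaceD(1)[OF assms]]] by simp
  show "mart_norm p q (scl c v) = norm c * mart_norm p q v"
    unfolding mart_norm_def c using assms by (intro bmart_cmult(2)[OF pq] mart_spaceD)
qed

lemma zero_in_mart_space: "0 \<in> mart_space p q"
proof -
  have "amb (\<lambda>_. 0) = 0" by (rule bcontfun_eqI) (simp add: apply_amb grow_def exI[of _ 0])
  then show ?thesis using mart_spaceI[OF bmart_zero[OF pq]] by simp
qed

lemma mart_space_diff:
  assumes "v \<in> mart_space p q" "w \<in> mart_space p q" shows "v - w \<in> mart_space p q"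
  using mart_space_add(1)[OF assms(1) mart_space_scl(1)[OF assms(2), of "- 1"]]
    normed_space_over_scale_minus[OF normed_space_over_scl] by simp

lemma mart_norm_zero: "mart_norm p q 0 = 0"
  using bnorm_zero[OF pq] by (simp add: mart_norm_def coord_zero[abs_def])

lemma mart_norm_nonneg: "v \<in> mart_space p q \<Longrightarrow> 0 \<le> mart_norm p q v"
  unfolding mart_norm_def by (intro bnorm_nonneg[OF pq] mart_spaceD)

lemma mart_space_coord:
  "v \<in> mart_space p q \<Longrightarrow> norm (coord v l) \<le> 2 ^ Suc (length l) * mart_norm p q v"
  unfolding mart_norm_def by (intro bmart_point[OF pq] mart_spaceD)

lemma norm_le_mart_norm:
  assumes "v \<in> mart_space p q" shows "norm v \<le> mart_norm p q v"
proof (rule norm_bound)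
  fix i
  have "apply_bcontfun v i = coord v (from_nat i) / 2 ^ Suc (length (from_nat i :: bool list))"
    using apply_amb[OF bmart_grow[OF mart_spaceD(1)[OF assms]], of i] mart_spaceD(2)[OF assms] by simp
  then show "norm (apply_bcontfun v i) \<le> mart_norm p q v"
    using mart_space_coord[OF assms, of "from_nat i"]
    by (simp add: norm_divide norm_mult norm_power divide_le_eq mult.commute)
qed

text \<open>The coordinates of a Cauchy sequence converge, and since balls are closed under
  pointwise convergence, the Cauchy estimate persists for the limit.\<close>

lemma banach_on_mart_space: "banach_on scl (mart_space p q) (mart_norm p q)"
proof -
  interpret vector_space scl by (rule vector_space_scl)
  have zero_iff: "mart_norm p q v = 0 \<longleftrightarrow> v = 0" if "v \<in> mart_space p q" for v
    using norm_le_mart_norm[OF that] mart_norm_zero by auto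
  have complete: "\<exists>l\<in>mart_space p q. (\<lambda>n. mart_norm p q (u n - l)) \<longlonglongrightarrow> 0"
    if u: "\<And>n. u n \<in> mart_space p q" and cau: "\<And>e. e > 0 \<Longrightarrow> \<exists>k. \<forall>m\<ge>k. \<forall>n\<ge>k. mart_norm p q (u m - u n) < e" for u
  proof -
    have "convergent (\<lambda>n. coord (u n) l)" for l
    proof -
      have "Cauchy (\<lambda>n. coord (u n) l)"
      proof (rule CauchyI)
        fix e :: real assume "e > 0"
        then have "e / 2 ^ Suc (length l) > 0" by simp
        then obtain k where k: "\<And>m n. m \<ge> k \<Longrightarrow> n \<ge> k \<Longrightarrow> mart_norm p q (u m - u n) < e / 2 ^ Suc (length l)"
          using cau by blast
        have "norm (coord (u m) l - coord (u n) l) < e" if "m \<ge> k" "n \<ge> k" for m n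
          using mart_space_coord[OF mart_space_diff[OF u u], of m n l] k[OF that]
          by (simp add: coord_diff field_simps)
        then show "\<exists>M. \<forall>m\<ge>M. \<forall>n\<ge>M. norm (coord (u m) l - coord (u n) l) < e" by blast
      qed
      then show ?thesis by (rule Cauchy_convergent)
    qed
    then obtain g where g: "\<And>l. (\<lambda>n. coord (u n) l) \<longlonglongrightarrow> g l" unfolding convergent_def by metis
    have tail: "(\<lambda>l. coord (u m) l - g l) \<in> bmart p q \<and> bnorm p q (\<lambda>l. coord (u m) l - g l) \<le> e"
      if m: "m \<ge> k" and k: "\<And>m n. m \<ge> k \<Longrightarrow> n \<ge> k \<Longrightarrow> mart_norm p q (u m - u n) < e" for m k e
    proof -
      have 1: "(\<lambda>l. coord (u m) l - coord (u (n + k)) l) \<in> bmart p q" for n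
        using mart_spaceD(1)[OF u] by (intro bmart_diff[OF pq])
      have 2: "bnorm p q (\<lambda>l. coord (u m) l - coord (u (n + k)) l) \<le> e" for n
        using k[OF m, of "n + k"] by (simp add: mart_norm_def coord_diff[abs_def])
      have 3: "(\<lambda>n. coord (u m) l - coord (u (n + k)) l) \<longlonglongrightarrow> coord (u m) l - g l" for l
        by (intro tendsto_intros LIMSEQ_ignore_initial_segment g)
      show ?thesis using bmart_limit[OF pq 1 2 3] by blast
    qed
    obtain k0 where "\<And>m n. m \<ge> k0 \<Longrightarrow> n \<ge> k0 \<Longrightarrow> mart_norm p q (u m - u n) < 1" using cau[of 1] by auto
    then have "(\<lambda>l. coord (u k0) l - g l) \<in> bmart p q" using tail[of k0 k0 1] by blast
    then have gb: "g \<in> bmart p q" using bmart_diff[OF pq mart_spaceD(1)[OF u, of k0]] by fastforce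
    have "(\<lambda>n. mart_norm p q (u n - amb g)) \<longlonglongrightarrow> 0"
    proof (rule LIMSEQ_I)
      fix e :: real assume "e > 0"
      then obtain k where k: "\<And>m n. m \<ge> k \<Longrightarrow> n \<ge> k \<Longrightarrow> mart_norm p q (u m - u n) < e / 2"
        using cau[of "e / 2"] by auto
      have "norm (mart_norm p q (u n - amb g) - 0) < e" if "n \<ge> k" for n
      proof -
        have "mart_norm p q (u n - amb g) \<le> e / 2"
          using tail[OF that k] by (simp add: mart_norm_def coord_diff[abs_def] coord_amb[OF bmart_grow[OF gb]])
        then show ?thesis
          using mart_norm_nonneg[OF mart_space_diff[OF u mart_spaceI[OF gb]], of n] \<open>e > 0\<close> by simp
      qed
      then show "\<exists>N. \<forall>n\<ge>N. norm (mart_norm p q (u n - amb g) - 0) < e" by blast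
    qed
    then show ?thesis using mart_spaceI[OF gb] by blast
  qed
  show ?thesis
    unfolding banach_on_def
    using subspaceI[of "mart_space p q", OF zero_in_mart_space mart_space_add(1) mart_space_scl(1)]
      mart_norm_nonneg zero_iff mart_space_add(2) mart_space_scl(2) complete by blast
qed

lemma mart_space_suminf:
  assumes g: "\<And>k. g k \<in> bmart p q" and sum: "summable (\<lambda>k. bnorm p q (g k))"
  shows "amb (\<lambda>l. \<Sum>k. g k l) \<in> mart_space p q"
    "mart_norm p q (amb (\<lambda>l. \<Sum>k. g k l)) \<le> (\<Sum>k. bnorm p q (g k))"
  using bmart_suminf[OF pq assms] by (auto simp: mart_norm_amb mart_spaceI)

end

lemma hilbert_on_mart_space: "hilbert_on scl (mart_space 2 2) (mart_norm 2 2)"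
proof -
  from bmart_2_inner_product obtain ip :: "(bool list \<Rightarrow> complex) \<Rightarrow> (bool list \<Rightarrow> complex) \<Rightarrow> complex" where ip:
    "\<forall>f\<in>bmart 2 2. \<forall>g\<in>bmart 2 2. \<forall>h\<in>bmart 2 2. ip (\<lambda>l. f l + g l) h = ip f h + ip g h"
    "\<forall>c. \<forall>f\<in>bmart 2 2. \<forall>g\<in>bmart 2 2. ip (\<lambda>l. c * f l) g = c * ip f g"
    "\<forall>f\<in>bmart 2 2. \<forall>g\<in>bmart 2 2. ip g f = cnj (ip f g)"
    "\<forall>f\<in>bmart 2 2. ip f f = of_real ((bnorm 2 2 f)\<^sup>2)"
    by (elim exE conjE)
  have two: "1 \<le> (2::real)" by simp
  have D: "coord v \<in> bmart 2 2" if "v \<in> mart_space 2 2" for v by (rule mart_spaceD(1)[OF two two that])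
  show ?thesis
    unfolding hilbert_on_def
  proof (intro conjI exI[of _ "\<lambda>v w. ip (coord v) (coord w)"] ballI allI banach_on_mart_space two)
    fix x y z c assume x: "x \<in> mart_space 2 2"
    show "ip (coord x) (coord x) = of_real ((mart_norm 2 2 x)\<^sup>2)"
      unfolding mart_norm_def by (rule ip(4)[rule_format, OF D[OF x]])
    assume y: "y \<in> mart_space 2 2"
    show "ip (coord (scl c x)) (coord y) = c * ip (coord x) (coord y)"
      using ip(2)[rule_format, OF D[OF x] D[OF y], of c] by (simp add: coord_scl[abs_def])
    show "ip (coord y) (coord x) = cnj (ip (coord x) (coord y))" by (rule ip(3)[rule_format, OF D[OF x] D[OF y]])
    assume z: "z \<in> mart_space 2 2"
    show "ip (coord (x + y)) (coord z) = ip (coord x) (coord z) + ip (coord y) (coord z)"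
      using ip(1)[rule_format, OF D[OF x] D[OF y] D[OF z]] by (simp add: coord_add[abs_def])
  qed
qed

lemma compatible_couple_mart_spaces:
  assumes "1 \<le> p" "1 \<le> q" "1 \<le> p'" "1 \<le> q'"
  shows "compatible_couple scl (mart_space p q) (mart_norm p q) (mart_space p' q') (mart_norm p' q')"
  unfolding compatible_couple_def
  using normed_space_over_scl banach_on_mart_space[OF assms(1,2)] banach_on_mart_space[OF assms(3,4)]
    norm_le_mart_norm[OF assms(1,2)] norm_le_mart_norm[OF assms(3,4)]
  by (intro conjI exI[of _ 1]) auto


section \<open>Interpolation: the upper bound for the martingale norm\<close>

text \<open>As for \<open>powr\<close>, a power of 0 is 0 even for the exponent 0. Then
  \<open>norm_cpow\<close> holds without exception, and the power is holomorphic in z for every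
  base.\<close>

definition cpow :: "real \<Rightarrow> complex \<Rightarrow> complex" where
  "cpow x z = (if x = 0 then 0 else exp (z * of_real (ln x)))"

lemma norm_cpow: "0 \<le> x \<Longrightarrow> norm (cpow x z) = x powr Re z"
  by (simp add: cpow_def powr_def norm_exp_eq_Re)

lemma cpow_of_real: "0 \<le> x \<Longrightarrow> cpow x (of_real t) = of_real (x powr t)"
  by (simp add: cpow_def powr_def flip: exp_of_real)

lemma holomorphic_cpow: "g holomorphic_on S \<Longrightarrow> (\<lambda>z. cpow x (g z)) holomorphic_on S"
  by (cases "x = 0") (auto simp: cpow_def intro!: holomorphic_intros)

lemma continuous_cpow: "continuous_on S g \<Longrightarrow> continuous_on S (\<lambda>z. cpow x (g z))"
  by (cases "x = 0") (auto simp: cpow_def intro!: continuous_intros)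

lemma continuous_on_lmean:
  "(\<And>l. length l = n \<Longrightarrow> continuous_on S (\<lambda>z. f z l)) \<Longrightarrow> continuous_on S (\<lambda>z. lmean n (f z) :: complex)"
proof (induction n arbitrary: f)
  case (Suc n)
  have "continuous_on S (\<lambda>z. lmean n (\<lambda>l. f z (s # l)))" for s
    by (rule Suc.IH) (simp add: Suc.prems)
  then show ?case by (auto intro!: continuous_intros)
qed auto

lemma holomorphic_on_lmean:
  "(\<And>l. length l = n \<Longrightarrow> (\<lambda>z. f z l) holomorphic_on S) \<Longrightarrow> (\<lambda>z. lmean n (f z)) holomorphic_on S"
proof (induction n arbitrary: f)
  case (Suc n)
  have "(\<lambda>z. lmean n (\<lambda>l. f z (s # l))) holomorphic_on S" for s
    by (rule Suc.IH) (simp add: Suc.prems)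
  then show ?case by (auto intro!: holomorphic_intros)
qed auto

lemma norm_lmean_le:
  fixes f :: "bool list \<Rightarrow> complex"
  shows "(\<And>l. length l = n \<Longrightarrow> norm (f l) \<le> B) \<Longrightarrow> norm (lmean n f) \<le> B"
proof (induction n arbitrary: f)
  case (Suc n)
  have "norm (lmean n (\<lambda>l. f (s # l))) \<le> B" for s
    by (rule Suc.IH) (simp add: Suc.prems)
  from norm_triangle_mono[OF this[of True] this[of False]] show ?case by (simp add: norm_divide)
qed auto

lemma powr_le_one_plus:
  fixes x t :: real
  assumes "0 \<le> x" "0 \<le> t" "t \<le> 1" shows "x powr t \<le> 1 + x"
proof (cases "x \<le> 1")
  case True
  then have "x powr t \<le> 1" using assms by (intro powr_le1) auto
  then show ?thesis using assms by simp
next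
  case False
  then have "x powr t \<le> x powr 1" using assms by (intro powr_mono) auto
  then show ?thesis using assms by simp
qed

text \<open>One end of the couple is fixed at the exponents 2, 2, where the martingale space is a
  Hilbert space.\<close>

locale interpolation_exponents =
  fixes p q p0 q0 \<theta> :: real
  assumes pq: "1 < p" "1 < q" and pq0: "1 < p0" "1 < q0" and th: "0 < \<theta>" "\<theta> < 1"
    and p_eq: "1 / p = (1 - \<theta>) / p0 + \<theta> / 2" and q_eq: "1 / q = (1 - \<theta>) / q0 + \<theta> / 2"
begin

abbreviation "S0 \<equiv> mart_space p0 q0"
abbreviation "N0 \<equiv> mart_norm p0 q0"
abbreviation "S1 \<equiv> mart_space 2 2"
abbreviation "N1 \<equiv> mart_norm 2 2"
abbreviation "V \<equiv> sum_space S0 S1"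
abbreviation "K \<equiv> sum_norm S0 N0 S1 N1"

lemma exps_le: "1 \<le> p" "1 \<le> q" "1 \<le> p0" "1 \<le> q0" "1 \<le> (2::real)"
  using pq pq0 by auto

lemma S0_subset_V: "S0 \<subseteq> V" and S1_subset_V: "S1 \<subseteq> V"
  using zero_in_mart_space[OF exps_le(3,4)] zero_in_mart_space[OF exps_le(5,5)]
  by (force simp: sum_space_def)+

lemma K_set_bdd: "bdd_below {N0 a + N1 b | a b. a \<in> S0 \<and> b \<in> S1 \<and> x = a + b}"
  using mart_norm_nonneg[OF exps_le(3,4)] mart_norm_nonneg[OF exps_le(5,5)]
  by (intro bdd_belowI[of _ 0]) (auto intro!: add_nonneg_nonneg)

lemma K_le: "a \<in> S0 \<Longrightarrow> b \<in> S1 \<Longrightarrow> K (a + b) \<le> N0 a + N1 b"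
  unfolding sum_norm_def by (rule cInf_lower[OF _ K_set_bdd]) auto

lemma K_le_N0: "a \<in> S0 \<Longrightarrow> K a \<le> N0 a"
  using K_le[OF _ zero_in_mart_space[OF exps_le(5,5)], of a] mart_norm_zero[OF exps_le(5,5)] by simp

lemma K_approx:
  assumes "x \<in> V" "\<epsilon> > 0"
  obtains a b where "a \<in> S0" "b \<in> S1" "x = a + b" "N0 a + N1 b < K x + \<epsilon>"
proof -
  have "{N0 a + N1 b | a b. a \<in> S0 \<and> b \<in> S1 \<and> x = a + b} \<noteq> {}" using assms by (auto simp: sum_space_def)
  then show ?thesis
    using cInf_lessD[of "{N0 a + N1 b | a b. a \<in> S0 \<and> b \<in> S1 \<and> x = a + b}" "K x + \<epsilon>"] assms that
    unfolding sum_norm_def by auto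
qed

lemma K_nonneg: "x \<in> V \<Longrightarrow> 0 \<le> K x"
  unfolding sum_norm_def
  using mart_norm_nonneg[OF exps_le(3,4)] mart_norm_nonneg[OF exps_le(5,5)]
  by (intro cInf_greatest) (auto simp: sum_space_def intro!: add_nonneg_nonneg)

text \<open>Coordinates are continuous functionals on the sum space; through them, functions on the
  strip with values there become ordinary holomorphic functions.\<close>

lemma K_coord:
  assumes "x \<in> V" shows "norm (coord x l) \<le> 2 ^ Suc (length l) * K x"
proof (rule field_le_epsilon)
  fix e :: real assume e: "e > 0"
  obtain a b where ab: "a \<in> S0" "b \<in> S1" "x = a + b" "N0 a + N1 b < K x + e / 2 ^ Suc (length l)"
    using K_approx[OF assms, of "e / 2 ^ Suc (length l)"] e by auto
  have "norm (coord x l) \<le> norm (coord a l) + norm (coord b l)"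
    unfolding ab(3) coord_add by (rule norm_triangle_ineq)
  also have "\<dots> \<le> 2 ^ Suc (length l) * (N0 a + N1 b)"
    using mart_space_coord[OF exps_le(3,4) ab(1), of l] mart_space_coord[OF exps_le(5,5) ab(2), of l]
    unfolding distrib_left by (rule add_mono)
  also have "\<dots> \<le> 2 ^ Suc (length l) * (K x + e / 2 ^ Suc (length l))"
    using ab(4) by (intro mult_left_mono) auto
  also have "\<dots> = 2 ^ Suc (length l) * K x + e" by (simp add: distrib_left)
  finally show "norm (coord x l) \<le> 2 ^ Suc (length l) * K x + e" .
qed

lemma V_diff: "x \<in> V \<Longrightarrow> y \<in> V \<Longrightarrow> x - y \<in> V"
proof -
  assume "x \<in> V" "y \<in> V"
  then obtain a b c d where "x = a + b" "y = c + d" "a \<in> S0" "b \<in> S1" "c \<in> S0" "d \<in> S1"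
    by (auto simp: sum_space_def)
  then have "x - y = (a - c) + (b - d)" "a - c \<in> S0" "b - d \<in> S1"
    using mart_space_diff[OF exps_le(3,4)] mart_space_diff[OF exps_le(5,5)] by auto
  then show ?thesis unfolding sum_space_def by blast
qed

lemma V_scl: "x \<in> V \<Longrightarrow> scl c x \<in> V"
proof -
  interpret vector_space scl by (rule vector_space_scl)
  assume "x \<in> V"
  then obtain a b where "x = a + b" "a \<in> S0" "b \<in> S1" by (auto simp: sum_space_def)
  then have "scl c x = scl c a + scl c b" "scl c a \<in> S0" "scl c b \<in> S1"
    using mart_space_scl(1)[OF exps_le(3,4)] mart_space_scl(1)[OF exps_le(5,5)]
    by (auto simp: scale_right_distrib)
  then show ?thesis unfolding sum_space_def by blast
qed

lemma V_amb: "x \<in> V \<Longrightarrow> mart (coord x) \<and> grow (coord x) \<and> amb (coord x) = x"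
proof -
  assume "x \<in> V"
  then obtain a b where x: "x = a + b" "a \<in> S0" "b \<in> S1" by (auto simp: sum_space_def)
  note a = mart_spaceD[OF exps_le(3,4) x(2)] and b = mart_spaceD[OF exps_le(5,5) x(3)]
  have c: "coord x = (\<lambda>l. coord a l + coord b l)" by (simp add: x fun_eq_iff coord_add)
  show ?thesis
    unfolding c using amb_add[OF bmart_grow[OF exps_le(3,4) a(1)] bmart_grow[OF exps_le(5,5) b(1)]] a b x
      mart_add[OF bmart_mart[OF exps_le(3,4) a(1)] bmart_mart[OF exps_le(5,5) b(1)]] by simp
qed

text \<open>A level norm at \<theta> is attained by a nonnegative dual function k. Its factorization
  into k0 and k1 yields an analytic family g that is bounded in the dual norm on either boundary
  line and whose value at \<theta> norms the level; the pairing G of F with g is a scalar function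
  on the strip.\<close>

lemma interpolation_upper:
  assumes F: "F \<in> strip_functions scl S0 N0 S1 N1"
  shows "F (of_real \<theta>) \<in> mart_space p q" "mart_norm p q (F (of_real \<theta>)) \<le> strip_norm N0 N1 F"
proof -
  define strip where "strip = {z. 0 \<le> Re z \<and> Re z \<le> 1}"
  have FV: "\<And>z. z \<in> strip \<Longrightarrow> F z \<in> V"
    and Fb: "bdd_above ((\<lambda>z. K (F z)) ` strip)"
    and Fc: "\<And>z. z \<in> strip \<Longrightarrow> ((\<lambda>w. K (F w - F z)) \<longlongrightarrow> 0) (at z within strip)"
    and Fd: "\<And>z. 0 < Re z \<Longrightarrow> Re z < 1 \<Longrightarrow> \<exists>l\<in>V. ((\<lambda>w. K (scl (1 / (w - z)) (F w - F z) - l)) \<longlongrightarrow> 0) (at z)"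
    and F0: "\<And>t. F (Complex 0 t) \<in> S0" and F1: "\<And>t. F (Complex 1 t) \<in> S1"
    and b0: "bdd_above (range (\<lambda>t. N0 (F (Complex 0 t))))" and b1: "bdd_above (range (\<lambda>t. N1 (F (Complex 1 t))))"
    using F by (auto simp: strip_functions_def Let_def strip_def)
  define M where "M = strip_norm N0 N1 F"
  have M0: "N0 (F (Complex 0 t)) \<le> M" for t
    unfolding M_def strip_norm_def using cSUP_upper[OF UNIV_I b0, of t] by simp
  have M1: "N1 (F (Complex 1 t)) \<le> M" for t
    unfolding M_def strip_norm_def using cSUP_upper[OF UNIV_I b1, of t] by simp
  obtain B where B: "\<And>z. z \<in> strip \<Longrightarrow> K (F z) \<le> B" using Fb by (auto simp: bdd_above_def)
  have thS: "of_real \<theta> \<in> strip" using th by (simp add: strip_def)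
  have Mn: "M \<ge> 0" using mart_norm_nonneg[OF exps_le(3,4) F0[of 0]] M0[of 0] by linarith
  have Bn: "B \<ge> 0" using K_nonneg[OF FV[OF thS]] B[OF thS] by linarith
  have ccont: "continuous_on strip (\<lambda>z. coord (F z) l)" for l
    unfolding continuous_on_def
  proof
    fix z assume z: "z \<in> strip"
    have "((\<lambda>w. coord (F w) l - coord (F z) l) \<longlongrightarrow> 0) (at z within strip)"
    proof (rule Lim_null_comparison)
      show "\<forall>\<^sub>F w in at z within strip. norm (coord (F w) l - coord (F z) l) \<le> 2 ^ Suc (length l) * K (F w - F z)"
        using K_coord[OF V_diff[OF FV FV[OF z]], of _ l] by (auto simp: eventually_at_filter coord_diff)
      show "((\<lambda>w. 2 ^ Suc (length l) * K (F w - F z)) \<longlongrightarrow> 0) (at z within strip)"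
        by (rule tendsto_mult_right_zero[OF Fc[OF z]])
    qed
    then show "((\<lambda>z. coord (F z) l) \<longlongrightarrow> coord (F z) l) (at z within strip)" by (rule LIM_zero_cancel)
  qed
  have chol: "(\<lambda>z. coord (F z) l) holomorphic_on {z. 0 < Re z \<and> Re z < 1}" for l
  proof -
    have "\<exists>d. ((\<lambda>z. coord (F z) l) has_field_derivative d) (at z)" if z: "0 < Re z" "Re z < 1" for z
    proof -
      obtain v where v: "v \<in> V" "((\<lambda>w. K (scl (1 / (w - z)) (F w - F z) - v)) \<longlongrightarrow> 0) (at z)"
        using Fd[OF z] by blast
      have zs: "z \<in> strip" using z by (simp add: strip_def)
      have "open {z. 0 < Re z \<and> Re z < 1}"
        by (intro open_Collect_conj open_Collect_less continuous_intros)
      then have ev: "\<forall>\<^sub>F w in at z. 0 < Re w \<and> Re w < 1"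
        using z by (intro eventually_at_topological[THEN iffD2]) auto
      have "((\<lambda>w. (coord (F w) l - coord (F z) l) / (w - z) - coord v l) \<longlongrightarrow> 0) (at z)"
      proof (rule Lim_null_comparison)
        show "\<forall>\<^sub>F w in at z. norm ((coord (F w) l - coord (F z) l) / (w - z) - coord v l)
            \<le> 2 ^ Suc (length l) * K (scl (1 / (w - z)) (F w - F z) - v)"
          using ev
        proof eventually_elim
          case (elim w)
          then have "w \<in> strip" by (simp add: strip_def)
          from K_coord[OF V_diff[OF V_scl[OF V_diff[OF FV[OF this] FV[OF zs]], of "1 / (w - z)"] v(1)], of l]
          show ?case by (simp add: coord_diff coord_scl)
        qed
        show "((\<lambda>w. 2 ^ Suc (length l) * K (scl (1 / (w - z)) (F w - F z) - v)) \<longlongrightarrow> 0) (at z)"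
          by (rule tendsto_mult_right_zero[OF v(2)])
      qed
      then have "((\<lambda>w. (coord (F w) l - coord (F z) l) / (w - z)) \<longlongrightarrow> coord v l) (at z)" by (rule LIM_zero_cancel)
      then show ?thesis by (auto simp: has_field_derivative_iff)
    qed
    moreover have "open {z. 0 < Re z \<and> Re z < 1}"
      by (intro open_Collect_conj open_Collect_less continuous_intros)
    ultimately show ?thesis by (auto simp: holomorphic_on_open)
  qed
  define f where "f = coord (F (of_real \<theta>))"
  define \<phi> where "\<phi> b = (if b then p else q)" for b
  define \<phi>0 where "\<phi>0 b = (if b then p0 else q0)" for b
  define conj where "conj r = r / (r - 1)" for r :: real
  have conj: "1 < conj r" "1 / r + 1 / conj r = 1" if "1 < r" for r
    using that by (auto simp: conj_def field_simps)
  have level: "mixed_norm (exps p q n) f \<le> M" for n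
  proof -
    define es where "es = exps True False n"
    have ex: "exps p q n = map \<phi> es" "exps p0 q0 n = map \<phi>0 es" "exps 2 2 n = map (\<lambda>_. 2) es" "length es = 2 * n"
      by (simp_all add: es_def map_exps \<phi>_def \<phi>0_def)
    have phi: "1 < \<phi> e" "1 < \<phi>0 e" "1 / \<phi> e = (1 - \<theta>) / \<phi>0 e + \<theta> / 2" for e
      using pq pq0 p_eq q_eq by (auto simp: \<phi>_def \<phi>0_def)
    define \<psi> where "\<psi> e = conj (\<phi> e)" for e
    define \<psi>0 where "\<psi>0 e = conj (\<phi>0 e)" for e
    have psi: "1 < \<psi> e" "1 < \<psi>0 e" "1 / \<phi> e + 1 / \<psi> e = 1" "1 / \<phi>0 e + 1 / \<psi>0 e = 1" for e
      unfolding \<psi>_def \<psi>0_def by (rule conj phi)+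
    \<comment> \<open>The conjugate exponents satisfy the same relation, so that the dual function
      can be factorized as well.\<close>
    have psi_eq: "1 / \<psi> e = (1 - \<theta>) / \<psi>0 e + \<theta> / 2" for e
    proof -
      have "1 / \<psi> e = 1 - ((1 - \<theta>) * (1 / \<phi>0 e) + \<theta> / 2)" using psi(3)[of e] phi(3)[of e] by simp
      also have "1 / \<phi>0 e = 1 - 1 / \<psi>0 e" using psi(4)[of e] by simp
      finally show ?thesis by (simp add: algebra_simps)
    qed
    obtain k :: "bool list \<Rightarrow> real" where k: "\<And>l. 0 \<le> k l" "mixed_norm (map \<psi> es) k \<le> 1"
      "lmean (length es) (\<lambda>l. norm (f l) * k l) = mixed_norm (map \<phi> es) f"
      using mixed_norm_dual_attained[of es \<phi> \<psi> f] phi psi by auto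
    have "\<forall>e\<in>set es. 1 \<le> \<psi> e \<and> 1 \<le> \<psi>0 e \<and> 1 \<le> (2::real) \<and> 1 / \<psi> e = (1 - \<theta>) / \<psi>0 e + \<theta> / 2"
      using psi psi_eq by (simp add: less_imp_le)
    from calderon_factorization[OF th this, of k] obtain k0 k1 :: "bool list \<Rightarrow> real" where
      k01: "\<forall>l. 0 \<le> k0 l \<and> 0 \<le> k1 l"
      "\<forall>l. length l = length es \<longrightarrow> norm (k l) = k0 l powr (1 - \<theta>) * k1 l powr \<theta>"
      "mixed_norm (map \<psi>0 es) k0 \<le> mixed_norm (map \<psi> es) k"
      "mixed_norm (map (\<lambda>_. 2) es) k1 \<le> mixed_norm (map \<psi> es) k"
      by (elim exE conjE)
    from k01(1) have k01_nonneg: "0 \<le> k0 l" "0 \<le> k1 l" for l by auto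
    define g where "g z l = cnj (sgn (f l)) * cpow (k0 l) (1 - z) * cpow (k1 l) z" for z l
    define G where "G z = lmean (2 * n) (\<lambda>l. coord (F z) l * g z l)" for z
    have ng: "norm (g z l) \<le> k0 l powr (1 - Re z) * k1 l powr Re z" for z l
      using k01_nonneg[of l] by (auto simp: g_def norm_mult norm_cpow norm_sgn)
    \<comment> \<open>A crude bound: the maximum principle asks for some bound on the whole strip,
      whatever its size.\<close>
    define B' where "B' = (\<Sum>l | length l = 2 * n. 2 ^ Suc (2 * n) * B * ((1 + k0 l) * (1 + k1 l)))"
    have "norm (G (of_real \<theta>)) \<le> M"
    proof (rule strip_maximum[where G = G and B = B'])
      show "continuous_on {z. 0 \<le> Re z \<and> Re z \<le> 1} G"
        unfolding G_def g_def strip_def[symmetric]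
        by (intro continuous_on_lmean continuous_intros ccont continuous_cpow)
      show "G holomorphic_on {z. 0 < Re z \<and> Re z < 1}"
        unfolding G_def g_def
        by (intro holomorphic_on_lmean holomorphic_on_mult chol holomorphic_cpow holomorphic_intros)
      show "norm (G z) \<le> B'" if z: "0 \<le> Re z" "Re z \<le> 1" for z
        unfolding G_def
      proof (rule norm_lmean_le)
        fix l :: "bool list" assume l: "length l = 2 * n"
        have zs: "z \<in> strip" using z by (simp add: strip_def)
        have "norm (coord (F z) l) \<le> 2 ^ Suc (2 * n) * B"
          using K_coord[OF FV[OF zs], of l] B[OF zs] l by (smt (verit) mult_left_mono zero_le_power)
        moreover have "norm (g z l) \<le> (1 + k0 l) * (1 + k1 l)"
          using ng[of z l] k01_nonneg[of l] z
          by (intro order_trans[OF ng] mult_mono powr_le_one_plus) auto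
        ultimately have "norm (coord (F z) l * g z l) \<le> 2 ^ Suc (2 * n) * B * ((1 + k0 l) * (1 + k1 l))"
          unfolding norm_mult using Bn by (intro mult_mono) auto
        also have "\<dots> \<le> B'" unfolding B'_def
          using l Bn k01_nonneg finite_bool_lists[of "2 * n"]
          by (intro member_le_sum[of l "{l. length l = 2 * n}" "\<lambda>l. 2 ^ Suc (2 * n) * B * ((1 + k0 l) * (1 + k1 l))"]) auto
        finally show "norm (coord (F z) l * g z l) \<le> B'" .
      qed
      show "norm (G (Complex 0 t)) \<le> M" for t
      proof -
        have "norm (G (Complex 0 t)) \<le> mixed_norm (map \<phi>0 es) (coord (F (Complex 0 t))) * mixed_norm (map \<psi>0 es) (g (Complex 0 t))"
          unfolding G_def ex(4)[symmetric] using phi psi by (intro mixed_norm_holder) auto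
        also have "mixed_norm (map \<psi>0 es) (g (Complex 0 t)) \<le> mixed_norm (map \<psi>0 es) k0"
        proof (rule mixed_norm_mono)
          show "\<forall>r\<in>set (map \<psi>0 es). 0 < r" using psi(2) less_trans[OF zero_less_one] by auto
          \<comment> \<open>On this line the factor from k1 has modulus 1, or 0 where
            \<open>k1 l = 0\<close>.\<close>
          show "norm (g (Complex 0 t) l) \<le> norm (k0 l)" for l
            using ng[of "Complex 0 t" l] k01_nonneg[of l] by (cases "k1 l = 0") auto
        qed
        then have "mixed_norm (map \<phi>0 es) (coord (F (Complex 0 t))) * mixed_norm (map \<psi>0 es) (g (Complex 0 t))
            \<le> M * 1"
          using k01(3) k(2) M0[of t] Mn level_le_bnorm[OF exps_le(3,4) mart_spaceD(1)[OF exps_le(3,4) F0[of t]], of n]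
          by (intro mult_mono) (auto simp: mart_norm_def ex)
        finally show ?thesis by simp
      qed
      show "norm (G (Complex 1 t)) \<le> M" for t
      proof -
        have "norm (G (Complex 1 t)) \<le> mixed_norm (map (\<lambda>_. 2) es) (coord (F (Complex 1 t))) * mixed_norm (map (\<lambda>_. 2) es) (g (Complex 1 t))"
          unfolding G_def ex(4)[symmetric] by (intro mixed_norm_holder) auto
        also have "mixed_norm (map (\<lambda>_. 2) es) (g (Complex 1 t)) \<le> mixed_norm (map (\<lambda>_. 2) es) k1"
        proof (rule mixed_norm_mono)
          show "norm (g (Complex 1 t) l) \<le> norm (k1 l)" for l
            using ng[of "Complex 1 t" l] k01_nonneg[of l] by (cases "k0 l = 0") auto
        qed auto
        then have "mixed_norm (map (\<lambda>_. 2) es) (coord (F (Complex 1 t))) * mixed_norm (map (\<lambda>_. 2) es) (g (Complex 1 t))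
            \<le> M * 1"
          using k01(4) k(2) M1[of t] Mn level_le_bnorm[OF exps_le(5,5) mart_spaceD(1)[OF exps_le(5,5) F1[of t]], of n]
          by (intro mult_mono) (auto simp: mart_norm_def ex)
        finally show ?thesis by simp
      qed
    qed (use th in auto)
    moreover have "G (of_real \<theta>) = of_real (mixed_norm (exps p q n) f)"
    proof -
      have "coord (F (of_real \<theta>)) l * g (of_real \<theta>) l = of_real (norm (f l) * k l)" if l: "length l = length es" for l
      proof -
        have "f l * cnj (sgn (f l)) = of_real (norm (f l))"
        proof -
          have "f l = norm (f l) * sgn (f l)" by (simp add: sgn_eq)
          then have "f l * cnj (sgn (f l)) = of_real (norm (f l)) * (sgn (f l) * cnj (sgn (f l)))"
            by (metis mult.assoc)
          also have "sgn (f l) * cnj (sgn (f l)) = of_real ((norm (sgn (f l)))\<^sup>2)" by (simp only: complex_norm_square)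
          finally show ?thesis by (cases "f l = 0") (simp_all add: norm_sgn)
        qed
        moreover have "cpow (k0 l) (1 - of_real \<theta>) * cpow (k1 l) (of_real \<theta>) = of_real (k l)"
        proof -
          have "cpow (k0 l) (of_real (1 - \<theta>)) * cpow (k1 l) (of_real \<theta>) = of_real (k0 l powr (1 - \<theta>) * k1 l powr \<theta>)"
            using k01_nonneg[of l] by (simp only: cpow_of_real of_real_mult)
          also have "k0 l powr (1 - \<theta>) * k1 l powr \<theta> = k l" using k01(2)[rule_format, OF l] k(1)[of l] by simp
          finally show ?thesis by simp
        qed
        ultimately show ?thesis by (simp add: g_def f_def mult.assoc flip: f_def)
      qed
      then have "G (of_real \<theta>) = lmean (length es) (\<lambda>l. of_real (norm (f l) * k l))"
        unfolding G_def ex(4)[symmetric] by (rule lmean_cong)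
      then show ?thesis by (simp only: lmean_of_real k(3) ex(1))
    qed
    ultimately show ?thesis by simp
  qed
  have Vth: "mart f" "amb f = F (of_real \<theta>)" using V_amb[OF FV[OF thS]] by (auto simp: f_def)
  have fb: "f \<in> bmart p q" by (rule bmartI[OF exps_le(1,2) Vth(1) level])
  show "F (of_real \<theta>) \<in> mart_space p q" using mart_spaceI[OF exps_le(1,2) fb] Vth(2) by simp
  show "mart_norm p q (F (of_real \<theta>)) \<le> strip_norm N0 N1 F"
    unfolding mart_norm_def M_def[symmetric] f_def[symmetric] by (rule bnorm_le[OF exps_le(1,2) level])
qed

end


section \<open>Functions on finite levels\<close>

text \<open>The martingale with values h at length m: longer words forget their newest bits, shorter
  ones average over the missing bits. Truncated subtraction makes one of the two operations
  trivial.\<close>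

definition ext :: "nat \<Rightarrow> (bool list \<Rightarrow> complex) \<Rightarrow> bool list \<Rightarrow> complex" where
  "ext m h l = lmean (m - length l) (\<lambda>u. h (drop (length l - m) (u @ l)))"

lemma ext_ge: "m \<le> length l \<Longrightarrow> ext m h l = h (drop (length l - m) l)"
  by (simp add: ext_def)

lemma ext_le: "length l \<le> m \<Longrightarrow> ext m h l = lmean (m - length l) (\<lambda>u. h (u @ l))"
  by (simp add: ext_def)

lemma ext_cong: "(\<And>l. length l = m \<Longrightarrow> h l = h' l) \<Longrightarrow> ext m h l = ext m h' l"
  unfolding ext_def by (rule lmean_cong) auto

lemma ext_add: "ext m (\<lambda>l. h l + h' l) l = ext m h l + ext m h' l"
  by (simp add: ext_def lmean_add)

lemma ext_cmult: "ext m (\<lambda>l. c * h l) l = c * ext m h l"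
  by (simp add: ext_def lmean_cmult)

lemma ext_diff: "ext m (\<lambda>l. h l - h' l) l = ext m h l - ext m h' l"
  using ext_add[of m h "\<lambda>l. - 1 * h' l" l] ext_cmult[of m "- 1" h' l] by simp

text \<open>A martingale grows at the head of l, which adjoins the end of u in \<open>u @ l\<close>;
  so the mean has to be split at the last bit.\<close>

lemma lmean_snoc: "lmean (Suc n) g = (lmean n (\<lambda>u. g (u @ [True])) + lmean n (\<lambda>u. g (u @ [False]))) / 2"
proof (induction n arbitrary: g)
  case (Suc n)
  have IH: "lmean (Suc n) (\<lambda>l. g (s # l)) = (lmean n (\<lambda>u. g (s # u @ [True])) + lmean n (\<lambda>u. g (s # u @ [False]))) / 2" for s
    by (rule Suc.IH)
  show ?case
    by (simp only: lmean.simps(2)[of "Suc n" g] IH lmean.simps(2)[of n "\<lambda>u. g (u @ [True])"]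
        lmean.simps(2)[of n "\<lambda>u. g (u @ [False])"] append_Cons) (simp add: field_simps)
qed simp

lemma mart_ext: "mart (ext m h)"
  unfolding mart_def
proof
  fix l
  show "ext m h l = (ext m h (True # l) + ext m h (False # l)) / 2"
  proof (cases "m \<le> length l")
    case True
    then have "drop (length (s # l) - m) (s # l) = drop (length l - m) l" for s
      by (simp add: Suc_diff_le)
    then show ?thesis using True by (simp add: ext_ge)
  next
    case False
    then have m: "m - length l = Suc (m - length (s # l))" for s :: bool by simp
    show ?thesis using False
      by (simp add: ext_le) (subst m[of True], subst lmean_snoc, simp)
  qed
qed

lemma lmean_mart: "mart f \<Longrightarrow> lmean n (\<lambda>u. f (u @ l)) = f l"
proof (induction n)
  case (Suc n)
  have "lmean (Suc n) (\<lambda>u. f (u @ l)) = lmean n (\<lambda>u. (1/2) * (f (True # u @ l) + f (False # u @ l)))"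
    unfolding lmean_cmult lmean_add by simp
  also have "\<dots> = lmean n (\<lambda>u. f (u @ l))"
    using martD[OF Suc.prems] by (intro lmean_cong) simp
  finally show ?case using Suc by simp
qed simp

lemma ext_mart: "mart f \<Longrightarrow> length l \<le> m \<Longrightarrow> ext m f l = f l"
  by (simp add: ext_le lmean_mart)

lemma ext_ext: "n \<le> m \<Longrightarrow> ext m (ext n f) = ext n f"
proof
  fix l assume nm: "n \<le> m"
  show "ext m (ext n f) l = ext n f l"
  proof (cases "length l \<le> m")
    case True
    then show ?thesis by (rule ext_mart[OF mart_ext])
  next
    case False
    then have "length l - m \<le> length l" "m - n + (length l - m) = length l - n" using nm by auto
    then show ?thesis using nm False by (simp add: ext_ge)
  qed
qed

context
  fixes p q :: real
  assumes pq: "1 \<le> p" "1 \<le> q"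
begin

lemma level_ext: "n \<le> k \<Longrightarrow> mixed_norm (exps p q k) (ext (2 * n) h) = mixed_norm (exps p q n) h"
proof (induction k rule: dec_induct)
  case base
  show ?case by (rule mixed_norm_cong) (simp add: ext_ge)
next
  case (step k)
  have "mixed_norm (exps p q k) (\<lambda>l. ext (2 * n) h (s # t # l)) = mixed_norm (exps p q k) (ext (2 * n) h)" for s t
  proof (rule mixed_norm_cong)
    fix l :: "bool list" assume "length l = length (exps p q k)"
    then have l: "length l = 2 * k" by simp
    then have "length (s # t # l) - 2 * n = Suc (Suc (length l - 2 * n))" using step by simp
    then show "ext (2 * n) h (s # t # l) = ext (2 * n) h l" using l step by (simp add: ext_ge)
  qed
  then show ?case using step pq by simp
qed

lemma ext_bmart: "ext (2 * n) h \<in> bmart p q" "bnorm p q (ext (2 * n) h) = mixed_norm (exps p q n) h"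
proof -
  have le: "mixed_norm (exps p q k) (ext (2 * n) h) \<le> mixed_norm (exps p q n) h" for k
    using level_mono[OF pq mart_ext, of k "max n k" "2 * n" h] level_ext[of n "max n k" h] by simp
  show b: "ext (2 * n) h \<in> bmart p q" by (rule bmartI[OF pq mart_ext le])
  show "bnorm p q (ext (2 * n) h) = mixed_norm (exps p q n) h"
    using bnorm_le[OF pq le] level_le_bnorm[OF pq b, of n] level_ext[of n n h] by simp
qed

end

text \<open>Norm convergence of bounded martingales. The midpoint u of f and its n-th level agrees
  with f on level n, so its norm is at least the n-th level norm, while f and its n-th level have
  norm at most A. As the level norms tend to A, uniform convexity squeezes the half difference v to
  0.\<close>

lemma bmart_ext_tendsto:
  assumes pq: "1 < p" "1 < q" and f: "f \<in> bmart p q"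
  shows "(\<lambda>n. bnorm p q (\<lambda>l. f l - ext (2 * n) f l)) \<longlonglongrightarrow> 0"
proof -
  have pq1: "1 \<le> p" "1 \<le> q" using pq by auto
  define a b where "a = min 2 (min p q)" "b = max 2 (max p q)"
  have ab: "1 < a" "a \<le> 2" "2 \<le> b" "a \<le> p" "a \<le> q" "p \<le> b" "q \<le> b"
    using pq by (auto simp: a_b_def)
  define c where "c = a * (a - 1) / 2"
  have c: "c > 0" using ab by (simp add: c_def)
  define A where "A = bnorm p q f"
  have A: "A \<ge> 0" unfolding A_def by (rule bnorm_nonneg[OF pq1 f])
  define r where "r n = 2 * ((A powr b - mixed_norm (exps p q n) f powr b) / c) powr (1/b)" for n
  have E: "ext (2 * n) f \<in> bmart p q" "bnorm p q (ext (2 * n) f) = mixed_norm (exps p q n) f" for n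
    by (rule ext_bmart[OF pq1])+
  have an: "mixed_norm (exps p q n) f \<le> A" for n unfolding A_def by (rule level_le_bnorm[OF pq1 f])
  have le: "bnorm p q (\<lambda>l. f l - ext (2 * n) f l) \<le> r n" for n
  proof -
    define u where "u l = (1/2) * (f l + ext (2 * n) f l)" for l
    define v where "v l = (1/2) * (f l - ext (2 * n) f l)" for l
    have ub: "u \<in> bmart p q" unfolding u_def by (intro bmart_cmult(1)[OF pq1] bmart_add(1)[OF pq1] f E)
    have vb: "v \<in> bmart p q" unfolding v_def by (intro bmart_cmult(1)[OF pq1] bmart_diff[OF pq1] f E)
    have vm: "mixed_norm (exps p q m) v \<le> ((A powr b - mixed_norm (exps p q n) f powr b) / c) powr (1/b)" if "n \<le> m" for m
    proof -
      have "mixed_norm (exps p q n) f = mixed_norm (exps p q n) u"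
        by (rule mixed_norm_cong) (simp add: u_def ext_ge)
      also have "\<dots> \<le> mixed_norm (exps p q m) u"
        using level_mono[OF pq1 bmart_mart[OF pq1 ub] that] .
      finally have 1: "mixed_norm (exps p q n) f powr b \<le> mixed_norm (exps p q m) u powr b"
        using ab by (intro powr_mono2) auto
      have "mixed_norm (exps p q m) (\<lambda>l. if \<sigma> then u l + v l else u l - v l) \<le> A" for \<sigma>
      proof -
        have "(\<lambda>l. if \<sigma> then u l + v l else u l - v l) = (if \<sigma> then f else ext (2 * n) f)"
          by (auto simp: u_def v_def fun_eq_iff field_simps)
        moreover have "mixed_norm (exps p q m) (ext (2 * n) f) \<le> A"
          using level_le_bnorm[OF pq1 E(1), of m n] E(2)[of n] an[of n] by linarith
        ultimately show ?thesis using an[of m] by auto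
      qed
      then have "D_norm a (\<lambda>\<sigma>. mixed_norm (exps p q m) (\<lambda>l. if \<sigma> then u l + v l else u l - v l)) \<le> D_norm a (\<lambda>_. A)"
        using ab by (intro D_norm_mono) (auto intro: order_trans[OF _ abs_ge_self])
      then have 2: "D_norm a (\<lambda>\<sigma>. mixed_norm (exps p q m) (\<lambda>l. if \<sigma> then u l + v l else u l - v l)) powr b \<le> A powr b"
        using ab A by (intro powr_mono2) auto
      have "mixed_norm (exps p q m) u powr b + c * mixed_norm (exps p q m) v powr b
        \<le> D_norm a (\<lambda>\<sigma>. mixed_norm (exps p q m) (\<lambda>l. if \<sigma> then u l + v l else u l - v l)) powr b"
        unfolding c_def using ab ball_exps[of "\<lambda>r. a \<le> r \<and> r \<le> b" p q m] by (intro mixed_norm_convexity) auto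
      then have "mixed_norm (exps p q m) v powr b \<le> (A powr b - mixed_norm (exps p q n) f powr b) / c"
        using 1 2 c by (simp add: field_simps)
      then have "(mixed_norm (exps p q m) v powr b) powr (1/b) \<le> ((A powr b - mixed_norm (exps p q n) f powr b) / c) powr (1/b)"
        using ab by (intro powr_mono2) auto
      then show ?thesis using ab by (simp add: powr_powr)
    qed
    have "bnorm p q v \<le> ((A powr b - mixed_norm (exps p q n) f powr b) / c) powr (1/b)"
    proof (rule bnorm_le[OF pq1])
      fix m
      have "mixed_norm (exps p q m) v \<le> mixed_norm (exps p q (max n m)) v"
        using level_mono[OF pq1 bmart_mart[OF pq1 vb]] by simp
      also have "\<dots> \<le> ((A powr b - mixed_norm (exps p q n) f powr b) / c) powr (1/b)" by (rule vm) simp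
      finally show "mixed_norm (exps p q m) v \<le> ((A powr b - mixed_norm (exps p q n) f powr b) / c) powr (1/b)" .
    qed
    moreover have "bnorm p q v = 1/2 * bnorm p q (\<lambda>l. f l - ext (2 * n) f l)"
      unfolding v_def by (subst bmart_cmult(2)[OF pq1 bmart_diff[OF pq1 f E(1)]]) (simp add: norm_divide)
    ultimately show ?thesis by (simp add: r_def)
  qed
  have "(\<lambda>n. mixed_norm (exps p q n) f powr b) \<longlonglongrightarrow> A powr b"
    unfolding A_def using ab by (intro tendsto_powr' tendsto_const level_tendsto_bnorm[OF pq1 f]) auto
  then have "(\<lambda>n. (A powr b - mixed_norm (exps p q n) f powr b) / c) \<longlonglongrightarrow> (A powr b - A powr b) / c"
    using c by (intro tendsto_divide tendsto_diff tendsto_const) auto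
  moreover have "0 \<le> (A powr b - mixed_norm (exps p q n) f powr b) / c" for n
    using an[of n] ab c by (auto intro!: divide_nonneg_nonneg powr_mono2)
  ultimately have "(\<lambda>n. ((A powr b - mixed_norm (exps p q n) f powr b) / c) powr (1/b)) \<longlonglongrightarrow> ((A powr b - A powr b) / c) powr (1/b)"
    using ab by (intro tendsto_powr' tendsto_const) auto
  from tendsto_mult_left[OF this, of 2] have r0: "r \<longlonglongrightarrow> 0" unfolding r_def by simp
  have nb: "norm (bnorm p q (\<lambda>l. f l - ext (2 * n) f l)) \<le> r n" for n
    using le[of n] bnorm_nonneg[OF pq1 bmart_diff[OF pq1 f E(1)], of n] by simp
  show ?thesis
    by (rule Lim_null_comparison[OF always_eventually r0]) (rule allI, rule nb)
qed

text \<open>Factorization needs finite levels. Telescoping along rapidly chosen levels loses at most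
  \<open>\<delta>\<close> in the norm, as an isometric identification demands.\<close>

lemma bmart_decomposition:
  assumes pq: "1 < p" "1 < q" and f: "f \<in> bmart p q" and \<delta>: "\<delta> > 0"
  shows "\<exists>n h. (\<forall>l. (\<lambda>k. ext (2 * n k) (h k) l) sums f l) \<and>
    summable (\<lambda>k. mixed_norm (exps p q (n k)) (h k)) \<and>
    (\<Sum>k. mixed_norm (exps p q (n k)) (h k)) \<le> bnorm p q f + \<delta>"
proof -
  have pq1: "1 \<le> p" "1 \<le> q" using pq by auto
  have "\<exists>N. \<forall>n\<ge>N. bnorm p q (\<lambda>l. f l - ext (2 * n) f l) < \<delta> / 2 ^ (k + 2)" for k
  proof -
    have "0 < \<delta> / 2 ^ (k + 2)" using \<delta> by simp
    from order_tendstoD(2)[OF bmart_ext_tendsto[OF pq f] this] show ?thesis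
      by (simp add: eventually_sequentially)
  qed
  then obtain N where N: "\<And>k n. n \<ge> N k \<Longrightarrow> bnorm p q (\<lambda>l. f l - ext (2 * n) f l) < \<delta> / 2 ^ (k + 2)" by metis
  \<comment> \<open>Summation makes the levels increase and keeps \<open>n k\<close> above both
    \<open>N k\<close> and k.\<close>
  define n where "n k = (\<Sum>j\<le>k. Suc (N j))" for k
  have nN: "N k \<le> n k" for k
  proof -
    have "Suc (N k) \<le> n k" unfolding n_def by (rule member_le_sum) auto
    then show ?thesis by simp
  qed
  have nmono: "n k \<le> n (Suc k)" for k by (simp add: n_def)
  have nk: "k \<le> n k" for k by (induction k) (auto simp: n_def)
  define E where "E k = ext (2 * n k) f" for k
  have Eb: "E k \<in> bmart p q" for k unfolding E_def by (rule ext_bmart[OF pq1])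
  \<comment> \<open>Not yet restricted to a level: extending \<open>f - E j\<close> from level
    \<open>n (Suc j)\<close> gives the telescoping term \<open>E (Suc j) - E j\<close>.\<close>
  define h where "h k = (case k of 0 \<Rightarrow> f | Suc j \<Rightarrow> (\<lambda>l. f l - E j l))" for k
  have T: "ext (2 * n (Suc k)) (h (Suc k)) l = E (Suc k) l - E k l" for k l
    using ext_ext[of "2 * n k" "2 * n (Suc k)" f] nmono[of k] by (simp add: h_def ext_diff E_def)
  have T0: "ext (2 * n 0) (h 0) l = E 0 l" for l by (simp add: h_def E_def)
  have part: "(\<Sum>k<Suc m. ext (2 * n k) (h k) l) = E m l" for m l
    by (induction m) (simp_all add: T T0)
  have sums: "(\<lambda>k. ext (2 * n k) (h k) l) sums f l" for l
  proof -
    have "eventually (\<lambda>m. f l = (\<Sum>k<Suc m. ext (2 * n k) (h k) l)) sequentially"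
      unfolding part E_def
    proof (rule eventually_sequentiallyI)
      fix m assume "length l \<le> m"
      then have "length l \<le> 2 * n m" using nk[of m] by linarith
      then show "f l = ext (2 * n m) f l" using ext_mart[OF bmart_mart[OF pq1 f]] by simp
    qed
    then have "(\<lambda>m. \<Sum>k<Suc m. ext (2 * n k) (h k) l) \<longlonglongrightarrow> f l"
      by (rule tendsto_eventually[OF eventually_mono]) simp
    then show ?thesis unfolding sums_def by (rule LIMSEQ_imp_Suc)
  qed
  define c where "c k = mixed_norm (exps p q (n k)) (h k)" for k
  have c0: "c 0 \<le> bnorm p q f" unfolding c_def h_def using level_le_bnorm[OF pq1 f] by simp
  have cS: "c (Suc k) \<le> \<delta> * (1/2) ^ Suc k" for k
  proof -
    have "c (Suc k) = bnorm p q (ext (2 * n (Suc k)) (h (Suc k)))"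
      unfolding c_def by (rule ext_bmart(2)[OF pq1, symmetric])
    also have "ext (2 * n (Suc k)) (h (Suc k)) = (\<lambda>l. (f l - E k l) + - 1 * (f l - E (Suc k) l))"
      by (simp add: fun_eq_iff T)
    also have "bnorm p q \<dots> \<le> bnorm p q (\<lambda>l. f l - E k l) + bnorm p q (\<lambda>l. - 1 * (f l - E (Suc k) l))"
      by (intro bmart_add(2)[OF pq1] bmart_cmult(1)[OF pq1] bmart_diff[OF pq1] f Eb)
    also have "bnorm p q (\<lambda>l. - 1 * (f l - E (Suc k) l)) = bnorm p q (\<lambda>l. f l - E (Suc k) l)"
      using bmart_cmult(2)[OF pq1 bmart_diff[OF pq1 f Eb], of "- 1"] by simp
    also have "bnorm p q (\<lambda>l. f l - E k l) + bnorm p q (\<lambda>l. f l - E (Suc k) l) \<le> \<delta> / 2 ^ (k + 2) + \<delta> / 2 ^ (Suc k + 2)"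
      unfolding E_def by (intro add_mono less_imp_le N nN)
    also have "\<dots> \<le> \<delta> * (1/2) ^ Suc k" using \<delta> by (simp add: power_divide field_simps)
    finally show ?thesis .
  qed
  have geo: "(\<lambda>k. \<delta> * (1/2) ^ Suc k) sums (\<delta> * 1)" by (intro sums_mult power_half_series)
  have c_nonneg: "0 \<le> c k" for k by (simp add: c_def)
  have sumS: "summable (\<lambda>k. c (Suc k))"
    by (rule summable_comparison_test'[OF sums_summable[OF geo]]) (use cS c_nonneg in auto)
  then have sum: "summable c" by (simp add: summable_Suc_iff)
  have "suminf c = c 0 + (\<Sum>k. c (Suc k))" using suminf_split_head[OF sum] by simp
  also have "(\<Sum>k. c (Suc k)) \<le> \<delta>"
    using suminf_le[OF cS sumS sums_summable[OF geo]] sums_unique[OF geo] by simp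
  finally have "suminf c \<le> bnorm p q f + \<delta>" using c0 by linarith
  then show ?thesis using sums sum unfolding c_def
    by (intro exI[of _ n] exI[of _ h] conjI allI) auto
qed


section \<open>Interpolation: construction of analytic functions\<close>

text \<open>Sums are taken coordinatewise in the ambient space, so that a series has the same sum in
  both members of the couple and in their sum space.\<close>

definition series :: "(nat \<Rightarrow> nat \<Rightarrow>\<^sub>C complex) \<Rightarrow> nat \<Rightarrow>\<^sub>C complex" where
  "series x = amb (\<lambda>l. \<Sum>k. coord (x k) l)"

definition countably_subadditive :: "(nat \<Rightarrow>\<^sub>C complex) set \<Rightarrow> ((nat \<Rightarrow>\<^sub>C complex) \<Rightarrow> real) \<Rightarrow> bool" where
  "countably_subadditive S N \<longleftrightarrow> (\<forall>x. (\<forall>k. x k \<in> S) \<and> summable (\<lambda>k. N (x k)) \<longrightarrow>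
     series x \<in> S \<and> N (series x) \<le> (\<Sum>k. N (x k)))"

lemma countably_subadditive_mart_space:
  assumes "1 \<le> p" "1 \<le> q"
  shows "countably_subadditive (mart_space p q) (mart_norm p q)"
  unfolding countably_subadditive_def series_def
proof (intro allI impI, elim conjE)
  fix x assume x: "\<forall>k. x k \<in> mart_space p q" "summable (\<lambda>k. mart_norm p q (x k))"
  then have "coord (x k) \<in> bmart p q" for k using mart_spaceD(1)[OF assms] by blast
  from mart_space_suminf[OF assms this] x(2)
  show "amb (\<lambda>l. \<Sum>k. coord (x k) l) \<in> mart_space p q \<and>
      mart_norm p q (amb (\<lambda>l. \<Sum>k. coord (x k) l)) \<le> (\<Sum>k. mart_norm p q (x k))"
    by (simp add: mart_norm_def)
qed

text \<open>Dominated convergence for series (Tannery's theorem), with \<open>M\<close> as the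
  majorant.\<close>

lemma series_tendsto_0:
  assumes csub: "countably_subadditive S N" and N: "\<And>x. x \<in> S \<Longrightarrow> 0 \<le> N x"
    and ev: "\<forall>\<^sub>F w in F. \<forall>k. x w k \<in> S \<and> N (x w k) \<le> M k" and M: "summable M"
    and lim: "\<And>k. ((\<lambda>w. N (x w k)) \<longlongrightarrow> 0) F"
  shows "((\<lambda>w. N (series (x w))) \<longlongrightarrow> 0) F"
proof (cases "F = bot")
  case False
  have "\<forall>\<^sub>F (k, w) in at_top \<times>\<^sub>F F. norm (N (x w k)) \<le> M k"
    unfolding eventually_prod_filter
    by (rule exI[of _ "\<lambda>_. True"], rule exI[of _ "\<lambda>w. \<forall>k. x w k \<in> S \<and> N (x w k) \<le> M k"])
      (use ev N in auto)
  from tannerys_theorem[of "\<lambda>k w. N (x w k)" "\<lambda>_. 0", OF lim this M False]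
  have "((\<lambda>w. \<Sum>k. N (x w k)) \<longlongrightarrow> 0) F" by simp
  moreover have "\<forall>\<^sub>F w in F. norm (N (series (x w))) \<le> (\<Sum>k. N (x w k))"
    using ev
  proof eventually_elim
    case (elim w)
    have "summable (\<lambda>k. N (x w k))"
      by (rule summable_comparison_test'[OF M]) (use elim N in auto)
    then have "series (x w) \<in> S \<and> N (series (x w)) \<le> (\<Sum>k. N (x w k))"
      using csub elim unfolding countably_subadditive_def by blast
    then show ?case using N by auto
  qed
  ultimately show ?thesis by (rule Lim_null_comparison[rotated])
qed simp

text \<open>The derivative of Calderon's function contains the logarithm t of the ratio of the two
  end values; away from the boundary lines the exponential absorbs it.\<close>

lemma abs_times_exp_le:
  fixes t x r :: real
  assumes "0 < r" "r \<le> x" "x \<le> 1 - r"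
  shows "\<bar>t\<bar> * exp (x * t) \<le> 1 / r * (1 + exp t)"
proof -
  have "r * \<bar>t\<bar> \<le> exp (r * \<bar>t\<bar>)" using exp_ge_add_one_self[of "r * \<bar>t\<bar>"] by linarith
  then have "r * \<bar>t\<bar> * exp (x * t) \<le> exp (r * \<bar>t\<bar>) * exp (x * t)" by (intro mult_right_mono) auto
  also have "\<dots> = exp (r * \<bar>t\<bar> + x * t)" by (simp add: exp_add)
  also have "\<dots> \<le> 1 + exp t"
  proof (cases "t \<ge> 0")
    case True
    then have "(r + x) * t \<le> 1 * t" using assms by (intro mult_right_mono) auto
    then have "exp (r * \<bar>t\<bar> + x * t) \<le> exp t" using True by (simp add: algebra_simps)
    then show ?thesis by linarith
  next
    case False
    then have "(x - r) * t \<le> 0" using assms by (intro mult_nonneg_nonpos) auto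
    then have "exp (r * \<bar>t\<bar> + x * t) \<le> 1" using False by (simp add: algebra_simps)
    then show ?thesis using exp_ge_zero[of t] by linarith
  qed
  finally show ?thesis using assms by (simp add: field_simps)
qed

text \<open>Calderon's analytic function on the strip; \<open>dcald\<close> is its derivative.\<close>

definition cald :: "complex \<Rightarrow> real \<Rightarrow> real \<Rightarrow> complex \<Rightarrow> complex" where
  "cald s a b z = s * cpow a (1 - z) * cpow b z"

definition dcald :: "complex \<Rightarrow> real \<Rightarrow> real \<Rightarrow> complex \<Rightarrow> complex" where
  "dcald s a b z = of_real (ln b - ln a) * cald s a b z"

lemma cald_deriv: "(cald s a b has_field_derivative dcald s a b z) (at z)"
proof (cases "a = 0 \<or> b = 0")
  case True
  then have "cald s a b = (\<lambda>_. 0)" "dcald s a b z = 0" by (auto simp: cald_def dcald_def cpow_def)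
  then show ?thesis by simp
next
  case False
  then have "cald s a b = (\<lambda>z. s * exp ((1 - z) * of_real (ln a)) * exp (z * of_real (ln b)))"
    by (simp add: cald_def cpow_def fun_eq_iff)
  then show ?thesis using False
    by (auto intro!: derivative_eq_intros simp: dcald_def cald_def cpow_def algebra_simps)
qed

context
  fixes s :: complex and a b :: real
  assumes s: "norm s \<le> 1" and ab: "0 \<le> a" "0 \<le> b"
begin

lemma norm_cald: "norm (cald s a b z) \<le> a powr (1 - Re z) * b powr Re z"
proof -
  have "norm (cald s a b z) = norm s * (a powr (1 - Re z) * b powr Re z)"
    using ab by (simp add: cald_def norm_mult norm_cpow)
  also have "\<dots> \<le> 1 * (a powr (1 - Re z) * b powr Re z)" using s by (intro mult_right_mono) auto
  finally show ?thesis by simp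
qed

lemma norm_cald_0: "Re z = 0 \<Longrightarrow> norm (cald s a b z) \<le> a"
  using norm_cald[of z] ab by (cases "b = 0") auto

lemma norm_cald_1: "Re z = 1 \<Longrightarrow> norm (cald s a b z) \<le> b"
  using norm_cald[of z] ab by (cases "a = 0") auto

lemma norm_cald_strip:
  assumes "0 \<le> Re z" "Re z \<le> 1" shows "norm (cald s a b z) \<le> a + b"
proof -
  define m where "m = max a b"
  have m: "m \<ge> 0" "a \<le> m" "b \<le> m" "m \<le> a + b" using ab by (auto simp: m_def)
  have "a powr (1 - Re z) * b powr Re z \<le> m powr (1 - Re z) * m powr Re z"
    using ab assms m by (intro mult_mono powr_mono2) auto
  also have "\<dots> \<le> m" using m by (cases "m = 0") (auto simp flip: powr_add)
  finally show ?thesis using norm_cald[of z] m by linarith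
qed

lemma norm_dcald:
  assumes r: "0 < r" "r \<le> Re z" "Re z \<le> 1 - r"
  shows "norm (dcald s a b z) \<le> 1 / r * (a + b)"
proof (cases "a = 0 \<or> b = 0")
  case True
  then have "dcald s a b z = 0" by (auto simp: dcald_def cald_def cpow_def)
  then show ?thesis using ab r by simp
next
  case False
  then have pos: "a > 0" "b > 0" using ab by auto
  define t where "t = ln b - ln a"
  have b: "b = a * exp t" using pos by (simp add: t_def exp_diff)
  have e: "a powr (1 - Re z) * b powr Re z = a * exp (Re z * t)"
  proof -
    have "a powr (1 - Re z) * b powr Re z = exp (ln a + Re z * t)"
      using pos by (simp add: powr_def t_def algebra_simps flip: exp_add)
    then show ?thesis using pos by (simp add: exp_add)
  qed
  have "norm (dcald s a b z) = \<bar>t\<bar> * norm (cald s a b z)"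
    unfolding dcald_def t_def[symmetric] by (simp add: norm_mult)
  also have "\<dots> \<le> \<bar>t\<bar> * (a * exp (Re z * t))"
    using norm_cald[of z] unfolding e by (intro mult_left_mono) auto
  also have "\<dots> = a * (\<bar>t\<bar> * exp (Re z * t))" by simp
  also have "\<dots> \<le> a * (1 / r * (1 + exp t))"
    using abs_times_exp_le[OF r, of t] ab by (intro mult_left_mono) auto
  also have "\<dots> = 1 / r * (a + b)" by (simp add: b algebra_simps)
  finally show ?thesis .
qed

text \<open>By the mean value inequality, difference quotient and derivative are both bounded by
  \<open>1 / r * (a + b)\<close>. This provides a summable majorant for differentiating the series
  term by term.\<close>

lemma cald_quotient:
  assumes r: "0 < r" "2 * r \<le> Re z" "2 * r \<le> 1 - Re z" and w: "dist w z < r" "w \<noteq> z"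
  shows "norm ((cald s a b w - cald s a b z) / (w - z) - dcald s a b z) \<le> 2 / r * (a + b)"
proof -
  have Re: "r \<le> Re u" "Re u \<le> 1 - r" if "u \<in> ball z r" for u
    using abs_Re_le_cmod[of "u - z"] that r by (auto simp: dist_norm norm_minus_commute)
  have "norm (cald s a b w - cald s a b z) \<le> 1 / r * (a + b) * norm (w - z)"
  proof (rule field_differentiable_bound[of "ball z r"])
    show "(cald s a b has_field_derivative dcald s a b u) (at u within ball z r)" for u
      by (rule has_field_derivative_at_within[OF cald_deriv])
    show "norm (dcald s a b u) \<le> 1 / r * (a + b)" if "u \<in> ball z r" for u
      using norm_dcald[OF r(1) Re[OF that]] .
  qed (use w r in \<open>auto simp: dist_commute\<close>)
  then have "norm ((cald s a b w - cald s a b z) / (w - z)) \<le> 1 / r * (a + b)"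
    using w by (simp add: norm_divide divide_le_eq)
  moreover have "norm (dcald s a b z) \<le> 1 / r * (a + b)" using r by (intro norm_dcald) auto
  ultimately have "norm ((cald s a b w - cald s a b z) / (w - z) - dcald s a b z) \<le> 1 / r * (a + b) + 1 / r * (a + b)"
    by (rule order_trans[OF norm_triangle_ineq4 add_mono])
  then show ?thesis by simp
qed

end

section \<open>Finite levels inside the ambient space\<close>

definition lev :: "nat \<Rightarrow> (bool list \<Rightarrow> complex) \<Rightarrow> nat \<Rightarrow>\<^sub>C complex" where
  "lev n h = amb (ext (2 * n) h)"

lemma
  assumes "1 \<le> p" "1 \<le> q"
  shows lev_in_mart_space: "lev n h \<in> mart_space p q"
    and mart_norm_lev: "mart_norm p q (lev n h) = mixed_norm (exps p q n) h"
  unfolding lev_def using ext_bmart[OF assms] by (auto simp: mart_spaceI[OF assms] mart_norm_amb[OF assms])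

lemma grow_ext: "grow (ext (2 * n) h)"
  using bmart_grow[OF _ _ ext_bmart(1), of 1 1] by simp

lemma coord_lev: "coord (lev n h) = ext (2 * n) h"
  by (simp add: lev_def coord_amb grow_ext)

lemma lev_diff: "lev n h - lev n h' = lev n (\<lambda>l. h l - h' l)"
  using amb_diff[OF grow_ext[of n h] grow_ext[of n h']] by (simp add: lev_def ext_diff[abs_def])

lemma lev_add: "lev n h + lev n h' = lev n (\<lambda>l. h l + h' l)"
  using amb_add[OF grow_ext[of n h] grow_ext[of n h']] by (simp add: lev_def ext_add[abs_def])

lemma scl_lev: "scl c (lev n h) = lev n (\<lambda>l. c * h l)"
  using amb_cmult[OF grow_ext[of n h], of c] by (simp add: lev_def ext_cmult[abs_def])

lemma lev_cong: "(\<And>l. length l = 2 * n \<Longrightarrow> h l = h' l) \<Longrightarrow> lev n h = lev n h'"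
  unfolding lev_def by (intro arg_cong[of _ _ amb] ext ext_cong) auto

context interpolation_exponents
begin

lemma V_series_coord:
  assumes "\<And>k. x k \<in> V" "summable (\<lambda>k. K (x k))"
  shows "summable (\<lambda>k. coord (x k) l)" "grow (\<lambda>l. \<Sum>k. coord (x k) l)"
proof -
  have le: "norm (coord (x k) l) \<le> 2 ^ Suc (length l) * K (x k)" for k l by (rule K_coord[OF assms(1)])
  have sm: "summable (\<lambda>k. 2 ^ Suc (length l) * K (x k))" for l :: "bool list" by (rule summable_mult[OF assms(2)])
  have sn: "summable (\<lambda>k. norm (coord (x k) l))" for l
    by (rule summable_comparison_test'[OF sm]) (use le in auto)
  show "summable (\<lambda>k. coord (x k) l)" by (rule summable_norm_cancel[OF sn])
  have "norm (\<Sum>k. coord (x k) l) \<le> 2 ^ Suc (length l) * (\<Sum>k. K (x k))" for l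
  proof -
    have "norm (\<Sum>k. coord (x k) l) \<le> (\<Sum>k. norm (coord (x k) l))" by (rule summable_norm[OF sn])
    also have "\<dots> \<le> (\<Sum>k. 2 ^ Suc (length l) * K (x k))" by (rule suminf_le[OF le sn sm])
    also have "\<dots> = 2 ^ Suc (length l) * (\<Sum>k. K (x k))" by (rule suminf_mult[OF assms(2)])
    finally show ?thesis .
  qed
  then show "grow (\<lambda>l. \<Sum>k. coord (x k) l)" unfolding grow_def by blast
qed

lemma series_diff:
  assumes "\<And>k. x k \<in> V" "summable (\<lambda>k. K (x k))" "\<And>k. y k \<in> V" "summable (\<lambda>k. K (y k))"
  shows "series x - series y = series (\<lambda>k. x k - y k)"
  unfolding series_def
  using amb_diff[OF V_series_coord(2)[OF assms(1,2)] V_series_coord(2)[OF assms(3,4)]]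
    suminf_diff[OF V_series_coord(1)[OF assms(1,2)] V_series_coord(1)[OF assms(3,4)]]
  by (simp add: coord_diff)

lemma scl_series:
  assumes "\<And>k. x k \<in> V" "summable (\<lambda>k. K (x k))"
  shows "scl c (series x) = series (\<lambda>k. scl c (x k))"
  unfolding series_def
  using amb_cmult[OF V_series_coord(2)[OF assms], of c] suminf_mult[OF V_series_coord(1)[OF assms]]
  by (simp add: coord_scl)

text \<open>Almost optimal decompositions of the terms, the k-th up to
  \<open>\<epsilon> * (1/2) ^ Suc k\<close>, add up to a decomposition of the sum whose cost exceeds
  the sum of the \<open>K (x k)\<close> by at most \<open>\<epsilon>\<close>.\<close>

lemma countably_subadditive_V: "countably_subadditive V K"
  unfolding countably_subadditive_def
proof (intro allI impI, elim conjE)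
  fix x assume x: "\<forall>k. x k \<in> V" and sum: "summable (\<lambda>k. K (x k))"
  have dec: "\<exists>a b. a \<in> S0 \<and> b \<in> S1 \<and> series x = a + b \<and> N0 a + N1 b \<le> (\<Sum>k. K (x k)) + \<epsilon>" if \<epsilon>: "\<epsilon> > 0" for \<epsilon>
  proof -
    have "\<exists>a b. a \<in> S0 \<and> b \<in> S1 \<and> x k = a + b \<and> N0 a + N1 b < K (x k) + \<epsilon> * (1/2) ^ Suc k" for k
    proof -
      have "\<epsilon> * (1/2) ^ Suc k > 0" using \<epsilon> by simp
      then show ?thesis using K_approx[of "x k"] x by metis
    qed
    then obtain a b where ab: "\<And>k. a k \<in> S0" "\<And>k. b k \<in> S1" "\<And>k. x k = a k + b k"
      "\<And>k. N0 (a k) + N1 (b k) < K (x k) + \<epsilon> * (1/2) ^ Suc k" by metis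
    have geo: "(\<lambda>k. \<epsilon> * (1/2) ^ Suc k) sums (\<epsilon> * 1)" by (intro sums_mult power_half_series)
    have S: "summable (\<lambda>k. K (x k) + \<epsilon> * (1/2) ^ Suc k)"
      by (rule summable_add[OF sum sums_summable[OF geo]])
    have nn: "0 \<le> N0 (a k)" "0 \<le> N1 (b k)" for k
      using mart_norm_nonneg[OF exps_le(3,4) ab(1)] mart_norm_nonneg[OF exps_le(5,5) ab(2)] by auto
    have le: "N0 (a k) \<le> K (x k) + \<epsilon> * (1/2) ^ Suc k" "N1 (b k) \<le> K (x k) + \<epsilon> * (1/2) ^ Suc k" for k
      using ab(4)[of k] nn[of k] by linarith+
    have Sa: "summable (\<lambda>k. N0 (a k))"
      by (rule summable_comparison_test'[OF S]) (use le(1) nn in simp)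
    have Sb: "summable (\<lambda>k. N1 (b k))"
      by (rule summable_comparison_test'[OF S]) (use le(2) nn in simp)
    have A: "series a \<in> S0" "N0 (series a) \<le> (\<Sum>k. N0 (a k))"
      using countably_subadditive_mart_space[OF exps_le(3,4)] ab(1) Sa unfolding countably_subadditive_def by blast+
    have B: "series b \<in> S1" "N1 (series b) \<le> (\<Sum>k. N1 (b k))"
      using countably_subadditive_mart_space[OF exps_le(5,5)] ab(2) Sb unfolding countably_subadditive_def by blast+
    have ca: "coord (a k) \<in> bmart p0 q0" for k by (rule mart_spaceD(1)[OF exps_le(3,4) ab(1)])
    have cb: "coord (b k) \<in> bmart 2 2" for k by (rule mart_spaceD(1)[OF exps_le(5,5) ab(2)])
    note sa = bmart_suminf[OF exps_le(3,4) ca Sa[unfolded mart_norm_def]]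
    note sb = bmart_suminf[OF exps_le(5,5) cb Sb[unfolded mart_norm_def]]
    have "series x = series a + series b"
      unfolding series_def
      using amb_add[OF bmart_grow[OF exps_le(3,4) sa(2)] bmart_grow[OF exps_le(5,5) sb(2)]]
        suminf_add[OF sa(1) sb(1)]
      by (simp add: ab(3) coord_add)
    moreover have "N0 (series a) + N1 (series b) \<le> (\<Sum>k. K (x k)) + \<epsilon>"
    proof -
      have "N0 (series a) + N1 (series b) \<le> (\<Sum>k. N0 (a k) + N1 (b k))"
        using A(2) B(2) suminf_add[OF Sa Sb] by simp
      also have "\<dots> \<le> (\<Sum>k. K (x k) + \<epsilon> * (1/2) ^ Suc k)"
        by (rule suminf_le[OF less_imp_le[OF ab(4)] summable_add[OF Sa Sb] S])
      also have "\<dots> = (\<Sum>k. K (x k)) + \<epsilon>"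
        using suminf_add[OF sum sums_summable[OF geo]] sums_unique[OF geo] by simp
      finally show ?thesis .
    qed
    ultimately show ?thesis using A(1) B(1) by blast
  qed
  show "series x \<in> V \<and> K (series x) \<le> (\<Sum>k. K (x k))"
  proof
    obtain a b where "a \<in> S0" "b \<in> S1" "series x = a + b" using dec[of 1] by auto
    then show "series x \<in> V" unfolding sum_space_def by blast
    show "K (series x) \<le> (\<Sum>k. K (x k))"
    proof (rule field_le_epsilon)
      fix \<epsilon> :: real assume "\<epsilon> > 0"
      then obtain a b where "a \<in> S0" "b \<in> S1" "series x = a + b" "N0 a + N1 b \<le> (\<Sum>k. K (x k)) + \<epsilon>"
        using dec by blast
      then show "K (series x) \<le> (\<Sum>k. K (x k)) + \<epsilon>" using K_le[of a b] by simp
    qed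
  qed
qed

lemma lev_in: "lev n h \<in> S0" "lev n h \<in> S1" "lev n h \<in> V"
  "N0 (lev n h) = mixed_norm (exps p0 q0 n) h" "N1 (lev n h) = mixed_norm (exps 2 2 n) h"
  using lev_in_mart_space[OF exps_le(3,4)] lev_in_mart_space[OF exps_le(5,5)] S0_subset_V
    mart_norm_lev[OF exps_le(3,4)] mart_norm_lev[OF exps_le(5,5)] by auto

text \<open>On a fixed level the norms are continuous functions of finitely many values.\<close>

lemma K_lev_tendsto_0:
  assumes "\<And>l. length l = 2 * n \<Longrightarrow> ((\<lambda>w. u w l) \<longlongrightarrow> 0) F"
  shows "((\<lambda>w. N0 (lev n (u w))) \<longlongrightarrow> 0) F" "((\<lambda>w. N1 (lev n (u w))) \<longlongrightarrow> 0) F" "((\<lambda>w. K (lev n (u w))) \<longlongrightarrow> 0) F"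
proof -
  have "((\<lambda>w. mixed_norm (exps p0 q0 n) (u w)) \<longlongrightarrow> mixed_norm (exps p0 q0 n) (\<lambda>_. 0 :: complex)) F"
    using exps_ge_1(2)[OF exps_le(3,4)] assms by (intro tendsto_mixed_norm) auto
  then show 0: "((\<lambda>w. N0 (lev n (u w))) \<longlongrightarrow> 0) F"
    using exps_ge_1(2)[OF exps_le(3,4)] by (simp add: lev_in)
  have "((\<lambda>w. mixed_norm (exps 2 2 n) (u w)) \<longlongrightarrow> mixed_norm (exps 2 2 n) (\<lambda>_. 0 :: complex)) F"
    using exps_ge_1(2)[OF exps_le(5,5)] assms by (intro tendsto_mixed_norm) auto
  then show "((\<lambda>w. N1 (lev n (u w))) \<longlongrightarrow> 0) F"
    using exps_ge_1(2)[OF exps_le(5,5)] by (simp add: lev_in)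
  show "((\<lambda>w. K (lev n (u w))) \<longlongrightarrow> 0) F"
    by (rule Lim_null_comparison[OF _ 0]) (use K_le_N0[OF lev_in(1)] K_nonneg[OF lev_in(3)] in auto)
qed

text \<open>The lattice structure enters here: u is split in the proportion of g0 to g1 into parts
  dominated by C g0 and C g1. Where g0 + g1 = 0 the bound forces u = 0.\<close>

lemma K_lev_le:
  assumes g: "\<And>l. 0 \<le> g0 l" "\<And>l. 0 \<le> g1 l" and C: "C \<ge> 0"
    and u: "\<And>l. length l = 2 * n \<Longrightarrow> norm (u l) \<le> C * (g0 l + g1 l)"
    and c: "mixed_norm (exps p0 q0 n) g0 \<le> c" "mixed_norm (exps 2 2 n) g1 \<le> c"
  shows "K (lev n u) \<le> C * (2 * c)"
proof -
  define a where "a l = u l * of_real (g0 l / (g0 l + g1 l))" for l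
  define b where "b l = u l * of_real (g1 l / (g0 l + g1 l))" for l
  have uab: "u l = a l + b l" "norm (a l) \<le> norm (C * g0 l)" "norm (b l) \<le> norm (C * g1 l)"
    if l: "length l = 2 * n" for l
  proof -
    show "u l = a l + b l"
    proof (cases "g0 l + g1 l = 0")
      case True
      then show ?thesis using u[OF l] by (simp add: a_def b_def)
    next
      case False
      then have "g0 l / (g0 l + g1 l) + g1 l / (g0 l + g1 l) = 1" by (simp flip: add_divide_distrib)
      then have "of_real (g0 l / (g0 l + g1 l)) + of_real (g1 l / (g0 l + g1 l)) = (1 :: complex)"
        by (metis of_real_1 of_real_add)
      then show ?thesis unfolding a_def b_def by (metis distrib_left mult.right_neutral)
    qed
    have part: "norm (u l) * (x / (g0 l + g1 l)) \<le> C * x" if "0 \<le> x" for x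
    proof (cases "g0 l + g1 l = 0")
      case True
      then show ?thesis using C that by simp
    next
      case False
      then have pos: "g0 l + g1 l > 0" using g[of l] by (simp add: less_le)
      have "norm (u l) * (x / (g0 l + g1 l)) \<le> C * (g0 l + g1 l) * (x / (g0 l + g1 l))"
        using u[OF l] pos that by (intro mult_right_mono) auto
      then show ?thesis using pos by simp
    qed
    have nr: "norm (of_real (x / (g0 l + g1 l)) :: complex) = x / (g0 l + g1 l)" if "0 \<le> x" for x
      using g[of l] that by (simp only: norm_of_real) simp
    show "norm (a l) \<le> norm (C * g0 l)" "norm (b l) \<le> norm (C * g1 l)"
      using part[OF g(1)[of l]] part[OF g(2)[of l]] nr[OF g(1)[of l]] nr[OF g(2)[of l]] C g[of l]
      unfolding a_def b_def by (simp_all only: norm_mult real_norm_def abs_of_nonneg)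
  qed
  have "lev n u = lev n a + lev n b" unfolding lev_add by (rule lev_cong) (rule uab(1))
  then have "K (lev n u) \<le> mixed_norm (exps p0 q0 n) a + mixed_norm (exps 2 2 n) b"
    using K_le[OF lev_in(1,2), of n a n b] by (simp add: lev_in)
  also have "\<dots> \<le> mixed_norm (exps p0 q0 n) (\<lambda>l. C * g0 l) + mixed_norm (exps 2 2 n) (\<lambda>l. C * g1 l)"
    using exps_ge_1(2)[OF exps_le(3,4)] exps_ge_1(2)[OF exps_le(5,5)] uab
    by (intro add_mono mixed_norm_mono) auto
  also have "\<dots> = C * mixed_norm (exps p0 q0 n) g0 + C * mixed_norm (exps 2 2 n) g1"
    using exps_ge_1(2)[OF exps_le(3,4)] exps_ge_1(2)[OF exps_le(5,5)] C by (simp add: mixed_norm_cmult)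
  also have "\<dots> \<le> C * c + C * c" using c C by (intro add_mono mult_left_mono)
  finally show ?thesis by simp
qed

text \<open>F is the sum of Calderon's functions of the pieces from
  \<open>bmart_decomposition\<close>. On either boundary line the k-th summand has norm at most
  \<open>c k\<close>, which gives the sharp bound; inside the strip, the cruder
  \<open>2 * c k\<close> is enough for boundedness and for majorants.\<close>

lemma interpolation_lower:
  assumes v: "v \<in> mart_space p q" and \<delta>: "\<delta> > 0"
  obtains F where "F \<in> strip_functions scl S0 N0 S1 N1" "F (of_real \<theta>) = v"
    "strip_norm N0 N1 F \<le> mart_norm p q v + \<delta>"
proof -
  have fb: "coord v \<in> bmart p q" and fv: "amb (coord v) = v" using mart_spaceD[OF exps_le(1,2) v] by auto
  from bmart_decomposition[OF pq fb \<delta>] obtain n h where nh: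
    "\<forall>l. (\<lambda>k. ext (2 * n k) (h k) l) sums coord v l"
    "summable (\<lambda>k. mixed_norm (exps p q (n k)) (h k))"
    "(\<Sum>k. mixed_norm (exps p q (n k)) (h k)) \<le> bnorm p q (coord v) + \<delta>"
    by (elim exE conjE)
  define c where "c k = mixed_norm (exps p q (n k)) (h k)" for k
  have c: "summable c" "suminf c \<le> mart_norm p q v + \<delta>" "\<And>k. 0 \<le> c k"
    using nh(2,3) unfolding c_def[abs_def] mart_norm_def by auto
  have "\<exists>f0 f1 :: bool list \<Rightarrow> real. (\<forall>l. 0 \<le> f0 l \<and> 0 \<le> f1 l) \<and>
      (\<forall>l. length l = 2 * n k \<longrightarrow> norm (h k l) = f0 l powr (1 - \<theta>) * f1 l powr \<theta>) \<and>
      mixed_norm (exps p0 q0 (n k)) f0 \<le> c k \<and> mixed_norm (exps 2 2 (n k)) f1 \<le> c k" for k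
  proof -
    have "\<forall>e\<in>set (exps True False (n k)). 1 \<le> (if e then p else q) \<and> 1 \<le> (if e then p0 else q0) \<and> 1 \<le> (2::real)
        \<and> 1 / (if e then p else q) = (1 - \<theta>) / (if e then p0 else q0) + \<theta> / 2"
      using exps_le p_eq q_eq by auto
    from calderon_factorization[OF th this, of "h k"] show ?thesis unfolding c_def by (simp add: map_exps)
  qed
  then obtain f0 f1 :: "nat \<Rightarrow> bool list \<Rightarrow> real" where f: "\<And>k l. 0 \<le> f0 k l" "\<And>k l. 0 \<le> f1 k l"
    "\<And>k l. length l = 2 * n k \<Longrightarrow> norm (h k l) = f0 k l powr (1 - \<theta>) * f1 k l powr \<theta>"
    "\<And>k. mixed_norm (exps p0 q0 (n k)) (f0 k) \<le> c k" "\<And>k. mixed_norm (exps 2 2 (n k)) (f1 k) \<le> c k"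
    by metis
  define \<phi> where "\<phi> k z l = cald (sgn (h k l)) (f0 k l) (f1 k l) z" for k z l
  define d where "d k z l = dcald (sgn (h k l)) (f0 k l) (f1 k l) z" for k z l
  have sg: "norm (sgn (h k l)) \<le> 1" for k l by (simp add: norm_sgn)
  define P where "P z k = lev (n k) (\<phi> k z)" for z k
  define F where "F z = series (P z)" for z
  define strip where "strip = {z. 0 \<le> Re z \<and> Re z \<le> 1}"
  have PV: "P z k \<in> V" for z k unfolding P_def by (rule lev_in)
  have KP: "K (P z k) \<le> 2 * c k" if "z \<in> strip" for z k
    using K_lev_le[of "f0 k" "f1 k" 1 "n k" "\<phi> k z" "c k"] f norm_cald_strip[OF sg f(1,2)] that
    unfolding P_def \<phi>_def strip_def by auto
  have KP0: "0 \<le> K (P z k)" for z k by (rule K_nonneg[OF PV])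
  have sumc: "summable (\<lambda>k. C * c k)" for C by (rule summable_mult[OF c(1)])
  have KPs: "summable (\<lambda>k. K (P z k))" if "z \<in> strip" for z
    by (rule summable_comparison_test'[OF sumc[of 2]]) (use KP[OF that] KP0 in simp)
  have FV: "F z \<in> V" "K (F z) \<le> 2 * suminf c" if "z \<in> strip" for z
  proof -
    have "F z \<in> V \<and> K (F z) \<le> (\<Sum>k. K (P z k))"
      using countably_subadditive_V PV KPs[OF that] unfolding countably_subadditive_def F_def by blast
    moreover have "(\<Sum>k. K (P z k)) \<le> (\<Sum>k. 2 * c k)" by (rule suminf_le[OF KP[OF that] KPs[OF that] sumc])
    moreover have "(\<Sum>k. 2 * c k) = 2 * suminf c" by (rule suminf_mult[OF c(1)])
    ultimately show "F z \<in> V" "K (F z) \<le> 2 * suminf c" by auto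
  qed
  have Fdiff: "F w - F z = series (\<lambda>k. P w k - P z k)" if "w \<in> strip" "z \<in> strip" for w z
    unfolding F_def using series_diff[of "P w" "P z", OF PV KPs[OF that(1)] PV KPs[OF that(2)]] .
  have Pdiff: "P w k - P z k = lev (n k) (\<lambda>l. \<phi> k w l - \<phi> k z l)" for w z k
    by (simp add: P_def lev_diff)
  have \<phi>cont: "((\<lambda>w. \<phi> k w l - \<phi> k z l) \<longlongrightarrow> 0) (at z within S)" for k l z S
  proof -
    have "isCont (\<lambda>w. \<phi> k w l) z" unfolding \<phi>_def by (rule DERIV_isCont[OF cald_deriv])
    then have "((\<lambda>w. \<phi> k w l) \<longlongrightarrow> \<phi> k z l) (at z within S)"
      unfolding isCont_def by (rule tendsto_within_subset) simp
    then show ?thesis by (rule LIM_zero)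
  qed
  have bnd0: "mixed_norm (exps p0 q0 (n k)) (\<lambda>l. \<phi> k (Complex 0 t) l) \<le> c k" for k t
  proof -
    have "mixed_norm (exps p0 q0 (n k)) (\<lambda>l. \<phi> k (Complex 0 t) l) \<le> mixed_norm (exps p0 q0 (n k)) (f0 k)"
      using exps_ge_1(2)[OF exps_le(3,4)] norm_cald_0[OF sg f(1,2)] f(1) unfolding \<phi>_def
      by (intro mixed_norm_mono) auto
    then show ?thesis using f(4)[of k] by linarith
  qed
  have bnd1: "mixed_norm (exps 2 2 (n k)) (\<lambda>l. \<phi> k (Complex 1 t) l) \<le> c k" for k t
  proof -
    have "mixed_norm (exps 2 2 (n k)) (\<lambda>l. \<phi> k (Complex 1 t) l) \<le> mixed_norm (exps 2 2 (n k)) (f1 k)"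
      using exps_ge_1(2)[OF exps_le(5,5)] norm_cald_1[OF sg f(1,2)] f(2) unfolding \<phi>_def
      by (intro mixed_norm_mono) auto
    then show ?thesis using f(5)[of k] by linarith
  qed
  have N0P: "N0 (P (Complex 0 t) k) \<le> c k" and N1P: "N1 (P (Complex 1 t) k) \<le> c k" for t k
    using bnd0[of k t] bnd1[of k t] by (simp_all add: P_def lev_in)
  have cs0: "countably_subadditive S0 N0" and cs1: "countably_subadditive S1 N1"
    by (rule countably_subadditive_mart_space[OF exps_le(3,4)], rule countably_subadditive_mart_space[OF exps_le(5,5)])
  have nn0: "0 \<le> N0 x" if "x \<in> S0" for x by (rule mart_norm_nonneg[OF exps_le(3,4) that])
  have nn1: "0 \<le> N1 x" if "x \<in> S1" for x by (rule mart_norm_nonneg[OF exps_le(5,5) that])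
  have PS: "P z k \<in> S0" "P z k \<in> S1" for z k unfolding P_def by (rule lev_in)+
  have F0: "F (Complex 0 t) \<in> S0" "N0 (F (Complex 0 t)) \<le> suminf c" for t
  proof -
    have s: "summable (\<lambda>k. N0 (P (Complex 0 t) k))"
      by (rule summable_comparison_test'[OF c(1)]) (use N0P nn0[OF PS(1)] in simp)
    then have "F (Complex 0 t) \<in> S0 \<and> N0 (F (Complex 0 t)) \<le> (\<Sum>k. N0 (P (Complex 0 t) k))"
      using cs0 PS(1) unfolding countably_subadditive_def F_def by blast
    then show "F (Complex 0 t) \<in> S0" "N0 (F (Complex 0 t)) \<le> suminf c"
      using suminf_le[OF N0P s c(1)] by auto
  qed
  have F1: "F (Complex 1 t) \<in> S1" "N1 (F (Complex 1 t)) \<le> suminf c" for t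
  proof -
    have s: "summable (\<lambda>k. N1 (P (Complex 1 t) k))"
      by (rule summable_comparison_test'[OF c(1)]) (use N1P nn1[OF PS(2)] in simp)
    then have "F (Complex 1 t) \<in> S1 \<and> N1 (F (Complex 1 t)) \<le> (\<Sum>k. N1 (P (Complex 1 t) k))"
      using cs1 PS(2) unfolding countably_subadditive_def F_def by blast
    then show "F (Complex 1 t) \<in> S1" "N1 (F (Complex 1 t)) \<le> suminf c"
      using suminf_le[OF N1P s c(1)] by auto
  qed
  have mem: "F \<in> strip_functions scl S0 N0 S1 N1"
    unfolding strip_functions_def Let_def mem_Collect_eq strip_def[symmetric]
  proof (intro conjI ballI allI impI FV(1) F0(1) F1(1))
    show "bdd_above ((\<lambda>z. K (F z)) ` strip)" by (rule bdd_aboveI2) (rule FV(2))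
    show "bdd_above (range (\<lambda>t. N0 (F (Complex 0 t))))" by (rule bdd_aboveI2) (rule F0(2))
    show "bdd_above (range (\<lambda>t. N1 (F (Complex 1 t))))" by (rule bdd_aboveI2) (rule F1(2))
  next
    fix z assume z: "z \<in> strip"
    have "((\<lambda>w. K (series (\<lambda>k. P w k - P z k))) \<longlongrightarrow> 0) (at z within strip)"
    proof (rule series_tendsto_0[OF countably_subadditive_V K_nonneg])
      have "K (P w k - P z k) \<le> 2 * (2 * c k)" if w: "w \<in> strip" for w k
      proof -
        have "norm (\<phi> k w l - \<phi> k z l) \<le> 2 * (f0 k l + f1 k l)" for l
          using norm_triangle_ineq4[of "\<phi> k w l" "\<phi> k z l"] norm_cald_strip[OF sg f(1,2), of w k l k l k l]
            norm_cald_strip[OF sg f(1,2), of z k l k l k l] w z unfolding \<phi>_def strip_def by simp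
        then show ?thesis unfolding Pdiff using f by (intro K_lev_le[of "f0 k" "f1 k"]) auto
      qed
      then show "\<forall>\<^sub>F w in at z within strip. \<forall>k. P w k - P z k \<in> V \<and> K (P w k - P z k) \<le> 2 * (2 * c k)"
        using V_diff[OF PV PV] by (auto simp: eventually_at_filter)
      show "summable (\<lambda>k. 2 * (2 * c k))" by (intro summable_mult c)
      show "((\<lambda>w. K (P w k - P z k)) \<longlongrightarrow> 0) (at z within strip)" for k
        unfolding Pdiff by (rule K_lev_tendsto_0(3)) (rule \<phi>cont)
    qed
    then show "((\<lambda>w. K (F w - F z)) \<longlongrightarrow> 0) (at z within strip)"
      by (rule Lim_transform_eventually) (auto simp: eventually_at_filter Fdiff z)
  next
    fix z assume z: "0 < Re z \<and> Re z < 1"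
    \<comment> \<open>Points within r of z keep the distance r from both boundary lines, as the
      bound for the derivative requires.\<close>
    define r where "r = min (Re z) (1 - Re z) / 2"
    have r: "0 < r" "2 * r \<le> Re z" "2 * r \<le> 1 - Re z" using z by (auto simp: r_def)
    have zs: "z \<in> strip" using z by (simp add: strip_def)
    define D where "D k = lev (n k) (d k z)" for k
    have DV: "D k \<in> V" for k unfolding D_def by (rule lev_in)
    have KD: "K (D k) \<le> 1 / r * (2 * c k)" for k
      unfolding D_def d_def using f r norm_dcald[OF sg f(1,2) r(1)] by (intro K_lev_le[of "f0 k" "f1 k"]) auto
    have KDs: "summable (\<lambda>k. K (D k))"
      by (rule summable_comparison_test'[of "\<lambda>k. 1 / r * (2 * c k)"])
        (use KD K_nonneg[OF DV] in \<open>auto intro!: summable_mult c\<close>)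
    have DVs: "series D \<in> V"
      using countably_subadditive_V DV KDs unfolding countably_subadditive_def by blast
    \<comment> \<open>The k-th term of the difference quotient minus its limit; near z it is
      dominated by \<open>cald_quotient\<close>, uniformly in w.\<close>
    define u where "u w k l = (\<phi> k w l - \<phi> k z l) / (w - z) - d k z l" for w k l
    have near: "\<forall>\<^sub>F w in at z. dist w z < r \<and> w \<noteq> z"
      using r(1) by (auto simp: eventually_at)
    have nstrip: "w \<in> strip" if "dist w z < r" for w
      using abs_Re_le_cmod[of "w - z"] that r by (auto simp: strip_def dist_norm)
    have eq: "scl (1 / (w - z)) (F w - F z) - series D = series (\<lambda>k. lev (n k) (u w k))" if w: "w \<in> strip" for w
    proof -
      have Kd: "summable (\<lambda>k. K (P w k - P z k))"
      proof (rule summable_comparison_test'[of "\<lambda>k. 2 * (2 * c k)"])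
        show "norm (K (P w k - P z k)) \<le> 2 * (2 * c k)" for k
        proof -
          have "norm (\<phi> k w l - \<phi> k z l) \<le> 2 * (f0 k l + f1 k l)" for l
            using norm_triangle_ineq4[of "\<phi> k w l" "\<phi> k z l"] norm_cald_strip[OF sg f(1,2), of w k l k l k l]
              norm_cald_strip[OF sg f(1,2), of z k l k l k l] w zs unfolding \<phi>_def strip_def by simp
          then have "K (P w k - P z k) \<le> 2 * (2 * c k)"
            unfolding Pdiff using f by (intro K_lev_le[of "f0 k" "f1 k"]) auto
          then show ?thesis using K_nonneg[OF V_diff[OF PV PV]] by simp
        qed
      qed (intro summable_mult c)
      have sq: "scl (1 / (w - z)) (F w - F z) = series (\<lambda>k. scl (1 / (w - z)) (P w k - P z k))"
        unfolding Fdiff[OF w zs] by (rule scl_series[OF V_diff[OF PV PV] Kd])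
      have qV: "scl (1 / (w - z)) (P w k - P z k) \<in> V" for k by (intro V_scl V_diff PV)
      have Kqb: "K (scl (1 / (w - z)) (P w k - P z k)) \<le> norm (1 / (w - z)) * 2 * (2 * c k)" for k
        unfolding Pdiff scl_lev using f
      proof (intro K_lev_le[of "f0 k" "f1 k"])
        show "norm (1 / (w - z) * (\<phi> k w l - \<phi> k z l)) \<le> norm (1 / (w - z)) * 2 * (f0 k l + f1 k l)" for l
        proof -
          have "norm (\<phi> k w l - \<phi> k z l) \<le> 2 * (f0 k l + f1 k l)"
            using norm_triangle_ineq4[of "\<phi> k w l" "\<phi> k z l"] norm_cald_strip[OF sg f(1,2), of w k l k l k l]
              norm_cald_strip[OF sg f(1,2), of z k l k l k l] w zs unfolding \<phi>_def strip_def by simp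
          then show ?thesis unfolding norm_mult mult.assoc by (intro mult_left_mono) auto
        qed
      qed auto
      have Kq: "summable (\<lambda>k. K (scl (1 / (w - z)) (P w k - P z k)))"
      proof (rule summable_comparison_test'[of "\<lambda>k. norm (1 / (w - z)) * 2 * (2 * c k)"])
        show "norm (K (scl (1 / (w - z)) (P w k - P z k))) \<le> norm (1 / (w - z)) * 2 * (2 * c k)" for k
          using Kqb[of k] K_nonneg[OF qV[of k]] by (simp only: real_norm_def abs_of_nonneg)
      qed (intro summable_mult c)
      have "scl (1 / (w - z)) (P w k - P z k) - D k = lev (n k) (u w k)" for k
        unfolding Pdiff scl_lev D_def lev_diff u_def by (rule lev_cong) simp
      then show ?thesis
        unfolding sq series_diff[of _ D, OF qV Kq DV KDs] by simp
    qed
    have "((\<lambda>w. K (series (\<lambda>k. lev (n k) (u w k)))) \<longlongrightarrow> 0) (at z)"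
    proof (rule series_tendsto_0[OF countably_subadditive_V K_nonneg])
      show "\<forall>\<^sub>F w in at z. \<forall>k. lev (n k) (u w k) \<in> V \<and> K (lev (n k) (u w k)) \<le> 2 / r * (2 * c k)"
        using near
      proof eventually_elim
        case (elim w)
        have "K (lev (n k) (u w k)) \<le> 2 / r * (2 * c k)" for k
          unfolding u_def \<phi>_def d_def using f r cald_quotient[OF sg f(1,2) r, of w] elim
          by (intro K_lev_le[of "f0 k" "f1 k"]) auto
        then show ?case using lev_in(3) by blast
      qed
      show "summable (\<lambda>k. 2 / r * (2 * c k))" by (intro summable_mult c)
      show "((\<lambda>w. K (lev (n k) (u w k))) \<longlongrightarrow> 0) (at z)" for k
      proof (rule K_lev_tendsto_0(3))
        fix l
        have "((\<lambda>w. (\<phi> k w l - \<phi> k z l) / (w - z)) \<longlongrightarrow> d k z l) (at z)"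
          using cald_deriv unfolding has_field_derivative_iff \<phi>_def d_def by blast
        then show "((\<lambda>w. u w k l) \<longlongrightarrow> 0) (at z)" unfolding u_def by (rule LIM_zero)
      qed
    qed
    then have "((\<lambda>w. K (scl (1 / (w - z)) (F w - F z) - series D)) \<longlongrightarrow> 0) (at z)"
      by (rule Lim_transform_eventually) (rule eventually_mono[OF near], use eq nstrip in auto)
    then show "\<exists>v\<in>V. ((\<lambda>w. K (scl (1 / (w - z)) (F w - F z) - v)) \<longlongrightarrow> 0) (at z)"
      using DVs by blast
  next
    fix t
    have line: "Complex a u \<in> strip" if "a = 0 \<or> a = 1" for a u using that by (auto simp: strip_def)
    have lim: "((\<lambda>u. \<phi> k (Complex a u) l - \<phi> k (Complex a t) l) \<longlongrightarrow> 0) (at t)" for k l a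
    proof -
      have "isCont (\<lambda>w. \<phi> k w l) (Complex a t)" unfolding \<phi>_def by (rule DERIV_isCont[OF cald_deriv])
      moreover have "isCont (\<lambda>u. Complex a u) t" by (auto simp: isCont_def Complex_eq intro!: tendsto_intros)
      ultimately have "isCont (\<lambda>u. \<phi> k (Complex a u) l) t" by (rule isCont_o2[rotated])
      then show ?thesis unfolding isCont_def by (rule LIM_zero)
    qed
    have d0: "F (Complex 0 u) - F (Complex 0 t) = series (\<lambda>k. P (Complex 0 u) k - P (Complex 0 t) k)"
      and d1: "F (Complex 1 u) - F (Complex 1 t) = series (\<lambda>k. P (Complex 1 u) k - P (Complex 1 t) k)" for u
      by (intro Fdiff line; simp)+
    show "((\<lambda>u. N0 (F (Complex 0 u) - F (Complex 0 t))) \<longlongrightarrow> 0) (at t)"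
      unfolding d0
    proof (rule series_tendsto_0[OF cs0 nn0])
      have "N0 (P (Complex 0 u) k - P (Complex 0 t) k) \<le> 2 * c k" for u k
        using mart_space_add(2)[OF exps_le(3,4) PS(1) mart_space_scl(1)[OF exps_le(3,4) PS(1), of "- 1"], of "Complex 0 u" k "Complex 0 t" k]
          mart_space_scl(2)[OF exps_le(3,4) PS(1), of "- 1" "Complex 0 t" k] N0P[of u k] N0P[of t k]
          normed_space_over_scale_minus[OF normed_space_over_scl] by simp
      then show "\<forall>\<^sub>F u in at t. \<forall>k. P (Complex 0 u) k - P (Complex 0 t) k \<in> S0 \<and> N0 (P (Complex 0 u) k - P (Complex 0 t) k) \<le> 2 * c k"
        using mart_space_diff[OF exps_le(3,4) PS(1) PS(1)] by auto
      show "summable (\<lambda>k. 2 * c k)" by (rule sumc)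
      show "((\<lambda>u. N0 (P (Complex 0 u) k - P (Complex 0 t) k)) \<longlongrightarrow> 0) (at t)" for k
        unfolding Pdiff by (rule K_lev_tendsto_0(1)) (rule lim)
    qed
    show "((\<lambda>u. N1 (F (Complex 1 u) - F (Complex 1 t))) \<longlongrightarrow> 0) (at t)"
      unfolding d1
    proof (rule series_tendsto_0[OF cs1 nn1])
      have "N1 (P (Complex 1 u) k - P (Complex 1 t) k) \<le> 2 * c k" for u k
        using mart_space_add(2)[OF exps_le(5,5) PS(2) mart_space_scl(1)[OF exps_le(5,5) PS(2), of "- 1"], of "Complex 1 u" k "Complex 1 t" k]
          mart_space_scl(2)[OF exps_le(5,5) PS(2), of "- 1" "Complex 1 t" k] N1P[of u k] N1P[of t k]
          normed_space_over_scale_minus[OF normed_space_over_scl] by simp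
      then show "\<forall>\<^sub>F u in at t. \<forall>k. P (Complex 1 u) k - P (Complex 1 t) k \<in> S1 \<and> N1 (P (Complex 1 u) k - P (Complex 1 t) k) \<le> 2 * c k"
        using mart_space_diff[OF exps_le(5,5) PS(2) PS(2)] by auto
      show "summable (\<lambda>k. 2 * c k)" by (rule sumc)
      show "((\<lambda>u. N1 (P (Complex 1 u) k - P (Complex 1 t) k)) \<longlongrightarrow> 0) (at t)" for k
        unfolding Pdiff by (rule K_lev_tendsto_0(2)) (rule lim)
    qed
  qed
  have val: "F (of_real \<theta>) = v"
  proof -
    \<comment> \<open>At \<theta> the two powers multiply to the modulus of h, and
      \<open>sgn\<close> restores the phase.\<close>
    have "\<phi> k (of_real \<theta>) l = h k l" if l: "length l = 2 * n k" for k l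
    proof -
      have "cpow (f0 k l) (1 - of_real \<theta>) * cpow (f1 k l) (of_real \<theta>) = of_real (norm (h k l))"
        using cpow_of_real[OF f(1), of k l "1 - \<theta>"] cpow_of_real[OF f(2), of k l \<theta>] f(3)[OF l] by simp
      then have "\<phi> k (of_real \<theta>) l = sgn (h k l) * of_real (norm (h k l))"
        by (simp add: \<phi>_def cald_def mult.assoc)
      then show ?thesis by (simp add: sgn_eq)
    qed
    then have "P (of_real \<theta>) k = lev (n k) (h k)" for k unfolding P_def by (rule lev_cong)
    then have "coord (P (of_real \<theta>) k) l = ext (2 * n k) (h k) l" for k l by (simp add: coord_lev)
    then have "F (of_real \<theta>) = amb (\<lambda>l. \<Sum>k. ext (2 * n k) (h k) l)" by (simp add: F_def series_def)
    also have "\<dots> = amb (coord v)"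
      by (intro arg_cong[of _ _ amb] ext sums_unique[OF nh(1)[rule_format], symmetric])
    finally show ?thesis using fv by simp
  qed
  have nrm: "strip_norm N0 N1 F \<le> suminf c"
    unfolding strip_norm_def by (intro max.boundedI cSUP_least F0 F1) auto
  show ?thesis by (rule that[OF mem val order_trans[OF nrm c(2)]])
qed

lemma interpolation_mart_space:
  "interp_space scl S0 N0 S1 N1 \<theta> = mart_space p q"
  "v \<in> mart_space p q \<Longrightarrow> interp_norm scl S0 N0 S1 N1 \<theta> v = mart_norm p q v"
proof -
  show "interp_space scl S0 N0 S1 N1 \<theta> = mart_space p q"
  proof
    show "interp_space scl S0 N0 S1 N1 \<theta> \<subseteq> mart_space p q"
      unfolding interp_space_def using interpolation_upper(1) by auto
    show "mart_space p q \<subseteq> interp_space scl S0 N0 S1 N1 \<theta>"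
    proof
      fix v assume "v \<in> mart_space p q"
      then obtain F where "F \<in> strip_functions scl S0 N0 S1 N1" "F (of_real \<theta>) = v"
        using interpolation_lower[of v 1] by auto
      then show "v \<in> interp_space scl S0 N0 S1 N1 \<theta>" unfolding interp_space_def by blast
    qed
  qed
  assume v: "v \<in> mart_space p q"
  define A where "A = strip_norm N0 N1 ` {F \<in> strip_functions scl S0 N0 S1 N1. F (of_real \<theta>) = v}"
  have lower: "mart_norm p q v \<le> x" if "x \<in> A" for x
    using that interpolation_upper(2) unfolding A_def by auto
  have "A \<noteq> {}" using interpolation_lower[OF v, of 1] unfolding A_def by force
  then have "mart_norm p q v \<le> Inf A" using lower by (intro cInf_greatest)
  moreover have "Inf A \<le> mart_norm p q v"
  proof (rule field_le_epsilon)
    fix \<delta> :: real assume "\<delta> > 0"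
    then obtain F where F: "F \<in> strip_functions scl S0 N0 S1 N1" "F (of_real \<theta>) = v"
      "strip_norm N0 N1 F \<le> mart_norm p q v + \<delta>" using interpolation_lower[OF v] by blast
    then have "Inf A \<le> strip_norm N0 N1 F"
      using lower unfolding A_def by (intro cInf_lower bdd_belowI) auto
    then show "Inf A \<le> mart_norm p q v + \<delta>" using F(3) by linarith
  qed
  ultimately show "interp_norm scl S0 N0 S1 N1 \<theta> v = mart_norm p q v"
    unfolding interp_norm_def A_def[symmetric] by simp
qed

end


section \<open>X(p,q) as a space of martingales\<close>

locale complex_X =
  fixes p q :: real
    and sc :: "complex \<Rightarrow> 'y \<Rightarrow> 'y::banach"
    and J :: "((nat \<Rightarrow> bool) \<Rightarrow> complex) \<Rightarrow> 'y"
  assumes X: "is_X p q sc J" and pq: "1 < p" "1 < q"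
begin

lemma pq1: "1 \<le> p" "1 \<le> q"
  using pq by auto

text \<open>The point of the completion that a martingale represents; the inverse map will be the
  isometry onto the interpolation space.\<close>

definition limit_point :: "(nat \<Rightarrow>\<^sub>C complex) \<Rightarrow> 'y" where
  "limit_point v = lim (\<lambda>n. J (\<lambda>\<omega>. coord v (bits n \<omega>)))"

text \<open>The difference of two levels is bounded by the distance of the martingale from the lower
  one, which tends to 0; so the images under J are Cauchy.\<close>

lemma limit_point:
  assumes "v \<in> mart_space p q"
  shows "(\<lambda>n. J (\<lambda>\<omega>. coord v (bits n \<omega>))) \<longlonglongrightarrow> limit_point v"
proof -
  define f where "f = coord v"
  have f: "f \<in> bmart p q" unfolding f_def by (rule mart_spaceD(1)[OF pq1 assms])
  define z where "z n = J (\<lambda>\<omega>. f (bits n \<omega>))" for n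
  define r where "r n = bnorm p q (\<lambda>l. f l - ext (2 * n) f l)" for n
  have zr: "norm (z m - z n) \<le> r n" if "n \<le> m" for n m
  proof -
    have e: "ext (2 * n) f (bits m \<omega>) = f (bits n \<omega>)" for \<omega>
      using that drop_bits[OF that] by (simp add: ext_ge)
    have "z m - z n = J (\<lambda>\<omega>. f (bits m \<omega>) - f (bits n \<omega>))"
      unfolding z_def by (rule is_X_diff[OF X bits_in_X_union bits_in_X_union, symmetric])
    also have "\<dots> = J (\<lambda>\<omega>. (\<lambda>l. f l - ext (2 * n) f l) (bits m \<omega>))" by (simp add: e)
    also have "norm \<dots> = mixed_norm (exps p q m) (\<lambda>l. f l - ext (2 * n) f l)"
      by (rule is_X_norm_bits[OF X])
    also have "\<dots> \<le> r n"
      unfolding r_def by (rule level_le_bnorm[OF pq1 bmart_diff[OF pq1 f ext_bmart(1)[OF pq1]]])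
    finally show ?thesis .
  qed
  have r0: "r \<longlonglongrightarrow> 0" unfolding r_def by (rule bmart_ext_tendsto[OF pq f])
  have "Cauchy z"
  proof (rule CauchyI)
    fix e :: real assume "e > 0"
    then have "\<forall>\<^sub>F n in sequentially. r n < e / 2" using r0 by (intro order_tendstoD(2)) auto
    then obtain N where N: "r N < e / 2" by (auto simp: eventually_sequentially)
    have "norm (z m - z n) < e" if "N \<le> m" "N \<le> n" for m n
      using norm_triangle_ineq4[of "z m - z N" "z n - z N"] zr[OF that(1)] zr[OF that(2)] N by simp
    then show "\<exists>M. \<forall>m\<ge>M. \<forall>n\<ge>M. norm (z m - z n) < e" by blast
  qed
  then show ?thesis
    unfolding limit_point_def z_def f_def by (simp add: Cauchy_convergent_iff convergent_LIMSEQ_iff)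
qed

lemma limit_point_add:
  assumes "v \<in> mart_space p q" "w \<in> mart_space p q"
  shows "limit_point (v + w) = limit_point v + limit_point w"
proof -
  have "J (\<lambda>\<omega>. coord (v + w) (bits n \<omega>)) = J (\<lambda>\<omega>. coord v (bits n \<omega>)) + J (\<lambda>\<omega>. coord w (bits n \<omega>))" for n
    unfolding coord_add by (rule is_X_add[OF X bits_in_X_union bits_in_X_union])
  then show ?thesis
    using limit_point[OF mart_space_add(1)[OF pq1 assms]] tendsto_add[OF limit_point[OF assms(1)] limit_point[OF assms(2)]]
    by (simp add: LIMSEQ_unique)
qed

lemma limit_point_scl:
  assumes "v \<in> mart_space p q"
  shows "limit_point (scl c v) = sc c (limit_point v)"
proof -
  have nso: "normed_space_over sc" by (rule is_X_normed_space[OF X])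
  interpret vector_space sc using nso by (simp add: normed_space_over_def)
  have bl: "bounded_linear (sc c)"
  proof (rule bounded_linear_intro[where K = "norm c"])
    show "sc c (x + y) = sc c x + sc c y" for x y by (rule scale_right_distrib)
    show "sc c (r *\<^sub>R x) = r *\<^sub>R sc c x" for r x
    proof -
      have e: "sc (of_real r) y = r *\<^sub>R y" for y using nso by (simp add: normed_space_over_def)
      have "sc c (sc (of_real r) x) = sc (of_real r) (sc c x)" by (simp add: mult.commute)
      then show ?thesis unfolding e .
    qed
    show "norm (sc c x) \<le> norm x * norm c" for x using nso by (simp add: normed_space_over_def)
  qed
  have "J (\<lambda>\<omega>. coord (scl c v) (bits n \<omega>)) = sc c (J (\<lambda>\<omega>. coord v (bits n \<omega>)))" for n
    unfolding coord_scl by (rule is_X_cmult[OF X bits_in_X_union])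
  then show ?thesis
    using limit_point[OF mart_space_scl(1)[OF pq1 assms, of c]] bounded_linear.tendsto[OF bl limit_point[OF assms]]
    by (simp add: LIMSEQ_unique)
qed

lemma norm_limit_point:
  assumes "v \<in> mart_space p q" shows "norm (limit_point v) = mart_norm p q v"
proof -
  have "(\<lambda>n. mixed_norm (exps p q n) (coord v)) \<longlonglongrightarrow> norm (limit_point v)"
    using tendsto_norm[OF limit_point[OF assms]] unfolding is_X_norm_bits[OF X] .
  then show ?thesis
    using level_tendsto_bnorm[OF pq1 mart_spaceD(1)[OF pq1 assms]] unfolding mart_norm_def by (rule LIMSEQ_unique)
qed

lemma limit_point_diff:
  assumes "v \<in> mart_space p q" "w \<in> mart_space p q"
  shows "limit_point (v - w) = limit_point v - limit_point w"
  using limit_point_add[OF mart_space_diff[OF pq1 assms] assms(2)] by simp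

lemma limit_point_inj: "inj_on limit_point (mart_space p q)"
proof (rule inj_onI)
  fix v w assume vw: "v \<in> mart_space p q" "w \<in> mart_space p q" "limit_point v = limit_point w"
  then have "mart_norm p q (v - w) = 0"
    using norm_limit_point[OF mart_space_diff[OF pq1 vw(1,2)]] limit_point_diff[OF vw(1,2)] by simp
  then have "norm (v - w) \<le> 0" using norm_le_mart_norm[OF pq1 mart_space_diff[OF pq1 vw(1,2)]] by simp
  then show "v = w" by simp
qed

lemma limit_point_lev: "limit_point (lev n h) = J (\<lambda>\<omega>. h (bits n \<omega>))"
proof -
  have "eventually (\<lambda>m. J (\<lambda>\<omega>. coord (lev n h) (bits m \<omega>)) = J (\<lambda>\<omega>. h (bits n \<omega>))) sequentially"
  proof (rule eventually_sequentiallyI)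
    fix m assume "n \<le> m"
    then have "ext (2 * n) h (bits m \<omega>) = h (bits n \<omega>)" for \<omega>
      using drop_bits[of n m \<omega>] by (simp add: ext_ge)
    then show "J (\<lambda>\<omega>. coord (lev n h) (bits m \<omega>)) = J (\<lambda>\<omega>. h (bits n \<omega>))" by (simp add: coord_lev)
  qed
  then have "(\<lambda>m. J (\<lambda>\<omega>. coord (lev n h) (bits m \<omega>))) \<longlonglongrightarrow> J (\<lambda>\<omega>. h (bits n \<omega>))"
    by (rule tendsto_eventually)
  with limit_point[OF lev_in_mart_space[OF pq1]] show ?thesis by (rule LIMSEQ_unique)
qed

text \<open>The range contains the dense union of the levels, and it is complete because
  \<open>limit_point\<close> is isometric.\<close>

lemma limit_point_surj: "limit_point ` mart_space p q = UNIV"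
proof
  show "UNIV \<subseteq> limit_point ` mart_space p q"
  proof
    fix y :: 'y
    obtain g where g: "\<And>k. g k \<in> J ` X_union" "g \<longlonglongrightarrow> y"
      using is_X_closure[OF X] closure_sequential by (metis UNIV_I)
    have "\<exists>v. v \<in> mart_space p q \<and> limit_point v = g k" for k
    proof -
      obtain f m where f: "g k = J f" "f \<in> X_level m" using g(1)[of k] by (auto simp: X_union_def)
      then obtain h where "f = (\<lambda>\<omega>. h (bits m \<omega>))" by (meson X_levelE)
      then show ?thesis using f limit_point_lev[of m h] lev_in_mart_space[OF pq1, of m h] by auto
    qed
    then obtain v where v: "\<And>k. v k \<in> mart_space p q" "\<And>k. limit_point (v k) = g k" by metis
    have nv: "mart_norm p q (v m - v n) = norm (g m - g n)" for m n
      using norm_limit_point[OF mart_space_diff[OF pq1 v(1) v(1)]] limit_point_diff[OF v(1) v(1)] v(2) by simp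
    have "Cauchy g" using g(2) by (rule LIMSEQ_imp_Cauchy)
    then have "\<forall>e>0. \<exists>k. \<forall>m\<ge>k. \<forall>n\<ge>k. mart_norm p q (v m - v n) < e"
      unfolding nv using CauchyD by blast
    moreover have "\<forall>u. (\<forall>n. u n \<in> mart_space p q) \<and>
        (\<forall>e>0. \<exists>k. \<forall>m\<ge>k. \<forall>n\<ge>k. mart_norm p q (u m - u n) < e) \<longrightarrow>
        (\<exists>l\<in>mart_space p q. (\<lambda>n. mart_norm p q (u n - l)) \<longlonglongrightarrow> 0)"
      using banach_on_mart_space[OF pq1] unfolding banach_on_def by (elim conjE)
    ultimately have "\<exists>l\<in>mart_space p q. (\<lambda>n. mart_norm p q (v n - l)) \<longlonglongrightarrow> 0"
      using v(1) by (elim allE[of _ v] impE) auto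
    then obtain w where w: "w \<in> mart_space p q" "(\<lambda>n. mart_norm p q (v n - w)) \<longlonglongrightarrow> 0"
      by blast
    have gw: "norm (g n - limit_point w) = mart_norm p q (v n - w)" for n
      using norm_limit_point[OF mart_space_diff[OF pq1 v(1) w(1)]] limit_point_diff[OF v(1) w(1)] v(2) by simp
    have "(\<lambda>n. norm (g n - limit_point w)) \<longlonglongrightarrow> 0" unfolding gw by (rule w(2))
    then have "g \<longlonglongrightarrow> limit_point w" by (rule LIM_zero_cancel[OF tendsto_norm_zero_cancel])
    then have "y = limit_point w" using g(2) by (metis LIMSEQ_unique)
    then show "y \<in> limit_point ` mart_space p q" using w(1) by blast
  qed
qed simp

lemma theta_hilbertian_X:
  assumes ie: "interpolation_exponents p q p0 q0 \<theta>"
  shows "theta_hilbertian TYPE(nat \<Rightarrow>\<^sub>C complex) \<theta> sc"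
proof -
  interpret interpolation_exponents p q p0 q0 \<theta> by (rule ie)
  define T where "T = inv_into (mart_space p q) limit_point"
  have T: "T y \<in> mart_space p q" "limit_point (T y) = y" for y
    unfolding T_def using limit_point_surj by (auto intro: inv_into_into f_inv_into_f)
  have Teq: "T y = v" if "v \<in> mart_space p q" "limit_point v = y" for v y
    using inj_onD[OF limit_point_inj _ T(1) that(1)] T(2) that(2) by simp
  have lin: "Vector_Spaces.linear sc scl T"
  proof (intro Vector_Spaces.linear.intro module_hom.intro module_hom_axioms.intro)
    show vs: "vector_space sc" using is_X_normed_space[OF X] by (simp add: normed_space_over_def)
    show vl: "vector_space scl" by (rule vector_space_scl)
    show "module sc" using vs by (simp add: module_iff_vector_space)
    show "module scl" using vl by (simp add: module_iff_vector_space)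
    show "T (x + y) = T x + T y" for x y
      using T by (intro Teq mart_space_add(1)[OF pq1]) (simp_all add: limit_point_add)
    show "T (sc c x) = scl c (T x)" for c x
      using T by (intro Teq mart_space_scl(1)[OF pq1]) (simp_all add: limit_point_scl)
  qed
  have ran: "range T = mart_space p q"
  proof
    show "mart_space p q \<subseteq> range T"
    proof
      fix v assume "v \<in> mart_space p q"
      from Teq[OF this refl] show "v \<in> range T" by (metis rangeI)
    qed
  qed (use T(1) in auto)
  have nT: "interp_norm scl S0 N0 S1 N1 \<theta> (T y) = norm y" for y
    using interpolation_mart_space(2)[OF T(1)[of y]] norm_limit_point[OF T(1)[of y]] T(2)[of y] by simp
  show ?thesis
    unfolding theta_hilbertian_def
    using th lin ran nT interpolation_mart_space(1)
      compatible_couple_mart_spaces[OF exps_le(3,4,5,5)] hilbert_on_mart_space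
    by (intro conjI exI[of _ scl] exI[of _ S0] exI[of _ N0] exI[of _ S1] exI[of _ N1] exI[of _ T]) auto
qed

end

lemma interpolation_exponents_exist:
  assumes pq: "1 < p" "1 < q"
  obtains p0 q0 \<theta> where "interpolation_exponents p q p0 q0 \<theta>"
proof -
  \<comment> \<open>For r = p and r = q, a positive \<theta> below 1/r and 1 - 1/r puts
    \<open>1 / r - \<theta> / 2\<close> strictly between 0 and \<open>1 - \<theta>\<close>; this
    makes the other end exponent \<open>e r\<close> exceed 1.\<close>
  define \<theta> where "\<theta> = min (min (1 / p) (1 / q)) (min (1 - 1 / p) (1 - 1 / q))"
  have th: "0 < \<theta>" "\<theta> < 1" "\<theta> \<le> 1 / p" "\<theta> \<le> 1 / q" "\<theta> \<le> 1 - 1 / p" "\<theta> \<le> 1 - 1 / q"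
    using pq by (auto simp: \<theta>_def min_less_iff_disj)
  define e where "e r = (1 - \<theta>) / (1 / r - \<theta> / 2)" for r :: real
  have e: "1 < e r" "1 / r = (1 - \<theta>) / e r + \<theta> / 2" if "\<theta> \<le> 1 / r" "\<theta> \<le> 1 - 1 / r" for r
  proof -
    have pos: "1 / r - \<theta> / 2 > 0" using that th by linarith
    have "1 / r - \<theta> / 2 < 1 - \<theta>" using that th by linarith
    then show "1 < e r" using pos by (simp add: e_def)
    have "(1 - \<theta>) / e r = 1 / r - \<theta> / 2" unfolding e_def using th pos by simp
    then show "1 / r = (1 - \<theta>) / e r + \<theta> / 2" by simp
  qed
  show ?thesis
    by (rule that[of "e p" "e q" \<theta>], unfold_locales) (use pq th e[of p] e[of q] in auto)
qed

theorem corollary5p3: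
  fixes p q :: real
    and J :: "((nat \<Rightarrow> bool) \<Rightarrow> real) \<Rightarrow> 'x::{banach,second_countable_topology}"
    and scC :: "complex \<Rightarrow> 'y \<Rightarrow> 'y::{banach,second_countable_topology}"
    and JC :: "((nat \<Rightarrow> bool) \<Rightarrow> complex) \<Rightarrow> 'y"
  assumes "1 < p" "1 < q" "p \<noteq> q"
    and "is_X p q scaleR J"
    and "is_X p q scC JC"
  shows "\<not> UMD TYPE('x) \<and>
         \<not> AUMD scC \<and>
         (\<exists>\<theta>. 0 < \<theta> \<and> \<theta> < 1 \<and> theta_hilbertian TYPE(nat \<Rightarrow>\<^sub>C complex) \<theta> scC) \<and>
         super_reflexive TYPE('u::banach) scC \<and>
         super_reflexive TYPE('v::banach) (scaleR :: real \<Rightarrow> 'x \<Rightarrow> 'x)"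
proof (intro conjI)
  show "\<not> UMD TYPE('x)" by (rule not_UMD_X[OF assms(4,1,2,3)])
  show "\<not> AUMD scC" by (rule not_AUMD_X[OF assms(5,1,2,3)])
  show "super_reflexive TYPE('u) scC" by (rule super_reflexive_X[OF assms(5,1,2)])
  show "super_reflexive TYPE('v) (scaleR :: real \<Rightarrow> 'x \<Rightarrow> 'x)" by (rule super_reflexive_X[OF assms(4,1,2)])
  obtain p0 q0 \<theta> where ie: "interpolation_exponents p q p0 q0 \<theta>"
    using interpolation_exponents_exist[OF assms(1,2)] .
  interpret complex_X p q scC JC using assms by unfold_locales
  have "0 < \<theta>" "\<theta> < 1" using ie by (auto simp: interpolation_exponents_def)
  then show "\<exists>\<theta>. 0 < \<theta> \<and> \<theta> < 1 \<and> theta_hilbertian TYPE(nat \<Rightarrow>\<^sub>C complex) \<theta> scC"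
    using theta_hilbertian_X[OF ie] by blast
qed

end
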